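(* Let $(Q,\tau)$ be the $\imath$quiver consisting of a single vertex, no arrows, and trivial involution, with $\imath$quiver algebra $\Lambda^\imath=k[x]/(x^2)$, $k=\mathbb F_q$. The following identity holds in the $\imath$Hall algebra $\widetilde{\mathcal H}(kQ,\tau)$ for all $n\in\mathbb N$: $$[S]^{(n)}_{\bar0}=\sum_{l=0}^{\lfloor n/2\rfloor}\frac{\mathbf v^{\,l(l-(-1)^n)-\binom{n-2l}{2}}\,(\mathbf v-\mathbf v^{-1})^l}{[n-2l]_{\mathbf v}!\,[2l]_{\mathbf v}^{!!}}\,[(n-2l)S]*[\mathbb K]^l .$$
   Context: $\mathbf v=\sqrt q$, $[m]_{\mathbf v}=\frac{\mathbf v^m-\mathbf v^{-m}}{\mathbf v-\mathbf v^{-1}}$, $[m]_{\mathbf v}!=\prod_{s=1}^m[s]_{\mathbf v}$, $[0]_{\mathbf v}^{!!}=1$, $[2l]_{\mathbf v}^{!!}=[2l]_{\mathbf v}[2l-2]_{\mathbf v}\cdots[2]_{\mathbf v}$. $\lfloor x\rfloor$ is the floor. $S$ is the simple $\Lambda^\imath$-module, $[mS]=[S^{\oplus m}]$, $\mathbb K=k[x]/(x^2)$ is the regular module. $\mathcal H(\Lambda^\imath)$ is the $\mathbb Q(\mathbf v)$-vector space with basis isoclasses $[M]$ of finite-dimensional $\Lambda^\imath$-modules and product $[M]\diamond[N]=\sum_{[L]}\frac{|\mathrm{Ext}^1(M,N)_L|}{|\mathrm{Hom}(M,N)|}[L]$, where $\mathrm{Ext}^1(M,N)_L$ is the set of classes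 of extensions $0\to N\to L'\to M\to0$ with $L'\cong L$. Let $\mathcal P^{\le1}$ be the class of finite-dimensional $\Lambda^\imath$-modules of projective dimension $\le1$, let $I$ be the two-sided ideal generated by all $[K]-[K']$ with $K\cong K'$ in $\mathcal P^{\le1}$ (i.e. $0$) and all $[L]-[K\oplus M]$ for which there is an exact sequence $0\to K\to L\to M\to0$ with $K\in\mathcal P^{\le1}$, and let $\mathcal S=\{a[K]\mid a\in\mathbb Q^\times,K\in\mathcal P^{\le1}\}$. $\widetilde{\mathcal H}(kQ,\tau)$ is $(\mathcal H(\Lambda^\imath)/I)[\mathcal S^{-1}]$ with twisted product $[M]*[N]=\mathbf v^{\dim_k M\cdot\dim_k N}[M]\diamond[N]$ (the exponent is the Euler form of $kQ=k$ on the restrictions). $[\mathbb K]^l$ is the $l$-th power with respect to $*$; $[\mathbb K]$ is central. The $\imath$-divided powers (all products with respect to $*$) are $$[S]^{(2l)}_{\bar0}=\tfrac1{[2l]_{\mathbf v}!}\prod_{j=1}^l\big([S]^2+\mathbf v^{-1}(\mathbf v^2-1)^2[2j-2]_{\mathbf v}^2[\mathbb K]\big),\quad [S]^{(2l+1)}_{\bar0}=\tfrac1{[2l+1]_{\mathbf v}!}[S]\prod_{j=1}^l\big([S]^2+\mathbf v^{-1}(\mathbf v^2-1)^2[2j]_{\mathbf v}^2[\mathbb K]\big).$$ *)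

theory Defs
  imports
    "HOL-Algebra.Algebra"
    "HOL-Algebra.Algebraic_Closure_Type"
    "HOL-Computational_Algebra.Polynomial"
    "Jordan_Normal_Form.Missing_VectorSpace"
begin

text \<open>
  Throughout, \<open>'k\<close> ranges over the finite fields, \<open>q\<close> is the cardinality of \<open>'k\<close>, and
  \<open>\<Lambda> = k[x]/(x\<^sup>2)\<close> is \<^term>\<open>Lam\<close>. Since \<open>k\<close> is finite, a finite-dimensional
  \<open>\<Lambda>\<close>-module is a finite set, so each one has an isomorphic copy whose carrier is a set of
  natural numbers. The category of finite-dimensional \<open>\<Lambda>\<close>-modules is represented by
  the modules with carrier in \<^typ>\<open>nat\<close>; modules with other carriers (such as direct sums) enter
  through their isomorphism classes.
\<close>

section \<open>Finite-dimensional modules over \<open>k[x]/(x\<^sup>2)\<close>\<close>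

definition Lam :: "'k::{field,finite} poly set ring" where
  "Lam = (ring_of_type_algebra :: 'k poly ring) Quot
           (PIdl\<^bsub>(ring_of_type_algebra :: 'k poly ring)\<^esub> ([:0, 1:] ^ 2))"

definition Lam_const :: "'k::{field,finite} \<Rightarrow> 'k poly set" where
  "Lam_const c = (PIdl\<^bsub>(ring_of_type_algebra :: 'k poly ring)\<^esub> ([:0, 1:] ^ 2))
                   +>\<^bsub>(ring_of_type_algebra :: 'k poly ring)\<^esub> [:c:]"

definition restrict_to_k :: "('k::{field,finite} poly set, 'a) module \<Rightarrow> ('k, 'a) module" where
  "restrict_to_k M = \<lparr>carrier = carrier M, monoid.mult = (\<otimes>\<^bsub>M\<^esub>), one = \<one>\<^bsub>M\<^esub>, ring.zero = \<zero>\<^bsub>M\<^esub>,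
      add = (\<oplus>\<^bsub>M\<^esub>), module.smult = (\<lambda>c x. Lam_const c \<odot>\<^bsub>M\<^esub> x)\<rparr>"

definition fd_mod :: "('k::{field,finite} poly set, 'a) module \<Rightarrow> bool" where
  "fd_mod M \<longleftrightarrow> module Lam M \<and>
     vectorspace.fin_dim (ring_of_type_algebra :: 'k ring) (restrict_to_k M)"

definition dim_k :: "('k::{field,finite} poly set, 'a) module \<Rightarrow> nat" where
  "dim_k M = vectorspace.dim (ring_of_type_algebra :: 'k ring) (restrict_to_k M)"

definition mod_iso ::
    "('k::{field,finite} poly set, 'a) module \<Rightarrow> ('k poly set, 'b) module \<Rightarrow> bool" where
  "mod_iso M N \<longleftrightarrow> (\<exists>f \<in> module_hom Lam M N. bij_betw f (carrier M) (carrier N))"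

text \<open>Homomorphisms are taken to be extensional here so that they can be counted.\<close>

definition Hom_set ::
    "('k::{field,finite} poly set, 'a) module \<Rightarrow> ('k poly set, 'b) module \<Rightarrow> ('a \<Rightarrow> 'b) set" where
  "Hom_set M N = module_hom Lam M N \<inter> extensional (carrier M)"

definition short_exact ::
    "('k::{field,finite} poly set, 'a) module \<Rightarrow> ('k poly set, 'b) module \<Rightarrow>
     ('k poly set, 'c) module \<Rightarrow> ('a \<Rightarrow> 'b) \<Rightarrow> ('b \<Rightarrow> 'c) \<Rightarrow> bool" where
  "short_exact N L M f g \<longleftrightarrow>
     f \<in> module_hom Lam N L \<and> g \<in> module_hom Lam L M \<and>
     inj_on f (carrier N) \<and> g ` carrier L = carrier M \<and>
     f ` carrier N = {x \<in> carrier L. g x = \<zero>\<^bsub>M\<^esub>}"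

definition simple_mod :: "('k::{field,finite} poly set, 'a) module \<Rightarrow> bool" where
  "simple_mod M \<longleftrightarrow> module Lam M \<and> carrier M \<noteq> {\<zero>\<^bsub>M\<^esub>} \<and>
     (\<forall>N. LinearCombinations.submodule Lam N M \<longrightarrow> N = {\<zero>\<^bsub>M\<^esub>} \<or> N = carrier M)"

definition regular_mod :: "('k::{field,finite} poly set, 'k poly set) module" where
  "regular_mod = \<lparr>carrier = carrier Lam, monoid.mult = (\<otimes>\<^bsub>Lam\<^esub>), one = \<one>\<^bsub>Lam\<^esub>, ring.zero = \<zero>\<^bsub>Lam\<^esub>,
      add = (\<oplus>\<^bsub>Lam\<^esub>), module.smult = (\<otimes>\<^bsub>Lam\<^esub>)\<rparr>"

definition zero_mod :: "('k::{field,finite} poly set, nat) module" where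
  "zero_mod = \<lparr>carrier = {0}, monoid.mult = (\<lambda>_ _. 0), one = 0, ring.zero = 0, add = (\<lambda>_ _. 0),
      module.smult = (\<lambda>_ _. 0)\<rparr>"

text \<open>The \<open>m\<close>-fold direct sum of copies of \<open>M\<close>; the fields \<open>mult\<close> and \<open>one\<close> play no role.\<close>

definition direct_power ::
    "nat \<Rightarrow> ('k::{field,finite} poly set, 'a) module \<Rightarrow> ('k poly set, nat \<Rightarrow> 'a) module" where
  "direct_power m M = \<lparr>carrier = {..<m} \<rightarrow>\<^sub>E carrier M,
      monoid.mult = (\<lambda>x y. \<lambda>i\<in>{..<m}. \<zero>\<^bsub>M\<^esub>), one = (\<lambda>i\<in>{..<m}. \<zero>\<^bsub>M\<^esub>), ring.zero = (\<lambda>i\<in>{..<m}. \<zero>\<^bsub>M\<^esub>),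
      add = (\<lambda>x y. \<lambda>i\<in>{..<m}. x i \<oplus>\<^bsub>M\<^esub> y i), module.smult = (\<lambda>c x. \<lambda>i\<in>{..<m}. c \<odot>\<^bsub>M\<^esub> x i)\<rparr>"

text \<open>
  Projective objects of the category of finite-dimensional modules. As \<open>\<Lambda>\<close> is a
  finite-dimensional algebra, they are exactly the finite-dimensional projective \<open>\<Lambda>\<close>-modules,
  and projective dimension may be computed with them.
\<close>

definition projective_mod :: "('k::{field,finite} poly set, nat) module \<Rightarrow> bool" where
  "projective_mod P \<longleftrightarrow> fd_mod P \<and>
     (\<forall>(A :: ('k poly set, nat) module) (B :: ('k poly set, nat) module) g h.
        fd_mod A \<and> fd_mod B \<and> g \<in> module_hom Lam A B \<and> g ` carrier A = carrier B \<and>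
        h \<in> module_hom Lam P B \<longrightarrow>
        (\<exists>h' \<in> module_hom Lam P A. \<forall>x \<in> carrier P. g (h' x) = h x))"

definition pd_le_one :: "('k::{field,finite} poly set, nat) module \<Rightarrow> bool" where
  "pd_le_one M \<longleftrightarrow> fd_mod M \<and>
     (\<exists>(P1 :: ('k poly set, nat) module) (P0 :: ('k poly set, nat) module) f g.
        projective_mod P1 \<and> projective_mod P0 \<and> short_exact P1 P0 M f g)"


section \<open>Isomorphism classes and extension classes\<close>

type_synonym 'k iclass = "('k poly set, nat) module set"

definition isoclass :: "('k::{field,finite} poly set, 'a) module \<Rightarrow> 'k iclass" where
  "isoclass M = {N. fd_mod N \<and> mod_iso M N}"

definition isoclasses :: "'k::{field,finite} iclass set" where
  "isoclasses = {isoclass M | M :: ('k poly set, nat) module. fd_mod M}"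

definition rep :: "'k::{field,finite} iclass \<Rightarrow> ('k poly set, nat) module" where
  "rep c = (SOME M. M \<in> c)"

text \<open>Extensions \<open>0 \<rightarrow> N \<rightarrow> L \<rightarrow> M \<rightarrow> 0\<close> are stored as triples \<open>(L, f, g)\<close>.\<close>

definition extensions ::
    "('k::{field,finite} poly set, nat) module \<Rightarrow> ('k poly set, nat) module \<Rightarrow>
     (('k poly set, nat) module \<times> (nat \<Rightarrow> nat) \<times> (nat \<Rightarrow> nat)) set" where
  "extensions M N = {(L, f, g). fd_mod L \<and> short_exact N L M f g}"

definition ext_equiv ::
    "('k::{field,finite} poly set, nat) module \<Rightarrow> ('k poly set, nat) module \<Rightarrow>
     (('k poly set, nat) module \<times> (nat \<Rightarrow> nat) \<times> (nat \<Rightarrow> nat)) rel" where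
  "ext_equiv M N = {((L, f, g), (L', f', g')).
     (L, f, g) \<in> extensions M N \<and> (L', f', g') \<in> extensions M N \<and>
     (\<exists>\<phi> \<in> module_hom Lam L L'. bij_betw \<phi> (carrier L) (carrier L') \<and>
        (\<forall>x \<in> carrier N. \<phi> (f x) = f' x) \<and> (\<forall>y \<in> carrier L. g' (\<phi> y) = g y))}"

definition Ext1_mid ::
    "('k::{field,finite} poly set, nat) module \<Rightarrow> ('k poly set, nat) module \<Rightarrow>
     ('k poly set, nat) module \<Rightarrow>
     (('k poly set, nat) module \<times> (nat \<Rightarrow> nat) \<times> (nat \<Rightarrow> nat)) set set" where
  "Ext1_mid M N L = {E \<in> extensions M N. mod_iso (fst E) L} // ext_equiv M N"


section \<open>The Hall algebra\<close>

definition qsqrt :: "'k::{field,finite} itself \<Rightarrow> real" where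
  "qsqrt T = sqrt (real (card (UNIV :: 'k set)))"

text \<open>The field \<open>\<rat>(v) \<subseteq> \<real>\<close>; recall that \<open>v\<^sup>2 = q\<close> is an integer.\<close>

definition Q_adjoin :: "real \<Rightarrow> real set" where
  "Q_adjoin v = {a + b * v | a b. a \<in> \<rat> \<and> b \<in> \<rat>}"

definition hclass :: "('k::{field,finite} poly set, 'a) module \<Rightarrow> 'k iclass \<Rightarrow> real" where
  "hclass M = (\<lambda>c. if c = isoclass M then 1 else 0)"

definition hall_number :: "'k::{field,finite} iclass \<Rightarrow> 'k iclass \<Rightarrow> 'k iclass \<Rightarrow> real" where
  "hall_number a b c =
     real (card (Ext1_mid (rep a) (rep b) (rep c))) / real (card (Hom_set (rep a) (rep b)))"

definition hall :: "('k::{field,finite} iclass \<Rightarrow> real) ring" where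
  "hall = \<lparr>carrier = {f. finite {c. f c \<noteq> 0} \<and> {c. f c \<noteq> 0} \<subseteq> isoclasses \<and>
                        range f \<subseteq> Q_adjoin (qsqrt TYPE('k))},
      monoid.mult = (\<lambda>f g c. if c \<in> isoclasses
                then (\<Sum>a\<in>{a. f a \<noteq> 0}. \<Sum>b\<in>{b. g b \<noteq> 0}. f a * g b * hall_number a b c)
                else 0),
      one = hclass zero_mod,
      ring.zero = (\<lambda>_. 0),
      add = (\<lambda>f g c. f c + g c)\<rparr>"

definition hall_ideal :: "('k::{field,finite} iclass \<Rightarrow> real) set" where
  "hall_ideal = Idl\<^bsub>hall\<^esub>
     ({(\<lambda>c. hclass K c - hclass K' c) 
        | (K :: ('k poly set, nat) module) (K' :: ('k poly set, nat) module).
         pd_le_one K \<and> pd_le_one K' \<and> mod_iso K K'} \<union>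
      {(\<lambda>c. hclass L c - hclass (direct_sum K M) c) 
        | (L :: ('k poly set, nat) module) (K :: ('k poly set, nat) module) (M :: ('k poly set, nat) module).
         fd_mod L \<and> fd_mod M \<and> pd_le_one K \<and> (\<exists>f g. short_exact K L M f g)})"

definition hall_quot :: "('k::{field,finite} iclass \<Rightarrow> real) set ring" where
  "hall_quot = hall Quot hall_ideal"

definition hall_denoms :: "('k::{field,finite} iclass \<Rightarrow> real) set set" where
  "hall_denoms = {hall_ideal +>\<^bsub>hall\<^esub> (\<lambda>c. a * hclass K c) | a (K :: ('k poly set, nat) module).
     a \<in> \<rat> \<and> a \<noteq> 0 \<and> pd_le_one K}"


section \<open>Right Ore localization\<close>

text \<open>
  The pair \<open>(r, s)\<close> stands for the right fraction \<open>r s\<^sup>-\<^sup>1\<close>.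
\<close>

definition ore_rel :: "('a, 'b) ring_scheme \<Rightarrow> 'a set \<Rightarrow> ('a \<times> 'a) rel" where
  "ore_rel R S = {((r, s), (r', s')).
     r \<in> carrier R \<and> s \<in> S \<and> r' \<in> carrier R \<and> s' \<in> S \<and>
     (\<exists>a \<in> carrier R. \<exists>a' \<in> carrier R.
        r \<otimes>\<^bsub>R\<^esub> a = r' \<otimes>\<^bsub>R\<^esub> a' \<and> s \<otimes>\<^bsub>R\<^esub> a = s' \<otimes>\<^bsub>R\<^esub> a' \<and> s \<otimes>\<^bsub>R\<^esub> a \<in> S)}"

definition ore_frac :: "('a, 'b) ring_scheme \<Rightarrow> 'a set \<Rightarrow> 'a \<Rightarrow> 'a \<Rightarrow> ('a \<times> 'a) set" where
  "ore_frac R S r s = ore_rel R S `` {(r, s)}"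

text \<open>
  As for \<^const>\<open>rcoset_mult\<close>, the operations on classes are unions over all representatives
  and all choices of common denominators; when \<open>S\<close> is a right denominator set all the
  classes in the union coincide. In the product, \<open>s\<^sub>1 a = r\<^sub>2 t\<close> gives
  \<open>r\<^sub>1 s\<^sub>1\<^sup>-\<^sup>1 r\<^sub>2 s\<^sub>2\<^sup>-\<^sup>1 = r\<^sub>1 a (s\<^sub>2 t)\<^sup>-\<^sup>1\<close>.
\<close>

definition ore_localization :: "('a, 'b) ring_scheme \<Rightarrow> 'a set \<Rightarrow> ('a \<times> 'a) set ring" where
  "ore_localization R S =
    \<lparr>carrier = (carrier R \<times> S) // ore_rel R S,
     monoid.mult = (\<lambda>U V. \<Union>{ore_frac R S (r1 \<otimes>\<^bsub>R\<^esub> a) (s2 \<otimes>\<^bsub>R\<^esub> t) | r1 s1 r2 s2 a t.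
        (r1, s1) \<in> U \<and> (r2, s2) \<in> V \<and> a \<in> carrier R \<and> t \<in> S \<and> s1 \<otimes>\<^bsub>R\<^esub> a = r2 \<otimes>\<^bsub>R\<^esub> t}),
     one = ore_frac R S \<one>\<^bsub>R\<^esub> \<one>\<^bsub>R\<^esub>,
     ring.zero = ore_frac R S \<zero>\<^bsub>R\<^esub> \<one>\<^bsub>R\<^esub>,
     add = (\<lambda>U V. \<Union>{ore_frac R S (r1 \<otimes>\<^bsub>R\<^esub> a1 \<oplus>\<^bsub>R\<^esub> r2 \<otimes>\<^bsub>R\<^esub> a2) (s1 \<otimes>\<^bsub>R\<^esub> a1) | r1 s1 r2 s2 a1 a2.
        (r1, s1) \<in> U \<and> (r2, s2) \<in> V \<and> a1 \<in> carrier R \<and> a2 \<in> carrier R \<and>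
        s1 \<otimes>\<^bsub>R\<^esub> a1 = s2 \<otimes>\<^bsub>R\<^esub> a2 \<and> s1 \<otimes>\<^bsub>R\<^esub> a1 \<in> S})\<rparr>"


section \<open>The twisted localized algebra\<close>

type_synonym 'k ihall_elt =
  "(('k iclass \<Rightarrow> real) set \<times> ('k iclass \<Rightarrow> real) set) set"

definition sd_hall :: "'k::{field,finite} ihall_elt ring" where
  "sd_hall = ore_localization hall_quot hall_denoms"

definition hall_to_sd :: "('k::{field,finite} iclass \<Rightarrow> real) \<Rightarrow> 'k ihall_elt" where
  "hall_to_sd f = ore_frac hall_quot hall_denoms (hall_ideal +>\<^bsub>hall\<^esub> f) \<one>\<^bsub>hall_quot\<^esub>"

text \<open>
  The algebra is graded by the Grothendieck group \<open>\<int>\<close> of finite-dimensional vector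
  spaces: a fraction \<open>f (a[K])\<^sup>-\<^sup>1\<close>, with \<open>f\<close> a combination of classes of dimension \<open>m\<close>, has
  degree \<open>m - dim K\<close>.
\<close>

definition sd_degree_part :: "int \<Rightarrow> 'k::{field,finite} ihall_elt set" where
  "sd_degree_part d =
     {ore_frac hall_quot hall_denoms
        (hall_ideal +>\<^bsub>hall\<^esub> f) (hall_ideal +>\<^bsub>hall\<^esub> (\<lambda>c. a * hclass K c))
      | f a (K :: ('k poly set, nat) module).
        f \<in> carrier hall \<and> a \<in> \<rat> \<and> a \<noteq> 0 \<and> pd_le_one K \<and>
        (\<forall>c. f c \<noteq> 0 \<longrightarrow> int (dim_k (rep c)) - int (dim_k K) = d)}"

definition sd_component :: "'k::{field,finite} ihall_elt \<Rightarrow> int \<Rightarrow> 'k ihall_elt" where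
  "sd_component x = (THE h. (\<forall>d. h d \<in> sd_degree_part d) \<and> finite {d. h d \<noteq> \<zero>\<^bsub>sd_hall\<^esub>} \<and>
     x = (\<Oplus>\<^bsub>sd_hall\<^esub>d\<in>{d. h d \<noteq> \<zero>\<^bsub>sd_hall\<^esub>}. h d))"

definition sd_smult :: "real \<Rightarrow> 'k::{field,finite} ihall_elt \<Rightarrow> 'k ihall_elt" where
  "sd_smult r x = hall_to_sd (\<lambda>c. r * hclass zero_mod c) \<otimes>\<^bsub>sd_hall\<^esub> x"

text \<open>
  The twist multiplies the product of homogeneous elements of degrees \<open>d\<close> and \<open>e\<close> by
  \<open>v\<^bsup>\<langle>d,e\<rangle>\<^esup>\<close>, where \<open>\<langle>d,e\<rangle> = d e\<close> is the Euler form of \<open>k\<close>; it is extended biadditively.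
\<close>

definition sd_twisted_mult ::
    "'k::{field,finite} ihall_elt \<Rightarrow> 'k ihall_elt \<Rightarrow> 'k ihall_elt" where
  "sd_twisted_mult x y =
     (\<Oplus>\<^bsub>sd_hall\<^esub>d\<in>{d. sd_component x d \<noteq> \<zero>\<^bsub>sd_hall\<^esub>}.
      \<Oplus>\<^bsub>sd_hall\<^esub>e\<in>{e. sd_component y e \<noteq> \<zero>\<^bsub>sd_hall\<^esub>}.
        sd_smult (qsqrt TYPE('k) powi (d * e)) (sd_component x d \<otimes>\<^bsub>sd_hall\<^esub> sd_component y e))"

text \<open>Only scalars in \<open>\<rat>(v)\<close> are meaningful in \<open>smult\<close>.\<close>

definition ihall :: "(real, 'k::{field,finite} ihall_elt) module" where
  "ihall = \<lparr>carrier = carrier sd_hall, monoid.mult = sd_twisted_mult, one = \<one>\<^bsub>sd_hall\<^esub>,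
      ring.zero = \<zero>\<^bsub>sd_hall\<^esub>, add = (\<oplus>\<^bsub>sd_hall\<^esub>), module.smult = sd_smult\<rparr>"

definition ihall_class :: "('k::{field,finite} poly set, 'a) module \<Rightarrow> 'k ihall_elt" where
  "ihall_class M = hall_to_sd (hclass M)"


section \<open>Quantum integers and divided powers\<close>

definition qint :: "real \<Rightarrow> nat \<Rightarrow> real" where
  "qint v m = (v ^ m - inverse v ^ m) / (v - inverse v)"

definition qfact :: "real \<Rightarrow> nat \<Rightarrow> real" where
  "qfact v m = (\<Prod>s=1..m. qint v s)"

text \<open>\<open>qdfact_even v l\<close> is the double factorial \<open>[2l]!!\<close>.\<close>

definition qdfact_even :: "real \<Rightarrow> nat \<Rightarrow> real" where
  "qdfact_even v l = (\<Prod>i=1..l. qint v (2 * i))"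

definition list_product :: "('a, 'b) monoid_scheme \<Rightarrow> (nat \<Rightarrow> 'a) \<Rightarrow> nat \<Rightarrow> 'a" where
  "list_product A F l = foldr (\<lambda>j y. F j \<otimes>\<^bsub>A\<^esub> y) [1..<Suc l] \<one>\<^bsub>A\<^esub>"

definition idivided_power_even :: "('k::{field,finite} poly set, 'a) module \<Rightarrow> nat \<Rightarrow> 'k ihall_elt"
  where
  "idivided_power_even S n =
    (let v = qsqrt TYPE('k); l = n div 2; s = ihall_class S; \<kappa> = ihall_class regular_mod in
     if even n then
       (1 / qfact v (2 * l)) \<odot>\<^bsub>ihall\<^esub>
         list_product ihall (\<lambda>j. s [^]\<^bsub>ihall\<^esub> (2::nat) \<oplus>\<^bsub>ihall\<^esub>
           (inverse v * (v\<^sup>2 - 1)\<^sup>2 * (qint v (2 * j - 2))\<^sup>2) \<odot>\<^bsub>ihall\<^esub> \<kappa>) l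
     else
       (1 / qfact v (2 * l + 1)) \<odot>\<^bsub>ihall\<^esub>
         (s \<otimes>\<^bsub>ihall\<^esub> list_product ihall (\<lambda>j. s [^]\<^bsub>ihall\<^esub> (2::nat) \<oplus>\<^bsub>ihall\<^esub>
           (inverse v * (v\<^sup>2 - 1)\<^sup>2 * (qint v (2 * j))\<^sup>2) \<odot>\<^bsub>ihall\<^esub> \<kappa>) l))"

end

theory Submission
  imports Defs
begin

text \<open>
  A module is a \<open>k\<close>-space with an endomorphism \<open>x\<close> of square zero, so it is determined up to
  isomorphism by the orders of the space and of the image of \<open>x\<close>. Projective dimension at most one
  is the same as acyclicity, \<open>ker x = im x\<close>. Acyclic modules are free, hence projective and
  injective: every extension with an acyclic end term splits, so the relations that define the
  ideal already hold, the classes of acyclic modules are central, and the localization is a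
  central one. The twist is a coboundary: \<open>[M] \<mapsto> v ^ (dim M choose 2) [M]\<close> turns the original
  product into the twisted one.

  An extension of \<open>S\<close> by \<open>mS\<close> is given by a map from \<open>S\<close> to \<open>mS\<close>: the zero map yields
  \<open>(m + 1)S\<close> and each of the \<open>q\<^sup>m - 1\<close> others yields \<open>K \<oplus> (m - 1)S\<close>, where \<open>K\<close> is the regular
  module. Hence \<open>[S] * [mS]\<close> is a combination of \<open>[(m + 1)S]\<close> and \<open>[K] * [(m - 1)S]\<close>. Since
  the divided power \<open>S\<^sub>n\<close> is a multiple of \<open>[S] * S\<^sub>n\<^sub>-\<^sub>1\<close>, corrected by a multiple of \<open>[K] * S\<^sub>n\<^sub>-\<^sub>2\<close>
  when \<open>n\<close> is odd, induction reduces the formula to two identities between its coefficients.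
\<close>


subsection \<open>Linear maps between finite vector spaces\<close>

text \<open>The device behind all splittings is the anticommutator: for k-linear \<psi>, the map
  \<open>x \<psi> + \<psi> x\<close> commutes with \<open>x\<close>, because the square of
  \<open>x\<close> is zero. An acyclic module has a k-linear \<open>h\<close> with
  \<open>x h + h x = 1\<close>, so anticommuting a k-linear section, retraction or lift with
  \<open>h\<close> makes it linear over the algebra, without any choice of a free basis. Since k is
  finite, orders stand in for dimensions. Centrality of the class of an acyclic K needs more than
  splitting: products are divided by |Hom|, so |Hom(K, M)| = |Hom(M, K)| is required. Both count
  k-linear maps between the image of \<open>x\<close> in K and M. Associativity of the Hall product
  is never verified: an ideal containing the relations presupposes a ring, and if there is no such
  ideal, the generated one is everything. The operations of the localization are unions over all
  representatives, and homogeneous components are given by a definite description. Independence of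
  representatives and uniqueness of the decomposition therefore have to come before any computation
  with the twisted product.\<close>

lemma module_homI:
  assumes "\<And>x. x \<in> carrier M \<Longrightarrow> f x \<in> carrier N"
    and "\<And>x y. x \<in> carrier M \<Longrightarrow> y \<in> carrier M \<Longrightarrow> f (x \<oplus>\<^bsub>M\<^esub> y) = f x \<oplus>\<^bsub>N\<^esub> f y"
    and "\<And>r x. r \<in> carrier R \<Longrightarrow> x \<in> carrier M \<Longrightarrow> f (r \<odot>\<^bsub>M\<^esub> x) = r \<odot>\<^bsub>N\<^esub> f x"
  shows "f \<in> module_hom R M N"
  using assms by (auto simp: module_hom_def)

lemma module_hom_in: "f \<in> module_hom R M N \<Longrightarrow> x \<in> carrier M \<Longrightarrow> f x \<in> carrier N"
  by (auto simp: module_hom_def)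

lemma module_hom_zero:
  assumes "module R M" "module R N" "f \<in> module_hom R M N"
  shows "f \<zero>\<^bsub>M\<^esub> = \<zero>\<^bsub>N\<^esub>"
proof -
  interpret mod_hom R M N f
    using assms by (auto simp: mod_hom_def mod_hom_axioms_def)
  show ?thesis by simp
qed

lemma module_hom_minus:
  assumes "module R M" "module R N" "f \<in> module_hom R M N" "x \<in> carrier M" "y \<in> carrier M"
  shows "f (x \<ominus>\<^bsub>M\<^esub> y) = f x \<ominus>\<^bsub>N\<^esub> f y"
proof -
  interpret mod_hom R M N f
    using assms by (auto simp: mod_hom_def mod_hom_axioms_def)
  show ?thesis using assms by simp
qed

lemma module_hom_comp:
  assumes "f \<in> module_hom R M N" "g \<in> module_hom R N P"
  shows "(\<lambda>x. g (f x)) \<in> module_hom R M P"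
  using assms module_hom_in[OF assms(1)]
  by (intro module_homI) (simp_all add: module_hom_add module_hom_smult module_hom_in)

lemma module_hom_cong:
  assumes "f \<in> module_hom R M N" "\<And>x. x \<in> carrier M \<Longrightarrow> f x = g x" "module R M"
  shows "g \<in> module_hom R M N"
proof -
  interpret M: module R M by fact
  show ?thesis
    by (intro module_homI)
       (simp_all add: assms(2)[symmetric] module_hom_in[OF assms(1)] module_hom_add[OF assms(1)] module_hom_smult[OF assms(1)])
qed

lemma module_hom_inj_on:
  assumes "module R M" "module R N" "f \<in> module_hom R M N"
    and ker: "\<And>x. x \<in> carrier M \<Longrightarrow> f x = \<zero>\<^bsub>N\<^esub> \<Longrightarrow> x = \<zero>\<^bsub>M\<^esub>"
  shows "inj_on f (carrier M)"
proof
  interpret M: module R M by fact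
  interpret N: module R N by fact
  fix x y assume xy: "x \<in> carrier M" "y \<in> carrier M" "f x = f y"
  have "f (x \<ominus>\<^bsub>M\<^esub> y) = \<zero>\<^bsub>N\<^esub>"
    using xy module_hom_in[OF assms(3)] by (simp add: module_hom_minus[OF assms(1-3)])
  then have "x \<ominus>\<^bsub>M\<^esub> y = \<zero>\<^bsub>M\<^esub>" using ker xy by auto
  then show "x = y" using xy by simp
qed

text \<open>Composition with \<open>g\<close> is built in so that the image of \<open>f\<close> need
  not be turned into a module. With \<open>g\<close> the identity this inverts a bijective
  homomorphism; in general it factors a map through an embedded submodule.\<close>

lemma module_hom_the_inv:
  assumes "module R M" "module R N" "f \<in> module_hom R M N" "inj_on f (carrier M)"
    and "module R P" "g \<in> module_hom R P N" "g ` carrier P \<subseteq> f ` carrier M"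
  shows "(\<lambda>x. the_inv_into (carrier M) f (g x)) \<in> module_hom R P M"
proof -
  interpret M: module R M by fact
  interpret N: module R N by fact
  interpret P: module R P by fact
  let ?i = "the_inv_into (carrier M) f"
  have i: "?i y \<in> carrier M" "f (?i y) = y" if "y \<in> f ` carrier M" for y
    using that assms(4) by (auto simp: the_inv_into_f_f)
  have eq: "?i y = x" if "x \<in> carrier M" "f x = y" for x y
    using that assms(4) by (auto simp: the_inv_into_f_f)
  have g: "g x \<in> f ` carrier M" if "x \<in> carrier P" for x using that assms(7) by auto
  show ?thesis
  proof (rule module_homI)
    show "?i (g x) \<in> carrier M" if "x \<in> carrier P" for x using i g that by blast
    show "?i (g (x \<oplus>\<^bsub>P\<^esub> y)) = ?i (g x) \<oplus>\<^bsub>M\<^esub> ?i (g y)" if "x \<in> carrier P" "y \<in> carrier P" for x y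
      using that by (intro eq) (simp_all add: i g module_hom_add[OF assms(3)] module_hom_add[OF assms(6)])
    show "?i (g (r \<odot>\<^bsub>P\<^esub> x)) = r \<odot>\<^bsub>M\<^esub> ?i (g x)" if "r \<in> carrier R" "x \<in> carrier P" for r x
      using that by (intro eq) (simp_all add: i g module_hom_smult[OF assms(3)] module_hom_smult[OF assms(6)])
  qed
qed

section \<open>Enlarging a subspace by one vector\<close>

context vectorspace
begin

text \<open>Subspaces grow one vector at a time instead of through bases, so that each construction
  below has to choose only the image of a single new vector.\<close>

definition adjoin :: "'c set \<Rightarrow> 'c \<Rightarrow> 'c set" where
  "adjoin A v = {a \<oplus>\<^bsub>V\<^esub> c \<odot>\<^bsub>V\<^esub> v | a c. a \<in> A \<and> c \<in> carrier K}"

context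
  fixes A v
  assumes A: "LinearCombinations.submodule K A V" and v: "v \<in> carrier V" "v \<notin> A"
begin

interpretation A: LinearCombinations.submodule K A V by (rule A)

text \<open>If the scalars differed, \<open>(c - c') v = a' - a\<close> would lie in
  \<open>A\<close>, and dividing by the nonzero scalar would put \<open>v\<close> into
  \<open>A\<close>.\<close>

lemma adjoin_unique:
  assumes a: "a \<in> A" "a' \<in> A" and c: "c \<in> carrier K" "c' \<in> carrier K"
    and eq: "a \<oplus>\<^bsub>V\<^esub> c \<odot>\<^bsub>V\<^esub> v = a' \<oplus>\<^bsub>V\<^esub> c' \<odot>\<^bsub>V\<^esub> v"
  shows "a = a' \<and> c = c'"
proof -
  have aV: "a \<in> carrier V" "a' \<in> carrier V" using a A.subset by auto
  have negA: "\<ominus>\<^bsub>V\<^esub> x \<in> A" if "x \<in> A" for x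
  proof -
    have "(\<ominus>\<^bsub>K\<^esub> \<one>\<^bsub>K\<^esub>) \<odot>\<^bsub>V\<^esub> x \<in> A" using that by (intro A.smult_closed) auto
    moreover have "x \<in> carrier V" using that A.subset by auto
    ultimately show ?thesis by (simp add: smult_l_minus)
  qed
  have "c = c'"
  proof (rule ccontr)
    assume ne: "c \<noteq> c'"
    let ?d = "c \<ominus>\<^bsub>K\<^esub> c'"
    have d: "?d \<in> carrier K" "?d \<noteq> \<zero>\<^bsub>K\<^esub>" using c ne by auto
    then have dU: "?d \<in> Units K" using field_Units by auto
    have cv: "c \<odot>\<^bsub>V\<^esub> v \<in> carrier V" "c' \<odot>\<^bsub>V\<^esub> v \<in> carrier V" using c v by auto
    have "?d \<odot>\<^bsub>V\<^esub> v = c \<odot>\<^bsub>V\<^esub> v \<ominus>\<^bsub>V\<^esub> c' \<odot>\<^bsub>V\<^esub> v"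
      using c v by (simp add: a_minus_def smult_l_distr smult_l_minus)
    also have "c \<odot>\<^bsub>V\<^esub> v = (\<ominus>\<^bsub>V\<^esub> a) \<oplus>\<^bsub>V\<^esub> (a \<oplus>\<^bsub>V\<^esub> c \<odot>\<^bsub>V\<^esub> v)"
      using aV cv by (metis M.add.inv_solve_left M.add.m_closed)
    also have "\<dots> \<ominus>\<^bsub>V\<^esub> c' \<odot>\<^bsub>V\<^esub> v = (\<ominus>\<^bsub>V\<^esub> a) \<oplus>\<^bsub>V\<^esub> a'"
      unfolding eq using aV cv by (simp add: a_minus_def M.a_assoc M.r_neg)
    also have "\<dots> \<in> A" using a negA by auto
    finally have "?d \<odot>\<^bsub>V\<^esub> v \<in> A" .
    then have "inv\<^bsub>K\<^esub> ?d \<odot>\<^bsub>V\<^esub> (?d \<odot>\<^bsub>V\<^esub> v) \<in> A" using dU by (intro A.smult_closed[of "inv\<^bsub>K\<^esub> ?d"]) auto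
    moreover have "inv\<^bsub>K\<^esub> ?d \<odot>\<^bsub>V\<^esub> (?d \<odot>\<^bsub>V\<^esub> v) = v"
    proof -
      have "inv\<^bsub>K\<^esub> ?d \<otimes>\<^bsub>K\<^esub> ?d = \<one>\<^bsub>K\<^esub>" "inv\<^bsub>K\<^esub> ?d \<in> carrier K" using dU by auto
      then show ?thesis using smult_assoc1[of "inv\<^bsub>K\<^esub> ?d" ?d v] d(1) v by (metis smult_one)
    qed
    ultimately show False using v by simp
  qed
  moreover have "a = a'"
    using eq aV c v unfolding \<open>c = c'\<close> by (simp add: M.add.right_cancel)
  ultimately show ?thesis by simp
qed

lemma adjoin_submodule: "LinearCombinations.submodule K (adjoin A v) V"
proof
  show "adjoin A v \<subseteq> carrier V" using A.subset v by (auto simp: adjoin_def)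
next
  fix x y assume "x \<in> adjoin A v" "y \<in> adjoin A v"
  then obtain a c a' c' where *: "x = a \<oplus>\<^bsub>V\<^esub> c \<odot>\<^bsub>V\<^esub> v" "y = a' \<oplus>\<^bsub>V\<^esub> c' \<odot>\<^bsub>V\<^esub> v"
    "a \<in> A" "a' \<in> A" "c \<in> carrier K" "c' \<in> carrier K" by (auto simp: adjoin_def)
  then have "x \<oplus>\<^bsub>V\<^esub> y = (a \<oplus>\<^bsub>V\<^esub> a') \<oplus>\<^bsub>V\<^esub> (c \<oplus>\<^bsub>K\<^esub> c') \<odot>\<^bsub>V\<^esub> v"
    using v A.subset by (simp add: smult_l_distr subsetD M.a_ac)
  then show "x \<oplus>\<^bsub>V\<^esub> y \<in> adjoin A v" using * by (auto simp: adjoin_def)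
next
  have "\<zero>\<^bsub>V\<^esub> = \<zero>\<^bsub>V\<^esub> \<oplus>\<^bsub>V\<^esub> \<zero>\<^bsub>K\<^esub> \<odot>\<^bsub>V\<^esub> v" using v by simp
  then show "\<zero>\<^bsub>V\<^esub> \<in> adjoin A v" unfolding adjoin_def using A.zero_closed by blast
next
  fix r x assume r: "r \<in> carrier K" and "x \<in> adjoin A v"
  then obtain a c where *: "x = a \<oplus>\<^bsub>V\<^esub> c \<odot>\<^bsub>V\<^esub> v" "a \<in> A" "c \<in> carrier K" by (auto simp: adjoin_def)
  then have "r \<odot>\<^bsub>V\<^esub> x = r \<odot>\<^bsub>V\<^esub> a \<oplus>\<^bsub>V\<^esub> (r \<otimes>\<^bsub>K\<^esub> c) \<odot>\<^bsub>V\<^esub> v"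
    using v A.subset r by (simp add: smult_r_distr smult_assoc1 subsetD)
  then show "r \<odot>\<^bsub>V\<^esub> x \<in> adjoin A v" using * r by (auto simp: adjoin_def)
qed

lemma adjoin_supset: "A \<subset> adjoin A v"
proof -
  have "a \<in> adjoin A v" if "a \<in> A" for a
  proof -
    have "a = a \<oplus>\<^bsub>V\<^esub> \<zero>\<^bsub>K\<^esub> \<odot>\<^bsub>V\<^esub> v" using v that A.subset by (simp add: subsetD)
    then show ?thesis unfolding adjoin_def using that by blast
  qed
  moreover have "v = \<zero>\<^bsub>V\<^esub> \<oplus>\<^bsub>V\<^esub> \<one>\<^bsub>K\<^esub> \<odot>\<^bsub>V\<^esub> v" using v by simp
  then have "v \<in> adjoin A v" unfolding adjoin_def using A.zero_closed by blast
  ultimately show ?thesis using v by blast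
qed

lemma card_adjoin:
  assumes "finite (carrier V)" "finite (carrier K)"
  shows "card (adjoin A v) = card A * card (carrier K)"
proof -
  have "adjoin A v = (\<lambda>(a, c). a \<oplus>\<^bsub>V\<^esub> c \<odot>\<^bsub>V\<^esub> v) ` (A \<times> carrier K)"
    by (auto simp: adjoin_def)
  moreover have "inj_on (\<lambda>(a, c). a \<oplus>\<^bsub>V\<^esub> c \<odot>\<^bsub>V\<^esub> v) (A \<times> carrier K)"
  proof (rule inj_onI)
    fix x y assume "x \<in> A \<times> carrier K" "y \<in> A \<times> carrier K"
      "(case x of (a, c) \<Rightarrow> a \<oplus>\<^bsub>V\<^esub> c \<odot>\<^bsub>V\<^esub> v) = (case y of (a, c) \<Rightarrow> a \<oplus>\<^bsub>V\<^esub> c \<odot>\<^bsub>V\<^esub> v)"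
    then show "x = y" using adjoin_unique[of "fst x" "fst y" "snd x" "snd y"]
      by (simp add: split_beta mem_Times_iff prod_eq_iff)
  qed
  ultimately show ?thesis by (simp add: card_image card_cartesian_product)
qed

text \<open>Elements of \<open>adjoin A v\<close> have unique coordinates \<open>(a, c)\<close>,
  which \<open>p\<close> reads off, so the value \<open>u\<close> at the new vector can be
  prescribed freely.\<close>

lemma hom_adjoin:
  assumes W: "vectorspace K W" and \<alpha>: "\<alpha> \<in> module_hom K (V\<lparr>carrier := A\<rparr>) W" and u: "u \<in> carrier W"
  obtains \<beta> where "\<beta> \<in> module_hom K (V\<lparr>carrier := adjoin A v\<rparr>) W"
    and "\<And>a c. a \<in> A \<Longrightarrow> c \<in> carrier K \<Longrightarrow> \<beta> (a \<oplus>\<^bsub>V\<^esub> c \<odot>\<^bsub>V\<^esub> v) = \<alpha> a \<oplus>\<^bsub>W\<^esub> c \<odot>\<^bsub>W\<^esub> u"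
proof -
  interpret W: vectorspace K W by fact
  define p where "p x = (THE ac. fst ac \<in> A \<and> snd ac \<in> carrier K \<and> x = fst ac \<oplus>\<^bsub>V\<^esub> snd ac \<odot>\<^bsub>V\<^esub> v)" for x
  define \<beta> where "\<beta> x = \<alpha> (fst (p x)) \<oplus>\<^bsub>W\<^esub> snd (p x) \<odot>\<^bsub>W\<^esub> u" for x
  have p: "p (a \<oplus>\<^bsub>V\<^esub> c \<odot>\<^bsub>V\<^esub> v) = (a, c)" if "a \<in> A" "c \<in> carrier K" for a c
    unfolding p_def using that adjoin_unique by (intro the_equality) (auto simp only: prod_eq_iff fst_conv snd_conv)
  have \<alpha>A: "\<alpha> a \<in> carrier W" if "a \<in> A" for a using \<alpha> that by (auto simp: module_hom_def)
  have \<beta>: "\<beta> (a \<oplus>\<^bsub>V\<^esub> c \<odot>\<^bsub>V\<^esub> v) = \<alpha> a \<oplus>\<^bsub>W\<^esub> c \<odot>\<^bsub>W\<^esub> u" if "a \<in> A" "c \<in> carrier K" for a c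
    using p[OF that] by (simp add: \<beta>_def)
  moreover have "\<beta> \<in> module_hom K (V\<lparr>carrier := adjoin A v\<rparr>) W"
  proof (rule module_homI)
    fix x assume "x \<in> carrier (V\<lparr>carrier := adjoin A v\<rparr>)"
    then show "\<beta> x \<in> carrier W" using u \<alpha>A by (auto simp: adjoin_def \<beta>)
  next
    fix x y assume "x \<in> carrier (V\<lparr>carrier := adjoin A v\<rparr>)" "y \<in> carrier (V\<lparr>carrier := adjoin A v\<rparr>)"
    then obtain a c a' c' where *: "x = a \<oplus>\<^bsub>V\<^esub> c \<odot>\<^bsub>V\<^esub> v" "y = a' \<oplus>\<^bsub>V\<^esub> c' \<odot>\<^bsub>V\<^esub> v"
      "a \<in> A" "a' \<in> A" "c \<in> carrier K" "c' \<in> carrier K" by (auto simp: adjoin_def)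
    then have "x \<oplus>\<^bsub>V\<^esub> y = (a \<oplus>\<^bsub>V\<^esub> a') \<oplus>\<^bsub>V\<^esub> (c \<oplus>\<^bsub>K\<^esub> c') \<odot>\<^bsub>V\<^esub> v"
      using v A.subset by (simp add: smult_l_distr subsetD M.a_ac)
    then have "\<beta> (x \<oplus>\<^bsub>V\<^esub> y) = \<alpha> (a \<oplus>\<^bsub>V\<^esub> a') \<oplus>\<^bsub>W\<^esub> (c \<oplus>\<^bsub>K\<^esub> c') \<odot>\<^bsub>W\<^esub> u"
      using * by (simp add: \<beta>)
    also have "\<alpha> (a \<oplus>\<^bsub>V\<^esub> a') = \<alpha> a \<oplus>\<^bsub>W\<^esub> \<alpha> a'" using * \<alpha> by (auto simp: module_hom_def)
    finally show "\<beta> (x \<oplus>\<^bsub>V\<lparr>carrier := adjoin A v\<rparr>\<^esub> y) = \<beta> x \<oplus>\<^bsub>W\<^esub> \<beta> y"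
      using * u \<alpha>A by (simp add: \<beta> W.smult_l_distr W.M.a_ac)
  next
    fix r x assume r: "r \<in> carrier K" and "x \<in> carrier (V\<lparr>carrier := adjoin A v\<rparr>)"
    then obtain a c where *: "x = a \<oplus>\<^bsub>V\<^esub> c \<odot>\<^bsub>V\<^esub> v" "a \<in> A" "c \<in> carrier K" by (auto simp: adjoin_def)
    then have "r \<odot>\<^bsub>V\<^esub> x = r \<odot>\<^bsub>V\<^esub> a \<oplus>\<^bsub>V\<^esub> (r \<otimes>\<^bsub>K\<^esub> c) \<odot>\<^bsub>V\<^esub> v"
      using v A.subset r by (simp add: smult_r_distr smult_assoc1 subsetD)
    then have "\<beta> (r \<odot>\<^bsub>V\<^esub> x) = \<alpha> (r \<odot>\<^bsub>V\<^esub> a) \<oplus>\<^bsub>W\<^esub> (r \<otimes>\<^bsub>K\<^esub> c) \<odot>\<^bsub>W\<^esub> u" using * r by (simp add: \<beta>)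
    also have "\<alpha> (r \<odot>\<^bsub>V\<^esub> a) = r \<odot>\<^bsub>W\<^esub> \<alpha> a" using * \<alpha> r by (auto simp: module_hom_def)
    finally show "\<beta> (r \<odot>\<^bsub>V\<lparr>carrier := adjoin A v\<rparr>\<^esub> x) = r \<odot>\<^bsub>W\<^esub> \<beta> x"
      using * u \<alpha>A r by (simp add: \<beta> W.smult_r_distr W.smult_assoc1)
  qed
  ultimately show ?thesis using that by blast
qed

end

text \<open>A proper subspace leaves out some vector, and adjoining it lowers
  \<open>card (carrier V) - card A\<close>. Starting from \<open>A0\<close> instead of zero lets the
  same rule extend maps already given on a subspace.\<close>

lemma finite_subspace_induct [consumes 2, case_names base adjoin]:
  assumes "finite (carrier V)" "LinearCombinations.submodule K A0 V"
    and base: "P A0"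
    and step: "\<And>A v. LinearCombinations.submodule K A V \<Longrightarrow> A0 \<subseteq> A \<Longrightarrow> v \<in> carrier V \<Longrightarrow> v \<notin> A \<Longrightarrow> P A \<Longrightarrow> P (adjoin A v)"
  shows "P (carrier V)"
proof -
  have "P (carrier V)" if "LinearCombinations.submodule K A V" "A0 \<subseteq> A" "P A" for A
    using that
  proof (induction "card (carrier V) - card A" arbitrary: A rule: less_induct)
    case less
    interpret A: LinearCombinations.submodule K A V by fact
    show ?case
    proof (cases "A = carrier V")
      case False
      then obtain v where v: "v \<in> carrier V" "v \<notin> A" using A.subset by auto
      have sub: "adjoin A v \<subseteq> carrier V"
        using adjoin_submodule[OF less(2) v] by (simp add: submodule_def)
      have "card A < card (adjoin A v)" "card (adjoin A v) \<le> card (carrier V)"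
        using adjoin_supset[OF less(2) v] sub assms(1)
        by (auto intro!: psubset_card_mono card_mono intro: finite_subset)
      then show ?thesis
        using less v adjoin_supset[OF less(2) v]
        by (intro less(1)[OF _ adjoin_submodule[OF less(2) v]] step) auto
    qed (use less in auto)
  qed
  then show ?thesis using assms by auto
qed

lemma zero_submodule: "LinearCombinations.submodule K {\<zero>\<^bsub>V\<^esub>} V"
  by unfold_locales auto

lemma zero_hom:
  assumes "vectorspace K W"
  shows "(\<lambda>_. \<zero>\<^bsub>W\<^esub>) \<in> module_hom K M W"
proof -
  interpret W: vectorspace K W by fact
  show ?thesis by (intro module_homI) auto
qed

text \<open>Each new vector is sent to an arbitrary preimage under \<open>g\<close>; linearity gives
  the section property on the enlarged subspace.\<close>

lemma linear_section:
  assumes fin: "finite (carrier V)" and L: "vectorspace K L" and g: "g \<in> module_hom K L V" 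
    and surj: "g ` carrier L = carrier V"
  obtains \<sigma> where "\<sigma> \<in> module_hom K V L" "\<And>x. x \<in> carrier V \<Longrightarrow> g (\<sigma> x) = x"
proof -
  interpret L: vectorspace K L by fact
  have g0: "g \<zero>\<^bsub>L\<^esub> = \<zero>\<^bsub>V\<^esub>"
    by (rule module_hom_zero[OF L.module_axioms module_axioms g])
  have "\<exists>\<sigma>\<in>module_hom K (V\<lparr>carrier := carrier V\<rparr>) L. \<forall>x\<in>carrier V. g (\<sigma> x) = x"
    using fin zero_submodule
  proof (induction rule: finite_subspace_induct)
    case base
    show ?case
      by (rule bexI[OF _ zero_hom[OF L]]) (simp add: g0)
  next
    case (adjoin A v)
    from adjoin(5) obtain \<sigma> where \<sigma>: "\<sigma> \<in> module_hom K (V\<lparr>carrier := A\<rparr>) L" "\<And>x. x \<in> A \<Longrightarrow> g (\<sigma> x) = x" by blast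
    obtain u where u: "u \<in> carrier L" "g u = v" using surj adjoin(3) by (metis imageE)
    obtain \<beta> where \<beta>: "\<beta> \<in> module_hom K (V\<lparr>carrier := adjoin A v\<rparr>) L"
      "\<And>a c. a \<in> A \<Longrightarrow> c \<in> carrier K \<Longrightarrow> \<beta> (a \<oplus>\<^bsub>V\<^esub> c \<odot>\<^bsub>V\<^esub> v) = \<sigma> a \<oplus>\<^bsub>L\<^esub> c \<odot>\<^bsub>L\<^esub> u"
      using hom_adjoin[OF adjoin(1) adjoin(3,4) L \<sigma>(1) u(1)] by blast
    have "\<sigma> a \<in> carrier L" if "a \<in> A" for a using \<sigma>(1) that by (auto simp: module_hom_def)
    then have "g (\<beta> x) = x" if "x \<in> adjoin A v" for x
    proof -
      from that obtain a c where x: "x = a \<oplus>\<^bsub>V\<^esub> c \<odot>\<^bsub>V\<^esub> v" "a \<in> A" "c \<in> carrier K" by (auto simp: adjoin_def)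
      with \<open>\<And>a. a \<in> A \<Longrightarrow> \<sigma> a \<in> carrier L\<close> u \<sigma>(2) show ?thesis
        by (simp add: \<beta>(2) module_hom_add[OF g] module_hom_smult[OF g])
    qed
    then show ?case using \<beta>(1) by blast
  qed
  moreover have "V\<lparr>carrier := carrier V\<rparr> = V" by simp
  ultimately show ?thesis using that by metis
qed

text \<open>The new vector is sent outside the image of \<open>B\<close>, which is proper because it
  has fewer elements than \<open>W\<close>; uniqueness of coordinates in \<open>W\<close> keeps the
  map injective. Equality of the orders finally turns the injection into a bijection.\<close>

lemma iso_extension:
  assumes fin: "finite (carrier V)" "finite (carrier W)" and W: "vectorspace K W" 
    and card: "card (carrier V) = card (carrier W)"
    and A: "LinearCombinations.submodule K A V"
    and \<alpha>: "\<alpha> \<in> module_hom K (V\<lparr>carrier := A\<rparr>) W" "inj_on \<alpha> A"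
  obtains \<beta> where "\<beta> \<in> module_hom K V W" "bij_betw \<beta> (carrier V) (carrier W)" 
    "\<And>x. x \<in> A \<Longrightarrow> \<beta> x = \<alpha> x"
proof -
  interpret W: vectorspace K W by fact
  have "\<exists>\<beta>\<in>module_hom K (V\<lparr>carrier := carrier V\<rparr>) W. inj_on \<beta> (carrier V) \<and> (\<forall>x\<in>A. \<beta> x = \<alpha> x)"
    using fin(1) A
  proof (induction rule: finite_subspace_induct)
    case base
    then show ?case using \<alpha> by auto
  next
    case (adjoin B v)
    from adjoin(5) obtain \<beta> where \<beta>: "\<beta> \<in> module_hom K (V\<lparr>carrier := B\<rparr>) W" "inj_on \<beta> B" "\<And>x. x \<in> A \<Longrightarrow> \<beta> x = \<alpha> x" 
      by blast
    interpret B: LinearCombinations.submodule K B V by fact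
    have \<beta>B: "\<beta> b \<in> carrier W" if "b \<in> B" for b using \<beta>(1) that by (auto simp: module_hom_def)
    have "B \<subset> carrier V" using adjoin(3,4) B.subset by auto
    then have "card B < card (carrier W)" using fin(1) card by (metis psubset_card_mono)
    then have "\<beta> ` B \<noteq> carrier W" using \<beta>(2) by (metis card_image less_irrefl)
    then obtain u where u: "u \<in> carrier W" "u \<notin> \<beta> ` B" using \<beta>B by blast
    obtain \<gamma> where \<gamma>: "\<gamma> \<in> module_hom K (V\<lparr>carrier := adjoin B v\<rparr>) W"
      "\<And>a c. a \<in> B \<Longrightarrow> c \<in> carrier K \<Longrightarrow> \<gamma> (a \<oplus>\<^bsub>V\<^esub> c \<odot>\<^bsub>V\<^esub> v) = \<beta> a \<oplus>\<^bsub>W\<^esub> c \<odot>\<^bsub>W\<^esub> u"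
      using hom_adjoin[OF adjoin(1) adjoin(3,4) W \<beta>(1) u(1)] by blast
    have modB: "module K (V\<lparr>carrier := B\<rparr>)" using submodule_is_module adjoin(1) by blast
    then have mh: "mod_hom K (V\<lparr>carrier := B\<rparr>) W \<beta>"
      using W.module_axioms \<beta>(1) by (simp only: mod_hom_def mod_hom_axioms_def)
    then have im: "LinearCombinations.submodule K (\<beta> ` B) W"
      using mod_hom.im_is_submodule[OF mh] unfolding mod_hom.im_def[OF mh] by simp
    have "inj_on \<gamma> (adjoin B v)"
    proof
      fix x y assume "x \<in> adjoin B v" "y \<in> adjoin B v" and eq: "\<gamma> x = \<gamma> y"
      then obtain a c a' c' where *: "x = a \<oplus>\<^bsub>V\<^esub> c \<odot>\<^bsub>V\<^esub> v" "y = a' \<oplus>\<^bsub>V\<^esub> c' \<odot>\<^bsub>V\<^esub> v"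
        "a \<in> B" "a' \<in> B" "c \<in> carrier K" "c' \<in> carrier K" unfolding adjoin_def by blast
      then have "\<beta> a = \<beta> a' \<and> c = c'"
        using eq by (intro W.adjoin_unique[OF im u]) (simp_all add: \<gamma>(2))
      then show "x = y" using * inj_onD[OF \<beta>(2)] by blast
    qed
    moreover have "\<gamma> x = \<alpha> x" if "x \<in> A" for x
    proof -
      have x: "x \<in> B" "x \<in> carrier V" using that adjoin(2) B.subset by auto
      then have "\<gamma> x = \<gamma> (x \<oplus>\<^bsub>V\<^esub> \<zero>\<^bsub>K\<^esub> \<odot>\<^bsub>V\<^esub> v)" using adjoin(3) by simp
      also have "\<dots> = \<beta> x" using x(1) u \<beta>B by (simp add: \<gamma>(2))
      finally show ?thesis using \<beta>(3) that by simp
    qed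
    ultimately show ?case using \<gamma>(1) by blast
  qed
  moreover have "V\<lparr>carrier := carrier V\<rparr> = V" by simp
  ultimately obtain \<beta> where \<beta>: "\<beta>\<in>module_hom K V W" "inj_on \<beta> (carrier V)" "\<forall>x\<in>A. \<beta> x = \<alpha> x" by metis
  have "\<beta> ` carrier V \<subseteq> carrier W" using \<beta>(1) by (auto simp: module_hom_def)
  moreover have "card (\<beta> ` carrier V) = card (carrier W)" using \<beta>(2) card by (simp add: card_image)
  ultimately have "\<beta> ` carrier V = carrier W" using fin(2) by (intro card_subset_eq) auto
  then show ?thesis using \<beta> that by (auto simp: bij_betw_def)
qed

text \<open>Extending the zero map from the zero subspace gives an isomorphism between
  \<open>A\<close> and \<open>B\<close>, which is extended once more to the whole spaces.\<close>

lemma iso_pair: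
  assumes fin: "finite (carrier V)" "finite (carrier W)" and W: "vectorspace K W" 
    and card: "card (carrier V) = card (carrier W)"
    and A: "LinearCombinations.submodule K A V" and B: "LinearCombinations.submodule K B W" "card A = card B"
  obtains \<beta> where "\<beta> \<in> module_hom K V W" "bij_betw \<beta> (carrier V) (carrier W)" "\<beta> ` A = B"
proof -
  interpret W: vectorspace K W by fact
  interpret A: LinearCombinations.submodule K A V by fact
  interpret B: LinearCombinations.submodule K B W by fact
  interpret VA: vectorspace K "V\<lparr>carrier := A\<rparr>" 
    using subspace_is_vs A vectorspace_axioms by (auto simp: subspace_def)
  interpret WB: vectorspace K "W\<lparr>carrier := B\<rparr>" 
    using W.subspace_is_vs B W by (auto simp: subspace_def)
  have "finite A" "finite B" using A.subset B.subset fin finite_subset by blast+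
  obtain \<alpha> where "\<alpha> \<in> module_hom K (V\<lparr>carrier := A\<rparr>) (W\<lparr>carrier := B\<rparr>)" 
    "bij_betw \<alpha> (carrier (V\<lparr>carrier := A\<rparr>)) (carrier (W\<lparr>carrier := B\<rparr>))"
    by (rule VA.iso_extension[OF _ _ WB.vectorspace_axioms _ VA.zero_submodule VA.zero_hom[OF WB.vectorspace_axioms]])
      (use B(2) \<open>finite A\<close> \<open>finite B\<close> in simp_all)
  then have \<alpha>: "\<alpha> \<in> module_hom K (V\<lparr>carrier := A\<rparr>) (W\<lparr>carrier := B\<rparr>)" "bij_betw \<alpha> A B" by simp_all
  have "\<alpha> \<in> module_hom K (V\<lparr>carrier := A\<rparr>) W" using \<alpha>(1) B.subset by (auto simp: module_hom_def)
  moreover have "inj_on \<alpha> A" using \<alpha>(2) by (simp add: bij_betw_def)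
  ultimately obtain \<beta> where \<beta>: "\<beta> \<in> module_hom K V W" "bij_betw \<beta> (carrier V) (carrier W)" 
    "\<And>x. x \<in> A \<Longrightarrow> \<beta> x = \<alpha> x"
    using iso_extension[OF fin W card A] by blast
  have "\<beta> ` A = \<alpha> ` A" using \<beta>(3) by (rule image_cong[OF refl])
  then show ?thesis using that \<beta> \<alpha>(2) by (simp add: bij_betw_def)
qed

text \<open>The exponent is the dimension of \<open>V\<close>: every adjoined vector multiplies the
  order of \<open>V\<close> by that of \<open>K\<close>, and the number of maps by the number of its
  possible values in \<open>W\<close>. One statement for both powers makes the exponents agree by
  construction.\<close>

lemma card_hom:
  assumes fin: "finite (carrier V)" "finite (carrier K)" "finite (carrier W)" and W: "vectorspace K W" 
  shows "\<exists>n. card (carrier V) = card (carrier K) ^ n \<and> 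
    card (module_hom K V W \<inter> extensional (carrier V)) = card (carrier W) ^ n"
proof -
  interpret W: vectorspace K W by fact
  have "\<exists>n. card (carrier V) = card (carrier K) ^ n \<and> 
    card (module_hom K (V\<lparr>carrier := carrier V\<rparr>) W \<inter> extensional (carrier V)) = card (carrier W) ^ n"
    using fin(1) zero_submodule
  proof (induction rule: finite_subspace_induct)
    case base
    have "f = (\<lambda>x\<in>{\<zero>\<^bsub>V\<^esub>}. \<zero>\<^bsub>W\<^esub>)" 
      if f: "f \<in> module_hom K (V\<lparr>carrier := {\<zero>\<^bsub>V\<^esub>}\<rparr>) W \<inter> extensional {\<zero>\<^bsub>V\<^esub>}" for f
    proof -
      have "module K (V\<lparr>carrier := {\<zero>\<^bsub>V\<^esub>}\<rparr>)" using submodule_is_module zero_submodule by blast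
      then have "f \<zero>\<^bsub>V\<^esub> = \<zero>\<^bsub>W\<^esub>" using module_hom_zero[OF _ W.module_axioms, of "V\<lparr>carrier := {\<zero>\<^bsub>V\<^esub>}\<rparr>" f] f by auto
      then show ?thesis using f by (auto simp: extensional_def fun_eq_iff)
    qed
    moreover have "(\<lambda>x\<in>{\<zero>\<^bsub>V\<^esub>}. \<zero>\<^bsub>W\<^esub>) \<in> module_hom K (V\<lparr>carrier := {\<zero>\<^bsub>V\<^esub>}\<rparr>) W"
      by (intro module_homI) auto
    ultimately have "module_hom K (V\<lparr>carrier := {\<zero>\<^bsub>V\<^esub>}\<rparr>) W \<inter> extensional {\<zero>\<^bsub>V\<^esub>} = {\<lambda>x\<in>{\<zero>\<^bsub>V\<^esub>}. \<zero>\<^bsub>W\<^esub>}" 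
      by auto
    then have "card (module_hom K (V\<lparr>carrier := {\<zero>\<^bsub>V\<^esub>}\<rparr>) W \<inter> extensional {\<zero>\<^bsub>V\<^esub>}) = 1" by simp
    then show ?case by (intro exI[of _ 0]) simp
  next
    case (adjoin A v)
    interpret A: LinearCombinations.submodule K A V by fact
    let ?H = "module_hom K (V\<lparr>carrier := A\<rparr>) W \<inter> extensional A"
    let ?H' = "module_hom K (V\<lparr>carrier := adjoin A v\<rparr>) W \<inter> extensional (adjoin A v)"
    from adjoin(5) obtain n where n: "card A = card (carrier K) ^ n" "card ?H = card (carrier W) ^ n" by blast
    note Asub = adjoin_supset[OF adjoin(1,3,4)]
    have mem: "a \<oplus>\<^bsub>V\<^esub> c \<odot>\<^bsub>V\<^esub> v \<in> adjoin A v" if "a \<in> A" "c \<in> carrier K" for a c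
      using that by (auto simp: adjoin_def)
    have v_mem: "v \<in> adjoin A v" using mem[of "\<zero>\<^bsub>V\<^esub>" "\<one>\<^bsub>K\<^esub>"] adjoin(3) by simp
    have cv_mem: "c \<odot>\<^bsub>V\<^esub> v \<in> adjoin A v" if "c \<in> carrier K" for c using mem[of "\<zero>\<^bsub>V\<^esub>" c] that adjoin(3) by simp
    \<comment> \<open>A map on the enlarged subspace amounts to its restriction to \<open>A\<close>
      together with its value at \<open>v\<close>.\<close>
    let ?F = "\<lambda>f. (restrict f A, f v)"
    have val: "f (a \<oplus>\<^bsub>V\<^esub> c \<odot>\<^bsub>V\<^esub> v) = f a \<oplus>\<^bsub>W\<^esub> c \<odot>\<^bsub>W\<^esub> f v" if "f \<in> ?H'" "a \<in> A" "c \<in> carrier K" for f a c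
      using that v_mem cv_mem[of c] Asub by (auto simp: module_hom_def)
    have "bij_betw ?F ?H' (?H \<times> carrier W)"
      unfolding bij_betw_def
    proof
      show "inj_on ?F ?H'"
      proof
        fix f g assume fg: "f \<in> ?H'" "g \<in> ?H'" and eq: "?F f = ?F g"
        have "f a = g a" if "a \<in> A" for a using eq that by (metis Pair_inject restrict_apply')
        then have "f x = g x" if "x \<in> adjoin A v" for x 
          using that eq val[OF fg(1)] val[OF fg(2)] by (auto simp: adjoin_def)
        then show "f = g" using fg by (auto intro: extensionalityI)
      qed
      show "?F ` ?H' = ?H \<times> carrier W"
      proof
        show "?F ` ?H' \<subseteq> ?H \<times> carrier W"
        proof
          fix y assume "y \<in> ?F ` ?H'"
          then obtain f where f: "f \<in> ?H'" "y = ?F f" by auto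
          have "restrict f A \<in> module_hom K (V\<lparr>carrier := A\<rparr>) W"
          proof (rule module_homI)
            have AsubD: "x \<in> adjoin A v" if "x \<in> A" for x using Asub that by blast
            fix x assume x: "x \<in> carrier (V\<lparr>carrier := A\<rparr>)"
            then show "restrict f A x \<in> carrier W" using f(1) AsubD by (simp add: module_hom_def Pi_iff)
            show "restrict f A (x \<oplus>\<^bsub>V\<lparr>carrier := A\<rparr>\<^esub> y) = restrict f A x \<oplus>\<^bsub>W\<^esub> restrict f A y" 
              if "y \<in> carrier (V\<lparr>carrier := A\<rparr>)" for y
              using f(1) AsubD x that by (simp add: module_hom_def)
            show "restrict f A (r \<odot>\<^bsub>V\<lparr>carrier := A\<rparr>\<^esub> x) = r \<odot>\<^bsub>W\<^esub> restrict f A x" 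
              if "r \<in> carrier K" for r
              using f(1) AsubD x that by (simp add: module_hom_def)
          qed
          then show "y \<in> ?H \<times> carrier W" using f v_mem by (auto simp: module_hom_def)
        qed
        show "?H \<times> carrier W \<subseteq> ?F ` ?H'"
        proof
          fix y assume "y \<in> ?H \<times> carrier W"
          then obtain \<alpha> u where y: "y = (\<alpha>, u)" "\<alpha> \<in> ?H" "u \<in> carrier W" by auto
          then obtain \<beta> where \<beta>: "\<beta> \<in> module_hom K (V\<lparr>carrier := adjoin A v\<rparr>) W"
            "\<And>a c. a \<in> A \<Longrightarrow> c \<in> carrier K \<Longrightarrow> \<beta> (a \<oplus>\<^bsub>V\<^esub> c \<odot>\<^bsub>V\<^esub> v) = \<alpha> a \<oplus>\<^bsub>W\<^esub> c \<odot>\<^bsub>W\<^esub> u"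
            using hom_adjoin[OF adjoin(1) adjoin(3,4) W _ y(3), of \<alpha>] by blast
          have \<alpha>A: "\<alpha> a \<in> carrier W" if "a \<in> A" for a using y(2) that by (auto simp: module_hom_def)
          have "module K (V\<lparr>carrier := A\<rparr>)" using submodule_is_module adjoin(1) by blast
          then have \<alpha>0: "\<alpha> \<zero>\<^bsub>V\<^esub> = \<zero>\<^bsub>W\<^esub>" using module_hom_zero[OF _ W.module_axioms, of "V\<lparr>carrier := A\<rparr>" \<alpha>] y by auto
          have \<beta>v: "\<beta> v = u"
            using \<beta>(2)[of "\<zero>\<^bsub>V\<^esub>" "\<one>\<^bsub>K\<^esub>"] adjoin(3) y(3) \<alpha>0 by simp
          have \<beta>A: "\<beta> a = \<alpha> a" if "a \<in> A" for a
            using \<beta>(2)[of a "\<zero>\<^bsub>K\<^esub>"] adjoin(3) y(3) that A.subset \<alpha>A by (simp add: subsetD)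
          have "restrict \<beta> (adjoin A v) \<in> ?H'"
            using module_hom_cong[OF \<beta>(1), of "restrict \<beta> (adjoin A v)"] 
              submodule_is_module[OF adjoin_submodule[OF adjoin(1,3,4)]] by auto
          moreover have "?F (restrict \<beta> (adjoin A v)) = y"
            using y(2) \<beta>v \<beta>A v_mem Asub by (auto simp: y(1) restrict_def extensional_def fun_eq_iff)
          ultimately show "y \<in> ?F ` ?H'" by blast
        qed
      qed
    qed
    then have "card ?H' = card (carrier W) ^ Suc n"
      using n(2) by (simp add: bij_betw_same_card card_cartesian_product)
    moreover have "card (adjoin A v) = card (carrier K) ^ Suc n"
      using card_adjoin[OF adjoin(1,3,4) fin(1,2)] n(1) by simp
    ultimately show ?case by blast
  qed
  moreover have "V\<lparr>carrier := carrier V\<rparr> = V" by simp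
  ultimately show ?thesis by auto
qed

text \<open>Coordinates in a basis identify \<open>V\<close> with the functions from the basis to
  \<open>K\<close>. This ties the orders used for counting to the library's \<open>dim\<close>, and
  so to the exponents of the twist.\<close>

lemma card_eq_card_field_power_dim:
  assumes "finite (carrier V)"
  shows "card (carrier V) = card (carrier K) ^ dim"
proof -
  have "fin_dim"
    using assms in_own_span[of "carrier V"] span_is_subset2[of "carrier V"] 
    by (auto simp: fin_dim_def intro!: exI[of _ "carrier V"])
  then obtain B where B: "finite B" "basis B" using finite_basis_exists by blast
  have Bc: "B \<subseteq> carrier V" using B by (auto simp: basis_def)
  have uniq: "\<forall>v. v \<in> carrier V \<longrightarrow> (\<exists>!a. a \<in> B \<rightarrow>\<^sub>E carrier K \<and> lincomb a B = v)"
    using basis_criterion[OF B(1) Bc] B(2) by simp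
  have "bij_betw (\<lambda>a. lincomb a B) (B \<rightarrow>\<^sub>E carrier K) (carrier V)"
    unfolding bij_betw_def
  proof
    have cl: "lincomb a B \<in> carrier V" if "a \<in> B \<rightarrow>\<^sub>E carrier K" for a
      using that Bc by (intro lincomb_closed) auto
    show "inj_on (\<lambda>a. lincomb a B) (B \<rightarrow>\<^sub>E carrier K)"
      using uniq cl by (intro inj_onI) blast
    show "(\<lambda>a. lincomb a B) ` (B \<rightarrow>\<^sub>E carrier K) = carrier V" using uniq cl by blast
  qed
  then have "card (carrier V) = card (B \<rightarrow>\<^sub>E carrier K)" by (metis bij_betw_same_card)
  also have "\<dots> = card (carrier K) ^ card B" using B by (simp add: card_funcsetE)
  finally show ?thesis using dim_basis[OF B] by simp
qed

end

lemma finite_if_fin_dim: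
  assumes "vectorspace K V" "vectorspace.fin_dim K V" "finite (carrier K)"
  shows "finite (carrier V)"
proof -
  interpret vectorspace K V by fact
  obtain A where A: "finite A" "A \<subseteq> carrier V" "span A = carrier V" using assms by (auto simp: fin_dim_def)
  have "carrier V \<subseteq> (\<lambda>a. lincomb a A) ` (A \<rightarrow>\<^sub>E carrier K)"
  proof
    fix v assume "v \<in> carrier V"
    then obtain a where a: "a \<in> A \<rightarrow> carrier K" "lincomb a A = v" using A finite_in_span[of A v] by auto
    have "lincomb (restrict a A) A = lincomb a A"
      using a A by (intro lincomb_cong) auto
    then show "v \<in> (\<lambda>a. lincomb a A) ` (A \<rightarrow>\<^sub>E carrier K)" using a by (auto intro!: image_eqI[of _ _ "restrict a A"])
  qed
  moreover have "finite (A \<rightarrow>\<^sub>E carrier K)" using A assms by (intro finite_PiE) auto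
  ultimately show ?thesis using finite_surj by blast
qed

text \<open>Both numbers are the order of \<open>K\<close> raised to the product of the two
  dimensions.\<close>

lemma card_hom_commute:
  assumes V: "vectorspace K V" "finite (carrier V)" and W: "vectorspace K W" "finite (carrier W)"
    and K: "finite (carrier K)"
  shows "card (module_hom K V W \<inter> extensional (carrier V)) = card (module_hom K W V \<inter> extensional (carrier W))"
proof -
  obtain n where n: "card (carrier V) = card (carrier K) ^ n" 
      "card (module_hom K V W \<inter> extensional (carrier V)) = card (carrier W) ^ n"
    using vectorspace.card_hom[OF V K W(2,1)] by blast
  obtain m where m: "card (carrier W) = card (carrier K) ^ m" 
      "card (module_hom K W V \<inter> extensional (carrier W)) = card (carrier V) ^ m"
    using vectorspace.card_hom[OF W K V(2,1)] by blast
  show ?thesis by (simp add: n m power_mult[symmetric] mult.commute)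
qed

subsection \<open>The algebra \<open>k[x]/(x\<^sup>2)\<close>\<close>

abbreviation kring :: "'k::{field,finite} ring" where
  "kring \<equiv> ring_of_type_algebra"

lemma kring_simps [simp]:
  "carrier ring_of_type_algebra = UNIV" "a \<oplus>\<^bsub>ring_of_type_algebra\<^esub> b = a + b"
  "a \<otimes>\<^bsub>ring_of_type_algebra\<^esub> b = a * b" "\<one>\<^bsub>ring_of_type_algebra\<^esub> = 1" "\<zero>\<^bsub>ring_of_type_algebra\<^esub> = 0"
  by (simp_all add: ring_of_type_algebra_def)

definition lam :: "'k::{field,finite} poly \<Rightarrow> 'k poly set" where
  "lam p = (PIdl\<^bsub>(ring_of_type_algebra :: 'k poly ring)\<^esub> ([:0, 1:] ^ 2))
                   +>\<^bsub>(ring_of_type_algebra :: 'k poly ring)\<^esub> p"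

abbreviation lamx :: "'k::{field,finite} poly set" where
  "lamx \<equiv> lam [:0, 1:]"

lemma Lam_const_lam: "Lam_const c = lam [:c:]"
  by (simp add: Lam_const_def lam_def)

lemma X2_dvd_iff:
  fixes p :: "'k::field poly"
  shows "[:0, 1:] ^ 2 dvd p \<longleftrightarrow> coeff p 0 = 0 \<and> coeff p 1 = 0"
proof -
  have eq: "[:0, 1:] ^ 2 = (monom 1 2 :: 'k poly)"
    by (simp add: monom_altdef)
  show ?thesis unfolding eq monom_1_dvd_iff' by (auto simp: less_2_cases_iff)
qed

lemma ideal_X2: "ideal (PIdl\<^bsub>(ring_of_type_algebra :: 'k::{field,finite} poly ring)\<^esub> ([:0, 1:] ^ 2)) ring_of_type_algebra"
  by (rule cring.cgenideal_ideal[OF cring_from_type_algebra]) simp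

lemma mem_X2:
  fixes p :: "'k::{field,finite} poly"
  shows "p \<in> PIdl\<^bsub>(ring_of_type_algebra :: 'k::{field,finite} poly ring)\<^esub> ([:0, 1:] ^ 2) \<longleftrightarrow>
    coeff p 0 = 0 \<and> coeff p 1 = 0"
proof -
  have "p \<in> PIdl\<^bsub>(ring_of_type_algebra :: 'k poly ring)\<^esub> ([:0, 1:] ^ 2) \<longleftrightarrow> [:0, 1:] ^ 2 dvd p"
    by (simp only: cgenideal_def kring_simps dvd_def mem_Collect_eq mult.commute UNIV_I) blast
  then show ?thesis by (simp only: X2_dvd_iff)
qed

lemma mem_lam: "p' \<in> lam p \<longleftrightarrow> coeff p' 0 = coeff p 0 \<and> coeff p' 1 = coeff p 1"
proof -
  have "p' \<in> lam p \<longleftrightarrow> (\<exists>h. (coeff h 0 = 0 \<and> coeff h 1 = 0) \<and> p' = h + p)"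
    unfolding lam_def a_r_coset_def r_coset_def
    by (auto simp only: mem_X2 UN_iff kring_simps monoid.simps partial_object.simps singleton_iff)
  also have "\<dots> \<longleftrightarrow> coeff p' 0 = coeff p 0 \<and> coeff p' 1 = coeff p 1"
    by (rule iffI, force) (auto intro!: exI[of _ "p' - p"])
  finally show ?thesis .
qed

lemma lam_eq_iff: "lam p = lam p' \<longleftrightarrow> coeff p 0 = coeff p' 0 \<and> coeff p 1 = coeff p' 1"
proof
  assume "lam p = lam p'"
  then have "p \<in> lam p'" using mem_lam[of p p] by simp
  then show "coeff p 0 = coeff p' 0 \<and> coeff p 1 = coeff p' 1" by (simp add: mem_lam)
qed (simp add: set_eq_iff mem_lam)

lemma cring_Lam: "cring Lam"
  unfolding Lam_def by (rule ideal.quotient_is_cring[OF ideal_X2 cring_from_type_algebra])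

lemma lam_ring_hom: "(lam :: 'k::{field,finite} poly \<Rightarrow> _) \<in> ring_hom ring_of_type_algebra Lam"
proof -
  have lam: "(lam :: 'k poly \<Rightarrow> _) = (+>\<^bsub>ring_of_type_algebra\<^esub>) (PIdl\<^bsub>(ring_of_type_algebra :: 'k poly ring)\<^esub> ([:0, 1:] ^ 2))"
    by (simp add: fun_eq_iff lam_def)
  show ?thesis unfolding Lam_def lam by (rule ideal.rcos_ring_hom[OF ideal_X2])
qed

lemma lam_closed [simp]: "lam p \<in> carrier Lam"
  using ring_hom_closed[OF lam_ring_hom] by simp

lemma lam_add: "lam p \<oplus>\<^bsub>Lam\<^esub> lam p' = lam (p + p')"
  using ring_hom_add[OF lam_ring_hom, of p p'] by simp

lemma lam_mult: "lam p \<otimes>\<^bsub>Lam\<^esub> lam p' = lam (p * p')"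
  using ring_hom_mult[OF lam_ring_hom, of p p'] by simp

lemma lam_const_mult: "lam [:a:] \<otimes>\<^bsub>Lam\<^esub> lam [:b:] = lam [:a * b:]"
  by (simp add: lam_mult lam_eq_iff)

lemma lam_one: "\<one>\<^bsub>Lam\<^esub> = lam 1"
  using ring_hom_one[OF lam_ring_hom] by (metis kring_simps(4))

lemma lam_zero: "\<zero>\<^bsub>Lam\<^esub> = lam 0"
proof -
  interpret cring Lam by (rule cring_Lam)
  have "lam 0 \<oplus>\<^bsub>Lam\<^esub> lam 0 = lam 0" by (simp add: lam_add)
  then show ?thesis using lam_closed[of 0] by (metis add.r_cancel_one')
qed

lemma carrier_Lam: "carrier (Lam :: 'k::{field,finite} poly set ring) = range (\<lambda>(a, b). lam [:a, b:])"
proof -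
  have "carrier (Lam :: 'k poly set ring) = range lam"
    unfolding Lam_def FactRing_def A_RCOSETS_def RCOSETS_def
    by (simp only: partial_object.simps lam_def[abs_def] a_r_coset_def kring_simps monoid.simps UNION_singleton_eq_range)
  also have "\<dots> = range (\<lambda>(a, b). lam [:a, b:])"
  proof -
    have "lam p = lam [:coeff p 0, coeff p 1:]" for p :: "'k poly" by (simp add: lam_eq_iff)
    then show ?thesis by (auto simp: image_def)
  qed
  finally show ?thesis .
qed

lemma Lam_cases:
  fixes r :: "'k::{field,finite} poly set"
  assumes "r \<in> carrier Lam"
  obtains a b where "r = lam [:a, b:]"
  using assms by (auto simp: carrier_Lam)

lemma inj_lam: "inj (\<lambda>(a, b). lam [:a, b:])"
  by (auto simp: inj_def lam_eq_iff)

text \<open>A coefficient of a coset, read off an arbitrary representative; only the indices 0 and 1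
  are independent of that choice.\<close>

definition lcoef :: "nat \<Rightarrow> 'k::{field,finite} poly set \<Rightarrow> 'k" where
  "lcoef i r = coeff (SOME p. p \<in> r) i"

lemma lcoef_lam [simp]: "lcoef 0 (lam p) = coeff p 0" "lcoef (Suc 0) (lam p) = coeff p 1"
proof -
  have "(SOME p'. p' \<in> lam p) \<in> lam p" by (rule someI[of _ p]) (simp add: mem_lam)
  then show "lcoef 0 (lam p) = coeff p 0" "lcoef (Suc 0) (lam p) = coeff p 1"
    by (simp_all add: lcoef_def mem_lam)
qed

subsection \<open>Modules as vector spaces with a square-zero endomorphism\<close>

abbreviation xop :: "('k::{field,finite} poly set, 'a) module \<Rightarrow> 'a \<Rightarrow> 'a" where
  "xop M m \<equiv> lamx \<odot>\<^bsub>M\<^esub> m"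

lemma restrict_to_k_simps [simp]:
  "carrier (restrict_to_k M) = carrier M" "\<zero>\<^bsub>restrict_to_k M\<^esub> = \<zero>\<^bsub>M\<^esub>"
  "x \<oplus>\<^bsub>restrict_to_k M\<^esub> y = x \<oplus>\<^bsub>M\<^esub> y" "c \<odot>\<^bsub>restrict_to_k M\<^esub> x = lam [:c:] \<odot>\<^bsub>M\<^esub> x"
  by (simp_all add: restrict_to_k_def Lam_const_lam)

lemma restrict_to_k_minus:
  "a_inv (restrict_to_k M) = a_inv M" "x \<ominus>\<^bsub>restrict_to_k M\<^esub> y = x \<ominus>\<^bsub>M\<^esub> y"
proof -
  show 1: "a_inv (restrict_to_k M) = a_inv M"
    by (simp add: fun_eq_iff a_inv_def m_inv_def)
  show "x \<ominus>\<^bsub>restrict_to_k M\<^esub> y = x \<ominus>\<^bsub>M\<^esub> y" by (simp add: a_minus_def 1)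
qed

lemma vectorspace_restrict:
  assumes "module Lam M"
  shows "vectorspace (kring :: 'k ring) (restrict_to_k (M :: ('k::{field,finite} poly set, 'a) module))"
proof -
  interpret M: module Lam M by fact
  show ?thesis
  proof (rule vs_criteria)
    show "field (kring :: 'k ring)" by (rule field_from_type_algebra)
    show "\<forall>v\<in>carrier (restrict_to_k M). \<exists>w\<in>carrier (restrict_to_k M). v \<oplus>\<^bsub>restrict_to_k M\<^esub> w = \<zero>\<^bsub>restrict_to_k M\<^esub>"
      using M.M.r_neg by auto
    show "\<forall>a b v. a \<in> carrier kring \<and> b \<in> carrier kring \<and> v \<in> carrier (restrict_to_k M) \<longrightarrow>
        (a \<otimes>\<^bsub>kring\<^esub> b) \<odot>\<^bsub>restrict_to_k M\<^esub> v = a \<odot>\<^bsub>restrict_to_k M\<^esub> (b \<odot>\<^bsub>restrict_to_k M\<^esub> v)"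
      by (simp add: M.smult_assoc1[symmetric] lam_const_mult)
    show "\<forall>v\<in>carrier (restrict_to_k M). \<one>\<^bsub>kring\<^esub> \<odot>\<^bsub>restrict_to_k M\<^esub> v = v"
      using M.smult_one by (simp add: lam_one pCons_one)
    show "\<forall>a b v. a \<in> carrier kring \<and> b \<in> carrier kring \<and> v \<in> carrier (restrict_to_k M) \<longrightarrow>
        (a \<oplus>\<^bsub>kring\<^esub> b) \<odot>\<^bsub>restrict_to_k M\<^esub> v = a \<odot>\<^bsub>restrict_to_k M\<^esub> v \<oplus>\<^bsub>restrict_to_k M\<^esub> b \<odot>\<^bsub>restrict_to_k M\<^esub> v"
      by (simp add: M.smult_l_distr[symmetric] lam_add)
  qed (simp_all add: M.M.a_ac M.smult_r_distr)
qed

lemma xop_closed: "module Lam M \<Longrightarrow> m \<in> carrier M \<Longrightarrow> xop M m \<in> carrier M"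
  by (simp add: module.smult_closed)

lemma xop_hom:
  assumes "module Lam M"
  shows "xop M \<in> module_hom kring (restrict_to_k M) (restrict_to_k M)"
proof -
  interpret M: module Lam M by fact
  show ?thesis by (rule module_homI) (simp_all add: M.smult_r_distr M.smult_assoc1[symmetric] lam_mult mult.commute)
qed

lemma xop_xop:
  fixes M :: "('k::{field,finite} poly set, 'a) module"
  assumes "module Lam M" "m \<in> carrier M"
  shows "xop M (xop M m) = \<zero>\<^bsub>M\<^esub>"
proof -
  interpret M: module Lam M by fact
  have "lam ([:0, 1:] * [:0, 1:]) = (lam 0 :: 'k poly set)" by (simp add: lam_eq_iff)
  then have "lamx \<otimes>\<^bsub>Lam\<^esub> lamx = (\<zero>\<^bsub>Lam\<^esub> :: 'k poly set)" unfolding lam_mult lam_zero .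
  then show ?thesis using assms by (simp add: M.smult_assoc1[symmetric])
qed

text \<open>Every scalar has the form \<open>a + b x\<close>, so the module structure is recovered
  from the k-structure and the operator \<open>x\<close>. This is what reduces homomorphisms to
  k-linear maps commuting with \<open>x\<close>.\<close>

lemma smult_lam:
  assumes "module Lam M" "m \<in> carrier M"
  shows "lam [:a, b:] \<odot>\<^bsub>M\<^esub> m = lam [:a:] \<odot>\<^bsub>M\<^esub> m \<oplus>\<^bsub>M\<^esub> lam [:b:] \<odot>\<^bsub>M\<^esub> xop M m"
proof -
  interpret M: module Lam M by fact
  have "lam [:a, b:] = lam [:a:] \<oplus>\<^bsub>Lam\<^esub> lam [:b:] \<otimes>\<^bsub>Lam\<^esub> lamx"
    by (simp add: lam_add lam_mult lam_eq_iff)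
  then show ?thesis using assms by (simp add: M.smult_l_distr M.smult_assoc1)
qed

lemma Lam_hom_iff:
  fixes M :: "('k::{field,finite} poly set, 'a) module"
  assumes M: "module Lam M" and N: "module Lam N"
  shows "f \<in> module_hom Lam M N \<longleftrightarrow>
    f \<in> module_hom kring (restrict_to_k M) (restrict_to_k N) \<and> (\<forall>m\<in>carrier M. f (xop M m) = xop N (f m))"
proof
  assume "f \<in> module_hom Lam M N"
  then show "f \<in> module_hom kring (restrict_to_k M) (restrict_to_k N) \<and> (\<forall>m\<in>carrier M. f (xop M m) = xop N (f m))"
    by (simp add: module_hom_def)
next
  interpret M: module Lam M by fact
  interpret N: module Lam N by fact
  assume f: "f \<in> module_hom kring (restrict_to_k M) (restrict_to_k N) \<and> (\<forall>m\<in>carrier M. f (xop M m) = xop N (f m))"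
  then have f1: "f x \<in> carrier N" "x \<in> carrier M \<Longrightarrow> y \<in> carrier M \<Longrightarrow> f (x \<oplus>\<^bsub>M\<^esub> y) = f x \<oplus>\<^bsub>N\<^esub> f y"
     "f (lam [:c:] \<odot>\<^bsub>M\<^esub> x) = lam [:c:] \<odot>\<^bsub>N\<^esub> f x" "f (xop M x) = xop N (f x)"
    if "x \<in> carrier M" for x y c
    using that by (auto simp: module_hom_def Pi_iff)
  show "f \<in> module_hom Lam M N"
  proof (rule module_homI)
    fix r :: "'k poly set" and x assume "r \<in> carrier Lam" and x: "x \<in> carrier M"
    then obtain a b where r: "r = lam [:a, b:]" using Lam_cases by blast
    show "f (r \<odot>\<^bsub>M\<^esub> x) = r \<odot>\<^bsub>N\<^esub> f x"
      using x smult_lam[OF M x, of a b] smult_lam[OF N f1(1)[OF x], of a b] unfolding r by (simp add: f1)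
  qed (use f1 in auto)
qed

lemma Lam_homI:
  assumes "module Lam M" "module Lam N" "f \<in> module_hom kring (restrict_to_k M) (restrict_to_k N)"
    and "\<And>m. m \<in> carrier M \<Longrightarrow> f (xop M m) = xop N (f m)"
  shows "f \<in> module_hom Lam M N"
  using assms by (simp add: Lam_hom_iff)

lemma Lam_hom_k: "f \<in> module_hom Lam M N \<Longrightarrow> f \<in> module_hom kring (restrict_to_k M) (restrict_to_k N)"
  by (simp add: module_hom_def)

lemma Lam_hom_xop: "f \<in> module_hom Lam M N \<Longrightarrow> m \<in> carrier M \<Longrightarrow> f (xop M m) = xop N (f m)"
  by (simp add: module_hom_smult)

section \<open>Modules built from a square-zero endomorphism\<close>

text \<open>Converse to the passage from a module to \<open>restrict_to_k\<close> and
  \<open>xop\<close>. It supplies the induced module in the study of projectives and the extension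
  that realizes a given map.\<close>

definition lam_mod :: "('k::{field,finite}, 'a) module \<Rightarrow> ('a \<Rightarrow> 'a) \<Rightarrow> ('k poly set, 'a) module" where
  "lam_mod V \<xi> = \<lparr>carrier = carrier V, monoid.mult = (\<lambda>_ _. \<zero>\<^bsub>V\<^esub>), one = \<zero>\<^bsub>V\<^esub>, ring.zero = \<zero>\<^bsub>V\<^esub>,
      add = add V, module.smult = (\<lambda>r m. (lcoef 0 r \<odot>\<^bsub>V\<^esub> m) \<oplus>\<^bsub>V\<^esub> (lcoef 1 r \<odot>\<^bsub>V\<^esub> (\<xi> m)))\<rparr>"

lemma lam_mod_simps [simp]:
  "carrier (lam_mod V \<xi>) = carrier V" "\<zero>\<^bsub>lam_mod V \<xi>\<^esub> = \<zero>\<^bsub>V\<^esub>" "x \<oplus>\<^bsub>lam_mod V \<xi>\<^esub> y = x \<oplus>\<^bsub>V\<^esub> y"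
  by (simp_all add: lam_mod_def)

lemma lam_mod:
  assumes V: "vectorspace (kring :: 'k::{field,finite} ring) V" and \<xi>: "\<xi> \<in> module_hom kring V V" 
    and XX: "\<And>m. m \<in> carrier V \<Longrightarrow> \<xi> (\<xi> m) = \<zero>\<^bsub>V\<^esub>"
  shows "module Lam (lam_mod V \<xi>)"
    and "m \<in> carrier V \<Longrightarrow> xop (lam_mod V \<xi>) m = \<xi> m"
    and "m \<in> carrier V \<Longrightarrow> lam [:c:] \<odot>\<^bsub>lam_mod V \<xi>\<^esub> m = c \<odot>\<^bsub>V\<^esub> m"
proof -
  interpret V: vectorspace kring V by fact
  have s0: "0 \<odot>\<^bsub>V\<^esub> m = \<zero>\<^bsub>V\<^esub>" "1 \<odot>\<^bsub>V\<^esub> m = m" if "m \<in> carrier V" for m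
    using V.smult_l_null[OF that] V.smult_one[OF that] by simp_all
  have cl: "c \<odot>\<^bsub>V\<^esub> m \<in> carrier V" if "m \<in> carrier V" for c m
    using V.smult_closed[OF _ that, of c] by simp
  have as: "(a * b) \<odot>\<^bsub>V\<^esub> m = a \<odot>\<^bsub>V\<^esub> (b \<odot>\<^bsub>V\<^esub> m)" if "m \<in> carrier V" for a b m
    using V.smult_assoc1[OF _ _ that, of a b] by simp
  have ld: "(a + b) \<odot>\<^bsub>V\<^esub> m = a \<odot>\<^bsub>V\<^esub> m \<oplus>\<^bsub>V\<^esub> b \<odot>\<^bsub>V\<^esub> m" if "m \<in> carrier V" for a b m
    using V.smult_l_distr[OF _ _ that, of a b] by simp
  have rd: "a \<odot>\<^bsub>V\<^esub> (m \<oplus>\<^bsub>V\<^esub> m') = a \<odot>\<^bsub>V\<^esub> m \<oplus>\<^bsub>V\<^esub> a \<odot>\<^bsub>V\<^esub> m'" if "m \<in> carrier V" "m' \<in> carrier V" for a m m'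
    using V.smult_r_distr[OF _ that, of a] by simp
  have r0: "a \<odot>\<^bsub>V\<^esub> \<zero>\<^bsub>V\<^esub> = \<zero>\<^bsub>V\<^esub>" for a using V.smult_r_null[of a] by simp
  have Xc: "\<xi> m \<in> carrier V" if "m \<in> carrier V" for m using module_hom_in[OF \<xi> that] .
  have Xa: "\<xi> (m \<oplus>\<^bsub>V\<^esub> m') = \<xi> m \<oplus>\<^bsub>V\<^esub> \<xi> m'" if "m \<in> carrier V" "m' \<in> carrier V" for m m'
    using module_hom_add[OF \<xi> that] .
  have Xs: "\<xi> (a \<odot>\<^bsub>V\<^esub> m) = a \<odot>\<^bsub>V\<^esub> \<xi> m" if "m \<in> carrier V" for a m
    using module_hom_smult[OF \<xi> _ that, of a] by simp
  note rules = s0 cl as ld rd r0 Xc Xa Xs XX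
  have sm: "r \<odot>\<^bsub>lam_mod V \<xi>\<^esub> m = lcoef 0 r \<odot>\<^bsub>V\<^esub> m \<oplus>\<^bsub>V\<^esub> lcoef 1 r \<odot>\<^bsub>V\<^esub> \<xi> m" for r :: "'k poly set" and m
    by (simp add: lam_mod_def)
  show "xop (lam_mod V \<xi>) m = \<xi> m" if "m \<in> carrier V"
    using that by (simp add: sm rules)
  show "lam [:c:] \<odot>\<^bsub>lam_mod V \<xi>\<^esub> m = c \<odot>\<^bsub>V\<^esub> m" if "m \<in> carrier V"
    using that by (simp add: sm rules)
  show "module Lam (lam_mod V \<xi>)"
  proof (rule moduleI)
    show "cring Lam" by (rule cring_Lam)
    show "abelian_group (lam_mod V \<xi>)"
    proof (rule abelian_groupI)
      fix x assume "x \<in> carrier (lam_mod V \<xi>)"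
      then show "\<exists>y\<in>carrier (lam_mod V \<xi>). y \<oplus>\<^bsub>lam_mod V \<xi>\<^esub> x = \<zero>\<^bsub>lam_mod V \<xi>\<^esub>"
        using V.M.l_neg[of x] by (intro bexI[of _ "\<ominus>\<^bsub>V\<^esub> x"]) simp_all
    qed (simp_all add: V.M.a_ac)
    show "\<one>\<^bsub>Lam\<^esub> \<odot>\<^bsub>lam_mod V \<xi>\<^esub> x = x" if "x \<in> carrier (lam_mod V \<xi>)" for x
      using that by (simp add: sm rules lam_one)
  next
    fix r :: "'k poly set" and x assume "r \<in> carrier Lam" "x \<in> carrier (lam_mod V \<xi>)"
    then show "r \<odot>\<^bsub>lam_mod V \<xi>\<^esub> x \<in> carrier (lam_mod V \<xi>)" by (simp add: sm rules)
  next
    fix r :: "'k poly set" and x y assume "r \<in> carrier Lam" "x \<in> carrier (lam_mod V \<xi>)" "y \<in> carrier (lam_mod V \<xi>)"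
    then show "r \<odot>\<^bsub>lam_mod V \<xi>\<^esub> (x \<oplus>\<^bsub>lam_mod V \<xi>\<^esub> y) = r \<odot>\<^bsub>lam_mod V \<xi>\<^esub> x \<oplus>\<^bsub>lam_mod V \<xi>\<^esub> r \<odot>\<^bsub>lam_mod V \<xi>\<^esub> y"
      by (simp add: sm rules V.M.a_ac)
  next
    fix r s :: "'k poly set" and x assume rs: "r \<in> carrier Lam" "s \<in> carrier Lam" and x: "x \<in> carrier (lam_mod V \<xi>)"
    obtain a b where r: "r = lam [:a, b:]" using rs Lam_cases by blast
    obtain c d where s: "s = lam [:c, d:]" using rs Lam_cases by blast
    have x: "x \<in> carrier V" using x by simp
    show "(r \<oplus>\<^bsub>Lam\<^esub> s) \<odot>\<^bsub>lam_mod V \<xi>\<^esub> x = r \<odot>\<^bsub>lam_mod V \<xi>\<^esub> x \<oplus>\<^bsub>lam_mod V \<xi>\<^esub> s \<odot>\<^bsub>lam_mod V \<xi>\<^esub> x"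
      using x unfolding r s by (simp add: sm rules lam_add V.M.a_ac)
    have p: "lcoef 0 (r \<otimes>\<^bsub>Lam\<^esub> s) = a * c" "lcoef 1 (r \<otimes>\<^bsub>Lam\<^esub> s) = a * d + b * c"
      unfolding r s lam_mult by simp_all
    have l: "lcoef 0 r = a" "lcoef 1 r = b" "lcoef 0 s = c" "lcoef 1 s = d" by (simp_all add: r s)
    \<comment> \<open>The summand containing \<xi> twice is zero, just as the product of two linear
      terms vanishes in the quotient ring.\<close>
    have Xs': "\<xi> (c \<odot>\<^bsub>V\<^esub> x \<oplus>\<^bsub>V\<^esub> d \<odot>\<^bsub>V\<^esub> \<xi> x) = c \<odot>\<^bsub>V\<^esub> \<xi> x"
      using x by (simp add: rules)
    show "(r \<otimes>\<^bsub>Lam\<^esub> s) \<odot>\<^bsub>lam_mod V \<xi>\<^esub> x = r \<odot>\<^bsub>lam_mod V \<xi>\<^esub> (s \<odot>\<^bsub>lam_mod V \<xi>\<^esub> x)"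
      using x unfolding sm p l Xs' by (simp add: rules V.M.a_assoc)
  qed
qed

lemma module_hom_plus:
  assumes "module R M" "module R N" "f \<in> module_hom R M N" "g \<in> module_hom R M N"
  shows "(\<lambda>x. f x \<oplus>\<^bsub>N\<^esub> g x) \<in> module_hom R M N"
proof -
  interpret N: module R N by fact
  show ?thesis
    by (rule module_homI)
      (simp_all add: module_hom_in[OF assms(3)] module_hom_in[OF assms(4)] module_hom_add[OF assms(3)] module_hom_add[OF assms(4)]
       module_hom_smult[OF assms(3)] module_hom_smult[OF assms(4)] N.smult_r_distr N.M.a_ac)
qed

lemma module_hom_diff:
  assumes "module R M" "module R N" "f \<in> module_hom R M N" "g \<in> module_hom R M N"
  shows "(\<lambda>x. f x \<ominus>\<^bsub>N\<^esub> g x) \<in> module_hom R M N"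
proof -
  interpret N: module R N by fact
  have s: "r \<odot>\<^bsub>N\<^esub> (\<ominus>\<^bsub>N\<^esub> x) = \<ominus>\<^bsub>N\<^esub> (r \<odot>\<^bsub>N\<^esub> x)" if "r \<in> carrier R" "x \<in> carrier N" for r x
    using that by (rule N.smult_r_minus)
  show ?thesis
    by (rule module_homI)
      (simp_all add: a_minus_def module_hom_in[OF assms(3)] module_hom_in[OF assms(4)] module_hom_add[OF assms(3)] module_hom_add[OF assms(4)]
       module_hom_smult[OF assms(3)] module_hom_smult[OF assms(4)] N.smult_r_distr s N.M.a_ac N.M.minus_add)
qed

lemma module_hom_ident: "(\<lambda>x. x) \<in> module_hom R M M"
  by (simp add: module_hom_def)

lemma fd_mod_iff:
  fixes M :: "('k::{field,finite} poly set, 'a) module"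
  shows "fd_mod M \<longleftrightarrow> module Lam M \<and> finite (carrier M)"
proof
  assume "fd_mod M"
  then have 1: "module Lam M" "vectorspace.fin_dim (kring :: 'k ring) (restrict_to_k M)" by (auto simp: fd_mod_def)
  have "finite (carrier (restrict_to_k M))"
    by (rule finite_if_fin_dim[OF vectorspace_restrict[OF 1(1)] 1(2)]) simp
  with 1 show "module Lam M \<and> finite (carrier M)" by simp
next
  assume a: "module Lam M \<and> finite (carrier M)"
  then interpret V: vectorspace "kring :: 'k ring" "restrict_to_k M" using vectorspace_restrict by blast
  have "V.fin_dim"
    unfolding V.fin_dim_def
    using a V.in_own_span[of "carrier M"] V.span_is_subset2[of "carrier M"] by (intro exI[of _ "carrier M"]) simp
  with a show "fd_mod M" by (simp add: fd_mod_def)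
qed

lemma card_carrier_dim_k:
  fixes M :: "('k::{field,finite} poly set, 'a) module"
  assumes "fd_mod M"
  shows "card (carrier M) = card (UNIV :: 'k set) ^ dim_k M"
proof -
  interpret V: vectorspace "kring :: 'k ring" "restrict_to_k M"
    using assms vectorspace_restrict by (auto simp: fd_mod_iff)
  show ?thesis using V.card_eq_card_field_power_dim assms by (simp add: dim_k_def fd_mod_iff)
qed

section \<open>Transport of structure\<close>

text \<open>Extensions, projectivity and isomorphism classes refer to modules with carrier in
  \<open>nat\<close>. Modules on pairs, functions or cosets reach them through a copy along an
  injection.\<close>

definition transport :: "('a \<Rightarrow> 'b) \<Rightarrow> ('r, 'a) module \<Rightarrow> ('r, 'b) module" where
  "transport f M = \<lparr>carrier = f ` carrier M, monoid.mult = (\<lambda>_ _. f \<zero>\<^bsub>M\<^esub>), one = f \<zero>\<^bsub>M\<^esub>,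
     ring.zero = f \<zero>\<^bsub>M\<^esub>,
     add = (\<lambda>x y. f (the_inv_into (carrier M) f x \<oplus>\<^bsub>M\<^esub> the_inv_into (carrier M) f y)),
     module.smult = (\<lambda>r x. f (r \<odot>\<^bsub>M\<^esub> the_inv_into (carrier M) f x))\<rparr>"

lemma carrier_transport [simp]: "carrier (transport f M) = f ` carrier M"
  by (simp add: transport_def)

lemma transport_ops:
  assumes "inj_on f (carrier M)"
  shows "\<zero>\<^bsub>transport f M\<^esub> = f \<zero>\<^bsub>M\<^esub>"
    and "x \<in> carrier M \<Longrightarrow> y \<in> carrier M \<Longrightarrow> f x \<oplus>\<^bsub>transport f M\<^esub> f y = f (x \<oplus>\<^bsub>M\<^esub> y)"
    and "x \<in> carrier M \<Longrightarrow> r \<odot>\<^bsub>transport f M\<^esub> f x = f (r \<odot>\<^bsub>M\<^esub> x)"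
  using assms by (simp_all add: transport_def the_inv_into_f_f)

lemma module_transport:
  assumes M: "module R M" and f: "inj_on f (carrier M)"
  shows "module R (transport f M)"
proof -
  interpret M: module R M by fact
  note [simp] = transport_ops[OF f]
  show ?thesis
  proof (rule moduleI)
    show "cring R" by (rule M.is_cring)
    show "abelian_group (transport f M)"
    proof (rule abelian_groupI)
      fix x assume "x \<in> carrier (transport f M)"
      then obtain a where "x = f a" "a \<in> carrier M" by auto
      then show "\<exists>y\<in>carrier (transport f M). y \<oplus>\<^bsub>transport f M\<^esub> x = \<zero>\<^bsub>transport f M\<^esub>"
        using M.M.l_neg[of a] by (intro bexI[of _ "f (\<ominus>\<^bsub>M\<^esub> a)"]) simp_all
    qed (auto simp: M.M.a_ac)
  qed (auto simp: M.smult_l_distr M.smult_r_distr M.smult_assoc1)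
qed

lemma transport_hom:
  assumes "module R M" and "inj_on f (carrier M)"
  shows "f \<in> module_hom R M (transport f M)"
  using assms by (intro module_homI) (auto simp: transport_ops)

lemma mod_iso_transport:
  assumes "module Lam M" and "inj_on f (carrier M)"
  shows "mod_iso M (transport f M)"
  using transport_hom[OF assms] assms by (auto simp: mod_iso_def bij_betw_def)

lemma mod_iso_refl: "mod_iso M M"
  unfolding mod_iso_def using module_hom_ident by (intro bexI[of _ "\<lambda>x. x"]) (auto simp: bij_betw_def)

lemma bij_hom_inverse:
  assumes "module R M" "module R N" "f \<in> module_hom R M N" "bij_betw f (carrier M) (carrier N)"
  shows "the_inv_into (carrier M) f \<in> module_hom R N M"
proof -
  have inj: "inj_on f (carrier M)" and im: "f ` carrier M = carrier N" using assms by (auto simp: bij_betw_def)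
  show ?thesis
    using module_hom_the_inv[OF assms(1-3) inj assms(2) module_hom_ident] im by simp
qed

lemma mod_iso_sym:
  assumes "module Lam M" "module Lam N" "mod_iso M N"
  shows "mod_iso N M"
proof -
  obtain f where "f \<in> module_hom Lam M N" "bij_betw f (carrier M) (carrier N)" using assms by (auto simp: mod_iso_def)
  then show ?thesis
    unfolding mod_iso_def using bij_hom_inverse[OF assms(1,2)] bij_betw_the_inv_into by blast
qed

lemma mod_iso_trans:
  assumes "mod_iso M N" "mod_iso N P"
  shows "mod_iso M P"
proof -
  obtain f g where "f \<in> module_hom Lam M N" "bij_betw f (carrier M) (carrier N)" 
    "g \<in> module_hom Lam N P" "bij_betw g (carrier N) (carrier P)" using assms by (auto simp: mod_iso_def)
  then show ?thesis
    unfolding mod_iso_def using module_hom_comp[of f Lam M N g P] bij_betw_trans[of f _ _ g]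
    by (intro bexI[of _ "\<lambda>x. g (f x)"]) (auto simp: comp_def)
qed

lemma ex_nat_copy:
  fixes M :: "('k::{field,finite} poly set, 'a) module"
  assumes "fd_mod M"
  obtains N :: "('k poly set, nat) module" where "fd_mod N" "mod_iso M N"
proof -
  have M: "module Lam M" "finite (carrier M)" using assms by (auto simp: fd_mod_iff)
  then obtain f :: "'a \<Rightarrow> nat" where f: "inj_on f (carrier M)" using finite_imp_inj_to_nat_seg by blast
  then show ?thesis 
    using that[of "transport f M"] M module_transport[OF M(1) f] mod_iso_transport[OF M(1) f] by (simp add: fd_mod_iff)
qed

subsection \<open>Classification by order and order of the image of \<open>x\<close>\<close>

definition xker :: "('k::{field,finite} poly set, 'a) module \<Rightarrow> 'a set" where
  "xker M = {m \<in> carrier M. xop M m = \<zero>\<^bsub>M\<^esub>}"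

definition xim :: "('k::{field,finite} poly set, 'a) module \<Rightarrow> 'a set" where
  "xim M = xop M ` carrier M"

context
  fixes M :: "('k::{field,finite} poly set, 'a) module"
  assumes M: "fd_mod M"
begin

interpretation M: module Lam M using M by (simp add: fd_mod_iff)
interpretation V: vectorspace "kring :: 'k ring" "restrict_to_k M" 
  using vectorspace_restrict M by (auto simp: fd_mod_iff)

lemma xop_linear:
  "m \<in> carrier M \<Longrightarrow> m' \<in> carrier M \<Longrightarrow> xop M (m \<oplus>\<^bsub>M\<^esub> m') = xop M m \<oplus>\<^bsub>M\<^esub> xop M m'"
  "m \<in> carrier M \<Longrightarrow> m' \<in> carrier M \<Longrightarrow> xop M (m \<ominus>\<^bsub>M\<^esub> m') = xop M m \<ominus>\<^bsub>M\<^esub> xop M m'"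
  "m \<in> carrier M \<Longrightarrow> xop M (lam [:c:] \<odot>\<^bsub>M\<^esub> m) = lam [:c:] \<odot>\<^bsub>M\<^esub> xop M m"
  "xop M \<zero>\<^bsub>M\<^esub> = \<zero>\<^bsub>M\<^esub>"
  using module_hom_add[OF xop_hom[OF M.module_axioms], of m m'] 
    module_hom_minus[OF V.module_axioms V.module_axioms xop_hom[OF M.module_axioms], of m m']
    module_hom_smult[OF xop_hom[OF M.module_axioms], of c m] 
  by (simp_all add: restrict_to_k_minus)

lemma xim_subset: "xim M \<subseteq> carrier M" "xim M \<subseteq> xker M" "xker M \<subseteq> carrier M"
  by (auto simp: xim_def xker_def xop_xop[OF M.module_axioms])

lemma finite_carrier: "finite (carrier M)" "finite (xim M)" "finite (xker M)"
  using M xim_subset finite_subset by (auto simp: fd_mod_iff xim_def xker_def)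

lemma xim_submodule: "LinearCombinations.submodule (kring :: 'k ring) (xim M) (restrict_to_k M)"
proof
  show "xim M \<subseteq> carrier (restrict_to_k M)" using xim_subset by simp
  show "\<zero>\<^bsub>restrict_to_k M\<^esub> \<in> xim M" 
    unfolding xim_def by (rule image_eqI[of _ _ "\<zero>\<^bsub>M\<^esub>"]) (simp_all add: xop_linear)
  show "v \<oplus>\<^bsub>restrict_to_k M\<^esub> w \<in> xim M" if vw: "v \<in> xim M" "w \<in> xim M" for v w
  proof -
    obtain a b where "v = xop M a" "w = xop M b" "a \<in> carrier M" "b \<in> carrier M" using vw by (auto simp: xim_def)
    then show ?thesis
      unfolding xim_def by (intro image_eqI[of _ _ "a \<oplus>\<^bsub>M\<^esub> b"]) (simp_all add: xop_linear)
  qed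
  show "c \<odot>\<^bsub>restrict_to_k M\<^esub> v \<in> xim M" if vw: "v \<in> xim M" for c v
  proof -
    obtain a where "v = xop M a" "a \<in> carrier M" using vw by (auto simp: xim_def)
    then show ?thesis
      unfolding xim_def by (intro image_eqI[of _ _ "lam [:c:] \<odot>\<^bsub>M\<^esub> a"]) (simp_all add: xop_linear)
  qed
qed

lemma xker_submodule: "LinearCombinations.submodule (kring :: 'k ring) (xker M) (restrict_to_k M)"
  by unfold_locales (auto simp: xker_def xop_linear)

text \<open>\<open>x\<close> maps onto its own image, and a surjection of finite spaces has a linear
  section.\<close>

lemma xop_section:
  obtains \<sigma> where "\<sigma> \<in> module_hom (kring :: 'k ring) ((restrict_to_k M)\<lparr>carrier := xim M\<rparr>) (restrict_to_k M)"
    and "\<And>u. u \<in> xim M \<Longrightarrow> \<sigma> u \<in> carrier M" and "\<And>u. u \<in> xim M \<Longrightarrow> xop M (\<sigma> u) = u"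
proof -
  let ?W = "(restrict_to_k M)\<lparr>carrier := xim M\<rparr>"
  interpret W: vectorspace "kring :: 'k ring" ?W
    using V.subspace_is_vs[of "xim M"] xim_submodule V.vectorspace_axioms by (auto simp: subspace_def)
  have hom: "xop M \<in> module_hom (kring :: 'k ring) (restrict_to_k M) ?W"
    by (rule module_homI) (simp_all add: xop_linear, simp add: xim_def)
  obtain \<sigma> where \<sigma>: "\<sigma> \<in> module_hom (kring :: 'k ring) ?W (restrict_to_k M)" 
    "\<And>u. u \<in> carrier ?W \<Longrightarrow> xop M (\<sigma> u) = u"
    by (rule W.linear_section[OF _ V.vectorspace_axioms hom]) (simp_all add: finite_carrier, simp add: xim_def)
  moreover have "\<sigma> u \<in> carrier M" if "u \<in> xim M" for u
    using module_hom_in[OF \<sigma>(1), of u] that by simp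
  ultimately show ?thesis using that by simp
qed

text \<open>If \<open>\<sigma>\<close> splits \<open>x\<close> over its image then \<open>m = (m - \<sigma> x m) + \<sigma> x m\<close>.\<close>

lemma xker_complement:
  assumes \<sigma>: "\<sigma> \<in> module_hom (kring :: 'k ring) ((restrict_to_k M)\<lparr>carrier := xim M\<rparr>) (restrict_to_k M)"
    "\<And>u. u \<in> xim M \<Longrightarrow> xop M (\<sigma> u) = u"
  shows "(\<lambda>m. m \<ominus>\<^bsub>M\<^esub> \<sigma> (xop M m)) \<in> module_hom (kring :: 'k ring) (restrict_to_k M) ((restrict_to_k M)\<lparr>carrier := xker M\<rparr>)"
    and "(\<lambda>m. \<sigma> (xop M m)) \<in> module_hom (kring :: 'k ring) (restrict_to_k M) (restrict_to_k M)"
    and "m \<in> carrier M \<Longrightarrow> m \<ominus>\<^bsub>M\<^esub> \<sigma> (xop M m) \<in> xker M"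
proof -
  have x: "xop M \<in> module_hom (kring :: 'k ring) (restrict_to_k M) ((restrict_to_k M)\<lparr>carrier := xim M\<rparr>)"
    by (rule module_homI) (simp_all add: xop_linear, simp add: xim_def)
  show 1: "(\<lambda>m. \<sigma> (xop M m)) \<in> module_hom (kring :: 'k ring) (restrict_to_k M) (restrict_to_k M)"
    by (rule module_hom_comp[OF x \<sigma>(1)])
  have 2: "(\<lambda>m. m \<ominus>\<^bsub>M\<^esub> \<sigma> (xop M m)) \<in> module_hom (kring :: 'k ring) (restrict_to_k M) (restrict_to_k M)"
    using module_hom_diff[OF V.module_axioms V.module_axioms module_hom_ident 1] by (simp add: restrict_to_k_minus)
  show 3: "m \<ominus>\<^bsub>M\<^esub> \<sigma> (xop M m) \<in> xker M" if "m \<in> carrier M" for m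
  proof -
    have s: "\<sigma> (xop M m) \<in> carrier M" using module_hom_in[OF 1, of m] that by simp
    have "xop M m \<in> xim M" using that by (simp add: xim_def)
    then have "xop M (m \<ominus>\<^bsub>M\<^esub> \<sigma> (xop M m)) = xop M m \<ominus>\<^bsub>M\<^esub> xop M m" using that s \<sigma>(2) by (simp add: xop_linear)
    also have "\<dots> = \<zero>\<^bsub>M\<^esub>" using that by (simp add: a_minus_def M.M.r_neg)
    finally show ?thesis using that s by (simp add: xker_def)
  qed
  show "(\<lambda>m. m \<ominus>\<^bsub>M\<^esub> \<sigma> (xop M m)) \<in> module_hom (kring :: 'k ring) (restrict_to_k M) ((restrict_to_k M)\<lparr>carrier := xker M\<rparr>)"
    using 2 3 by (simp add: module_hom_def Pi_iff)
qed

text \<open>Rank and nullity in multiplicative form: \<open>m\<close> corresponds to the pair of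
  \<open>m - \<sigma> x m\<close> in the kernel and \<open>x m\<close> in the image.\<close>

lemma card_xker_xim: "card (xker M) * card (xim M) = card (carrier M)"
proof -
  obtain \<sigma> where \<sigma>: "\<sigma> \<in> module_hom (kring :: 'k ring) ((restrict_to_k M)\<lparr>carrier := xim M\<rparr>) (restrict_to_k M)"
    "\<And>u. u \<in> xim M \<Longrightarrow> \<sigma> u \<in> carrier M" "\<And>u. u \<in> xim M \<Longrightarrow> xop M (\<sigma> u) = u"
    using xop_section by blast
  have xm: "xop M m \<in> xim M" if "m \<in> carrier M" for m using that by (simp add: xim_def)
  have k: "k \<in> carrier M" "xop M k = \<zero>\<^bsub>M\<^esub>" if "k \<in> xker M" for k using that by (auto simp: xker_def)
  have "bij_betw (\<lambda>(k, u). k \<oplus>\<^bsub>M\<^esub> \<sigma> u) (xker M \<times> xim M) (carrier M)"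
  proof (rule bij_betw_byWitness[of _ "\<lambda>m. (m \<ominus>\<^bsub>M\<^esub> \<sigma> (xop M m), xop M m)"])
    have "xop M (k \<oplus>\<^bsub>M\<^esub> \<sigma> u) = u" "k \<oplus>\<^bsub>M\<^esub> \<sigma> u \<ominus>\<^bsub>M\<^esub> \<sigma> u = k" if "k \<in> xker M" "u \<in> xim M" for k u
      using k[OF that(1)] \<sigma>(2,3)[of u] that xim_subset 
      by (auto simp: xop_linear a_minus_def M.M.a_assoc M.M.r_neg)
    then show "\<forall>a\<in>xker M \<times> xim M. (\<lambda>m. (m \<ominus>\<^bsub>M\<^esub> \<sigma> (xop M m), xop M m)) ((\<lambda>(k, u). k \<oplus>\<^bsub>M\<^esub> \<sigma> u) a) = a"
      by simp
    show "\<forall>m\<in>carrier M. (\<lambda>(k, u). k \<oplus>\<^bsub>M\<^esub> \<sigma> u) ((\<lambda>m. (m \<ominus>\<^bsub>M\<^esub> \<sigma> (xop M m), xop M m)) m) = m"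
      using \<sigma>(2) xm by (simp add: a_minus_def M.M.a_assoc M.M.l_neg)
    show "(\<lambda>(k, u). k \<oplus>\<^bsub>M\<^esub> \<sigma> u) ` (xker M \<times> xim M) \<subseteq> carrier M" using k \<sigma>(2) by auto
    show "(\<lambda>m. (m \<ominus>\<^bsub>M\<^esub> \<sigma> (xop M m), xop M m)) ` carrier M \<subseteq> xker M \<times> xim M"
      using xm xker_complement(3)[OF \<sigma>(1,3)] by auto
  qed
  from bij_betw_same_card[OF this] show ?thesis by (simp add: card_cartesian_product)
qed

end

lemma bij_betw_if_inj_card:
  "inj_on f A \<Longrightarrow> f ` A \<subseteq> B \<Longrightarrow> finite B \<Longrightarrow> card A = card B \<Longrightarrow> bij_betw f A B"
  by (metis bij_betw_def card_image card_subset_eq)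

text \<open>The two orders determine that of the kernel, so the pairs formed by \<open>ker x\<close>
  and \<open>im x\<close> are isomorphic as pairs of spaces. An isomorphism of the pairs extends to
  the complement \<open>\<sigma> (im x)\<close> with the help of the sections of \<open>x\<close> on
  both sides.\<close>

theorem mod_iso_iff_card:
  fixes M :: "('k::{field,finite} poly set, 'a) module" and N :: "('k poly set, 'b) module"
  assumes M: "fd_mod M" and N: "fd_mod N"
  shows "mod_iso M N \<longleftrightarrow> card (carrier M) = card (carrier N) \<and> card (xim M) = card (xim N)"
proof
  assume "mod_iso M N"
  then obtain f where f: "f \<in> module_hom Lam M N" "bij_betw f (carrier M) (carrier N)" by (auto simp: mod_iso_def)
  then have im: "f ` carrier M = carrier N" by (simp add: bij_betw_def)
  have "xim N = xop N ` f ` carrier M" by (simp add: xim_def im)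
  also have "\<dots> = f ` xim M" using Lam_hom_xop[OF f(1)] by (simp add: xim_def image_image)
  finally have "card (xim N) = card (xim M)"
    using f(2) xim_subset(1)[OF M] by (metis bij_betw_def card_image inj_on_subset)
  then show "card (carrier M) = card (carrier N) \<and> card (xim M) = card (xim N)"
    using f(2) by (auto intro: bij_betw_same_card)
next
  assume eq: "card (carrier M) = card (carrier N) \<and> card (xim M) = card (xim N)"
  have mod: "module Lam M" "module Lam N" using M N by (auto simp: fd_mod_iff)
  interpret M: module Lam M by fact
  interpret N: module Lam N by fact
  interpret V: vectorspace "kring :: 'k ring" "restrict_to_k M" using vectorspace_restrict mod by blast
  interpret W: vectorspace "kring :: 'k ring" "restrict_to_k N" using vectorspace_restrict mod by blast
  let ?V = "(restrict_to_k M)\<lparr>carrier := xker M\<rparr>"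
  let ?W = "(restrict_to_k N)\<lparr>carrier := xker N\<rparr>"
  interpret VK: vectorspace "kring :: 'k ring" ?V
    using V.subspace_is_vs[of "xker M"] xker_submodule[OF M] V.vectorspace_axioms by (auto simp: subspace_def)
  interpret WK: vectorspace "kring :: 'k ring" ?W
    using W.subspace_is_vs[of "xker N"] xker_submodule[OF N] W.vectorspace_axioms by (auto simp: subspace_def)
  have "card (xim N) > 0" using finite_carrier(2)[OF N] by (auto simp: xim_def card_gt_0_iff)
  then have ck: "card (xker M) = card (xker N)"
    using card_xker_xim[OF M] card_xker_xim[OF N] eq by (metis mult_right_cancel less_irrefl)
  have sub: "LinearCombinations.submodule (kring :: 'k ring) (xim M) ?V" "LinearCombinations.submodule (kring :: 'k ring) (xim N) ?W"
    using xim_submodule[OF M] xim_submodule[OF N] VK.module_axioms WK.module_axioms xim_subset(2)[OF M] xim_subset(2)[OF N]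
    by (auto simp: submodule_def)
  obtain \<alpha> where \<alpha>: "\<alpha> \<in> module_hom (kring :: 'k ring) ?V ?W" "bij_betw \<alpha> (xker M) (xker N)" "\<alpha> ` xim M = xim N"
    using VK.iso_pair[OF _ _ WK.vectorspace_axioms _ sub(1,2)] finite_carrier[OF M] finite_carrier[OF N] ck eq
    by auto
  obtain \<sigma> where \<sigma>: "\<sigma> \<in> module_hom (kring :: 'k ring) ((restrict_to_k M)\<lparr>carrier := xim M\<rparr>) (restrict_to_k M)"
    "\<And>u. u \<in> xim M \<Longrightarrow> \<sigma> u \<in> carrier M" "\<And>u. u \<in> xim M \<Longrightarrow> xop M (\<sigma> u) = u"
    using xop_section[OF M] by blast
  obtain \<tau> where \<tau>: "\<tau> \<in> module_hom (kring :: 'k ring) ((restrict_to_k N)\<lparr>carrier := xim N\<rparr>) (restrict_to_k N)"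
    "\<And>u. u \<in> xim N \<Longrightarrow> \<tau> u \<in> carrier N" "\<And>u. u \<in> xim N \<Longrightarrow> xop N (\<tau> u) = u"
    using xop_section[OF N] by blast
  \<comment> \<open>On the kernel this is \<alpha>; on \<open>\<sigma> u\<close> it is
    \<open>\<tau> (\<alpha> u)\<close>, the value that makes it compatible with
    \<open>x\<close>.\<close>
  define \<phi> where "\<phi> m = \<tau> (\<alpha> (xop M m)) \<oplus>\<^bsub>N\<^esub> \<alpha> (m \<ominus>\<^bsub>M\<^esub> \<sigma> (xop M m))" for m
  have xm: "xop M m \<in> xim M" if "m \<in> carrier M" for m using that by (simp add: xim_def)
  have h1: "xop M \<in> module_hom (kring :: 'k ring) (restrict_to_k M) ((restrict_to_k M)\<lparr>carrier := xim M\<rparr>)"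
    using xm xop_hom[OF mod(1)] by (simp add: module_hom_def Pi_iff)
  have h2: "\<alpha> \<in> module_hom (kring :: 'k ring) ((restrict_to_k M)\<lparr>carrier := xim M\<rparr>) ((restrict_to_k N)\<lparr>carrier := xim N\<rparr>)"
    using \<alpha>(1,3) xim_subset(2)[OF M] unfolding module_hom_def by (auto simp: subset_iff)
  have h3: "\<alpha> \<in> module_hom (kring :: 'k ring) ?V (restrict_to_k N)"
    using \<alpha>(1) xim_subset(3)[OF N] unfolding module_hom_def by (auto simp: subset_iff)
  have "(\<lambda>m. \<tau> (\<alpha> (xop M m))) \<in> module_hom (kring :: 'k ring) (restrict_to_k M) (restrict_to_k N)"
    by (rule module_hom_comp[OF module_hom_comp[OF h1 h2] \<tau>(1)])
  moreover have "(\<lambda>m. \<alpha> (m \<ominus>\<^bsub>M\<^esub> \<sigma> (xop M m))) \<in> module_hom (kring :: 'k ring) (restrict_to_k M) (restrict_to_k N)"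
    by (rule module_hom_comp[OF xker_complement(1)[OF M \<sigma>(1,3)] h3])
  ultimately have \<phi>k: "\<phi> \<in> module_hom (kring :: 'k ring) (restrict_to_k M) (restrict_to_k N)"
    using module_hom_plus[OF V.module_axioms W.module_axioms] unfolding \<phi>_def[abs_def] by simp
  have \<alpha>0: "\<alpha> \<zero>\<^bsub>M\<^esub> = \<zero>\<^bsub>N\<^esub>" using module_hom_zero[OF VK.module_axioms W.module_axioms h3] by simp
  have 0: "\<zero>\<^bsub>M\<^esub> \<in> xim M" "\<zero>\<^bsub>N\<^esub> \<in> xim N"
    using LinearCombinations.submodule.zero_closed[OF xim_submodule[OF M]] 
      LinearCombinations.submodule.zero_closed[OF xim_submodule[OF N]] by simp_all
  have \<sigma>0: "\<sigma> \<zero>\<^bsub>M\<^esub> = \<zero>\<^bsub>M\<^esub>" and \<tau>0: "\<tau> \<zero>\<^bsub>N\<^esub> = \<zero>\<^bsub>N\<^esub>"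
    using module_hom_zero[OF V.submodule_is_module[OF xim_submodule[OF M]] V.module_axioms \<sigma>(1)] 
      module_hom_zero[OF W.submodule_is_module[OF xim_submodule[OF N]] W.module_axioms \<tau>(1)] by simp_all
  have cl: "\<phi> m \<in> carrier N" "\<alpha> (xop M m) \<in> xim N" "\<alpha> (m \<ominus>\<^bsub>M\<^esub> \<sigma> (xop M m)) \<in> xker N" if "m \<in> carrier M" for m
    using module_hom_in[OF \<phi>k, of m] that xm[OF that] \<alpha>(3) xker_complement(3)[OF M \<sigma>(1,3) that] \<alpha>(2)
    by (auto simp: bij_betw_def)
  have x\<phi>: "xop N (\<phi> m) = \<alpha> (xop M m)" if "m \<in> carrier M" for m
  proof -
    have k: "\<alpha> (m \<ominus>\<^bsub>M\<^esub> \<sigma> (xop M m)) \<in> carrier N" "xop N (\<alpha> (m \<ominus>\<^bsub>M\<^esub> \<sigma> (xop M m))) = \<zero>\<^bsub>N\<^esub>" 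
      using cl(3)[OF that] by (auto simp: xker_def)
    have a: "\<alpha> (xop M m) \<in> carrier N" using cl(2)[OF that] xim_subset(1)[OF N] by auto
    show ?thesis
      unfolding \<phi>_def using k a \<tau>(2,3)[OF cl(2)[OF that]] by (simp add: xop_linear[OF N])
  qed
  have \<phi>x: "\<phi> k = \<alpha> k" if "k \<in> xker M" for k
  proof -
    have k: "k \<in> carrier M" "xop M k = \<zero>\<^bsub>M\<^esub>" using that by (auto simp: xker_def)
    have neg0: "\<ominus>\<^bsub>M\<^esub> \<zero>\<^bsub>M\<^esub> = \<zero>\<^bsub>M\<^esub>" using M.M.r_neg[of "\<zero>\<^bsub>M\<^esub>"] by simp
    have "\<alpha> k \<in> carrier N" using that \<alpha>(2) xim_subset(3)[OF N] by (auto simp: bij_betw_def)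
    then show ?thesis unfolding \<phi>_def k(2) using k(1) by (simp add: \<alpha>0 \<sigma>0 \<tau>0 a_minus_def neg0)
  qed
  have \<phi>L: "\<phi> \<in> module_hom Lam M N"
    by (rule Lam_homI[OF mod \<phi>k]) (use \<phi>x x\<phi> xm xim_subset(2)[OF M] in auto)
  \<comment> \<open>Applying \<open>x\<close> to \<open>\<phi> m = 0\<close> shows first that
    \<open>x m\<close> vanishes; then \<open>m\<close> lies in the kernel, where \<phi> is the
    injective \<alpha>.\<close>
  have "inj_on \<phi> (carrier M)"
  proof (rule module_hom_inj_on[OF mod \<phi>L])
    fix m assume m: "m \<in> carrier M" "\<phi> m = \<zero>\<^bsub>N\<^esub>"
    then have "\<alpha> (xop M m) = \<alpha> \<zero>\<^bsub>M\<^esub>" using x\<phi>[OF m(1)] by (simp add: xop_linear[OF N] \<alpha>0)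
    moreover have mem: "xop M m \<in> xker M" "\<zero>\<^bsub>M\<^esub> \<in> xker M" using xm[OF m(1)] 0 xim_subset(2)[OF M] by auto
    ultimately have "xop M m = \<zero>\<^bsub>M\<^esub>" using \<alpha>(2) by (auto simp: bij_betw_def inj_on_def)
    then have mk: "m \<in> xker M" using m by (simp add: xker_def)
    then have "\<alpha> m = \<alpha> \<zero>\<^bsub>M\<^esub>" using m(2) \<phi>x \<alpha>0 by simp
    then show "m = \<zero>\<^bsub>M\<^esub>" using \<alpha>(2) mk mem by (auto simp: bij_betw_def inj_on_def)
  qed
  then have "bij_betw \<phi> (carrier M) (carrier N)"
    by (rule bij_betw_if_inj_card) (use cl(1) finite_carrier[OF N] eq in auto)
  then show "mod_iso M N" using \<phi>L by (auto simp: mod_iso_def)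
qed

subsection \<open>Short exact sequences\<close>

lemma direct_sum_simps [simp]:
  "carrier (direct_sum A B) = carrier A \<times> carrier B"
  "\<zero>\<^bsub>direct_sum A B\<^esub> = (\<zero>\<^bsub>A\<^esub>, \<zero>\<^bsub>B\<^esub>)"
  "p \<oplus>\<^bsub>direct_sum A B\<^esub> p' = (fst p \<oplus>\<^bsub>A\<^esub> fst p', snd p \<oplus>\<^bsub>B\<^esub> snd p')"
  "r \<odot>\<^bsub>direct_sum A B\<^esub> p = (r \<odot>\<^bsub>A\<^esub> fst p, r \<odot>\<^bsub>B\<^esub> snd p)"
  by (simp_all add: direct_sum_def)

text \<open>The scalar ring is arbitrary so that one statement serves both the k-linear sections,
  which always exist, and the \<open>Lam\<close>-linear ones, which are constructed from
  acyclicity.\<close>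

lemma split_iso:
  assumes mod: "module R N" "module R L" "module R M"
    and f: "f \<in> module_hom R N L" "inj_on f (carrier N)" and g: "g \<in> module_hom R L M"
    and ex: "f ` carrier N = {x \<in> carrier L. g x = \<zero>\<^bsub>M\<^esub>}"
    and s: "s \<in> module_hom R M L" "\<And>m. m \<in> carrier M \<Longrightarrow> g (s m) = m"
  shows "(\<lambda>p. f (fst p) \<oplus>\<^bsub>L\<^esub> s (snd p)) \<in> module_hom R (direct_sum N M) L"
    and "bij_betw (\<lambda>p. f (fst p) \<oplus>\<^bsub>L\<^esub> s (snd p)) (carrier (direct_sum N M)) (carrier L)"
    and "n \<in> carrier N \<Longrightarrow> f n \<oplus>\<^bsub>L\<^esub> s \<zero>\<^bsub>M\<^esub> = f n"
    and "n \<in> carrier N \<Longrightarrow> m \<in> carrier M \<Longrightarrow> g (f n \<oplus>\<^bsub>L\<^esub> s m) = m"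
proof -
  interpret N: module R N by fact
  interpret L: module R L by fact
  interpret M: module R M by fact
  note cl = module_hom_in[OF f(1)] module_hom_in[OF g] module_hom_in[OF s(1)]
  note lin = module_hom_add[OF f(1)] module_hom_add[OF g] module_hom_add[OF s(1)]
    module_hom_smult[OF f(1)] module_hom_smult[OF g] module_hom_smult[OF s(1)]
  have s0: "s \<zero>\<^bsub>M\<^esub> = \<zero>\<^bsub>L\<^esub>" and f0: "f \<zero>\<^bsub>N\<^esub> = \<zero>\<^bsub>L\<^esub>" and g0: "g \<zero>\<^bsub>L\<^esub> = \<zero>\<^bsub>M\<^esub>"
    using module_hom_zero[OF mod(3,2) s(1)] module_hom_zero[OF mod(1,2) f(1)] module_hom_zero[OF mod(2,3) g] by simp_all
  have gf: "g (f n) = \<zero>\<^bsub>M\<^esub>" if "n \<in> carrier N" for n using ex that by auto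
  show 1: "(\<lambda>p. f (fst p) \<oplus>\<^bsub>L\<^esub> s (snd p)) \<in> module_hom R (direct_sum N M) L"
    by (rule module_homI) (auto simp: cl lin L.smult_r_distr L.M.a_ac)
  show "n \<in> carrier N \<Longrightarrow> f n \<oplus>\<^bsub>L\<^esub> s \<zero>\<^bsub>M\<^esub> = f n" by (simp add: s0 cl)
  show gs: "g (f n \<oplus>\<^bsub>L\<^esub> s m) = m" if "n \<in> carrier N" "m \<in> carrier M" for n m
    using that by (simp add: lin cl gf s(2))
  show "bij_betw (\<lambda>p. f (fst p) \<oplus>\<^bsub>L\<^esub> s (snd p)) (carrier (direct_sum N M)) (carrier L)"
    unfolding bij_betw_def
  proof
    show "inj_on (\<lambda>p. f (fst p) \<oplus>\<^bsub>L\<^esub> s (snd p)) (carrier (direct_sum N M))"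
    proof (rule module_hom_inj_on[OF direct_sum_is_module[OF mod(1,3)] mod(2) 1])
      fix p assume p: "p \<in> carrier (direct_sum N M)" "f (fst p) \<oplus>\<^bsub>L\<^esub> s (snd p) = \<zero>\<^bsub>L\<^esub>"
      obtain n m where nm: "p = (n, m)" "n \<in> carrier N" "m \<in> carrier M" using p(1) by auto
      have "m = \<zero>\<^bsub>M\<^esub>" using gs[OF nm(2,3)] p(2) g0 by (simp add: nm)
      moreover from this have "f n = f \<zero>\<^bsub>N\<^esub>" using p(2) nm s0 f0 by (simp add: cl)
      then have "n = \<zero>\<^bsub>N\<^esub>" using f(2) nm by (auto dest: inj_onD)
      ultimately show "p = \<zero>\<^bsub>direct_sum N M\<^esub>" by (simp add: nm)
    qed
    show "(\<lambda>p. f (fst p) \<oplus>\<^bsub>L\<^esub> s (snd p)) ` carrier (direct_sum N M) = carrier L"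
    proof
      show "(\<lambda>p. f (fst p) \<oplus>\<^bsub>L\<^esub> s (snd p)) ` carrier (direct_sum N M) \<subseteq> carrier L" by (auto simp: cl)
      show "carrier L \<subseteq> (\<lambda>p. f (fst p) \<oplus>\<^bsub>L\<^esub> s (snd p)) ` carrier (direct_sum N M)"
      proof
        fix l assume l: "l \<in> carrier L"
        \<comment> \<open>Surjectivity: \<open>l - s (g l)\<close> lies in the kernel of
          \<open>g\<close>, hence in the image of \<open>f\<close>.\<close>
        have "g (l \<ominus>\<^bsub>L\<^esub> s (g l)) = g l \<ominus>\<^bsub>M\<^esub> g l"
          using l by (simp add: module_hom_minus[OF mod(2,3) g] cl s(2))
        then have "l \<ominus>\<^bsub>L\<^esub> s (g l) \<in> f ` carrier N" using l by (simp add: ex cl a_minus_def M.M.r_neg)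
        then obtain n where n: "n \<in> carrier N" "f n = l \<ominus>\<^bsub>L\<^esub> s (g l)" by auto
        have "f n \<oplus>\<^bsub>L\<^esub> s (g l) = l" using l by (simp add: n cl a_minus_def L.M.a_assoc L.M.l_neg)
        then show "l \<in> (\<lambda>p. f (fst p) \<oplus>\<^bsub>L\<^esub> s (snd p)) ` carrier (direct_sum N M)"
          using n(1) l cl(2) by (intro image_eqI[of _ _ "(n, g l)"]) simp_all
      qed
    qed
  qed
qed

lemma fd_mod_direct_sum: "fd_mod M \<Longrightarrow> fd_mod N \<Longrightarrow> fd_mod (direct_sum M N)"
  by (simp add: fd_mod_iff direct_sum_is_module)

lemma xim_direct_sum: "xim (direct_sum M N) = xim M \<times> xim N"
  by (auto simp: xim_def image_def)

lemma fd_mod_transport: "fd_mod M \<Longrightarrow> inj_on f (carrier M) \<Longrightarrow> fd_mod (transport f M)"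
  by (simp add: fd_mod_iff module_transport)

lemma short_exact_transport:
  assumes L: "module Lam L" and j: "inj_on j (carrier L)" and ex: "short_exact N L M f g"
  shows "short_exact N (transport j L) M (\<lambda>n. j (f n)) (\<lambda>y. g (the_inv_into (carrier L) j y))"
proof -
  have h: "the_inv_into (carrier L) j (j l) = l" if "l \<in> carrier L" for l using j that by (simp add: the_inv_into_f_f)
  have f: "f \<in> module_hom Lam N L" "inj_on f (carrier N)" and g: "g \<in> module_hom Lam L M" "g ` carrier L = carrier M"
    and im: "f ` carrier N = {x \<in> carrier L. g x = \<zero>\<^bsub>M\<^esub>}" using ex by (auto simp: short_exact_def)
  note fin = module_hom_in[OF f(1)]
  have "(\<lambda>n. j (f n)) \<in> module_hom Lam N (transport j L)"
    by (rule module_hom_comp[OF f(1) transport_hom[OF L j]])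
  moreover have "(\<lambda>y. g (the_inv_into (carrier L) j y)) \<in> module_hom Lam (transport j L) M"
    by (rule module_hom_comp[OF bij_hom_inverse[OF L module_transport[OF L j] transport_hom[OF L j]] g(1)])
       (use j in \<open>auto simp: bij_betw_def\<close>)
  moreover have "inj_on (\<lambda>n. j (f n)) (carrier N)"
    using f(2) j fin by (auto simp: inj_on_def)
  moreover have "(\<lambda>y. g (the_inv_into (carrier L) j y)) ` carrier (transport j L) = carrier M"
    using g(2) h by (simp add: image_image)
  moreover have "(\<lambda>n. j (f n)) ` carrier N = j ` {x \<in> carrier L. g x = \<zero>\<^bsub>M\<^esub>}"
    by (simp add: im[symmetric] image_image)
  moreover have "j ` {x \<in> carrier L. g x = \<zero>\<^bsub>M\<^esub>} = {y \<in> j ` carrier L. g (the_inv_into (carrier L) j y) = \<zero>\<^bsub>M\<^esub>}"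
    using h by auto
  ultimately show ?thesis unfolding short_exact_def by (simp only: carrier_transport)
qed

context
  fixes N :: "('k::{field,finite} poly set, 'a) module" and L :: "('k poly set, 'b) module" 
    and M :: "('k poly set, 'c) module" and f g
  assumes fd: "fd_mod N" "fd_mod L" "fd_mod M" and ex: "short_exact N L M f g"
begin

lemma short_exactD:
  "f \<in> module_hom Lam N L" "g \<in> module_hom Lam L M" "inj_on f (carrier N)" "g ` carrier L = carrier M"
  "f ` carrier N = {x \<in> carrier L. g x = \<zero>\<^bsub>M\<^esub>}"
  using ex by (auto simp: short_exact_def)

lemma fd_moduleD: "module Lam N" "module Lam L" "module Lam M"
  using fd by (auto simp: fd_mod_iff)

lemma short_exact_k_section:
  obtains \<sigma> where "\<sigma> \<in> module_hom (kring :: 'k ring) (restrict_to_k M) (restrict_to_k L)"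
    "\<And>m. m \<in> carrier M \<Longrightarrow> g (\<sigma> m) = m"
proof -
  interpret V: vectorspace "kring :: 'k ring" "restrict_to_k M" by (rule vectorspace_restrict[OF fd_moduleD(3)])
  show ?thesis
    using V.linear_section[OF _ vectorspace_restrict[OF fd_moduleD(2)] Lam_hom_k[OF short_exactD(2)]] 
      finite_carrier(1)[OF fd(3)] short_exactD(4) that by (metis restrict_to_k_simps(1))
qed

text \<open>The sequence splits over k, and a k-linear splitting is enough for counting.\<close>

lemma card_short_exact: "card (carrier L) = card (carrier N) * card (carrier M)"
proof -
  obtain \<sigma> where \<sigma>: "\<sigma> \<in> module_hom (kring :: 'k ring) (restrict_to_k M) (restrict_to_k L)"
    "\<And>m. m \<in> carrier M \<Longrightarrow> g (\<sigma> m) = m" using short_exact_k_section by blast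
  note mod = fd_moduleD[THEN vectorspace_restrict, unfolded vectorspace_def, THEN conjunct1]
  have "bij_betw (\<lambda>p. f (fst p) \<oplus>\<^bsub>restrict_to_k L\<^esub> \<sigma> (snd p)) (carrier (direct_sum (restrict_to_k N) (restrict_to_k M))) 
      (carrier (restrict_to_k L))"
    by (rule split_iso(2)[OF mod Lam_hom_k[OF short_exactD(1)] _ Lam_hom_k[OF short_exactD(2)] _ \<sigma>(1)])
       (use short_exactD \<sigma> in simp_all)
  from bij_betw_same_card[OF this] show ?thesis by (simp add: card_cartesian_product)
qed

end

subsection \<open>Acyclic modules\<close>

text \<open>With \<open>x\<close> regarded as a differential, this says that the homology of
  \<open>M\<close> vanishes.\<close>

definition acyclic_mod :: "('k::{field,finite} poly set, 'a) module \<Rightarrow> bool" where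
  "acyclic_mod M \<longleftrightarrow> xker M = xim M"

lemma acyclic_modI: "fd_mod M \<Longrightarrow> xker M \<subseteq> xim M \<Longrightarrow> acyclic_mod M"
  by (simp add: acyclic_mod_def subset_antisym xim_subset(2))

text \<open>For a section \<sigma> of \<open>x\<close> over its image,
  \<open>h m = \<sigma> (m - \<sigma> x m)\<close> makes sense because
  \<open>m - \<sigma> x m\<close> lies in the kernel, which is the image. It is a contracting
  homotopy for the differential \<open>x\<close>.\<close>

lemma contraction:
  fixes M :: "('k::{field,finite} poly set, 'a) module"
  assumes M: "fd_mod M" "acyclic_mod M"
  obtains h where "h \<in> module_hom (kring :: 'k ring) (restrict_to_k M) (restrict_to_k M)"
    and "\<And>m. m \<in> carrier M \<Longrightarrow> xop M (h m) \<oplus>\<^bsub>M\<^esub> h (xop M m) = m"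
proof -
  have mod: "module Lam M" using M by (auto simp: fd_mod_iff)
  interpret M: module Lam M by fact
  interpret V: vectorspace "kring :: 'k ring" "restrict_to_k M" by (rule vectorspace_restrict[OF mod])
  obtain \<sigma> where \<sigma>: "\<sigma> \<in> module_hom (kring :: 'k ring) ((restrict_to_k M)\<lparr>carrier := xim M\<rparr>) (restrict_to_k M)"
    "\<And>u. u \<in> xim M \<Longrightarrow> \<sigma> u \<in> carrier M" "\<And>u. u \<in> xim M \<Longrightarrow> xop M (\<sigma> u) = u"
    using xop_section[OF M(1)] by blast
  note xk = M(2)[unfolded acyclic_mod_def]
  have \<sigma>0: "\<sigma> \<zero>\<^bsub>M\<^esub> = \<zero>\<^bsub>M\<^esub>"
    using module_hom_zero[OF V.submodule_is_module[OF xim_submodule[OF M(1)]] V.module_axioms \<sigma>(1)] by simp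
  have neg0: "\<ominus>\<^bsub>M\<^esub> \<zero>\<^bsub>M\<^esub> = \<zero>\<^bsub>M\<^esub>" using M.M.r_neg[of "\<zero>\<^bsub>M\<^esub>"] by simp
  have "xop M (\<sigma> (m \<ominus>\<^bsub>M\<^esub> \<sigma> (xop M m))) \<oplus>\<^bsub>M\<^esub> \<sigma> (xop M m \<ominus>\<^bsub>M\<^esub> \<sigma> (xop M (xop M m))) = m" if m: "m \<in> carrier M" for m
  proof -
    have x: "xop M m \<in> xim M" "xop M m \<in> carrier M" using m xop_closed[OF mod m] by (auto simp: xim_def)
    have "xop M (\<sigma> (m \<ominus>\<^bsub>M\<^esub> \<sigma> (xop M m))) = m \<ominus>\<^bsub>M\<^esub> \<sigma> (xop M m)" using \<sigma>(3) xker_complement(3)[OF M(1) \<sigma>(1,3) m, unfolded xk] by simp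
    moreover have "xop M m \<ominus>\<^bsub>M\<^esub> \<sigma> (xop M (xop M m)) = xop M m"
      using m x xop_xop[OF mod m] by (simp add: \<sigma>0 a_minus_def neg0)
    ultimately show ?thesis
      using m \<sigma>(2)[OF x(1)] by (simp add: a_minus_def M.M.a_assoc M.M.l_neg)
  qed
  then show ?thesis using that[of "\<lambda>m. \<sigma> (m \<ominus>\<^bsub>M\<^esub> \<sigma> (xop M m))"] 
    module_hom_comp[OF xker_complement(1)[OF M(1) \<sigma>(1,3), unfolded xk] \<sigma>(1)] by simp
qed

text \<open>Applying \<open>x\<close> before or after leaves \<open>x \<psi> x\<close> in both
  cases, since the other summand contains \<open>x\<close> twice in succession.\<close>

lemma anticommutator_hom:
  fixes M :: "('k::{field,finite} poly set, 'a) module" and N :: "('k poly set, 'b) module"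
  assumes M: "module Lam M" and N: "module Lam N"
    and \<psi>: "\<psi> \<in> module_hom (kring :: 'k ring) (restrict_to_k M) (restrict_to_k N)"
  shows "(\<lambda>m. xop N (\<psi> m) \<oplus>\<^bsub>N\<^esub> \<psi> (xop M m)) \<in> module_hom Lam M N"
proof (rule Lam_homI[OF M N])
  interpret M: module Lam M by fact
  interpret N: module Lam N by fact
  interpret V: vectorspace "kring :: 'k ring" "restrict_to_k M" by (rule vectorspace_restrict[OF M])
  interpret W: vectorspace "kring :: 'k ring" "restrict_to_k N" by (rule vectorspace_restrict[OF N])
  show "(\<lambda>m. xop N (\<psi> m) \<oplus>\<^bsub>N\<^esub> \<psi> (xop M m)) \<in> module_hom kring (restrict_to_k M) (restrict_to_k N)"
    using module_hom_plus[OF V.module_axioms W.module_axioms module_hom_comp[OF \<psi> xop_hom[OF N]] 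
      module_hom_comp[OF xop_hom[OF M] \<psi>]] by simp
  fix m assume m: "m \<in> carrier M"
  have "\<psi> \<zero>\<^bsub>M\<^esub> = \<zero>\<^bsub>N\<^esub>" using module_hom_zero[OF V.module_axioms W.module_axioms \<psi>] by simp
  moreover have cl: "\<psi> x \<in> carrier N" if "x \<in> carrier M" for x using module_hom_in[OF \<psi>, of x] that by simp
  ultimately show "xop N (\<psi> (xop M m)) \<oplus>\<^bsub>N\<^esub> \<psi> (xop M (xop M m)) = xop N (xop N (\<psi> m) \<oplus>\<^bsub>N\<^esub> \<psi> (xop M m))"
    using m xop_closed[OF M m] cl[OF m] cl[OF xop_closed[OF M m]] xop_closed[OF N cl[OF m]]
    by (simp add: xop_xop[OF M] xop_xop[OF N] N.smult_r_distr)
qed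

text \<open>If \<open>M\<close> is acyclic, the anticommutator of \<open>x\<close> with
  \<open>\<sigma> h\<close> is a section, since \<open>g\<close> carries it to
  \<open>x h + h x = 1\<close>. If \<open>N\<close> is acyclic, a \<open>Lam\<close>-linear
  retraction onto \<open>N\<close> is obtained in the same manner and then converted into a
  section.\<close>

lemma short_exact_section:
  fixes N :: "('k::{field,finite} poly set, 'a) module" and L :: "('k poly set, 'b) module" 
    and M :: "('k poly set, 'c) module"
  assumes fd: "fd_mod N" "fd_mod L" "fd_mod M" and ex: "short_exact N L M f g"
    and ac: "acyclic_mod N \<or> acyclic_mod M"
  obtains s where "s \<in> module_hom Lam M L" "\<And>m. m \<in> carrier M \<Longrightarrow> g (s m) = m"
proof -
  note mod = fd_moduleD[OF fd ex]
  note D = short_exactD[OF fd ex]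
  interpret N: module Lam N by (rule mod(1))
  interpret L: module Lam L by (rule mod(2))
  interpret M: module Lam M by (rule mod(3))
  interpret VN: vectorspace "kring :: 'k ring" "restrict_to_k N" by (rule vectorspace_restrict[OF mod(1)])
  interpret VL: vectorspace "kring :: 'k ring" "restrict_to_k L" by (rule vectorspace_restrict[OF mod(2)])
  interpret VM: vectorspace "kring :: 'k ring" "restrict_to_k M" by (rule vectorspace_restrict[OF mod(3)])
  obtain \<sigma> where \<sigma>: "\<sigma> \<in> module_hom (kring :: 'k ring) (restrict_to_k M) (restrict_to_k L)"
    "\<And>m. m \<in> carrier M \<Longrightarrow> g (\<sigma> m) = m" using short_exact_k_section[OF fd ex] by blast
  have \<sigma>c: "\<sigma> m \<in> carrier L" if "m \<in> carrier M" for m using module_hom_in[OF \<sigma>(1)] that by simp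
  show ?thesis
  proof (cases "acyclic_mod M")
    case True
    then obtain h where h: "h \<in> module_hom (kring :: 'k ring) (restrict_to_k M) (restrict_to_k M)"
      "\<And>m. m \<in> carrier M \<Longrightarrow> xop M (h m) \<oplus>\<^bsub>M\<^esub> h (xop M m) = m" using contraction[OF fd(3)] by blast
    have hc: "h m \<in> carrier M" if "m \<in> carrier M" for m using module_hom_in[OF h(1)] that by simp
    show ?thesis
    proof (rule that[OF anticommutator_hom[OF mod(3,2) module_hom_comp[OF h(1) \<sigma>(1)]]])
      fix m assume m: "m \<in> carrier M"
      note c = hc[OF m] hc[OF xop_closed[OF mod(3) m]]
      have "g (xop L (\<sigma> (h m)) \<oplus>\<^bsub>L\<^esub> \<sigma> (h (xop M m))) = g (xop L (\<sigma> (h m))) \<oplus>\<^bsub>M\<^esub> g (\<sigma> (h (xop M m)))"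
        by (rule module_hom_add[OF D(2)]) (use c \<sigma>c xop_closed[OF mod(2)] in auto)
      also have "\<dots> = m" using c \<sigma>c by (simp add: Lam_hom_xop[OF D(2)] \<sigma>(2) h(2)[OF m])
      finally show "g (xop L (\<sigma> (h m)) \<oplus>\<^bsub>L\<^esub> \<sigma> (h (xop M m))) = m" .
    qed
  next
    case False
    then obtain h where h: "h \<in> module_hom (kring :: 'k ring) (restrict_to_k N) (restrict_to_k N)"
      "\<And>n. n \<in> carrier N \<Longrightarrow> xop N (h n) \<oplus>\<^bsub>N\<^esub> h (xop N n) = n" using contraction[OF fd(1)] ac by blast
    note fc = module_hom_in[OF D(1)] and gc = module_hom_in[OF D(2)]
    have fk: "f \<in> module_hom (kring :: 'k ring) (restrict_to_k N) (restrict_to_k L)"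
      and gk: "g \<in> module_hom (kring :: 'k ring) (restrict_to_k L) (restrict_to_k M)"
      using Lam_hom_k D(1,2) by blast+
    have \<sigma>0: "\<sigma> \<zero>\<^bsub>M\<^esub> = \<zero>\<^bsub>L\<^esub>" using module_hom_zero[OF VM.module_axioms VL.module_axioms \<sigma>(1)] by simp
    have neg0: "\<ominus>\<^bsub>L\<^esub> \<zero>\<^bsub>L\<^esub> = \<zero>\<^bsub>L\<^esub>" using L.M.r_neg[of "\<zero>\<^bsub>L\<^esub>"] by simp
    have ker: "l \<in> f ` carrier N" if "l \<in> carrier L" "g l = \<zero>\<^bsub>M\<^esub>" for l using D(5) that by simp
    \<comment> \<open>The k-linear retraction of \<open>f\<close> complementary to \<sigma>:
      \<open>f (\<rho> l)\<close> is the part of \<open>l\<close> in the kernel of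
      \<open>g\<close>.\<close>
    define \<rho> where "\<rho> l = the_inv_into (carrier N) f (l \<ominus>\<^bsub>L\<^esub> \<sigma> (g l))" for l
    have d: "(\<lambda>l. l \<ominus>\<^bsub>L\<^esub> \<sigma> (g l)) \<in> module_hom (kring :: 'k ring) (restrict_to_k L) (restrict_to_k L)"
      using module_hom_diff[OF VL.module_axioms VL.module_axioms module_hom_ident module_hom_comp[OF gk \<sigma>(1)]] 
      by (simp add: restrict_to_k_minus)
    have dim: "l \<ominus>\<^bsub>L\<^esub> \<sigma> (g l) \<in> f ` carrier N" if "l \<in> carrier L" for l
    proof (rule ker)
      show "l \<ominus>\<^bsub>L\<^esub> \<sigma> (g l) \<in> carrier L" using that \<sigma>c gc by simp
      have "g (l \<ominus>\<^bsub>L\<^esub> \<sigma> (g l)) = g l \<ominus>\<^bsub>M\<^esub> g (\<sigma> (g l))"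
        by (rule module_hom_minus[OF mod(2,3) D(2) that \<sigma>c[OF gc[OF that]]])
      then show "g (l \<ominus>\<^bsub>L\<^esub> \<sigma> (g l)) = \<zero>\<^bsub>M\<^esub>" using that \<sigma>(2) gc by (simp add: a_minus_def M.M.r_neg)
    qed
    have \<rho>: "\<rho> \<in> module_hom (kring :: 'k ring) (restrict_to_k L) (restrict_to_k N)"
      unfolding \<rho>_def[abs_def]
      using module_hom_the_inv[OF VN.module_axioms VL.module_axioms fk _ VL.module_axioms d] D(3) dim by auto
    have \<rho>f: "\<rho> (f n) = n" if "n \<in> carrier N" for n
    proof -
      have "g (f n) = \<zero>\<^bsub>M\<^esub>" using D(5) that by auto
      then have "f n \<ominus>\<^bsub>L\<^esub> \<sigma> (g (f n)) = f n" using fc that by (simp add: \<sigma>0 a_minus_def neg0)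
      then show ?thesis unfolding \<rho>_def using D(3) that by (simp add: the_inv_into_f_f)
    qed
    \<comment> \<open>The retraction made \<open>Lam\<close>-linear by the contraction of
      \<open>N\<close>; it remains a retraction because \<open>x h + h x = 1\<close>.\<close>
    define r where "r l = xop N (h (\<rho> l)) \<oplus>\<^bsub>N\<^esub> h (\<rho> (xop L l))" for l
    have r: "r \<in> module_hom Lam L N"
      unfolding r_def[abs_def] by (rule anticommutator_hom[OF mod(2,1) module_hom_comp[OF \<rho> h(1)]])
    have rf: "r (f n) = n" if "n \<in> carrier N" for n
      unfolding r_def using that h(2)[OF that] xop_closed[OF mod(1) that]
      by (simp add: \<rho>f Lam_hom_xop[OF D(1), symmetric])
    define t where "t l = l \<ominus>\<^bsub>L\<^esub> f (r l)" for l
    have t: "t \<in> module_hom Lam L L"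
      unfolding t_def[abs_def] by (rule module_hom_diff[OF mod(2,2) module_hom_ident module_hom_comp[OF r D(1)]])
    \<comment> \<open>\<open>t\<close> kills the image of \<open>f\<close>, so it factors through
      \<open>g\<close>. Its composite with \<sigma> is therefore \<open>Lam\<close>-linear although
      \<sigma> is only k-linear.\<close>
    have tk: "t l = t l'" if "l \<in> carrier L" "l' \<in> carrier L" "g l = g l'" for l l'
    proof -
      have "g (l \<ominus>\<^bsub>L\<^esub> l') = \<zero>\<^bsub>M\<^esub>" 
        using that gc by (simp add: module_hom_minus[OF mod(2,3) D(2)])
      then have "l \<ominus>\<^bsub>L\<^esub> l' \<in> f ` carrier N" using that by (intro ker) simp_all
      then obtain n where n: "n \<in> carrier N" "l \<ominus>\<^bsub>L\<^esub> l' = f n" by blast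
      have "t l \<ominus>\<^bsub>L\<^esub> t l' = t (f n)" using module_hom_minus[OF mod(2,2) t that(1,2)] n by simp
      also have "\<dots> = \<zero>\<^bsub>L\<^esub>" unfolding t_def using n fc by (simp add: rf a_minus_def L.M.r_neg)
      finally show ?thesis using that module_hom_in[OF t] by simp
    qed
    show ?thesis
    proof (rule that)
      show "(\<lambda>m. t (\<sigma> m)) \<in> module_hom Lam M L"
      proof (rule Lam_homI[OF mod(3,2) module_hom_comp[OF \<sigma>(1) Lam_hom_k[OF t]]])
        fix m assume m: "m \<in> carrier M"
        have "t (\<sigma> (xop M m)) = t (xop L (\<sigma> m))"
          by (rule tk) (use m \<sigma>c xop_closed[OF mod(3)] xop_closed[OF mod(2)] in \<open>simp_all add: \<sigma>(2) Lam_hom_xop[OF D(2)]\<close>)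
        then show "t (\<sigma> (xop M m)) = xop L (t (\<sigma> m))" using m \<sigma>c by (simp add: Lam_hom_xop[OF t])
      qed
      fix m assume m: "m \<in> carrier M"
      have s: "\<sigma> m \<in> carrier L" and rs: "r (\<sigma> m) \<in> carrier N" using \<sigma>c[OF m] module_hom_in[OF r] by auto
      have "g (f (r (\<sigma> m))) = \<zero>\<^bsub>M\<^esub>" using D(5) rs by auto
      moreover have "\<ominus>\<^bsub>M\<^esub> \<zero>\<^bsub>M\<^esub> = \<zero>\<^bsub>M\<^esub>" using M.M.r_neg[of "\<zero>\<^bsub>M\<^esub>"] by simp
      moreover have "g (\<sigma> m \<ominus>\<^bsub>L\<^esub> f (r (\<sigma> m))) = g (\<sigma> m) \<ominus>\<^bsub>M\<^esub> g (f (r (\<sigma> m)))"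
        by (rule module_hom_minus[OF mod(2,3) D(2) s fc[OF rs]])
      ultimately show "g (t (\<sigma> m)) = m"
        unfolding t_def using m by (simp add: \<sigma>(2) a_minus_def)
    qed
  qed
qed

lemma short_exact_split:
  fixes N :: "('k::{field,finite} poly set, 'a) module" and L :: "('k poly set, 'b) module" 
    and M :: "('k poly set, 'c) module"
  assumes fd: "fd_mod N" "fd_mod L" "fd_mod M" and ex: "short_exact N L M f g"
    and ac: "acyclic_mod N \<or> acyclic_mod M"
  obtains \<phi> where "\<phi> \<in> module_hom Lam (direct_sum N M) L" 
    "bij_betw \<phi> (carrier (direct_sum N M)) (carrier L)"
    "\<And>n. n \<in> carrier N \<Longrightarrow> \<phi> (n, \<zero>\<^bsub>M\<^esub>) = f n"
    "\<And>n m. n \<in> carrier N \<Longrightarrow> m \<in> carrier M \<Longrightarrow> g (\<phi> (n, m)) = m"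
proof -
  obtain s where s: "s \<in> module_hom Lam M L" "\<And>m. m \<in> carrier M \<Longrightarrow> g (s m) = m" 
    using short_exact_section[OF fd ex ac] by blast
  note D = short_exactD[OF fd ex]
  note si = split_iso[OF fd_moduleD[OF fd ex] D(1,3,2,5) s]
  show ?thesis by (rule that[OF si(1,2)]) (use si(3,4) in simp_all)
qed

text \<open>Projectivity is tested on modules carried by \<open>nat\<close>; a copy of
  \<open>A\<close> extends the lifting property to other carriers, such as the pairs of the induced
  module.\<close>

lemma projective_lift:
  fixes P B :: "('k::{field,finite} poly set, nat) module" and A :: "('k poly set, 'a) module"
  assumes P: "projective_mod P" and A: "fd_mod A" and B: "fd_mod B"
    and g: "g \<in> module_hom Lam A B" "g ` carrier A = carrier B" and h: "h \<in> module_hom Lam P B"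
  obtains h' where "h' \<in> module_hom Lam P A" "\<And>x. x \<in> carrier P \<Longrightarrow> g (h' x) = h x"
proof -
  obtain A' :: "('k poly set, nat) module" where A': "fd_mod A'" "mod_iso A A'" using ex_nat_copy[OF A] by blast
  then obtain j where j: "j \<in> module_hom Lam A A'" "bij_betw j (carrier A) (carrier A')" by (auto simp: mod_iso_def)
  define i where "i = the_inv_into (carrier A) j"
  have i: "i \<in> module_hom Lam A' A" "i ` carrier A' = carrier A"
    using bij_hom_inverse[OF _ _ j] A A'(1) bij_betw_the_inv_into[OF j(2)] 
    by (auto simp: i_def fd_mod_iff bij_betw_def)
  have "(\<lambda>x. g (i x)) ` carrier A' = carrier B" using i(2) g(2) by (metis image_image)
  then obtain h1 where h1: "h1 \<in> module_hom Lam P A'" "\<forall>x\<in>carrier P. g (i (h1 x)) = h x"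
    using P A'(1) B module_hom_comp[OF i(1) g(1)] h unfolding projective_mod_def by blast
  show ?thesis
    by (rule that[OF module_hom_comp[OF h1(1) i(1)]]) (use h1(2) in simp)
qed

text \<open>
  A projective \<open>P\<close> is a direct summand of the induced module \<open>P[x]/(x\<^sup>2)\<close>, modelled on pairs
  \<open>(a, b) = a + b x\<close>, with the surjection \<open>(a, b) \<mapsto> a + x b\<close> onto \<open>P\<close>.
\<close>

lemma acyclic_if_projective:
  fixes P :: "('k::{field,finite} poly set, nat) module"
  assumes P: "projective_mod P"
  shows "acyclic_mod P"
proof -
  have fd: "fd_mod P" using P by (simp add: projective_mod_def)
  then have mod: "module Lam P" and fin: "finite (carrier P)" by (auto simp: fd_mod_iff)
  interpret P: module Lam P by fact
  interpret V: vectorspace "kring :: 'k ring" "restrict_to_k P" by (rule vectorspace_restrict[OF mod])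
  define D where "D = direct_sum (restrict_to_k P) (restrict_to_k P)"
  define \<xi> where "\<xi> p = (\<zero>\<^bsub>P\<^esub>, fst p)" for p :: "nat \<times> nat"
  have D: "vectorspace (kring :: 'k ring) D"
    unfolding D_def by (rule direct_sum_is_vs[OF V.vectorspace_axioms V.vectorspace_axioms])
  have \<xi>: "\<xi> \<in> module_hom kring D D"
    unfolding D_def \<xi>_def by (rule module_homI) auto
  have \<xi>\<xi>: "\<xi> (\<xi> m) = \<zero>\<^bsub>D\<^esub>" for m by (simp add: D_def \<xi>_def)
  note A = lam_mod[OF D \<xi> \<xi>\<xi>]
  let ?A = "lam_mod D \<xi>"
  have fdA: "fd_mod ?A" using A(1) fin by (simp add: fd_mod_iff D_def)
  define g where "g p = fst p \<oplus>\<^bsub>P\<^esub> xop P (snd p)" for p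
  have gk: "g \<in> module_hom Lam ?A P"
  proof (rule Lam_homI[OF A(1) mod])
    show "g \<in> module_hom kring (restrict_to_k ?A) (restrict_to_k P)"
    proof (rule module_homI)
      fix r x assume "x \<in> carrier (restrict_to_k ?A)"
      then have x: "x \<in> carrier D" by simp
      then show "g (r \<odot>\<^bsub>restrict_to_k ?A\<^esub> x) = r \<odot>\<^bsub>restrict_to_k P\<^esub> g x"
        unfolding restrict_to_k_simps A(3)[OF x] 
        by (auto simp: g_def D_def xop_linear[OF fd] P.smult_r_distr)
    qed (auto simp: g_def D_def xop_linear[OF fd] P.M.a_ac)
    fix m assume "m \<in> carrier ?A"
    then have m: "m \<in> carrier D" by simp
    then show "g (xop ?A m) = xop P (g m)"
      unfolding A(2)[OF m] by (auto simp: g_def \<xi>_def D_def xop_linear[OF fd] xop_xop[OF mod])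
  qed
  have "g ` carrier ?A = carrier P"
  proof
    show "g ` carrier ?A \<subseteq> carrier P" using module_hom_in[OF gk] by auto
    show "carrier P \<subseteq> g ` carrier ?A"
    proof
      fix x assume "x \<in> carrier P"
      then show "x \<in> g ` carrier ?A" 
        by (intro image_eqI[of _ _ "(x, \<zero>\<^bsub>P\<^esub>)"]) (auto simp: g_def D_def xop_linear[OF fd])
    qed
  qed
  from projective_lift[OF P fdA fd gk this module_hom_ident]
  obtain h where h: "h \<in> module_hom Lam P ?A" "\<And>x. x \<in> carrier P \<Longrightarrow> g (h x) = x" by blast
  show ?thesis
  proof (rule acyclic_modI[OF fd])
    show "xker P \<subseteq> xim P"
    proof
      fix p assume "p \<in> xker P"
      then have p: "p \<in> carrier P" "xop P p = \<zero>\<^bsub>P\<^esub>" by (auto simp: xker_def)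
      have hp: "h p \<in> carrier D" using module_hom_in[OF h(1) p(1)] by simp
      \<comment> \<open>In the induced module \<open>x (a, b) = (0, a)\<close>, so an element killed
        by \<open>x\<close> has first coordinate zero.\<close>
      have "xop ?A (h p) = h \<zero>\<^bsub>P\<^esub>" using Lam_hom_xop[OF h(1) p(1)] p(2) by simp
      also have "\<dots> = \<zero>\<^bsub>D\<^esub>" using module_hom_zero[OF mod A(1) h(1)] by simp
      finally have "fst (h p) = \<zero>\<^bsub>P\<^esub>" unfolding A(2)[OF hp] by (simp add: \<xi>_def D_def)
      moreover have "snd (h p) \<in> carrier P" using hp by (auto simp: D_def)
      ultimately have "p = xop P (snd (h p))" using h(2)[OF p(1)] by (simp add: g_def)
      then show "p \<in> xim P" using \<open>snd (h p) \<in> carrier P\<close> by (auto simp: xim_def)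
    qed
  qed
qed

text \<open>\<open>\<sigma> h\<close> lifts \<open>h\<close> over k. Precomposed with the
  contraction \<eta> and anticommuted with \<open>x\<close> it becomes \<open>Lam\<close>-linear,
  and it still lifts \<open>h\<close> because \<open>g\<close> and \<open>h\<close> commute with
  \<open>x\<close>.\<close>

lemma projective_if_acyclic:
  fixes P :: "('k::{field,finite} poly set, nat) module"
  assumes P: "fd_mod P" "acyclic_mod P"
  shows "projective_mod P"
  unfolding projective_mod_def
proof (intro conjI allI impI)
  show "fd_mod P" by fact
  fix A B :: "('k poly set, nat) module" and g h
  assume a: "fd_mod A \<and> fd_mod B \<and> g \<in> module_hom Lam A B \<and> g ` carrier A = carrier B \<and> h \<in> module_hom Lam P B"
  then have A: "fd_mod A" and B: "fd_mod B" and g: "g \<in> module_hom Lam A B" "g ` carrier A = carrier B"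
    and h: "h \<in> module_hom Lam P B" by auto
  have mod: "module Lam A" "module Lam B" "module Lam P" using A B P by (auto simp: fd_mod_iff)
  interpret A: module Lam A by (rule mod)
  interpret B: module Lam B by (rule mod)
  interpret W: vectorspace "kring :: 'k ring" "restrict_to_k B" by (rule vectorspace_restrict[OF mod(2)])
  obtain \<sigma> where \<sigma>: "\<sigma> \<in> module_hom (kring :: 'k ring) (restrict_to_k B) (restrict_to_k A)"
    "\<And>m. m \<in> carrier B \<Longrightarrow> g (\<sigma> m) = m"
    using W.linear_section[OF _ vectorspace_restrict[OF mod(1)] Lam_hom_k[OF g(1)]] g(2) finite_carrier(1)[OF B]
    by (metis restrict_to_k_simps(1))
  obtain \<eta> where \<eta>: "\<eta> \<in> module_hom (kring :: 'k ring) (restrict_to_k P) (restrict_to_k P)"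
    "\<And>m. m \<in> carrier P \<Longrightarrow> xop P (\<eta> m) \<oplus>\<^bsub>P\<^esub> \<eta> (xop P m) = m" using contraction[OF P] by blast
  have \<eta>c: "\<eta> m \<in> carrier P" if "m \<in> carrier P" for m using module_hom_in[OF \<eta>(1)] that by simp
  have \<sigma>c: "\<sigma> m \<in> carrier A" if "m \<in> carrier B" for m using module_hom_in[OF \<sigma>(1)] that by simp
  note hc = module_hom_in[OF h]
  define h' where "h' m = xop A (\<sigma> (h (\<eta> m))) \<oplus>\<^bsub>A\<^esub> \<sigma> (h (\<eta> (xop P m)))" for m
  have "h' \<in> module_hom Lam P A"
    unfolding h'_def[abs_def]
    by (rule anticommutator_hom[OF mod(3,1) module_hom_comp[OF module_hom_comp[OF \<eta>(1) Lam_hom_k[OF h]] \<sigma>(1)]])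
  moreover have "g (h' m) = h m" if m: "m \<in> carrier P" for m
  proof -
    note c = \<eta>c[OF m] \<eta>c[OF xop_closed[OF mod(3) m]]
    have "g (h' m) = g (xop A (\<sigma> (h (\<eta> m)))) \<oplus>\<^bsub>B\<^esub> g (\<sigma> (h (\<eta> (xop P m))))"
      unfolding h'_def by (rule module_hom_add[OF g(1)]) (use c hc \<sigma>c xop_closed[OF mod(1)] in auto)
    also have "\<dots> = h (xop P (\<eta> m)) \<oplus>\<^bsub>B\<^esub> h (\<eta> (xop P m))"
      using c hc \<sigma>c by (simp add: Lam_hom_xop[OF g(1)] \<sigma>(2) Lam_hom_xop[OF h])
    also have "\<dots> = h (xop P (\<eta> m) \<oplus>\<^bsub>P\<^esub> \<eta> (xop P m))"
      by (rule module_hom_add[OF h, symmetric]) (use c xop_closed[OF mod(3)] in auto)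
    finally show ?thesis using \<eta>(2)[OF m] by simp
  qed
  ultimately show "\<exists>h'\<in>module_hom Lam P A. \<forall>x\<in>carrier P. g (h' x) = h x" by blast
qed

lemma module_zero_mod: "module Lam (zero_mod :: ('k::{field,finite} poly set, nat) module)"
proof (rule moduleI)
  show "abelian_group (zero_mod :: ('k poly set, nat) module)"
    by (rule abelian_groupI) (auto simp: zero_mod_def)
qed (auto simp: zero_mod_def cring_Lam)

lemma zero_mod_simps [simp]: "carrier zero_mod = {0}" "\<zero>\<^bsub>zero_mod\<^esub> = 0"
  by (auto simp: zero_mod_def)

lemma fd_zero_mod: "fd_mod (zero_mod :: ('k::{field,finite} poly set, nat) module)"
  by (simp add: fd_mod_iff module_zero_mod)

lemma acyclic_zero_mod: "acyclic_mod (zero_mod :: ('k::{field,finite} poly set, nat) module)"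
  by (rule acyclic_modI[OF fd_zero_mod]) (auto simp: xker_def xim_def zero_mod_def)

text \<open>Acyclicity passes from \<open>P1\<close> and \<open>P0\<close> to the cokernel, as in
  the long exact homology sequence. Conversely an acyclic module is itself projective, and zero
  serves as its first syzygy.\<close>

lemma pd_le_one_iff:
  fixes M :: "('k::{field,finite} poly set, nat) module"
  shows "pd_le_one M \<longleftrightarrow> fd_mod M \<and> acyclic_mod M"
proof
  assume "pd_le_one M"
  then obtain P1 P0 :: "('k poly set, nat) module" and f g where M: "fd_mod M" 
    and P: "projective_mod P1" "projective_mod P0" and ex: "short_exact P1 P0 M f g"
    by (auto simp: pd_le_one_def)
  have fd: "fd_mod P1" "fd_mod P0" using P by (simp_all add: projective_mod_def)
  have ac: "xker P1 = xim P1" "xker P0 = xim P0" using P[THEN acyclic_if_projective] by (simp_all add: acyclic_mod_def)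
  note D = short_exactD[OF fd M ex]
  note mod = fd_moduleD[OF fd M ex]
  interpret P0: module Lam P0 by (rule mod)
  have "acyclic_mod M"
  proof (rule acyclic_modI[OF M], rule subsetI)
    fix m assume "m \<in> xker M"
    then have m: "m \<in> carrier M" "xop M m = \<zero>\<^bsub>M\<^esub>" by (auto simp: xker_def)
    then obtain p where p: "p \<in> carrier P0" "g p = m" using D(4) by (metis imageE)
    \<comment> \<open>For a lift \<open>p\<close> of a cycle, \<open>x p\<close> comes from some
      \<open>r\<close> in \<open>P1\<close>. Injectivity of \<open>f\<close> makes \<open>r\<close>
      a cycle, hence a boundary \<open>x s\<close>.\<close>
    have "xop P0 p \<in> f ` carrier P1" using p m xop_closed[OF mod(2)] by (simp add: D(5) Lam_hom_xop[OF D(2)])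
    then obtain r where r: "r \<in> carrier P1" "f r = xop P0 p" by auto
    have "f (xop P1 r) = f \<zero>\<^bsub>P1\<^esub>"
      using r p by (simp add: Lam_hom_xop[OF D(1)] xop_xop[OF mod(2)] module_hom_zero[OF mod(1,2) D(1)])
    then have "xop P1 r = \<zero>\<^bsub>P1\<^esub>"
      using D(3) r xop_closed[OF mod(1)] module.axioms(2)[OF mod(1)] by (auto dest!: inj_onD intro: abelian_group.axioms abelian_monoid.zero_closed)
    then have "r \<in> xim P1" using r ac by (auto simp: xker_def)
    then obtain s where s: "s \<in> carrier P1" "r = xop P1 s" by (auto simp: xim_def)
    have fs: "f s \<in> carrier P0" using module_hom_in[OF D(1) s(1)] .
    \<comment> \<open>Subtracting \<open>f s\<close> makes the lift a cycle of \<open>P0\<close>,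
      hence a boundary, without changing its image in \<open>M\<close>.\<close>
    have "xop P0 (p \<ominus>\<^bsub>P0\<^esub> f s) = xop P0 p \<ominus>\<^bsub>P0\<^esub> xop P0 p"
      using p fs r s by (simp add: xop_linear[OF fd(2)] Lam_hom_xop[OF D(1)])
    then have "p \<ominus>\<^bsub>P0\<^esub> f s \<in> xim P0"
      using p fs xop_closed[OF mod(2) p(1)] unfolding ac(2)[symmetric] by (simp add: xker_def a_minus_def P0.M.r_neg)
    then obtain t where t: "t \<in> carrier P0" "p \<ominus>\<^bsub>P0\<^esub> f s = xop P0 t" by (auto simp: xim_def)
    have gfs: "g (f s) = \<zero>\<^bsub>M\<^esub>" using D(5) s by auto
    interpret M: module Lam M by (rule mod)
    have neg0: "\<ominus>\<^bsub>M\<^esub> \<zero>\<^bsub>M\<^esub> = \<zero>\<^bsub>M\<^esub>" using M.M.r_neg[of "\<zero>\<^bsub>M\<^esub>"] by simp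
    have "xop M (g t) = g (p \<ominus>\<^bsub>P0\<^esub> f s)" unfolding t(2) using t(1) by (simp add: Lam_hom_xop[OF D(2)])
    also have "\<dots> = g p \<ominus>\<^bsub>M\<^esub> g (f s)" by (rule module_hom_minus[OF mod(2,3) D(2) p(1) fs])
    also have "\<dots> = m" using m p(2) gfs neg0 by (simp add: a_minus_def)
    finally show "m \<in> xim M" using module_hom_in[OF D(2) t(1)] by (auto simp: xim_def)
  qed
  with M show "fd_mod M \<and> acyclic_mod M" by simp
next
  assume a: "fd_mod M \<and> acyclic_mod M"
  then have mod: "module Lam M" by (simp add: fd_mod_iff)
  interpret M: module Lam M by fact
  have "short_exact zero_mod M M (\<lambda>_. \<zero>\<^bsub>M\<^esub>) (\<lambda>x. x)"
    unfolding short_exact_def by (auto simp: module_hom_ident intro!: module_homI)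
  then show "pd_le_one M"
    using a projective_if_acyclic fd_zero_mod acyclic_zero_mod unfolding pd_le_one_def by blast
qed

subsection \<open>Counting homomorphisms\<close>

text \<open>\<open>K\<close> is free on \<open>\<sigma> (im x)\<close>, so a homomorphism out of
  \<open>K\<close> is determined by its values there. Dually, free modules over this algebra are
  coinduced: a homomorphism into \<open>K\<close> is determined by its component in
  \<open>im x\<close>. What remains in both cases is a k-linear map between \<open>im x\<close> and
  \<open>M\<close>.\<close>

lemma card_Hom_set_acyclic:
  fixes K :: "('k::{field,finite} poly set, 'a) module" and M :: "('k poly set, 'b) module"
  assumes K: "fd_mod K" "acyclic_mod K" and M: "fd_mod M"
  defines "V \<equiv> (restrict_to_k K)\<lparr>carrier := xim K\<rparr>"
  shows "card (Hom_set K M) = card (module_hom (kring :: 'k ring) V (restrict_to_k M) \<inter> extensional (carrier V))"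
    and "card (Hom_set M K) = card (module_hom (kring :: 'k ring) (restrict_to_k M) V \<inter> extensional (carrier M))"
proof -
  have mod: "module Lam K" "module Lam M" using K M by (auto simp: fd_mod_iff)
  interpret K: module Lam K by (rule mod)
  interpret M: module Lam M by (rule mod)
  interpret VK: vectorspace "kring :: 'k ring" "restrict_to_k K" by (rule vectorspace_restrict[OF mod(1)])
  interpret VM: vectorspace "kring :: 'k ring" "restrict_to_k M" by (rule vectorspace_restrict[OF mod(2)])
  interpret V: module "kring :: 'k ring" V unfolding V_def by (rule VK.submodule_is_module[OF xim_submodule[OF K(1)]])
  have xk: "xker K = xim K" using K by (simp add: acyclic_mod_def)
  obtain \<sigma> where \<sigma>: "\<sigma> \<in> module_hom (kring :: 'k ring) V (restrict_to_k K)"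
    "\<And>u. u \<in> xim K \<Longrightarrow> \<sigma> u \<in> carrier K" "\<And>u. u \<in> xim K \<Longrightarrow> xop K (\<sigma> u) = u"
    unfolding V_def using xop_section[OF K(1)] by blast
  have cV [simp]: "carrier V = xim K" by (simp add: V_def)
  have xmem: "xop K y \<in> xim K" if "y \<in> carrier K" for y using that by (simp add: xim_def)
  have ximD: "u \<in> carrier K" "xop K u = \<zero>\<^bsub>K\<^esub>" if "u \<in> xim K" for u 
    using that unfolding xk[symmetric] by (auto simp: xker_def)
  have \<sigma>0: "\<sigma> \<zero>\<^bsub>K\<^esub> = \<zero>\<^bsub>K\<^esub>" using module_hom_zero[OF V.module_axioms VK.module_axioms \<sigma>(1)] by (simp add: V_def)
  have neg0: "\<ominus>\<^bsub>K\<^esub> \<zero>\<^bsub>K\<^esub> = \<zero>\<^bsub>K\<^esub>" using K.M.r_neg[of "\<zero>\<^bsub>K\<^esub>"] by simp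
  have comp: "(\<lambda>m. m \<ominus>\<^bsub>K\<^esub> \<sigma> (xop K m)) \<in> module_hom (kring :: 'k ring) (restrict_to_k K) V"
    using xker_complement(1)[OF K(1) \<sigma>(1)[unfolded V_def] \<sigma>(3)] by (simp add: V_def xk)
  have \<pi>: "m \<ominus>\<^bsub>K\<^esub> \<sigma> (xop K m) \<in> xim K" if "m \<in> carrier K" for m using module_hom_in[OF comp] that by simp
  have xV: "xop K \<in> module_hom (kring :: 'k ring) (restrict_to_k K) V"
    using xop_hom[OF mod(1)] xmem by (simp add: module_hom_def V_def Pi_iff)
  have incl: "\<psi> \<in> module_hom (kring :: 'k ring) (restrict_to_k M) (restrict_to_k K)" 
    if "\<psi> \<in> module_hom (kring :: 'k ring) (restrict_to_k M) V" for \<psi>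
    using that xim_subset(1)[OF K(1)] by (auto simp: module_hom_def V_def Pi_iff)
  let ?H1 = "module_hom (kring :: 'k ring) V (restrict_to_k M) \<inter> extensional (carrier V)"
  let ?H2 = "module_hom (kring :: 'k ring) (restrict_to_k M) V \<inter> extensional (carrier M)"
  \<comment> \<open>\<open>F\<close> restricts to the generators \<open>\<sigma> u\<close>.
    \<open>F'\<close> goes back by writing \<open>y\<close> as \<open>\<sigma> (x y)\<close> plus
    \<open>x\<close> applied to \<open>\<sigma> (y - \<sigma> (x y))\<close>.\<close>
  define F where "F \<phi> = restrict (\<lambda>u. \<phi> (\<sigma> u)) (xim K)" for \<phi> :: "'a \<Rightarrow> 'b"
  define F' where "F' \<psi> = restrict (\<lambda>y. \<psi> (xop K y) \<oplus>\<^bsub>M\<^esub> xop M (\<psi> (y \<ominus>\<^bsub>K\<^esub> \<sigma> (xop K y)))) (carrier K)" for \<psi>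
  have "bij_betw F (Hom_set K M) ?H1"
  proof (rule bij_betw_byWitness[of _ F'])
    show "\<forall>\<phi>\<in>Hom_set K M. F' (F \<phi>) = \<phi>"
    proof
      fix \<phi> assume "\<phi> \<in> Hom_set K M"
      then have \<phi>: "\<phi> \<in> module_hom Lam K M" "\<phi> \<in> extensional (carrier K)" by (auto simp: Hom_set_def)
      have "F' (F \<phi>) y = \<phi> y" if y: "y \<in> carrier K" for y
      proof -
        have m: "\<sigma> (xop K y) \<in> carrier K" "\<sigma> (y \<ominus>\<^bsub>K\<^esub> \<sigma> (xop K y)) \<in> carrier K" using \<sigma>(2) xmem[OF y] \<pi>[OF y] by auto
        have "F' (F \<phi>) y = \<phi> (\<sigma> (xop K y)) \<oplus>\<^bsub>M\<^esub> xop M (\<phi> (\<sigma> (y \<ominus>\<^bsub>K\<^esub> \<sigma> (xop K y))))"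
          using y by (simp add: F'_def F_def xmem \<pi>)
        also have "xop M (\<phi> (\<sigma> (y \<ominus>\<^bsub>K\<^esub> \<sigma> (xop K y)))) = \<phi> (y \<ominus>\<^bsub>K\<^esub> \<sigma> (xop K y))"
          using Lam_hom_xop[OF \<phi>(1) m(2)] \<sigma>(3)[OF \<pi>[OF y]] by simp
        also have "\<phi> (\<sigma> (xop K y)) \<oplus>\<^bsub>M\<^esub> \<phi> (y \<ominus>\<^bsub>K\<^esub> \<sigma> (xop K y)) = \<phi> (\<sigma> (xop K y) \<oplus>\<^bsub>K\<^esub> (y \<ominus>\<^bsub>K\<^esub> \<sigma> (xop K y)))"
          using module_hom_add[OF \<phi>(1)] m(1) ximD(1)[OF \<pi>[OF y]] by simp
        also have "\<sigma> (xop K y) \<oplus>\<^bsub>K\<^esub> (y \<ominus>\<^bsub>K\<^esub> \<sigma> (xop K y)) = y"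
          using y m(1) by (simp add: a_minus_def K.M.a_lcomm K.M.r_neg)
        finally show ?thesis .
      qed
      then show "F' (F \<phi>) = \<phi>" using \<phi>(2) by (intro extensionalityI[of _ "carrier K"]) (auto simp: F'_def)
    qed
    have F'h: "(\<lambda>y. \<psi> (xop K y) \<oplus>\<^bsub>M\<^esub> xop M (\<psi> (y \<ominus>\<^bsub>K\<^esub> \<sigma> (xop K y)))) \<in> module_hom Lam K M"
      and \<psi>0: "\<psi> \<zero>\<^bsub>K\<^esub> = \<zero>\<^bsub>M\<^esub>"
      if \<psi>: "\<psi> \<in> module_hom (kring :: 'k ring) V (restrict_to_k M)" for \<psi>
    proof -
      show \<psi>0: "\<psi> \<zero>\<^bsub>K\<^esub> = \<zero>\<^bsub>M\<^esub>" using module_hom_zero[OF V.module_axioms VM.module_axioms \<psi>] by (simp add: V_def)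
      have \<psi>c: "\<psi> u \<in> carrier M" if "u \<in> xim K" for u using module_hom_in[OF \<psi>, of u] that by simp
      show "(\<lambda>y. \<psi> (xop K y) \<oplus>\<^bsub>M\<^esub> xop M (\<psi> (y \<ominus>\<^bsub>K\<^esub> \<sigma> (xop K y)))) \<in> module_hom Lam K M"
      proof (rule Lam_homI[OF mod])
        show "(\<lambda>y. \<psi> (xop K y) \<oplus>\<^bsub>M\<^esub> xop M (\<psi> (y \<ominus>\<^bsub>K\<^esub> \<sigma> (xop K y)))) \<in> module_hom kring (restrict_to_k K) (restrict_to_k M)"
          using module_hom_plus[OF VK.module_axioms VM.module_axioms module_hom_comp[OF xV \<psi>] 
              module_hom_comp[OF module_hom_comp[OF comp \<psi>] xop_hom[OF mod(2)]]] by simp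
        fix y assume y: "y \<in> carrier K"
        have "xop K y \<ominus>\<^bsub>K\<^esub> \<sigma> (xop K (xop K y)) = xop K y"
          using y xop_closed[OF mod(1) y] by (simp add: xop_xop[OF mod(1)] \<sigma>0 a_minus_def neg0)
        then show "\<psi> (xop K (xop K y)) \<oplus>\<^bsub>M\<^esub> xop M (\<psi> (xop K y \<ominus>\<^bsub>K\<^esub> \<sigma> (xop K (xop K y)))) =
            xop M (\<psi> (xop K y) \<oplus>\<^bsub>M\<^esub> xop M (\<psi> (y \<ominus>\<^bsub>K\<^esub> \<sigma> (xop K y))))"
          using y \<psi>c[OF xmem[OF y]] \<psi>c[OF \<pi>[OF y]] 
          by (simp add: xop_xop[OF mod(1)] xop_xop[OF mod(2)] \<psi>0 xop_linear[OF M])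
      qed
    qed
    show "\<forall>\<psi>\<in>?H1. F (F' \<psi>) = \<psi>"
    proof
      fix \<psi> assume \<psi>: "\<psi> \<in> ?H1"
      have \<psi>c: "\<psi> u \<in> carrier M" if "u \<in> xim K" for u using module_hom_in[of \<psi> kring V "restrict_to_k M" u] \<psi> that by auto
      have "F (F' \<psi>) u = \<psi> u" if u: "u \<in> xim K" for u
      proof -
        have "F (F' \<psi>) u = \<psi> u \<oplus>\<^bsub>M\<^esub> xop M (\<psi> (\<sigma> u \<ominus>\<^bsub>K\<^esub> \<sigma> u))"
          using u \<sigma>(2,3)[OF u] by (simp add: F_def F'_def)
        also have "\<sigma> u \<ominus>\<^bsub>K\<^esub> \<sigma> u = \<zero>\<^bsub>K\<^esub>" using \<sigma>(2)[OF u] by (simp only: a_minus_def K.M.r_neg)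
        also have "\<psi> \<zero>\<^bsub>K\<^esub> = \<zero>\<^bsub>M\<^esub>" by (rule \<psi>0) (use \<psi> in blast)
        also have "xop M \<zero>\<^bsub>M\<^esub> = \<zero>\<^bsub>M\<^esub>" by (rule xop_linear(4)[OF M])
        finally show ?thesis using \<psi>c[OF u] by simp
      qed
      then show "F (F' \<psi>) = \<psi>" using \<psi> by (intro extensionalityI[of _ "xim K"]) (auto simp: F_def)
    qed
    show "F ` Hom_set K M \<subseteq> ?H1"
    proof (rule image_subsetI)
      fix \<phi> assume "\<phi> \<in> Hom_set K M"
      then have "(\<lambda>u. \<phi> (\<sigma> u)) \<in> module_hom (kring :: 'k ring) V (restrict_to_k M)"
        using module_hom_comp[OF \<sigma>(1) Lam_hom_k] by (auto simp: Hom_set_def)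
      then show "F \<phi> \<in> ?H1" using module_hom_cong[OF _ _ V.module_axioms] by (fastforce simp: F_def)
    qed
    show "F' ` ?H1 \<subseteq> Hom_set K M"
      using module_hom_cong[OF F'h _ mod(1)] by (fastforce simp: F'_def Hom_set_def)
  qed
  then show "card (Hom_set K M) = card ?H1" by (rule bij_betw_same_card)

  \<comment> \<open>\<open>G\<close> keeps the component in \<open>im x\<close>. The other component
    of \<open>\<phi> m\<close> is \<sigma> of \<open>x (\<phi> m) = \<phi> (x m)\<close>, which lies
    in \<open>im x\<close> already; this is what \<open>G'\<close> restores.\<close>
  define G where "G \<phi> = restrict (\<lambda>m. \<phi> m \<ominus>\<^bsub>K\<^esub> \<sigma> (xop K (\<phi> m))) (carrier M)" for \<phi> :: "'b \<Rightarrow> 'a"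
  define G' where "G' \<psi> = restrict (\<lambda>m. \<psi> m \<oplus>\<^bsub>K\<^esub> \<sigma> (\<psi> (xop M m))) (carrier M)" for \<psi>
  have "bij_betw G (Hom_set M K) ?H2"
  proof (rule bij_betw_byWitness[of _ G'])
    show "\<forall>\<phi>\<in>Hom_set M K. G' (G \<phi>) = \<phi>"
    proof
      fix \<phi> assume "\<phi> \<in> Hom_set M K"
      then have \<phi>: "\<phi> \<in> module_hom Lam M K" "\<phi> \<in> extensional (carrier M)" by (auto simp: Hom_set_def)
      note c = module_hom_in[OF \<phi>(1)]
      have "G' (G \<phi>) m = \<phi> m" if m: "m \<in> carrier M" for m
      proof -
        note xm = xop_closed[OF mod(2) m]
        have s: "\<sigma> (xop K (\<phi> m)) \<in> carrier K" using \<sigma>(2) xmem c m by auto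
        have "\<phi> (xop M m) \<ominus>\<^bsub>K\<^esub> \<sigma> (xop K (\<phi> (xop M m))) = xop K (\<phi> m)"
          using m c[OF m] xop_closed[OF mod(1) c[OF m]]
          by (simp add: Lam_hom_xop[OF \<phi>(1)] xop_xop[OF mod(1)] \<sigma>0 a_minus_def neg0)
        then show ?thesis using m xm c[OF m] s
          by (simp add: G'_def G_def a_minus_def K.M.a_assoc K.M.l_neg)
      qed
      then show "G' (G \<phi>) = \<phi>" using \<phi>(2) by (intro extensionalityI[of _ "carrier M"]) (auto simp: G'_def)
    qed
    have G'h: "(\<lambda>m. \<psi> m \<oplus>\<^bsub>K\<^esub> \<sigma> (\<psi> (xop M m))) \<in> module_hom Lam M K"
      if \<psi>: "\<psi> \<in> module_hom (kring :: 'k ring) (restrict_to_k M) V" for \<psi>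
    proof (rule Lam_homI[OF mod(2,1)])
      have \<psi>0: "\<psi> \<zero>\<^bsub>M\<^esub> = \<zero>\<^bsub>K\<^esub>" using module_hom_zero[OF VM.module_axioms V.module_axioms \<psi>] by (simp add: V_def)
      have \<psi>c: "\<psi> m \<in> xim K" if "m \<in> carrier M" for m using module_hom_in[OF \<psi>, of m] that by simp
      show "(\<lambda>m. \<psi> m \<oplus>\<^bsub>K\<^esub> \<sigma> (\<psi> (xop M m))) \<in> module_hom kring (restrict_to_k M) (restrict_to_k K)"
        using module_hom_plus[OF VM.module_axioms VK.module_axioms incl[OF \<psi>] 
            module_hom_comp[OF module_hom_comp[OF xop_hom[OF mod(2)] \<psi>] \<sigma>(1)]] by simp
      fix m assume m: "m \<in> carrier M"
      note \<psi>m = \<psi>c[OF m] and \<psi>xm = \<psi>c[OF xop_closed[OF mod(2) m]]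
      show "\<psi> (xop M m) \<oplus>\<^bsub>K\<^esub> \<sigma> (\<psi> (xop M (xop M m))) = xop K (\<psi> m \<oplus>\<^bsub>K\<^esub> \<sigma> (\<psi> (xop M m)))"
        using m ximD[OF \<psi>m] ximD[OF \<psi>xm] \<sigma>(2,3)[OF \<psi>xm]
        by (simp add: xop_xop[OF mod(2)] \<psi>0 \<sigma>0 xop_linear[OF K(1)])
    qed
    show "\<forall>\<psi>\<in>?H2. G (G' \<psi>) = \<psi>"
    proof
      fix \<psi> assume \<psi>: "\<psi> \<in> ?H2"
      have \<psi>c: "\<psi> m \<in> xim K" if "m \<in> carrier M" for m using module_hom_in[of \<psi> kring "restrict_to_k M" V m] \<psi> that by auto
      have "G (G' \<psi>) m = \<psi> m" if m: "m \<in> carrier M" for m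
      proof -
        note \<psi>m = \<psi>c[OF m] and \<psi>xm = \<psi>c[OF xop_closed[OF mod(2) m]]
        have "xop K (\<psi> m \<oplus>\<^bsub>K\<^esub> \<sigma> (\<psi> (xop M m))) = \<psi> (xop M m)"
          using ximD[OF \<psi>m] ximD[OF \<psi>xm] \<sigma>(2,3)[OF \<psi>xm] by (simp add: xop_linear[OF K(1)])
        then show ?thesis
          using m ximD(1)[OF \<psi>m] \<sigma>(2)[OF \<psi>xm] by (simp add: G_def G'_def a_minus_def K.M.a_assoc K.M.r_neg)
      qed
      then show "G (G' \<psi>) = \<psi>" using \<psi> by (intro extensionalityI[of _ "carrier M"]) (auto simp: G_def)
    qed
    show "G ` Hom_set M K \<subseteq> ?H2"
    proof (rule image_subsetI)
      fix \<phi> assume "\<phi> \<in> Hom_set M K"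
      then have "(\<lambda>m. \<phi> m \<ominus>\<^bsub>K\<^esub> \<sigma> (xop K (\<phi> m))) \<in> module_hom (kring :: 'k ring) (restrict_to_k M) V"
        using module_hom_comp[OF Lam_hom_k comp, of \<phi> M] by (auto simp: Hom_set_def)
      then show "G \<phi> \<in> ?H2" using module_hom_cong[OF _ _ VM.module_axioms] by (fastforce simp: G_def)
    qed
    show "G' ` ?H2 \<subseteq> Hom_set M K"
      using module_hom_cong[OF G'h _ mod(2)] by (fastforce simp: G'_def Hom_set_def)
  qed
  then show "card (Hom_set M K) = card ?H2" by (rule bij_betw_same_card)
qed

text \<open>Needed for the centrality of \<open>[K]\<close>: its products with \<open>[M]\<close> in
  the two orders involve the same middle term but are divided by different Hom sets.\<close>

lemma card_Hom_set_acyclic_commute: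
  fixes K :: "('k::{field,finite} poly set, 'a) module" and M :: "('k poly set, 'b) module"
  assumes K: "fd_mod K" "acyclic_mod K" and M: "fd_mod M"
  shows "card (Hom_set K M) = card (Hom_set M K)"
proof -
  have mod: "module Lam K" "module Lam M" using K M by (auto simp: fd_mod_iff)
  interpret VK: vectorspace "kring :: 'k ring" "restrict_to_k K" by (rule vectorspace_restrict[OF mod(1)])
  have V: "vectorspace (kring :: 'k ring) ((restrict_to_k K)\<lparr>carrier := xim K\<rparr>)"
    using VK.subspace_is_vs[of "xim K"] xim_submodule[OF K(1)] VK.vectorspace_axioms by (auto simp: subspace_def)
  show ?thesis
    unfolding card_Hom_set_acyclic[OF K M]
    using card_hom_commute[OF V _ vectorspace_restrict[OF mod(2)]] finite_carrier[OF K(1)] finite_carrier[OF M] by simp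
qed

text \<open>Here \<open>im x\<close> is a line, so the common exponent in \<open>card_hom\<close> is
  1.\<close>

lemma card_Hom_set_acyclic_rank_one:
  fixes K :: "('k::{field,finite} poly set, 'a) module" and M :: "('k poly set, 'b) module"
  assumes K: "fd_mod K" "acyclic_mod K" and M: "fd_mod M" and r: "card (xim K) = card (UNIV :: 'k set)"
  shows "card (Hom_set K M) = card (carrier M)"
proof -
  have mod: "module Lam K" "module Lam M" using K M by (auto simp: fd_mod_iff)
  interpret VK: vectorspace "kring :: 'k ring" "restrict_to_k K" by (rule vectorspace_restrict[OF mod(1)])
  interpret V: vectorspace "kring :: 'k ring" "(restrict_to_k K)\<lparr>carrier := xim K\<rparr>"
    using VK.subspace_is_vs[of "xim K"] xim_submodule[OF K(1)] VK.vectorspace_axioms by (auto simp: subspace_def)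
  obtain n where n: "card (xim K) = card (UNIV :: 'k set) ^ n" "card (Hom_set K M) = card (carrier M) ^ n"
    using V.card_hom[OF _ _ _ vectorspace_restrict[OF mod(2)]] finite_carrier[OF K(1)] finite_carrier[OF M] 
    unfolding card_Hom_set_acyclic(1)[OF K M] by auto
  have "card (UNIV :: 'k set) > 1"
    using card_mono[of "UNIV :: 'k set" "{0, 1}"] by auto
  then have "n = 1" using n(1) r power_inject_exp[of "card (UNIV :: 'k set)" n 1] by simp
  then show ?thesis using n by simp
qed

subsection \<open>Counting extension classes\<close>

text \<open>The class of an element of \<open>A\<close> is a full fibre of \<open>d\<close> in
  \<open>Y\<close>, and distinct values have distinct fibres. The ambient \<open>Y\<close> appears
  because a class is formed in the whole relation and not inside \<open>A\<close>.\<close>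

lemma card_quotient_invariant:
  assumes "A \<subseteq> Y" and "\<And>E E'. E \<in> A \<Longrightarrow> (E, E') \<in> r \<longleftrightarrow> E' \<in> Y \<and> d E = d E'"
  shows "card (A // r) = card (d ` A)"
proof -
  define C where "C \<delta> = {E' \<in> Y. d E' = \<delta>}" for \<delta>
  have "A // r = (\<lambda>E. r `` {E}) ` A" by (auto simp: quotient_def)
  also have "\<dots> = (\<lambda>E. C (d E)) ` A" using assms(2) by (intro image_cong) (auto simp: C_def)
  finally have "A // r = C ` d ` A" by (simp add: image_image)
  moreover have "inj_on C (d ` A)"
  proof (rule inj_onI)
    fix x y assume "x \<in> d ` A" "y \<in> d ` A" "C x = C y"
    moreover from this obtain E where "E \<in> A" "x = d E" by auto
    ultimately have "E \<in> C y" using assms(1) by (auto simp: C_def)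
    then show "x = y" using \<open>x = d E\<close> by (simp add: C_def)
  qed
  ultimately show ?thesis by (simp add: card_image)
qed

lemma mem_extensions: "(L, f, g) \<in> extensions M N \<longleftrightarrow> fd_mod L \<and> short_exact N L M f g"
  by (simp add: extensions_def)

lemma mem_ext_equiv: "((L, f, g), (L', f', g')) \<in> ext_equiv M N \<longleftrightarrow>
     (L, f, g) \<in> extensions M N \<and> (L', f', g') \<in> extensions M N \<and>
     (\<exists>\<phi> \<in> module_hom Lam L L'. bij_betw \<phi> (carrier L) (carrier L') \<and>
        (\<forall>x \<in> carrier N. \<phi> (f x) = f' x) \<and> (\<forall>y \<in> carrier L. g' (\<phi> y) = g y))"
  by (simp add: ext_equiv_def)

lemma short_exact_direct_sum:
  assumes "module Lam N" "module Lam M"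
  shows "short_exact N (direct_sum N M) M (\<lambda>n. (n, \<zero>\<^bsub>M\<^esub>)) snd"
proof -
  interpret N: module Lam N by fact
  interpret M: module Lam M by fact
  show ?thesis
    unfolding short_exact_def
    by (auto intro!: module_homI inj_onI image_eqI[of _ _ "(\<zero>\<^bsub>N\<^esub>, x)" for x])
qed

text \<open>A middle term on pairs is coded into \<open>nat\<close>, to fit the type of
  \<open>extensions\<close>.\<close>

lemma extensions_transport:
  fixes M N :: "('k::{field,finite} poly set, nat) module" and L :: "('k poly set, nat \<times> nat) module"
  assumes L: "fd_mod L" and ex: "short_exact N L M f g"
  shows "(transport prod_encode L, \<lambda>n. prod_encode (f n), \<lambda>y. g (the_inv_into (carrier L) prod_encode y)) \<in> extensions M N"
    and "mod_iso L (transport prod_encode L)"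
proof -
  have inj: "inj_on prod_encode (carrier L)" using inj_prod_encode inj_on_subset by blast
  have mod: "module Lam L" using L by (simp add: fd_mod_iff)
  show "(transport prod_encode L, \<lambda>n. prod_encode (f n), \<lambda>y. g (the_inv_into (carrier L) prod_encode y)) \<in> extensions M N"
    using fd_mod_transport[OF L inj] short_exact_transport[OF mod inj ex] by (simp add: mem_extensions)
  show "mod_iso L (transport prod_encode L)" by (rule mod_iso_transport[OF mod inj])
qed

lemma mod_iso_right:
  assumes "module Lam M" "module Lam N" "mod_iso M N"
  shows "mod_iso M L \<longleftrightarrow> mod_iso N L"
  using mod_iso_trans[OF mod_iso_sym[OF assms], of L] mod_iso_trans[OF assms(3), of L] by (rule iffI)

text \<open>Every extension is equivalent to the split one: both middle terms are identified with
  the direct sum compatibly with the outer maps. So there is a single class, and its middle term is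
  the direct sum.\<close>

lemma card_Ext1_mid_split:
  fixes M N L :: "('k::{field,finite} poly set, nat) module"
  assumes fd: "fd_mod M" "fd_mod N" and ac: "acyclic_mod M \<or> acyclic_mod N"
  shows "card (Ext1_mid M N L) = (if mod_iso (direct_sum N M) L then 1 else 0)"
proof -
  let ?A = "{E \<in> extensions M N. mod_iso (fst E) L}"
  have modD: "module Lam (direct_sum N M)" using fd by (simp add: fd_mod_iff direct_sum_is_module)
  have split: "\<exists>\<phi>\<in>module_hom Lam (direct_sum N M) L1. bij_betw \<phi> (carrier (direct_sum N M)) (carrier L1) \<and>
      (\<forall>n\<in>carrier N. \<phi> (n, \<zero>\<^bsub>M\<^esub>) = f n) \<and> (\<forall>n\<in>carrier N. \<forall>m\<in>carrier M. g (\<phi> (n, m)) = m)"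
    if "(L1, f, g) \<in> extensions M N" for L1 f g
  proof -
    have L1: "fd_mod L1" "short_exact N L1 M f g" using that by (auto simp: mem_extensions)
    obtain \<phi> where "\<phi> \<in> module_hom Lam (direct_sum N M) L1" 
      "bij_betw \<phi> (carrier (direct_sum N M)) (carrier L1)"
      "\<And>n. n \<in> carrier N \<Longrightarrow> \<phi> (n, \<zero>\<^bsub>M\<^esub>) = f n"
      "\<And>n m. n \<in> carrier N \<Longrightarrow> m \<in> carrier M \<Longrightarrow> g (\<phi> (n, m)) = m"
      by (rule short_exact_split[OF fd(2) L1(1) fd(1) L1(2)]) (use ac in blast)+
    then show ?thesis by blast
  qed
  have equiv: "(E, E') \<in> ext_equiv M N" if E: "E \<in> extensions M N" "E' \<in> extensions M N" for E E'
  proof -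
    obtain L1 f1 g1 where 1: "E = (L1, f1, g1)" by (cases E)
    obtain L2 f2 g2 where 2: "E' = (L2, f2, g2)" by (cases E')
    have mod: "module Lam L1" "module Lam L2" using E by (auto simp: 1 2 mem_extensions fd_mod_iff)
    interpret M: module Lam M using fd by (simp add: fd_mod_iff)
    obtain \<phi>1 where \<phi>1: "\<phi>1 \<in> module_hom Lam (direct_sum N M) L1" "bij_betw \<phi>1 (carrier (direct_sum N M)) (carrier L1)"
      "\<And>n. n \<in> carrier N \<Longrightarrow> \<phi>1 (n, \<zero>\<^bsub>M\<^esub>) = f1 n" 
      "\<And>n m. n \<in> carrier N \<Longrightarrow> m \<in> carrier M \<Longrightarrow> g1 (\<phi>1 (n, m)) = m" 
      using split E(1) unfolding 1 by blast
    obtain \<phi>2 where \<phi>2: "\<phi>2 \<in> module_hom Lam (direct_sum N M) L2" "bij_betw \<phi>2 (carrier (direct_sum N M)) (carrier L2)"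
      "\<And>n. n \<in> carrier N \<Longrightarrow> \<phi>2 (n, \<zero>\<^bsub>M\<^esub>) = f2 n" 
      "\<And>n m. n \<in> carrier N \<Longrightarrow> m \<in> carrier M \<Longrightarrow> g2 (\<phi>2 (n, m)) = m" 
      using split E(2) unfolding 2 by blast
    let ?i = "the_inv_into (carrier (direct_sum N M)) \<phi>1"
    have i: "?i (\<phi>1 p) = p" if "p \<in> carrier (direct_sum N M)" for p 
      using \<phi>1(2) that by (simp add: bij_betw_def the_inv_into_f_f)
    have "(\<lambda>y. \<phi>2 (?i y)) \<in> module_hom Lam L1 L2"
      by (rule module_hom_comp[OF bij_hom_inverse[OF modD mod(1) \<phi>1(1,2)] \<phi>2(1)])
    moreover have "bij_betw (\<lambda>y. \<phi>2 (?i y)) (carrier L1) (carrier L2)"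
      using bij_betw_trans[OF bij_betw_the_inv_into[OF \<phi>1(2)] \<phi>2(2)] by (simp add: comp_def)
    moreover have "\<phi>2 (?i (f1 n)) = f2 n" if "n \<in> carrier N" for n
    proof -
      have "?i (f1 n) = (n, \<zero>\<^bsub>M\<^esub>)" using i[of "(n, \<zero>\<^bsub>M\<^esub>)"] that by (simp add: \<phi>1(3))
      then show ?thesis using that by (simp add: \<phi>2(3))
    qed
    moreover have "g2 (\<phi>2 (?i y)) = g1 y" if "y \<in> carrier L1" for y
    proof -
      have "y \<in> \<phi>1 ` (carrier N \<times> carrier M)" using that \<phi>1(2) by (simp add: bij_betw_def)
      then obtain n m where "y = \<phi>1 (n, m)" "n \<in> carrier N" "m \<in> carrier M" by blast
      then show ?thesis using i[of "(n, m)"] by (simp add: \<phi>1(4) \<phi>2(4))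
    qed
    ultimately show ?thesis using E unfolding 1 2 mem_ext_equiv by blast
  qed
  have dom: "E \<in> extensions M N \<and> E' \<in> extensions M N" if "(E, E') \<in> ext_equiv M N" for E E'
    using that by (cases E, cases E') (simp add: mem_ext_equiv)
  have card: "card (Ext1_mid M N L) = card ((\<lambda>_. 0::nat) ` ?A)"
    unfolding Ext1_mid_def
  proof (rule card_quotient_invariant[of _ "extensions M N"])
    show "(E, E') \<in> ext_equiv M N \<longleftrightarrow> E' \<in> extensions M N \<and> (0::nat) = 0" if "E \<in> ?A" for E E'
      using equiv[of E E'] dom[of E E'] that by blast
  qed blast
  have iso: "mod_iso (fst E) L \<longleftrightarrow> mod_iso (direct_sum N M) L" if "E \<in> extensions M N" for E
  proof -
    obtain L1 f1 g1 where 1: "E = (L1, f1, g1)" by (cases E)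
    have "mod_iso (direct_sum N M) L1" using split[of L1 f1 g1] that unfolding 1 mod_iso_def by blast
    moreover have "module Lam L1" using that by (simp add: 1 mem_extensions fd_mod_iff)
    ultimately have "mod_iso (direct_sum N M) L \<longleftrightarrow> mod_iso L1 L" by (intro mod_iso_right[OF modD])
    then show ?thesis by (simp add: 1)
  qed
  have ne: "extensions M N \<noteq> {}"
    using extensions_transport(1)[OF fd_mod_direct_sum[OF fd(2,1)] short_exact_direct_sum] fd by (auto simp: fd_mod_iff)
  show ?thesis
  proof (cases "mod_iso (direct_sum N M) L")
    case True
    then have "?A = extensions M N" using iso by blast
    then show ?thesis using True ne by (simp add: card image_constant_conv)
  next
    case False
    then have "?A = {}" using iso by blast
    then show ?thesis using False by (simp only: card image_empty card.empty if_False)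
  qed
qed

text \<open>
  If \<open>x\<close> kills \<open>M\<close> and \<open>N\<close>, an extension \<open>L\<close> is classified by the map \<open>\<delta>\<close> from \<open>M\<close> to \<open>N\<close>
  through which multiplication by \<open>x\<close> on \<open>L\<close> factors.
\<close>

context
  fixes M N :: "('k::{field,finite} poly set, nat) module"
  assumes fd: "fd_mod M" "fd_mod N" and M0: "xim M = {\<zero>\<^bsub>M\<^esub>}" and N0: "xim N = {\<zero>\<^bsub>N\<^esub>}"
begin

definition ext_maps :: "(nat \<Rightarrow> nat) set" where
  "ext_maps = module_hom (kring :: 'k ring) (restrict_to_k M) (restrict_to_k N) \<inter> extensional (carrier M)"

definition ext_map_of :: "('k poly set, nat) module \<times> (nat \<Rightarrow> nat) \<times> (nat \<Rightarrow> nat) \<Rightarrow> (nat \<Rightarrow> nat) \<Rightarrow> bool" where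
  "ext_map_of E \<delta> = (case E of (L, f, g) \<Rightarrow> \<delta> \<in> ext_maps \<and> (\<forall>l\<in>carrier L. f (\<delta> (g l)) = xop L l))"

lemma xop_trivial: "m \<in> carrier M \<Longrightarrow> xop M m = \<zero>\<^bsub>M\<^esub>" "n \<in> carrier N \<Longrightarrow> xop N n = \<zero>\<^bsub>N\<^esub>"
  using M0 N0 by (auto simp: xim_def)

lemma ext_mapsD: "\<delta> \<in> ext_maps \<Longrightarrow> m \<in> carrier M \<Longrightarrow> \<delta> m \<in> carrier N"
  unfolding ext_maps_def using module_hom_in[of \<delta> kring "restrict_to_k M" "restrict_to_k N" m] by auto

lemma ext_map_unique:
  assumes E: "(L, f, g) \<in> extensions M N" and "ext_map_of (L, f, g) \<delta>" "ext_map_of (L, f, g) \<delta>'"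
  shows "\<delta> = \<delta>'"
proof -
  have L: "fd_mod L" "short_exact N L M f g" using E by (auto simp: mem_extensions)
  note D = short_exactD[OF fd(2) L(1) fd(1) L(2)]
  have \<delta>: "\<delta> \<in> ext_maps" "\<delta>' \<in> ext_maps" and eq: "f (\<delta> (g l)) = f (\<delta>' (g l))" if "l \<in> carrier L" for l
    using assms that by (auto simp: ext_map_of_def)
  have d: "\<delta> \<in> ext_maps" "\<delta>' \<in> ext_maps" using assms by (auto simp: ext_map_of_def)
  have "\<delta> m = \<delta>' m" if m: "m \<in> carrier M" for m
  proof -
    obtain l where "l \<in> carrier L" "g l = m" using m D(4) by (metis imageE)
    then show ?thesis using eq[of l] D(3) d ext_mapsD m by (auto dest: inj_onD)
  qed
  then show ?thesis using d by (intro extensionalityI[of _ "carrier M"]) (auto simp: ext_maps_def)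
qed

text \<open>\<open>x\<close> maps \<open>L\<close> into the image of \<open>f\<close>, since
  \<open>g x = x g = 0\<close>, and kills that image, since \<open>x f = f x = 0\<close>. Hence
  \<open>x l\<close> depends on \<open>g l\<close> only and can be computed on a k-linear
  section.\<close>

lemma ext_map_ex:
  assumes E: "(L, f, g) \<in> extensions M N"
  shows "\<exists>\<delta>. ext_map_of (L, f, g) \<delta>"
proof -
  have L: "fd_mod L" "short_exact N L M f g" using E by (auto simp: mem_extensions)
  note D = short_exactD[OF fd(2) L(1) fd(1) L(2)]
  note mod = fd_moduleD[OF fd(2) L(1) fd(1) L(2)]
  interpret L: module Lam L by (rule mod)
  interpret VN: vectorspace "kring :: 'k ring" "restrict_to_k N" by (rule vectorspace_restrict[OF mod(1)])
  interpret VL: vectorspace "kring :: 'k ring" "restrict_to_k L" by (rule vectorspace_restrict[OF mod(2)])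
  interpret VM: vectorspace "kring :: 'k ring" "restrict_to_k M" by (rule vectorspace_restrict[OF mod(3)])
  obtain \<sigma> where \<sigma>: "\<sigma> \<in> module_hom (kring :: 'k ring) (restrict_to_k M) (restrict_to_k L)"
    "\<And>m. m \<in> carrier M \<Longrightarrow> g (\<sigma> m) = m" using short_exact_k_section[OF fd(2) L(1) fd(1) L(2)] by blast
  have \<sigma>c: "\<sigma> m \<in> carrier L" if "m \<in> carrier M" for m using module_hom_in[OF \<sigma>(1)] that by simp
  have gx: "g (xop L l) = \<zero>\<^bsub>M\<^esub>" if "l \<in> carrier L" for l
    using that module_hom_in[OF D(2)] by (simp add: Lam_hom_xop[OF D(2)] xop_trivial)
  have xf: "xop L l \<in> f ` carrier N" if "l \<in> carrier L" for l
    using that gx xop_closed[OF mod(2)] by (simp add: D(5))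
  define \<delta> where "\<delta> m = the_inv_into (carrier N) f (xop L (\<sigma> m))" for m
  have \<delta>: "\<delta> \<in> module_hom kring (restrict_to_k M) (restrict_to_k N)"
    unfolding \<delta>_def[abs_def]
    using module_hom_the_inv[OF VN.module_axioms VL.module_axioms Lam_hom_k[OF D(1)] _ VM.module_axioms 
        module_hom_comp[OF \<sigma>(1) xop_hom[OF mod(2)]]] D(3) xf \<sigma>c by auto
  have f\<delta>: "f (\<delta> m) = xop L (\<sigma> m)" if "m \<in> carrier M" for m
    unfolding \<delta>_def using f_the_inv_into_f[OF D(3) xf[OF \<sigma>c[OF that]]] .
  have "f (restrict \<delta> (carrier M) (g l)) = xop L l" if l: "l \<in> carrier L" for l
  proof -
    have gl: "g l \<in> carrier M" using module_hom_in[OF D(2) l] .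
    have "g (l \<ominus>\<^bsub>L\<^esub> \<sigma> (g l)) = g l \<ominus>\<^bsub>M\<^esub> g (\<sigma> (g l))"
      by (rule module_hom_minus[OF mod(2,3) D(2) l \<sigma>c[OF gl]])
    then have "g (l \<ominus>\<^bsub>L\<^esub> \<sigma> (g l)) = \<zero>\<^bsub>M\<^esub>"
      using gl \<sigma>(2) VM.M.r_neg[of "g l"] by (simp add: a_minus_def restrict_to_k_minus)
    then have "l \<ominus>\<^bsub>L\<^esub> \<sigma> (g l) \<in> f ` carrier N" using l \<sigma>c[OF gl] by (simp add: D(5))
    then obtain n where n: "n \<in> carrier N" "l \<ominus>\<^bsub>L\<^esub> \<sigma> (g l) = f n" by auto
    have "xop L (l \<ominus>\<^bsub>L\<^esub> \<sigma> (g l)) = f (xop N n)" unfolding n(2) by (rule Lam_hom_xop[OF D(1) n(1), symmetric])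
    then have "xop L (l \<ominus>\<^bsub>L\<^esub> \<sigma> (g l)) = \<zero>\<^bsub>L\<^esub>"
      using n(1) by (simp add: xop_trivial module_hom_zero[OF mod(1,2) D(1)])
    then have "xop L l = xop L (\<sigma> (g l))"
      using l \<sigma>c[OF gl] xop_closed[OF mod(2)] by (simp add: xop_linear[OF L(1)])
    then show ?thesis using gl f\<delta> by simp
  qed
  moreover have "restrict \<delta> (carrier M) \<in> ext_maps"
    unfolding ext_maps_def using module_hom_cong[OF \<delta> _ VM.module_axioms] by fastforce
  ultimately show ?thesis unfolding ext_map_of_def by blast
qed

text \<open>The realizing extension is the space \<open>N \<oplus> M\<close> with
  \<open>x (n, m) = (\<delta> m, 0)\<close>, recoded into \<open>nat\<close>.\<close>

lemma ext_map_realize: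
  assumes \<delta>: "\<delta> \<in> ext_maps"
  shows "\<exists>E\<in>extensions M N. ext_map_of E \<delta>"
proof -
  have mod: "module Lam M" "module Lam N" using fd by (auto simp: fd_mod_iff)
  have \<delta>k: "\<delta> \<in> module_hom kring (restrict_to_k M) (restrict_to_k N)" using \<delta> by (simp add: ext_maps_def)
  note \<delta>c = ext_mapsD[OF \<delta>]
  interpret VN: vectorspace "kring :: 'k ring" "restrict_to_k N" by (rule vectorspace_restrict[OF mod(2)])
  interpret VM: vectorspace "kring :: 'k ring" "restrict_to_k M" by (rule vectorspace_restrict[OF mod(1)])
  interpret N: module Lam N by (rule mod)
  interpret M: module Lam M by (rule mod)
  have \<delta>0: "\<delta> \<zero>\<^bsub>M\<^esub> = \<zero>\<^bsub>N\<^esub>" using module_hom_zero[OF VM.module_axioms VN.module_axioms \<delta>k] by simp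
  define D where "D = direct_sum (restrict_to_k N) (restrict_to_k M)"
  define \<xi> where "\<xi> p = (if snd p \<in> carrier M then \<delta> (snd p) else \<zero>\<^bsub>N\<^esub>, \<zero>\<^bsub>M\<^esub>)" for p :: "nat \<times> nat"
  have D: "vectorspace (kring :: 'k ring) D"
    unfolding D_def by (rule direct_sum_is_vs[OF VN.vectorspace_axioms VM.vectorspace_axioms])
  have \<xi>: "\<xi> \<in> module_hom kring D D"
    using \<delta>c module_hom_add[OF \<delta>k] module_hom_smult[OF \<delta>k]
    unfolding D_def \<xi>_def by (intro module_homI) (auto)
  have \<xi>\<xi>: "\<xi> (\<xi> m) = \<zero>\<^bsub>D\<^esub>" for m by (simp add: D_def \<xi>_def \<delta>0)
  note A = lam_mod[OF D \<xi> \<xi>\<xi>]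
  let ?L = "lam_mod D \<xi>"
  have fdL: "fd_mod ?L" using A(1) fd by (simp add: fd_mod_iff D_def)
  have ops: "xop ?L p = (\<delta> (snd p), \<zero>\<^bsub>M\<^esub>)" "lam [:c:] \<odot>\<^bsub>?L\<^esub> p = (lam [:c:] \<odot>\<^bsub>N\<^esub> fst p, lam [:c:] \<odot>\<^bsub>M\<^esub> snd p)"
    if "fst p \<in> carrier N" "snd p \<in> carrier M" for c p
  proof -
    have p: "p \<in> carrier D" using that by (simp add: D_def mem_Times_iff)
    show "xop ?L p = (\<delta> (snd p), \<zero>\<^bsub>M\<^esub>)" unfolding A(2)[OF p] using that by (simp add: \<xi>_def)
    show "lam [:c:] \<odot>\<^bsub>?L\<^esub> p = (lam [:c:] \<odot>\<^bsub>N\<^esub> fst p, lam [:c:] \<odot>\<^bsub>M\<^esub> snd p)" unfolding A(3)[OF p] by (simp add: D_def)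
  qed
  have Dm: "p \<in> carrier D \<longleftrightarrow> fst p \<in> carrier N \<and> snd p \<in> carrier M" for p by (simp add: D_def mem_Times_iff)
  have ex: "short_exact N ?L M (\<lambda>n. (n, \<zero>\<^bsub>M\<^esub>)) snd"
    unfolding short_exact_def
  proof (intro conjI)
    show "(\<lambda>n. (n, \<zero>\<^bsub>M\<^esub>)) \<in> module_hom Lam N ?L"
    proof (rule Lam_homI[OF mod(2) A(1)])
      show "(\<lambda>n. (n, \<zero>\<^bsub>M\<^esub>)) \<in> module_hom kring (restrict_to_k N) (restrict_to_k ?L)"
        by (rule module_homI) (simp_all add: ops, simp_all add: D_def)
    qed (simp add: ops xop_trivial \<delta>0)
    show "snd \<in> module_hom Lam ?L M"
    proof (rule Lam_homI[OF A(1) mod(1)])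
      show "snd \<in> module_hom kring (restrict_to_k ?L) (restrict_to_k M)"
        by (rule module_homI) (simp_all add: Dm ops, simp_all add: D_def)
    qed (simp add: Dm ops xop_trivial)
  qed (auto simp: D_def intro!: inj_onI image_eqI[of _ _ "(\<zero>\<^bsub>N\<^esub>, x)" for x])
  let ?E = "(transport prod_encode ?L, \<lambda>n. prod_encode (n, \<zero>\<^bsub>M\<^esub>), \<lambda>y. snd (the_inv_into (carrier ?L) prod_encode y))"
  have "?E \<in> extensions M N" using extensions_transport(1)[OF fdL ex] by simp
  moreover have "ext_map_of ?E \<delta>"
  proof -
    have inj: "inj_on prod_encode (carrier ?L)" using inj_prod_encode inj_on_subset by blast
    have "prod_encode (\<delta> (snd (the_inv_into (carrier ?L) prod_encode y)), \<zero>\<^bsub>M\<^esub>) = xop (transport prod_encode ?L) y"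
      if "y \<in> carrier (transport prod_encode ?L)" for y
    proof -
      have "y \<in> prod_encode ` carrier ?L" using that by simp
      then obtain p where p: "p \<in> carrier ?L" "y = prod_encode p" by blast
      have "fst p \<in> carrier N" "snd p \<in> carrier M" using p(1) by (simp_all add: Dm)
      then show ?thesis
        unfolding p(2) transport_ops(3)[OF inj p(1)] the_inv_into_f_f[OF inj p(1)] by (simp add: ops)
    qed
    then show ?thesis using \<delta> by (simp add: ext_map_of_def)
  qed
  ultimately show ?thesis by blast
qed

text \<open>An equivalence transports \<open>x\<close>, hence \<delta>. Conversely, k-linear
  splittings of both extensions combine to a linear isomorphism compatible with the outer maps, and
  this commutes with \<open>x\<close> because \<open>x\<close> is \<open>f \<delta> g\<close> on
  either side.\<close>

lemma ext_equiv_iff_ext_map: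
  assumes E: "E \<in> extensions M N" "ext_map_of E \<delta>" and E': "E' \<in> extensions M N" "ext_map_of E' \<delta>'"
  shows "(E, E') \<in> ext_equiv M N \<longleftrightarrow> \<delta> = \<delta>'"
proof -
  obtain L f g where 1: "E = (L, f, g)" by (cases E)
  obtain L' f' g' where 2: "E' = (L', f', g')" by (cases E')
  have L: "fd_mod L" "short_exact N L M f g" and L': "fd_mod L'" "short_exact N L' M f' g'" 
    using E E' by (auto simp: 1 2 mem_extensions)
  note D = short_exactD[OF fd(2) L(1) fd(1) L(2)] and D' = short_exactD[OF fd(2) L'(1) fd(1) L'(2)]
  note mod = fd_moduleD[OF fd(2) L(1) fd(1) L(2)] and mod' = fd_moduleD[OF fd(2) L'(1) fd(1) L'(2)]
  have \<delta>: "\<delta> \<in> ext_maps" "\<And>l. l \<in> carrier L \<Longrightarrow> f (\<delta> (g l)) = xop L l" 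
    and \<delta>': "\<delta>' \<in> ext_maps" "\<And>l. l \<in> carrier L' \<Longrightarrow> f' (\<delta>' (g' l)) = xop L' l"
    using E(2) E'(2) by (auto simp: 1 2 ext_map_of_def)
  show ?thesis
  proof
    assume "(E, E') \<in> ext_equiv M N"
    then obtain \<phi> where \<phi>: "\<phi> \<in> module_hom Lam L L'" "\<forall>x \<in> carrier N. \<phi> (f x) = f' x" "\<forall>y \<in> carrier L. g' (\<phi> y) = g y"
      unfolding 1 2 mem_ext_equiv by blast
    have "f' (\<delta> (g' (\<phi> l))) = xop L' (\<phi> l)" if l: "l \<in> carrier L" for l
    proof -
      have "\<delta> (g l) \<in> carrier N" using ext_mapsD[OF \<delta>(1) module_hom_in[OF D(2) l]] .
      then have "f' (\<delta> (g l)) = \<phi> (xop L l)" using \<phi>(2) \<delta>(2)[OF l] by metis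
      then show ?thesis using \<phi>(3) l by (simp add: Lam_hom_xop[OF \<phi>(1) l])
    qed
    then have "f' (\<delta> (g l)) = f' (\<delta>' (g l))" if "l \<in> carrier L" for l
      using that \<delta>'(2) \<phi>(3) module_hom_in[OF \<phi>(1)] by metis
    then have "\<delta> m = \<delta>' m" if "m \<in> carrier M" for m
      using that D(4) inj_onD[OF D'(3)] ext_mapsD[OF \<delta>(1)] ext_mapsD[OF \<delta>'(1)] by (metis imageE)
    then show "\<delta> = \<delta>'" using \<delta>(1) \<delta>'(1) by (intro extensionalityI[of _ "carrier M"]) (auto simp: ext_maps_def)
  next
    assume eq: "\<delta> = \<delta>'"
    obtain \<sigma> where \<sigma>: "\<sigma> \<in> module_hom (kring :: 'k ring) (restrict_to_k M) (restrict_to_k L)"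
      "\<And>m. m \<in> carrier M \<Longrightarrow> g (\<sigma> m) = m" using short_exact_k_section[OF fd(2) L(1) fd(1) L(2)] by blast
    obtain \<sigma>' where \<sigma>': "\<sigma>' \<in> module_hom (kring :: 'k ring) (restrict_to_k M) (restrict_to_k L')"
      "\<And>m. m \<in> carrier M \<Longrightarrow> g' (\<sigma>' m) = m" using short_exact_k_section[OF fd(2) L'(1) fd(1) L'(2)] by blast
    let ?D = "direct_sum (restrict_to_k N) (restrict_to_k M)"
    note V = mod[THEN vectorspace_restrict, unfolded vectorspace_def, THEN conjunct1]
    note V' = mod'[THEN vectorspace_restrict, unfolded vectorspace_def, THEN conjunct1]
    have si: "(\<lambda>p. f (fst p) \<oplus>\<^bsub>restrict_to_k L\<^esub> \<sigma> (snd p)) \<in> module_hom kring ?D (restrict_to_k L)"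
      "bij_betw (\<lambda>p. f (fst p) \<oplus>\<^bsub>restrict_to_k L\<^esub> \<sigma> (snd p)) (carrier ?D) (carrier (restrict_to_k L))"
      "\<And>n. n \<in> carrier (restrict_to_k N) \<Longrightarrow> f n \<oplus>\<^bsub>restrict_to_k L\<^esub> \<sigma> \<zero>\<^bsub>restrict_to_k M\<^esub> = f n"
      "\<And>n m. n \<in> carrier (restrict_to_k N) \<Longrightarrow> m \<in> carrier (restrict_to_k M) \<Longrightarrow> g (f n \<oplus>\<^bsub>restrict_to_k L\<^esub> \<sigma> m) = m"
      by (rule split_iso[OF V Lam_hom_k[OF D(1)] _ Lam_hom_k[OF D(2)] _ \<sigma>(1)]; use D \<sigma> in simp)+
    have si': "(\<lambda>p. f' (fst p) \<oplus>\<^bsub>restrict_to_k L'\<^esub> \<sigma>' (snd p)) \<in> module_hom kring ?D (restrict_to_k L')"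
      "bij_betw (\<lambda>p. f' (fst p) \<oplus>\<^bsub>restrict_to_k L'\<^esub> \<sigma>' (snd p)) (carrier ?D) (carrier (restrict_to_k L'))"
      "\<And>n. n \<in> carrier (restrict_to_k N) \<Longrightarrow> f' n \<oplus>\<^bsub>restrict_to_k L'\<^esub> \<sigma>' \<zero>\<^bsub>restrict_to_k M\<^esub> = f' n"
      "\<And>n m. n \<in> carrier (restrict_to_k N) \<Longrightarrow> m \<in> carrier (restrict_to_k M) \<Longrightarrow> g' (f' n \<oplus>\<^bsub>restrict_to_k L'\<^esub> \<sigma>' m) = m"
      by (rule split_iso[OF V' Lam_hom_k[OF D'(1)] _ Lam_hom_k[OF D'(2)] _ \<sigma>'(1)]; use D' \<sigma>' in simp)+
    define \<theta> where "\<theta> p = f (fst p) \<oplus>\<^bsub>restrict_to_k L\<^esub> \<sigma> (snd p)" for p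
    define \<theta>' where "\<theta>' p = f' (fst p) \<oplus>\<^bsub>restrict_to_k L'\<^esub> \<sigma>' (snd p)" for p
    have \<theta>: "\<theta> \<in> module_hom kring ?D (restrict_to_k L)" "bij_betw \<theta> (carrier ?D) (carrier L)"
      "\<And>n. n \<in> carrier N \<Longrightarrow> \<theta> (n, \<zero>\<^bsub>M\<^esub>) = f n" "\<And>n m. n \<in> carrier N \<Longrightarrow> m \<in> carrier M \<Longrightarrow> g (\<theta> (n, m)) = m"
      unfolding \<theta>_def[abs_def] using si by simp_all
    have \<theta>': "\<theta>' \<in> module_hom kring ?D (restrict_to_k L')" "bij_betw \<theta>' (carrier ?D) (carrier L')"
      "\<And>n. n \<in> carrier N \<Longrightarrow> \<theta>' (n, \<zero>\<^bsub>M\<^esub>) = f' n" "\<And>n m. n \<in> carrier N \<Longrightarrow> m \<in> carrier M \<Longrightarrow> g' (\<theta>' (n, m)) = m"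
      unfolding \<theta>'_def[abs_def] using si' by simp_all
    let ?i = "the_inv_into (carrier ?D) \<theta>"
    have i: "?i (\<theta> p) = p" if "p \<in> carrier ?D" for p 
      using \<theta>(2) that by (simp add: bij_betw_def the_inv_into_f_f)
    interpret M: module Lam M by (rule mod(3))
    have i_f: "?i (f n) = (n, \<zero>\<^bsub>M\<^esub>)" if "n \<in> carrier N" for n
      using i[of "(n, \<zero>\<^bsub>M\<^esub>)"] that by (simp add: \<theta>(3))
    have modD: "module kring ?D" by (rule direct_sum_is_module[OF V(1,3)])
    define \<phi> where "\<phi> y = \<theta>' (?i y)" for y
    have \<phi>k: "\<phi> \<in> module_hom kring (restrict_to_k L) (restrict_to_k L')"
      unfolding \<phi>_def[abs_def]
      by (rule module_hom_comp[OF bij_hom_inverse[OF modD V(2) \<theta>(1)] \<theta>'(1)]) (use \<theta>(2) in simp)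
    have \<phi>b: "bij_betw \<phi> (carrier L) (carrier L')"
      using bij_betw_trans[OF bij_betw_the_inv_into[OF \<theta>(2)] \<theta>'(2)] by (simp add: comp_def \<phi>_def[abs_def])
    have \<phi>f: "\<phi> (f n) = f' n" if "n \<in> carrier N" for n using i_f that by (simp add: \<phi>_def \<theta>'(3))
    have \<phi>g: "g' (\<phi> y) = g y" if "y \<in> carrier L" for y
    proof -
      have "y \<in> \<theta> ` (carrier N \<times> carrier M)" using that \<theta>(2) by (simp add: bij_betw_def)
      then obtain n m where "y = \<theta> (n, m)" "n \<in> carrier N" "m \<in> carrier M" by blast
      then show ?thesis using i[of "(n, m)"] by (simp add: \<theta>(4) \<theta>'(4) \<phi>_def)
    qed
    have "\<phi> \<in> module_hom Lam L L'"
    proof (rule Lam_homI[OF mod(2) mod'(2) \<phi>k])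
      fix y assume y: "y \<in> carrier L"
      then have "\<delta> (g y) \<in> carrier N" using ext_mapsD[OF \<delta>(1) module_hom_in[OF D(2)]] by simp
      then have "\<phi> (xop L y) = f' (\<delta> (g y))" using \<phi>f \<delta>(2)[OF y] by metis
      also have "\<dots> = xop L' (\<phi> y)" using \<delta>'(2)[of "\<phi> y"] \<phi>g[OF y] \<phi>b y eq by (auto simp: bij_betw_def)
      finally show "\<phi> (xop L y) = xop L' (\<phi> y)" .
    qed
    then show "(E, E') \<in> ext_equiv M N"
      using E(1) E'(1) \<phi>b \<phi>f \<phi>g unfolding 1 2 mem_ext_equiv by blast
  qed
qed

text \<open>By the classification only two orders of the middle term matter. The order of
  \<open>im x\<close> is that of the image of \<delta>, because \<open>x = f \<delta> g\<close> with
  \<open>f\<close> injective and \<open>g\<close> surjective.\<close>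

lemma card_Ext1_mid_trivial:
  assumes L0: "fd_mod L0"
  shows "card (Ext1_mid M N L0) = card {\<delta> \<in> ext_maps. card (carrier L0) = card (carrier N) * card (carrier M) \<and> 
    card (xim L0) = card (\<delta> ` carrier M)}"
proof -
  let ?A = "{E \<in> extensions M N. mod_iso (fst E) L0}"
  define d where "d E = (THE \<delta>. ext_map_of E \<delta>)" for E
  have d: "ext_map_of E (d E)" if "E \<in> extensions M N" for E
  proof -
    obtain L f g where 1: "E = (L, f, g)" by (cases E)
    show ?thesis
      using ext_map_ex[of L f g] ext_map_unique[of L f g] that unfolding 1 d_def by (metis theI)
  qed
  have deq: "d E = \<delta>" if "E \<in> extensions M N" "ext_map_of E \<delta>" for E \<delta>
    using d[OF that(1)] that ext_map_unique by (cases E) blast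
  have dom: "E' \<in> extensions M N" if "(E, E') \<in> ext_equiv M N" for E E'
    using that by (cases E, cases E') (simp add: mem_ext_equiv)
  have "card (Ext1_mid M N L0) = card (d ` ?A)"
    unfolding Ext1_mid_def
  proof (rule card_quotient_invariant[of _ "extensions M N"])
    fix E E' assume E: "E \<in> ?A"
    show "(E, E') \<in> ext_equiv M N \<longleftrightarrow> E' \<in> extensions M N \<and> d E = d E'"
      using ext_equiv_iff_ext_map[OF _ d _ d, of E E'] dom[of E E'] E by blast
  qed auto
  also have "d ` ?A = {\<delta> \<in> ext_maps. card (carrier L0) = card (carrier N) * card (carrier M) \<and> 
    card (xim L0) = card (\<delta> ` carrier M)}" (is "_ = ?B")
  proof -
    have iso: "mod_iso (fst E) L0 \<longleftrightarrow> d E \<in> ?B" if E: "E \<in> extensions M N" for E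
    proof -
      obtain L f g where 1: "E = (L, f, g)" by (cases E)
      have L: "fd_mod L" "short_exact N L M f g" using E by (auto simp: 1 mem_extensions)
      note D = short_exactD[OF fd(2) L(1) fd(1) L(2)]
      have \<delta>: "d E \<in> ext_maps" "\<And>l. l \<in> carrier L \<Longrightarrow> xop L l = f (d E (g l))"
        using d[OF E] by (auto simp: 1 ext_map_of_def)
      have "xim L = (\<lambda>l. f (d E (g l))) ` carrier L" unfolding xim_def using \<delta>(2) by (rule image_cong[OF refl])
      also have "\<dots> = f ` d E ` carrier M" unfolding D(4)[symmetric] by (simp add: image_image)
      finally have "card (xim L) = card (d E ` carrier M)"
        using D(3) ext_mapsD[OF \<delta>(1)] by (metis card_image image_subsetI inj_on_subset)
      then show ?thesis
        using card_short_exact[OF fd(2) L(1) fd(1) L(2)] \<delta>(1) by (auto simp: 1 mod_iso_iff_card[OF L(1) L0])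
    qed
    show ?thesis
    proof
      show "d ` ?A \<subseteq> ?B" using iso by blast
      show "?B \<subseteq> d ` ?A"
      proof
        fix \<delta> assume \<delta>: "\<delta> \<in> ?B"
        then obtain E where E: "E \<in> extensions M N" "ext_map_of E \<delta>" using ext_map_realize by blast
        have "d E = \<delta>" using deq E by blast
        then show "\<delta> \<in> d ` ?A" using iso[OF E(1)] E(1) \<delta> by blast
      qed
    qed
  qed
  finally show ?thesis .
qed

lemma card_ext_maps:
  assumes q: "card (carrier M) = card (UNIV :: 'k set)"
  shows "card ext_maps = card (carrier N)"
proof -
  have mod: "module Lam M" "module Lam N" using fd by (auto simp: fd_mod_iff)
  interpret VM: vectorspace "kring :: 'k ring" "restrict_to_k M" by (rule vectorspace_restrict[OF mod(1)])
  have q1: "card (UNIV :: 'k set) > 1"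
    using card_mono[of "UNIV :: 'k set" "{0, 1}"] by auto
  obtain n where "card (carrier M) = card (UNIV :: 'k set) ^ n" "card ext_maps = card (carrier N) ^ n"
    using VM.card_hom[OF _ _ _ vectorspace_restrict[OF mod(2)]] finite_carrier[OF fd(1)] finite_carrier[OF fd(2)]
    by (auto simp: ext_maps_def)
  then show ?thesis
    using q q1 power_inject_exp[of "card (UNIV :: 'k set)" n 1] by auto
qed

text \<open>With \<open>x\<close> acting by zero, linearity over \<open>Lam\<close> is linearity
  over k. There are thus as many homomorphisms as extension classes, so the Hall numbers of such a
  pair add up to 1.\<close>

lemma Hom_set_ext_maps: "Hom_set M N = ext_maps"
proof -
  have mod: "module Lam M" "module Lam N" using fd by (auto simp: fd_mod_iff)
  have "f \<zero>\<^bsub>M\<^esub> = \<zero>\<^bsub>N\<^esub>" if "f \<in> module_hom (kring :: 'k ring) (restrict_to_k M) (restrict_to_k N)" for f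
  proof -
    interpret VM: vectorspace "kring :: 'k ring" "restrict_to_k M" by (rule vectorspace_restrict[OF mod(1)])
    interpret VN: vectorspace "kring :: 'k ring" "restrict_to_k N" by (rule vectorspace_restrict[OF mod(2)])
    show ?thesis using module_hom_zero[OF VM.module_axioms VN.module_axioms that] by simp
  qed
  moreover have "f m \<in> carrier N" 
    if "f \<in> module_hom (kring :: 'k ring) (restrict_to_k M) (restrict_to_k N)" "m \<in> carrier M" for f m
    using module_hom_in[OF that(1), of m] that(2) by simp
  ultimately show ?thesis
    unfolding Hom_set_def ext_maps_def by (auto simp: xop_trivial Lam_hom_iff[OF mod])
qed

text \<open>On the one-dimensional \<open>M\<close> a nonzero map has image of order q and the zero
  map has image of order 1; exactly one of the \<open>card (carrier N)\<close> maps is zero.\<close>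

lemma card_Ext1_mid_simple:
  assumes q: "card (carrier M) = card (UNIV :: 'k set)" and L0: "fd_mod L0" 
  shows "card (Ext1_mid M N L0) = (if card (carrier L0) = card (carrier N) * card (UNIV :: 'k set) then
    if card (xim L0) = 1 then 1 else if card (xim L0) = card (UNIV :: 'k set) then card (carrier N) - 1 else 0 else 0)"
proof -
  have mod: "module Lam M" "module Lam N" using fd by (auto simp: fd_mod_iff)
  interpret VN: vectorspace "kring :: 'k ring" "restrict_to_k N" by (rule vectorspace_restrict[OF mod(2)])
  interpret VM: vectorspace "kring :: 'k ring" "restrict_to_k M" by (rule vectorspace_restrict[OF mod(1)])
  have q1: "card (UNIV :: 'k set) > 1"
    using card_mono[of "UNIV :: 'k set" "{0, 1}"] by auto
  define z where "z = (\<lambda>m\<in>carrier M. \<zero>\<^bsub>N\<^esub>)"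
  have z: "z \<in> ext_maps"
    unfolding ext_maps_def z_def using module_hom_cong[OF VM.zero_hom[OF VN.vectorspace_axioms] _ VM.module_axioms] by fastforce
  have ne: "carrier M \<noteq> {}" using q q1 by auto
  have zc: "card (z ` carrier M) = 1" using ne by (simp add: z_def image_constant_conv)
  note cD = card_ext_maps[OF q]
  have "carrier N \<noteq> {}" using VN.M.zero_closed by auto
  then have fin: "finite ext_maps" using cD finite_carrier[OF fd(2)] by (metis card.infinite card_0_eq)
  have qc: "card (\<delta> ` carrier M) = card (UNIV :: 'k set)" if \<delta>: "\<delta> \<in> ext_maps" "\<delta> \<noteq> z" for \<delta>
  proof -
    have \<delta>k: "\<delta> \<in> module_hom kring (restrict_to_k M) (restrict_to_k N)" using \<delta>(1) by (simp add: ext_maps_def)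
    have "\<exists>m\<in>carrier M. \<delta> m \<noteq> \<zero>\<^bsub>N\<^esub>"
    proof (rule ccontr)
      assume "\<not> ?thesis"
      then have "\<delta> = z" using \<delta> by (intro extensionalityI[of _ "carrier M"]) (auto simp: z_def ext_maps_def)
      with \<delta> show False by simp
    qed
    then obtain m where m: "m \<in> carrier M" "\<delta> m \<noteq> \<zero>\<^bsub>N\<^esub>" by blast
    \<comment> \<open>The multiples of a nonzero value \<open>\<delta> m\<close> are distinct, so
      the image has at least q elements, and it has at most q because \<open>M\<close> has
      q.\<close>
    have "inj_on (\<lambda>c. lam [:c:] \<odot>\<^bsub>N\<^esub> \<delta> m) UNIV"
    proof (rule inj_onI)
      fix c c' :: 'k assume eq: "lam [:c:] \<odot>\<^bsub>N\<^esub> \<delta> m = lam [:c':] \<odot>\<^bsub>N\<^esub> \<delta> m"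
      have sub: "LinearCombinations.submodule (kring :: 'k ring) {\<zero>\<^bsub>N\<^esub>} (restrict_to_k N)" using VN.zero_submodule by simp
      show "c = c'"
        using VN.adjoin_unique[OF sub, of "\<delta> m" "\<zero>\<^bsub>N\<^esub>" "\<zero>\<^bsub>N\<^esub>" c c'] m eq ext_mapsD[OF \<delta>(1) m(1)] by simp
    qed
    then have "card (UNIV :: 'k set) = card (range (\<lambda>c. lam [:c:] \<odot>\<^bsub>N\<^esub> \<delta> m))" by (simp add: card_image)
    also have "\<dots> \<le> card (\<delta> ` carrier M)"
    proof (rule card_mono)
      show "finite (\<delta> ` carrier M)" using finite_carrier(1)[OF fd(1)] by simp
      show "range (\<lambda>c. lam [:c:] \<odot>\<^bsub>N\<^esub> \<delta> m) \<subseteq> \<delta> ` carrier M"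
      proof (rule image_subsetI)
        fix c :: 'k
        have "lam [:c:] \<odot>\<^bsub>M\<^esub> m \<in> carrier M" using VM.smult_closed[of c m] m(1) by simp
        then show "lam [:c:] \<odot>\<^bsub>N\<^esub> \<delta> m \<in> \<delta> ` carrier M" using module_hom_smult[OF \<delta>k, of c m] m(1) by force
      qed
    qed
    finally show ?thesis using card_image_le[OF finite_carrier(1)[OF fd(1)], of \<delta>] q by simp
  qed
  have "{\<delta> \<in> ext_maps. a = card (\<delta> ` carrier M)} = (if a = 1 then {z} else if a = card (UNIV :: 'k set) then ext_maps - {z} else {})" for a
  proof -
    have "\<delta> \<in> ext_maps \<and> a = card (\<delta> ` carrier M) \<longleftrightarrow> 
      (if \<delta> = z then a = 1 else \<delta> \<in> ext_maps \<and> a = card (UNIV :: 'k set))" for \<delta>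
      using qc[of \<delta>] zc z by (cases "\<delta> = z") auto
    then show ?thesis using q1 z by auto
  qed
  then show ?thesis
    unfolding card_Ext1_mid_trivial[OF L0] using cD fin z q by simp
qed

end

subsection \<open>Isomorphism classes\<close>

lemma card_field_gt_one: "card (UNIV :: 'k::{field,finite} set) > 1"
  using card_mono[of "UNIV :: 'k set" "{0, 1}"] by auto

text \<open>\<open>im x\<close> lies in \<open>ker x\<close> and their orders multiply to that of
  \<open>M\<close>, so equality of the two is a condition on orders. Acyclicity thereby becomes a
  property of the isomorphism class.\<close>

lemma acyclic_mod_iff_card:
  fixes M :: "('k::{field,finite} poly set, 'a) module"
  assumes M: "fd_mod M"
  shows "acyclic_mod M \<longleftrightarrow> card (xim M) * card (xim M) = card (carrier M)"
proof -
  have "card (xim M) > 0"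
    using finite_carrier(2)[OF M] LinearCombinations.submodule.zero_closed[OF xim_submodule[OF M]] 
    by (auto simp: card_gt_0_iff)
  then have "card (xim M) * card (xim M) = card (carrier M) \<longleftrightarrow> card (xim M) = card (xker M)"
    using card_xker_xim[OF M] by (metis mult_cancel2 neq0_conv)
  also have "\<dots> \<longleftrightarrow> acyclic_mod M"
    unfolding acyclic_mod_def using xim_subset(2)[OF M] finite_carrier(3)[OF M] card_subset_eq by metis
  finally show ?thesis by simp
qed

lemma isoclass_eq_iff:
  fixes M :: "('k::{field,finite} poly set, 'a) module" and N :: "('k poly set, 'b) module"
  assumes M: "fd_mod M" and N: "fd_mod N"
  shows "isoclass M = isoclass N \<longleftrightarrow> mod_iso M N"
proof
  have mod: "module Lam M" "module Lam N" using M N by (auto simp: fd_mod_iff)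
  show "isoclass M = isoclass N" if "mod_iso M N"
  proof -
    have "mod_iso M P \<longleftrightarrow> mod_iso N P" for P :: "('k poly set, nat) module"
      using mod_iso_right[OF mod that, of P] .
    then show ?thesis by (simp add: isoclass_def)
  qed
  show "mod_iso M N" if eq: "isoclass M = isoclass N"
  proof -
    obtain P :: "('k poly set, nat) module" where P: "fd_mod P" "mod_iso N P" using ex_nat_copy[OF N] by blast
    then have "P \<in> isoclass M" unfolding eq by (simp add: isoclass_def)
    then have "mod_iso M P" by (simp add: isoclass_def)
    moreover have "mod_iso P N" using mod_iso_sym[OF mod(2) _ P(2)] P(1) by (simp add: fd_mod_iff)
    ultimately show ?thesis by (rule mod_iso_trans)
  qed
qed

lemma isoclass_in_isoclasses:
  fixes M :: "('k::{field,finite} poly set, 'a) module"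
  assumes M: "fd_mod M"
  shows "isoclass M \<in> isoclasses"
proof -
  obtain N :: "('k poly set, nat) module" where N: "fd_mod N" "mod_iso M N" using ex_nat_copy[OF M] by blast
  have "isoclass N \<in> isoclasses" unfolding isoclasses_def using N(1) by (intro CollectI exI[of _ N] conjI refl)
  then show ?thesis using isoclass_eq_iff[OF M N(1)] N(2) by simp
qed

lemma rep_isoclass:
  fixes c :: "'k::{field,finite} iclass"
  assumes "c \<in> isoclasses"
  shows "fd_mod (rep c)" "isoclass (rep c) = c"
proof -
  obtain M :: "('k poly set, nat) module" where M: "fd_mod M" "c = isoclass M" using assms by (auto simp: isoclasses_def)
  then have "M \<in> c" using mod_iso_refl by (auto simp: isoclass_def)
  then have "rep c \<in> c" unfolding rep_def by (rule someI)
  then have r: "fd_mod (rep c)" "mod_iso M (rep c)" unfolding M(2) by (auto simp: isoclass_def)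
  then show "fd_mod (rep c)" "isoclass (rep c) = c" using isoclass_eq_iff[OF M(1) r(1)] M(2) by auto
qed

lemma rep_isoclass_card:
  fixes M :: "('k::{field,finite} poly set, 'a) module"
  assumes M: "fd_mod M"
  shows "card (carrier (rep (isoclass M))) = card (carrier M)" "card (xim (rep (isoclass M))) = card (xim M)"
    "acyclic_mod (rep (isoclass M)) \<longleftrightarrow> acyclic_mod M"
proof -
  note r = rep_isoclass[OF isoclass_in_isoclasses[OF M]]
  show 1: "card (carrier (rep (isoclass M))) = card (carrier M)" "card (xim (rep (isoclass M))) = card (xim M)"
    using r(2) isoclass_eq_iff[OF r(1) M] mod_iso_iff_card[OF r(1) M] by auto
  show "acyclic_mod (rep (isoclass M)) \<longleftrightarrow> acyclic_mod M"
    by (simp add: acyclic_mod_iff_card[OF r(1)] acyclic_mod_iff_card[OF M] 1)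
qed

lemma isoclass_eq_card:
  fixes M :: "('k::{field,finite} poly set, 'a) module"
  assumes c: "c \<in> isoclasses" and M: "fd_mod M"
  shows "c = isoclass M \<longleftrightarrow> card (carrier (rep c)) = card (carrier M) \<and> card (xim (rep c)) = card (xim M)"
  using isoclass_eq_iff[OF rep_isoclass(1)[OF c] M] mod_iso_iff_card[OF rep_isoclass(1)[OF c] M] rep_isoclass(2)[OF c] by simp

lemma isoclass_eqI_card:
  fixes M :: "('k::{field,finite} poly set, 'a) module" and N :: "('k poly set, 'b) module"
  assumes "fd_mod M" "fd_mod N" "card (carrier M) = card (carrier N)" "card (xim M) = card (xim N)"
  shows "isoclass M = isoclass N"
  using assms by (simp add: isoclass_eq_iff mod_iso_iff_card)

lemma dim_k_eqI:
  fixes M :: "('k::{field,finite} poly set, 'a) module"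
  assumes "fd_mod M" "card (carrier M) = card (UNIV :: 'k set) ^ n"
  shows "dim_k M = n"
  using card_carrier_dim_k[OF assms(1)] assms(2) card_field_gt_one[where 'k = 'k] 
  by (metis power_inject_exp)

lemma dim_k_rep_isoclass:
  fixes M :: "('k::{field,finite} poly set, 'a) module"
  assumes M: "fd_mod M"
  shows "dim_k (rep (isoclass M)) = dim_k M"
  by (rule dim_k_eqI[OF rep_isoclass(1)[OF isoclass_in_isoclasses[OF M]]])
     (simp add: rep_isoclass_card[OF M] card_carrier_dim_k[OF M])

lemma dim_k_direct_sum:
  fixes M :: "('k::{field,finite} poly set, 'a) module" and N :: "('k poly set, 'b) module"
  assumes "fd_mod M" "fd_mod N"
  shows "dim_k (direct_sum M N) = dim_k M + dim_k N"
  by (rule dim_k_eqI[OF fd_mod_direct_sum[OF assms]])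
     (simp add: card_cartesian_product card_carrier_dim_k[OF assms(1)] card_carrier_dim_k[OF assms(2)] power_add)

lemma acyclic_direct_sum:
  fixes M :: "('k::{field,finite} poly set, 'a) module" and N :: "('k poly set, 'b) module"
  assumes "fd_mod M" "fd_mod N" "acyclic_mod M" "acyclic_mod N"
  shows "acyclic_mod (direct_sum M N)"
  using assms
  by (simp add: acyclic_mod_iff_card fd_mod_direct_sum xim_direct_sum card_cartesian_product mult_ac)

subsection \<open>Hall numbers\<close>

definition hom_number :: "'k::{field,finite} iclass \<Rightarrow> 'k iclass \<Rightarrow> real" where
  "hom_number a b = real (card (Hom_set (rep a) (rep b)))"

text \<open>For the numerators, the split class is the only one in either order. For the
  denominators, the number of homomorphisms is the same in both directions.\<close>

lemma hall_number_acyclic: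
  fixes K :: "('k::{field,finite} poly set, 'a) module" and M :: "('k poly set, 'b) module"
  assumes K: "fd_mod K" "acyclic_mod K" and M: "fd_mod M" and c: "c \<in> isoclasses"
  shows "hall_number (isoclass K) (isoclass M) c = 
      (if c = isoclass (direct_sum K M) then 1 / hom_number (isoclass K) (isoclass M) else 0)"
    and "hall_number (isoclass M) (isoclass K) c = hall_number (isoclass K) (isoclass M) c"
proof -
  note rK = rep_isoclass(1)[OF isoclass_in_isoclasses[OF K(1)]] and rM = rep_isoclass(1)[OF isoclass_in_isoclasses[OF M]]
  note rc = rep_isoclass(1)[OF c]
  have ac: "acyclic_mod (rep (isoclass K))" using rep_isoclass_card(3)[OF K(1)] K(2) by simp
  have iso: "mod_iso (direct_sum (rep (isoclass M)) (rep (isoclass K))) (rep c) \<longleftrightarrow> c = isoclass (direct_sum K M)"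
    "mod_iso (direct_sum (rep (isoclass K)) (rep (isoclass M))) (rep c) \<longleftrightarrow> c = isoclass (direct_sum K M)"
    unfolding mod_iso_iff_card[OF fd_mod_direct_sum[OF rM rK] rc] mod_iso_iff_card[OF fd_mod_direct_sum[OF rK rM] rc]
      isoclass_eq_card[OF c fd_mod_direct_sum[OF K(1) M]] direct_sum_simps xim_direct_sum card_cartesian_product 
      rep_isoclass_card(1,2)[OF K(1)] rep_isoclass_card(1,2)[OF M] 
    by (auto simp: mult.commute)
  have h: "card (Hom_set (rep (isoclass K)) (rep (isoclass M))) = card (Hom_set (rep (isoclass M)) (rep (isoclass K)))"
    by (rule card_Hom_set_acyclic_commute[OF rK ac rM])
  have e: "card (Ext1_mid (rep (isoclass K)) (rep (isoclass M)) (rep c)) = (if c = isoclass (direct_sum K M) then 1 else 0)"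
    "card (Ext1_mid (rep (isoclass M)) (rep (isoclass K)) (rep c)) = (if c = isoclass (direct_sum K M) then 1 else 0)"
    using card_Ext1_mid_split[OF rK rM] card_Ext1_mid_split[OF rM rK] ac iso by simp_all
  show "hall_number (isoclass K) (isoclass M) c = 
      (if c = isoclass (direct_sum K M) then 1 / hom_number (isoclass K) (isoclass M) else 0)"
    by (simp add: hall_number_def e hom_number_def)
  show "hall_number (isoclass M) (isoclass K) c = hall_number (isoclass K) (isoclass M) c"
    by (simp add: hall_number_def e h)
qed

lemma hom_number_acyclic_rank_one:
  fixes K :: "('k::{field,finite} poly set, 'a) module" and M :: "('k poly set, 'b) module"
  assumes K: "fd_mod K" "acyclic_mod K" "card (xim K) = card (UNIV :: 'k set)" and M: "fd_mod M"
  shows "hom_number (isoclass K) (isoclass M) = real (card (carrier M))"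
proof -
  note rK = rep_isoclass(1)[OF isoclass_in_isoclasses[OF K(1)]] and rM = rep_isoclass(1)[OF isoclass_in_isoclasses[OF M]]
  show ?thesis
    unfolding hom_number_def
    using card_Hom_set_acyclic_rank_one[OF rK _ rM] K rep_isoclass_card[OF K(1)] rep_isoclass_card[OF M] by simp
qed

lemma xim_eq_zero_iff:
  assumes M: "fd_mod M"
  shows "card (xim M) = 1 \<longleftrightarrow> xim M = {\<zero>\<^bsub>M\<^esub>}"
  using LinearCombinations.submodule.zero_closed[OF xim_submodule[OF M]] by (auto simp: card_1_singleton_iff)

lemma hall_number_simple:
  fixes S :: "('k::{field,finite} poly set, 'a) module" and N :: "('k poly set, 'b) module"
  assumes S: "fd_mod S" "card (xim S) = 1" "card (carrier S) = card (UNIV :: 'k set)" 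
    and N: "fd_mod N" "card (xim N) = 1" and c: "c \<in> isoclasses"
  shows "hall_number (isoclass S) (isoclass N) c = 
      (if card (carrier (rep c)) = card (carrier N) * card (UNIV :: 'k set) then
        if card (xim (rep c)) = 1 then 1 
        else if card (xim (rep c)) = card (UNIV :: 'k set) then real (card (carrier N)) - 1 else 0 else 0) / 
      real (card (carrier N))"
proof -
  note rS = rep_isoclass(1)[OF isoclass_in_isoclasses[OF S(1)]] and rN = rep_isoclass(1)[OF isoclass_in_isoclasses[OF N(1)]]
  note rc = rep_isoclass(1)[OF c]
  have x: "xim (rep (isoclass S)) = {\<zero>\<^bsub>rep (isoclass S)\<^esub>}" "xim (rep (isoclass N)) = {\<zero>\<^bsub>rep (isoclass N)\<^esub>}"
    using S(2) N(2) by (simp_all flip: xim_eq_zero_iff[OF rS] xim_eq_zero_iff[OF rN] add: rep_isoclass_card[OF S(1)] rep_isoclass_card[OF N(1)])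
  have q: "card (carrier (rep (isoclass S))) = card (UNIV :: 'k set)" by (simp add: rep_isoclass_card[OF S(1)] S(3))
  have e: "card (Hom_set (rep (isoclass S)) (rep (isoclass N))) = card (carrier N)"
    using Hom_set_ext_maps[OF rS rN x] card_ext_maps[OF rS rN x q] by (simp add: rep_isoclass_card[OF N(1)])
  have "card (carrier N) > 0"
    using finite_carrier(1)[OF N(1)] LinearCombinations.submodule.zero_closed[OF xker_submodule[OF N(1)]] xim_subset(3)[OF N(1)]
    by (auto simp: card_gt_0_iff)
  then have r: "real (card (carrier N) - 1) = real (card (carrier N)) - 1" by simp
  show ?thesis
    unfolding hall_number_def e card_Ext1_mid_simple[OF rS rN x q rc] rep_isoclass_card[OF N(1)] using r by simp
qed

text \<open>A nonzero Hall number provides an actual extension, along which orders multiply. This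
  makes the Hall product graded by dimension.\<close>

lemma hall_number_dim:
  fixes a b c :: "'k::{field,finite} iclass"
  assumes "a \<in> isoclasses" "b \<in> isoclasses" "c \<in> isoclasses" "hall_number a b c \<noteq> 0"
  shows "dim_k (rep c) = dim_k (rep a) + dim_k (rep b)"
proof -
  note fd = rep_isoclass(1)[OF assms(1)] rep_isoclass(1)[OF assms(2)] rep_isoclass(1)[OF assms(3)]
  have "Ext1_mid (rep a) (rep b) (rep c) \<noteq> {}" using assms(4) by (auto simp: hall_number_def)
  then obtain L f g where L: "(L, f, g) \<in> extensions (rep a) (rep b)" "mod_iso L (rep c)"
    by (auto simp: Ext1_mid_def quotient_def)
  then have "fd_mod L" "short_exact (rep b) L (rep a) f g" by (auto simp: mem_extensions)
  then have "card (carrier (rep c)) = card (carrier (rep b)) * card (carrier (rep a))"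
    using card_short_exact[OF fd(2) _ fd(1)] mod_iso_iff_card[OF _ fd(3)] L(2) by metis
  then show ?thesis
    by (intro dim_k_eqI[OF fd(3)]) (simp add: card_carrier_dim_k[OF fd(1)] card_carrier_dim_k[OF fd(2)] power_add mult.commute)
qed

subsection \<open>The field of coefficients\<close>

lemma qsqrt_square: "qsqrt TYPE('k::{field,finite}) ^ 2 = real (card (UNIV :: 'k set))"
  by (simp add: qsqrt_def)

lemma qsqrt_gt_one: "qsqrt TYPE('k::{field,finite}) > 1"
  using card_field_gt_one[where 'k = 'k] by (simp add: qsqrt_def)

context
  fixes v :: real
  assumes v: "v\<^sup>2 \<in> \<rat>"
begin

lemma Q_adjoin_rat: "a \<in> \<rat> \<Longrightarrow> a \<in> Q_adjoin v"
  unfolding Q_adjoin_def by (intro CollectI exI[of _ a] exI[of _ 0]) simp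

lemma Q_adjoin_self: "v \<in> Q_adjoin v"
  unfolding Q_adjoin_def by (intro CollectI exI[of _ 0] exI[of _ 1]) simp

lemma Q_adjoin_add: "x \<in> Q_adjoin v \<Longrightarrow> y \<in> Q_adjoin v \<Longrightarrow> x + y \<in> Q_adjoin v"
proof -
  assume "x \<in> Q_adjoin v" "y \<in> Q_adjoin v"
  then obtain a b c d where "x = a + b * v" "y = c + d * v" "a \<in> \<rat>" "b \<in> \<rat>" "c \<in> \<rat>" "d \<in> \<rat>" by (auto simp: Q_adjoin_def)
  then show ?thesis unfolding Q_adjoin_def by (intro CollectI exI[of _ "a + c"] exI[of _ "b + d"]) (auto simp: algebra_simps)
qed

text \<open>Rationality of \<open>v\<^sup>2\<close> enters here: the product of the two irrational
  parts is rational again.\<close>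

lemma Q_adjoin_mult: "x \<in> Q_adjoin v \<Longrightarrow> y \<in> Q_adjoin v \<Longrightarrow> x * y \<in> Q_adjoin v"
proof -
  assume "x \<in> Q_adjoin v" "y \<in> Q_adjoin v"
  then obtain a b c d where "x = a + b * v" "y = c + d * v" "a \<in> \<rat>" "b \<in> \<rat>" "c \<in> \<rat>" "d \<in> \<rat>" by (auto simp: Q_adjoin_def)
  then show ?thesis unfolding Q_adjoin_def using v
    by (intro CollectI exI[of _ "a * c + b * d * v\<^sup>2"] exI[of _ "a * d + b * c"]) (auto simp: algebra_simps power2_eq_square)
qed

lemma Q_adjoin_uminus: "x \<in> Q_adjoin v \<Longrightarrow> - x \<in> Q_adjoin v"
  using Q_adjoin_mult[OF Q_adjoin_rat[of "-1"]] by simp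

lemma Q_adjoin_diff: "x \<in> Q_adjoin v \<Longrightarrow> y \<in> Q_adjoin v \<Longrightarrow> x - y \<in> Q_adjoin v"
  using Q_adjoin_add[OF _ Q_adjoin_uminus, of x y] by simp

text \<open>If \<open>a - b v = 0\<close>, the conjugate is useless for inverting \<open>a + b v\<close>, but then \<open>b = 0\<close> or \<open>v\<close> is rational.\<close>

lemma Q_adjoin_inverse:
  assumes "x \<in> Q_adjoin v"
  shows "inverse x \<in> Q_adjoin v"
proof -
  from assms obtain a b where x: "x = a + b * v" "a \<in> \<rat>" "b \<in> \<rat>" by (auto simp: Q_adjoin_def)
  show ?thesis
  proof (cases "a - b * v = 0")
    case True
    then have "b = 0 \<or> v = a / b" by (auto simp: field_simps)
    then have "x \<in> \<rat>" using x by auto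
    then show ?thesis by (intro Q_adjoin_rat) auto
  next
    case False
    let ?d = "a\<^sup>2 - b\<^sup>2 * v\<^sup>2"
    have "?d = x * (a - b * v)" by (simp add: x(1) algebra_simps power2_eq_square)
    then have "inverse x = (a - b * v) * inverse ?d" using False by simp
    also have "\<dots> \<in> Q_adjoin v"
    proof (rule Q_adjoin_mult)
      show "a - b * v \<in> Q_adjoin v"
        using x(2,3) by (intro Q_adjoin_diff Q_adjoin_mult[OF Q_adjoin_rat Q_adjoin_self] Q_adjoin_rat)
      show "inverse ?d \<in> Q_adjoin v" using x(2,3) v by (intro Q_adjoin_rat) simp
    qed
    finally show ?thesis .
  qed
qed

lemma Q_adjoin_divide: "x \<in> Q_adjoin v \<Longrightarrow> y \<in> Q_adjoin v \<Longrightarrow> x / y \<in> Q_adjoin v"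
  unfolding divide_inverse by (intro Q_adjoin_mult Q_adjoin_inverse)

lemma Q_adjoin_power: "x \<in> Q_adjoin v \<Longrightarrow> x ^ n \<in> Q_adjoin v"
  by (induction n) (auto intro: Q_adjoin_mult Q_adjoin_rat)

lemma Q_adjoin_powi: "x \<in> Q_adjoin v \<Longrightarrow> x powi n \<in> Q_adjoin v"
  by (auto simp: power_int_def intro: Q_adjoin_power Q_adjoin_inverse)

lemma Q_adjoin_prod: "(\<And>i. i \<in> A \<Longrightarrow> f i \<in> Q_adjoin v) \<Longrightarrow> prod f A \<in> Q_adjoin v"
  by (induction A rule: infinite_finite_induct) (auto intro: Q_adjoin_mult Q_adjoin_rat)

lemmas Q_adjoin_intros = Q_adjoin_add Q_adjoin_mult Q_adjoin_uminus Q_adjoin_diff Q_adjoin_inverse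
  Q_adjoin_divide Q_adjoin_power Q_adjoin_powi Q_adjoin_prod Q_adjoin_self

lemma Q_adjoin_qint: "qint v m \<in> Q_adjoin v"
  unfolding qint_def by (intro Q_adjoin_intros)

lemma Q_adjoin_qfact: "qfact v m \<in> Q_adjoin v" "qdfact_even v m \<in> Q_adjoin v"
  unfolding qfact_def qdfact_even_def by (intro Q_adjoin_intros Q_adjoin_qint)+

end

lemma qsqrt_square_rat: "qsqrt TYPE('k::{field,finite}) ^ 2 \<in> \<rat>"
  unfolding qsqrt_square by simp

subsection \<open>The Hall algebra\<close>

lemma mem_carrier_hall:
  fixes f :: "'k::{field,finite} iclass \<Rightarrow> real"
  shows "f \<in> carrier hall \<longleftrightarrow> finite {c. f c \<noteq> 0} \<and> (\<forall>c. f c \<noteq> 0 \<longrightarrow> c \<in> isoclasses) \<and> (\<forall>c. f c \<in> Q_adjoin (qsqrt TYPE('k)))"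
  by (auto simp: hall_def)

lemma hall_simps:
  fixes f g :: "'k::{field,finite} iclass \<Rightarrow> real"
  shows "\<one>\<^bsub>hall\<^esub> = (hclass zero_mod :: 'k iclass \<Rightarrow> real)" "\<zero>\<^bsub>hall\<^esub> = (\<lambda>_ :: 'k iclass. 0)"
    "f \<oplus>\<^bsub>hall\<^esub> g = (\<lambda>c. f c + g c)"
  by (simp_all add: hall_def)

text \<open>Index sets larger than the supports are allowed, so that products of related functions
  can be compared over a common range.\<close>

lemma hall_mult_apply:
  fixes f g :: "'k::{field,finite} iclass \<Rightarrow> real"
  assumes "finite A" "\<And>a. f a \<noteq> 0 \<Longrightarrow> a \<in> A" "finite B" "\<And>b. g b \<noteq> 0 \<Longrightarrow> b \<in> B"
  shows "(f \<otimes>\<^bsub>hall\<^esub> g) c = (if c \<in> isoclasses then \<Sum>a\<in>A. \<Sum>b\<in>B. f a * g b * hall_number a b c else 0)"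
proof -
  have "(\<Sum>a\<in>{a. f a \<noteq> 0}. \<Sum>b\<in>{b. g b \<noteq> 0}. f a * g b * hall_number a b c) = 
      (\<Sum>a\<in>A. \<Sum>b\<in>{b. g b \<noteq> 0}. f a * g b * hall_number a b c)"
    using assms by (intro sum.mono_neutral_left) auto
  also have "\<dots> = (\<Sum>a\<in>A. \<Sum>b\<in>B. f a * g b * hall_number a b c)"
    using assms by (intro sum.cong refl sum.mono_neutral_left) auto
  finally show ?thesis by (simp add: hall_def)
qed

lemma hclass_in_hall:
  fixes M :: "('k::{field,finite} poly set, 'a) module"
  assumes M: "fd_mod M"
  shows "hclass M \<in> carrier hall"
  using isoclass_in_isoclasses[OF M] Q_adjoin_rat[OF qsqrt_square_rat[where 'k = 'k]]
  by (auto simp: mem_carrier_hall hclass_def)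

lemma hall_smult_closed:
  fixes f :: "'k::{field,finite} iclass \<Rightarrow> real"
  assumes "f \<in> carrier hall" "r \<in> Q_adjoin (qsqrt TYPE('k))"
  shows "(\<lambda>c. r * f c) \<in> carrier hall"
  using assms Q_adjoin_mult[OF qsqrt_square_rat[where 'k = 'k]]
  by (auto simp: mem_carrier_hall intro: finite_subset[rotated])

lemma hall_add_closed:
  fixes f g :: "'k::{field,finite} iclass \<Rightarrow> real"
  assumes "f \<in> carrier hall" "g \<in> carrier hall"
  shows "(\<lambda>c. f c + g c) \<in> carrier hall"
proof -
  have "{c. f c + g c \<noteq> 0} \<subseteq> {c. f c \<noteq> 0} \<union> {c. g c \<noteq> 0}" by auto
  then show ?thesis
    using assms Q_adjoin_add[OF qsqrt_square_rat[where 'k = 'k]]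
    by (auto simp: mem_carrier_hall intro: finite_subset)
qed

lemma hall_mult_smult:
  fixes f g :: "'k::{field,finite} iclass \<Rightarrow> real"
  assumes "f \<in> carrier hall" "g \<in> carrier hall"
  shows "(\<lambda>c. r * f c) \<otimes>\<^bsub>hall\<^esub> g = (\<lambda>c. r * (f \<otimes>\<^bsub>hall\<^esub> g) c)"
    and "f \<otimes>\<^bsub>hall\<^esub> (\<lambda>c. r * g c) = (\<lambda>c. r * (f \<otimes>\<^bsub>hall\<^esub> g) c)"
proof -
  have fin: "finite {c. f c \<noteq> 0}" "finite {c. g c \<noteq> 0}" using assms by (auto simp: mem_carrier_hall)
  have fg: "(f \<otimes>\<^bsub>hall\<^esub> g) c = (if c \<in> isoclasses then \<Sum>a | f a \<noteq> 0. \<Sum>b | g b \<noteq> 0. f a * g b * hall_number a b c else 0)" for c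
    by (rule hall_mult_apply[OF fin(1) _ fin(2)]) auto
  have "((\<lambda>c. r * f c) \<otimes>\<^bsub>hall\<^esub> g) c = r * (f \<otimes>\<^bsub>hall\<^esub> g) c" for c
    by (subst hall_mult_apply[OF fin(1) _ fin(2)]) (auto simp: fg sum_distrib_left mult_ac)
  then show "(\<lambda>c. r * f c) \<otimes>\<^bsub>hall\<^esub> g = (\<lambda>c. r * (f \<otimes>\<^bsub>hall\<^esub> g) c)" by blast
  have "(f \<otimes>\<^bsub>hall\<^esub> (\<lambda>c. r * g c)) c = r * (f \<otimes>\<^bsub>hall\<^esub> g) c" for c
    by (subst hall_mult_apply[OF fin(1) _ fin(2)]) (auto simp: fg sum_distrib_left mult_ac)
  then show "f \<otimes>\<^bsub>hall\<^esub> (\<lambda>c. r * g c) = (\<lambda>c. r * (f \<otimes>\<^bsub>hall\<^esub> g) c)" by blast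
qed

lemma hclass_mult_hclass:
  fixes M :: "('k::{field,finite} poly set, 'a) module" and N :: "('k poly set, 'b) module"
  shows "(hclass M \<otimes>\<^bsub>hall\<^esub> hclass N) c = (if c \<in> isoclasses then hall_number (isoclass M) (isoclass N) c else 0)"
  by (subst hall_mult_apply[of "{isoclass M}" _ "{isoclass N}"]) (auto simp: hclass_def split: if_splits)

lemma hclass_eq_if_isoclass_eq: "isoclass M = isoclass N \<Longrightarrow> hclass M = hclass N"
  by (simp add: hclass_def)

lemma hclass_mult_acyclic:
  fixes K :: "('k::{field,finite} poly set, 'a) module" and M :: "('k poly set, 'b) module"
  assumes K: "fd_mod K" "acyclic_mod K" and M: "fd_mod M"
  shows "hclass K \<otimes>\<^bsub>hall\<^esub> hclass M = (\<lambda>c. 1 / hom_number (isoclass K) (isoclass M) * hclass (direct_sum K M) c)"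
proof
  fix c
  show "(hclass K \<otimes>\<^bsub>hall\<^esub> hclass M) c = 1 / hom_number (isoclass K) (isoclass M) * hclass (direct_sum K M) c"
    unfolding hclass_mult_hclass
    using hall_number_acyclic(1)[OF K M, of c] isoclass_in_isoclasses[OF fd_mod_direct_sum[OF K(1) M]]
    by (auto simp: hclass_def)
qed

lemma hclass_acyclic_central:
  fixes K :: "('k::{field,finite} poly set, 'a) module" and f :: "'k iclass \<Rightarrow> real"
  assumes K: "fd_mod K" "acyclic_mod K" and f: "f \<in> carrier hall"
  shows "hclass K \<otimes>\<^bsub>hall\<^esub> f = f \<otimes>\<^bsub>hall\<^esub> hclass K"
proof
  fix c
  have iso: "b \<in> isoclasses" if "f b \<noteq> 0" for b using f that by (auto simp: mem_carrier_hall)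
  have fin: "finite {c. f c \<noteq> 0}" using f by (auto simp: mem_carrier_hall)
  have hn: "hall_number b (isoclass K) c = hall_number (isoclass K) b c" if "f b \<noteq> 0" "c \<in> isoclasses" for b
    using hall_number_acyclic(2)[OF K rep_isoclass(1)[OF iso[OF that(1)]] that(2)] rep_isoclass(2)[OF iso[OF that(1)]] by simp
  have "(hclass K \<otimes>\<^bsub>hall\<^esub> f) c = (if c \<in> isoclasses then \<Sum>a\<in>{isoclass K}. \<Sum>b | f b \<noteq> 0. hclass K a * f b * hall_number a b c else 0)"
    by (rule hall_mult_apply[OF _ _ fin]) (auto simp: hclass_def split: if_splits)
  moreover have "(f \<otimes>\<^bsub>hall\<^esub> hclass K) c = (if c \<in> isoclasses then \<Sum>b | f b \<noteq> 0. \<Sum>a\<in>{isoclass K}. f b * hclass K a * hall_number b a c else 0)"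
    by (rule hall_mult_apply[OF fin]) (auto simp: hclass_def split: if_splits)
  ultimately show "(hclass K \<otimes>\<^bsub>hall\<^esub> f) c = (f \<otimes>\<^bsub>hall\<^esub> hclass K) c"
    using hn by (simp add: hclass_def)
qed

subsection \<open>Localization at central elements\<close>

text \<open>For central denominators the Ore construction is the localization of commutative
  algebra: \<open>r / s = r' / s'\<close> iff \<open>r s' u = r' s u\<close> for some
  \<open>u\<close> in \<open>S\<close>. The factor \<open>u\<close> accounts for denominators that
  are zero divisors.\<close>

locale central_localization = ring R for R (structure) +
  fixes S :: "'a set"
  assumes S_subset: "S \<subseteq> carrier R" and S_one: "\<one> \<in> S"
    and S_mult: "s \<in> S \<Longrightarrow> t \<in> S \<Longrightarrow> s \<otimes> t \<in> S"
    and S_central: "s \<in> S \<Longrightarrow> r \<in> carrier R \<Longrightarrow> s \<otimes> r = r \<otimes> s"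
begin

lemma S_carrier [simp, intro]: "s \<in> S \<Longrightarrow> s \<in> carrier R"
  using S_subset by auto

lemma S_comm: "s \<in> S \<Longrightarrow> t \<in> S \<Longrightarrow> s \<otimes> t = t \<otimes> s"
  by (simp add: S_central)

lemma S_lcomm: "s \<in> S \<Longrightarrow> t \<in> S \<Longrightarrow> y \<in> carrier R \<Longrightarrow> s \<otimes> (t \<otimes> y) = t \<otimes> (s \<otimes> y)"
  by (simp add: m_assoc[symmetric] S_comm)

lemma S_move: "s \<in> S \<Longrightarrow> r \<in> carrier R \<Longrightarrow> y \<in> carrier R \<Longrightarrow> s \<otimes> (r \<otimes> y) = r \<otimes> (s \<otimes> y)"
  by (simp add: m_assoc[symmetric] S_central)

abbreviation frac :: "'a \<Rightarrow> 'a \<Rightarrow> ('a \<times> 'a) set" where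
  "frac \<equiv> ore_frac R S"

text \<open>From \<open>a\<close> and \<open>a'\<close> the factor \<open>u = s a\<close> is
  obtained; conversely \<open>a = s' u\<close> and \<open>a' = s u\<close> serve.\<close>

lemma ore_rel_iff:
  "((r, s), (r', s')) \<in> ore_rel R S \<longleftrightarrow> r \<in> carrier R \<and> s \<in> S \<and> r' \<in> carrier R \<and> s' \<in> S \<and>
    (\<exists>u\<in>S. r \<otimes> (s' \<otimes> u) = r' \<otimes> (s \<otimes> u))"
proof
  assume "((r, s), (r', s')) \<in> ore_rel R S"
  then obtain a a' where c: "r \<in> carrier R" "s \<in> S" "r' \<in> carrier R" "s' \<in> S" "a \<in> carrier R" "a' \<in> carrier R"
    and e: "r \<otimes> a = r' \<otimes> a'" "s \<otimes> a = s' \<otimes> a'" "s \<otimes> a \<in> S" by (auto simp: ore_rel_def)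
  have "r \<otimes> (s' \<otimes> (s \<otimes> a)) = (r \<otimes> a) \<otimes> (s' \<otimes> s)"
    using c by (simp add: m_assoc S_central[of s' s] S_central[of s' a] S_central[of s a] S_move[of s' s a] S_move[of s' a s] S_move[of s a s'])
  also have "\<dots> = (r' \<otimes> a') \<otimes> (s \<otimes> s')" using e c by (simp add: S_comm)
  also have "\<dots> = r' \<otimes> (s \<otimes> (s' \<otimes> a'))"
    using c by (simp add: m_assoc S_central[of s' a'] S_central[of s a'] S_move[of s a' s'])
  finally have "r \<otimes> (s' \<otimes> (s \<otimes> a)) = r' \<otimes> (s \<otimes> (s \<otimes> a))" using e by simp
  with c e show "r \<in> carrier R \<and> s \<in> S \<and> r' \<in> carrier R \<and> s' \<in> S \<and> (\<exists>u\<in>S. r \<otimes> (s' \<otimes> u) = r' \<otimes> (s \<otimes> u))" by blast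
next
  assume "r \<in> carrier R \<and> s \<in> S \<and> r' \<in> carrier R \<and> s' \<in> S \<and> (\<exists>u\<in>S. r \<otimes> (s' \<otimes> u) = r' \<otimes> (s \<otimes> u))"
  then obtain u where c: "r \<in> carrier R" "s \<in> S" "r' \<in> carrier R" "s' \<in> S" "u \<in> S" "r \<otimes> (s' \<otimes> u) = r' \<otimes> (s \<otimes> u)" by blast
  then have "s' \<otimes> u \<in> carrier R" "s \<otimes> u \<in> carrier R" "s \<otimes> (s' \<otimes> u) = s' \<otimes> (s \<otimes> u)" "s \<otimes> (s' \<otimes> u) \<in> S"
    by (simp_all add: S_lcomm[of s s' u] S_mult)
  with c show "((r, s), (r', s')) \<in> ore_rel R S" unfolding ore_rel_def by blast
qed

lemma equiv_ore_rel: "equiv (carrier R \<times> S) (ore_rel R S)"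
proof (rule equivI)
  show "ore_rel R S \<subseteq> (carrier R \<times> S) \<times> (carrier R \<times> S)" by (auto simp: ore_rel_def)
  show "refl_on (carrier R \<times> S) (ore_rel R S)"
    by (rule refl_onI) (use S_one in \<open>auto simp: ore_rel_iff\<close>)
  show "sym (ore_rel R S)"
    by (rule symI) (clarsimp simp: ore_rel_iff, metis)
  show "trans (ore_rel R S)"
  proof (rule transI)
    fix x y z assume "(x, y) \<in> ore_rel R S" "(y, z) \<in> ore_rel R S"
    moreover obtain r s r' s' r'' s'' where xyz: "x = (r, s)" "y = (r', s')" "z = (r'', s'')" by (cases x, cases y, cases z) blast
    ultimately obtain u w where c: "r \<in> carrier R" "s \<in> S" "r' \<in> carrier R" "s' \<in> S" "r'' \<in> carrier R" "s'' \<in> S" "u \<in> S" "w \<in> S"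
      and e: "r \<otimes> (s' \<otimes> u) = r' \<otimes> (s \<otimes> u)" "r' \<otimes> (s'' \<otimes> w) = r'' \<otimes> (s' \<otimes> w)"
      by (auto simp: ore_rel_iff)
    \<comment> \<open>Transitivity: the factor \<open>s' u w\<close> makes both given equations
      applicable.\<close>
    have "r \<otimes> (s'' \<otimes> (s' \<otimes> u \<otimes> w)) = (r \<otimes> (s' \<otimes> u)) \<otimes> (s'' \<otimes> w)"
      using c by (simp add: m_assoc S_comm S_lcomm)
    also have "\<dots> = (r' \<otimes> (s'' \<otimes> w)) \<otimes> (s \<otimes> u)" unfolding e(1) using c by (simp add: m_assoc S_comm S_lcomm)
    also have "\<dots> = r'' \<otimes> (s \<otimes> (s' \<otimes> u \<otimes> w))" unfolding e(2) using c by (simp add: m_assoc S_comm S_lcomm)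
    finally show "(x, z) \<in> ore_rel R S" unfolding xyz ore_rel_iff using c S_mult by blast
  qed
qed

lemma frac_eq_iff:
  assumes "r \<in> carrier R" "s \<in> S" "r' \<in> carrier R" "s' \<in> S"
  shows "frac r s = frac r' s' \<longleftrightarrow> (\<exists>u\<in>S. r \<otimes> (s' \<otimes> u) = r' \<otimes> (s \<otimes> u))"
  unfolding ore_frac_def using eq_equiv_class_iff[OF equiv_ore_rel, of "(r, s)" "(r', s')"] assms by (simp add: ore_rel_iff)

lemma mem_frac:
  assumes "r \<in> carrier R" "s \<in> S"
  shows "(r', s') \<in> frac r s \<longleftrightarrow> r' \<in> carrier R \<and> s' \<in> S \<and> (\<exists>u\<in>S. r \<otimes> (s' \<otimes> u) = r' \<otimes> (s \<otimes> u))"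
  using assms by (simp add: ore_frac_def ore_rel_iff)

abbreviation "Q \<equiv> ore_localization R S"

lemma carrier_localization: "carrier Q = {frac r s | r s. r \<in> carrier R \<and> s \<in> S}"
  by (auto simp: ore_localization_def quotient_def ore_frac_def)

lemma frac_closed: "r \<in> carrier R \<Longrightarrow> s \<in> S \<Longrightarrow> frac r s \<in> carrier Q"
  by (auto simp: carrier_localization)

lemma one_localization: "\<one>\<^bsub>Q\<^esub> = frac \<one> \<one>" and zero_localization: "\<zero>\<^bsub>Q\<^esub> = frac \<zero> \<one>"
  by (simp_all add: ore_localization_def)

text \<open>Trades the numerator \<open>r'\<close> for the equivalent \<open>r\<close> under a
  further factor \<open>x\<close>, which may be a non-central common multiplier. The proofs that
  product and sum are well defined rest on it.\<close>

lemma expand_eq: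
  assumes "r \<in> carrier R" "r' \<in> carrier R" "x \<in> carrier R" "s \<in> S" "s' \<in> S" "u \<in> S"
    and e: "r \<otimes> (s' \<otimes> u) = r' \<otimes> (s \<otimes> u)"
  shows "(r' \<otimes> x) \<otimes> (s \<otimes> u) = (r \<otimes> (s' \<otimes> x)) \<otimes> u"
proof -
  have "(r' \<otimes> x) \<otimes> (s \<otimes> u) = (r' \<otimes> (s \<otimes> u)) \<otimes> x"
    using assms(1-6) by (simp add: m_assoc S_central[of s x] S_central[of u x] S_move[of s x u])
  also have "\<dots> = (r \<otimes> (s' \<otimes> u)) \<otimes> x" by (simp add: e)
  also have "\<dots> = (r \<otimes> (s' \<otimes> x)) \<otimes> u"
    using assms(1-6) by (simp add: m_assoc S_central[of u x])
  finally show ?thesis .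
qed

text \<open>The product is a union over all representatives and common denominators. All its members
  are shown to be equal, and the choice \<open>a = r2\<close>, \<open>t = s1\<close> shows that
  there is one.\<close>

lemma frac_mult:
  assumes c: "r1 \<in> carrier R" "s1 \<in> S" "r2 \<in> carrier R" "s2 \<in> S"
  shows "frac r1 s1 \<otimes>\<^bsub>Q\<^esub> frac r2 s2 = frac (r1 \<otimes> r2) (s1 \<otimes> s2)"
proof -
  have wd: "frac (r1' \<otimes> a) (s2' \<otimes> t) = frac (r1 \<otimes> r2) (s1 \<otimes> s2)"
    if 1: "(r1', s1') \<in> frac r1 s1" and 2: "(r2', s2') \<in> frac r2 s2" and a: "a \<in> carrier R" "t \<in> S" 
      "s1' \<otimes> a = r2' \<otimes> t" for r1' s1' r2' s2' a t
  proof -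
    obtain u where u: "r1' \<in> carrier R" "s1' \<in> S" "u \<in> S" "r1 \<otimes> (s1' \<otimes> u) = r1' \<otimes> (s1 \<otimes> u)" 
      using 1 c by (auto simp: mem_frac)
    obtain w where w: "r2' \<in> carrier R" "s2' \<in> S" "w \<in> S" "r2 \<otimes> (s2' \<otimes> w) = r2' \<otimes> (s2 \<otimes> w)" 
      using 2 c by (auto simp: mem_frac)
    have "(r1' \<otimes> a) \<otimes> ((s1 \<otimes> s2) \<otimes> (u \<otimes> w)) = ((r1' \<otimes> a) \<otimes> (s1 \<otimes> u)) \<otimes> (s2 \<otimes> w)"
      using c u w a by (simp add: m_assoc S_lcomm)
    also have "\<dots> = ((r1 \<otimes> (s1' \<otimes> a)) \<otimes> u) \<otimes> (s2 \<otimes> w)"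
      using expand_eq[OF c(1) u(1) a(1) c(2) u(2) u(3) u(4)] by simp
    also have "\<dots> = r1 \<otimes> ((r2' \<otimes> (s2 \<otimes> w)) \<otimes> (t \<otimes> u))"
      unfolding a(3) using c u(1-3) w(1-3) a(1,2) by (simp add: m_assoc S_lcomm S_comm)
    also have "\<dots> = (r1 \<otimes> r2) \<otimes> ((s2' \<otimes> t) \<otimes> (u \<otimes> w))"
      unfolding w(4)[symmetric] using c u(1-3) w(1-3) a(1,2) by (simp add: m_assoc S_lcomm S_comm)
    finally show ?thesis
      using c u w a S_mult by (subst frac_eq_iff) auto
  qed
  have mem: "(r1, s1) \<in> frac r1 s1" "(r2, s2) \<in> frac r2 s2" using c S_one by (auto simp: mem_frac)
  have "{frac (r1' \<otimes> a) (s2' \<otimes> t) | r1' s1' r2' s2' a t. (r1', s1') \<in> frac r1 s1 \<and> (r2', s2') \<in> frac r2 s2 \<and> 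
      a \<in> carrier R \<and> t \<in> S \<and> s1' \<otimes> a = r2' \<otimes> t} = {frac (r1 \<otimes> r2) (s1 \<otimes> s2)}" (is "?L = _")
  proof (rule equalityI)
    show "?L \<subseteq> {frac (r1 \<otimes> r2) (s1 \<otimes> s2)}"
    proof
      fix x assume "x \<in> ?L"
      then obtain r1' s1' r2' s2' a t where "x = frac (r1' \<otimes> a) (s2' \<otimes> t)" "(r1', s1') \<in> frac r1 s1" 
        "(r2', s2') \<in> frac r2 s2" "a \<in> carrier R" "t \<in> S" "s1' \<otimes> a = r2' \<otimes> t" by blast
      then show "x \<in> {frac (r1 \<otimes> r2) (s1 \<otimes> s2)}" using wd by simp
    qed
    have "frac (r1 \<otimes> r2) (s2 \<otimes> s1) \<in> ?L"
      by (rule CollectI, (rule exI)+, (intro conjI), rule refl, rule mem, rule mem) (use c S_central in auto)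
    then show "{frac (r1 \<otimes> r2) (s1 \<otimes> s2)} \<subseteq> ?L" using c by (simp add: S_comm)
  qed
  then show ?thesis by (simp add: ore_localization_def)
qed

text \<open>As for products; the admissible choice is \<open>a1 = s2\<close>,
  \<open>a2 = s1\<close>.\<close>

lemma frac_add:
  assumes c: "r1 \<in> carrier R" "s1 \<in> S" "r2 \<in> carrier R" "s2 \<in> S"
  shows "frac r1 s1 \<oplus>\<^bsub>Q\<^esub> frac r2 s2 = frac (r1 \<otimes> s2 \<oplus> r2 \<otimes> s1) (s1 \<otimes> s2)"
proof -
  have wd: "frac (r1' \<otimes> a1 \<oplus> r2' \<otimes> a2) (s1' \<otimes> a1) = frac (r1 \<otimes> s2 \<oplus> r2 \<otimes> s1) (s1 \<otimes> s2)"
    if 1: "(r1', s1') \<in> frac r1 s1" and 2: "(r2', s2') \<in> frac r2 s2" and a: "a1 \<in> carrier R" "a2 \<in> carrier R" 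
      "s1' \<otimes> a1 = s2' \<otimes> a2" "s1' \<otimes> a1 \<in> S" for r1' s1' r2' s2' a1 a2
  proof -
    obtain u where u: "r1' \<in> carrier R" "s1' \<in> S" "u \<in> S" "r1 \<otimes> (s1' \<otimes> u) = r1' \<otimes> (s1 \<otimes> u)" 
      using 1 c by (auto simp: mem_frac)
    obtain w where w: "r2' \<in> carrier R" "s2' \<in> S" "w \<in> S" "r2 \<otimes> (s2' \<otimes> w) = r2' \<otimes> (s2 \<otimes> w)" 
      using 2 c by (auto simp: mem_frac)
    define t where "t = s1' \<otimes> a1"
    have t: "t \<in> S" "s1' \<otimes> a1 = t" "s2' \<otimes> a2 = t" using a by (auto simp: t_def)
    have "(r1' \<otimes> a1) \<otimes> ((s1 \<otimes> s2) \<otimes> (u \<otimes> w)) = ((r1' \<otimes> a1) \<otimes> (s1 \<otimes> u)) \<otimes> (s2 \<otimes> w)"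
      using c u w a(1,2) by (simp add: m_assoc S_lcomm)
    also have "\<dots> = (r1 \<otimes> s2) \<otimes> (t \<otimes> (u \<otimes> w))"
      unfolding expand_eq[OF c(1) u(1) a(1) c(2) u(2) u(3) u(4)] t using c u(1-3) w(1-3) t(1) 
      by (simp add: m_assoc S_lcomm S_comm)
    finally have e1: "(r1' \<otimes> a1) \<otimes> ((s1 \<otimes> s2) \<otimes> (u \<otimes> w)) = (r1 \<otimes> s2) \<otimes> (t \<otimes> (u \<otimes> w))" .
    have "(r2' \<otimes> a2) \<otimes> ((s1 \<otimes> s2) \<otimes> (u \<otimes> w)) = ((r2' \<otimes> a2) \<otimes> (s2 \<otimes> w)) \<otimes> (s1 \<otimes> u)"
      using c u w a(1,2) by (simp add: m_assoc S_lcomm S_comm)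
    also have "\<dots> = (r2 \<otimes> s1) \<otimes> (t \<otimes> (u \<otimes> w))"
      unfolding expand_eq[OF c(3) w(1) a(2) c(4) w(2) w(3) w(4)] t using c u(1-3) w(1-3) t(1) 
      by (simp add: m_assoc S_lcomm S_comm)
    finally have e2: "(r2' \<otimes> a2) \<otimes> ((s1 \<otimes> s2) \<otimes> (u \<otimes> w)) = (r2 \<otimes> s1) \<otimes> (t \<otimes> (u \<otimes> w))" .
    have "(r1' \<otimes> a1 \<oplus> r2' \<otimes> a2) \<otimes> ((s1 \<otimes> s2) \<otimes> (u \<otimes> w)) = (r1 \<otimes> s2 \<oplus> r2 \<otimes> s1) \<otimes> (t \<otimes> (u \<otimes> w))"
      using c u(1-3) w(1-3) t(1) a(1,2) by (subst (1 2) l_distr) (simp_all only: e1 e2 m_closed S_carrier)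
    then show ?thesis
      unfolding t(2) using c u w a t(1) S_mult by (subst frac_eq_iff) auto
  qed
  have mem: "(r1, s1) \<in> frac r1 s1" "(r2, s2) \<in> frac r2 s2" using c S_one by (auto simp: mem_frac)
  have "{frac (r1' \<otimes> a1 \<oplus> r2' \<otimes> a2) (s1' \<otimes> a1) | r1' s1' r2' s2' a1 a2. (r1', s1') \<in> frac r1 s1 \<and> (r2', s2') \<in> frac r2 s2 \<and> 
      a1 \<in> carrier R \<and> a2 \<in> carrier R \<and> s1' \<otimes> a1 = s2' \<otimes> a2 \<and> s1' \<otimes> a1 \<in> S} = {frac (r1 \<otimes> s2 \<oplus> r2 \<otimes> s1) (s1 \<otimes> s2)}"
    (is "?L = _")
  proof (rule equalityI)
    show "?L \<subseteq> {frac (r1 \<otimes> s2 \<oplus> r2 \<otimes> s1) (s1 \<otimes> s2)}"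
    proof
      fix x assume "x \<in> ?L"
      then obtain r1' s1' r2' s2' a1 a2 where "x = frac (r1' \<otimes> a1 \<oplus> r2' \<otimes> a2) (s1' \<otimes> a1)" "(r1', s1') \<in> frac r1 s1" 
        "(r2', s2') \<in> frac r2 s2" "a1 \<in> carrier R" "a2 \<in> carrier R" "s1' \<otimes> a1 = s2' \<otimes> a2" "s1' \<otimes> a1 \<in> S" by blast
      then show "x \<in> {frac (r1 \<otimes> s2 \<oplus> r2 \<otimes> s1) (s1 \<otimes> s2)}" using wd by simp
    qed
    show "{frac (r1 \<otimes> s2 \<oplus> r2 \<otimes> s1) (s1 \<otimes> s2)} \<subseteq> ?L"
      unfolding insert_subset
      by (rule conjI, rule CollectI, (rule exI)+, (intro conjI), rule refl, rule mem, rule mem) 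
        (use c S_comm S_mult in auto)
  qed
  then show ?thesis by (simp add: ore_localization_def)
qed

lemma frac_add_same:
  assumes c: "r1 \<in> carrier R" "r2 \<in> carrier R" "s \<in> S"
  shows "frac r1 s \<oplus>\<^bsub>Q\<^esub> frac r2 s = frac (r1 \<oplus> r2) s"
proof -
  have "(r1 \<otimes> s \<oplus> r2 \<otimes> s) \<otimes> (s \<otimes> \<one>) = (r1 \<oplus> r2) \<otimes> ((s \<otimes> s) \<otimes> \<one>)"
    using c by (simp add: m_assoc l_distr)
  then show ?thesis
    unfolding frac_add[OF c(1,3,2,3)] using c S_one S_mult by (subst frac_eq_iff) (blast intro: bexI[of _ \<one>])+
qed

lemma frac_cancel:
  assumes "r \<in> carrier R" "s \<in> S" "t \<in> S"
  shows "frac (r \<otimes> t) (s \<otimes> t) = frac r s"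
  using assms S_one S_mult by (subst frac_eq_iff) (auto simp: m_assoc S_comm intro!: bexI[of _ \<one>])

lemma abelian_monoid_localization: "abelian_monoid Q"
proof (rule abelian_monoidI)
  fix x y assume "x \<in> carrier Q" "y \<in> carrier Q"
  then obtain r s r' s' where xy: "x = frac r s" "y = frac r' s'" "r \<in> carrier R" "s \<in> S" "r' \<in> carrier R" "s' \<in> S"
    by (auto simp: carrier_localization)
  then show "x \<oplus>\<^bsub>Q\<^esub> y \<in> carrier Q" by (simp add: frac_add frac_closed S_mult)
  have "frac (r \<otimes> s' \<oplus> r' \<otimes> s) (s \<otimes> s') = frac (r' \<otimes> s \<oplus> r \<otimes> s') (s' \<otimes> s)"
    using xy(3-6) by (simp add: a_comm S_comm)
  then show "x \<oplus>\<^bsub>Q\<^esub> y = y \<oplus>\<^bsub>Q\<^esub> x" using xy by (simp add: frac_add)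
next
  fix x y z assume "x \<in> carrier Q" "y \<in> carrier Q" "z \<in> carrier Q"
  then obtain r s r' s' r'' s'' where xy: "x = frac r s" "y = frac r' s'" "z = frac r'' s''" 
    and c: "r \<in> carrier R" "s \<in> S" "r' \<in> carrier R" "s' \<in> S" "r'' \<in> carrier R" "s'' \<in> S"
    by (auto simp: carrier_localization)
  have n: "(r \<otimes> s' \<oplus> r' \<otimes> s) \<otimes> s'' \<oplus> r'' \<otimes> (s \<otimes> s') = r \<otimes> (s' \<otimes> s'') \<oplus> (r' \<otimes> s'' \<oplus> r'' \<otimes> s') \<otimes> s"
    using c by (simp add: l_distr m_assoc a_assoc S_comm)
  have d: "s \<otimes> s' \<otimes> s'' = s \<otimes> (s' \<otimes> s'')" using c by (simp add: m_assoc)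
  show "x \<oplus>\<^bsub>Q\<^esub> y \<oplus>\<^bsub>Q\<^esub> z = x \<oplus>\<^bsub>Q\<^esub> (y \<oplus>\<^bsub>Q\<^esub> z)"
    unfolding xy using c by (simp add: frac_add S_mult n d)
next
  fix x assume "x \<in> carrier Q"
  then obtain r s where x: "x = frac r s" "r \<in> carrier R" "s \<in> S" by (auto simp: carrier_localization)
  then show "\<zero>\<^bsub>Q\<^esub> \<oplus>\<^bsub>Q\<^esub> x = x" using S_one by (simp add: zero_localization frac_add)
qed (auto simp: zero_localization frac_closed S_one)

end

subsection \<open>The defining ideal\<close>

text \<open>A sequence starting with an acyclic module splits, so the generator attached to it is a
  difference of equal classes.\<close>

lemma hall_ideal_gens_zero:
  fixes K L M :: "('k::{field,finite} poly set, nat) module"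
  assumes "fd_mod L" "fd_mod M" "pd_le_one K" "short_exact K L M f g"
  shows "isoclass L = isoclass (direct_sum K M)"
proof -
  have K: "fd_mod K" "acyclic_mod K" using assms(3) by (simp_all add: pd_le_one_iff)
  have "mod_iso (direct_sum K M) L"
    using short_exact_split[OF K(1) assms(1,2,4)] K(2) unfolding mod_iso_def by metis
  then show ?thesis using isoclass_eq_iff[OF fd_mod_direct_sum[OF K(1) assms(2)] assms(1)] by simp
qed

text \<open>The generated ideal is the intersection of all ideals containing the generators. If
  there is none, the intersection is everything. If there is one, its being an ideal includes that
  the Hall algebra is a ring; then the zero ideal contains the generators, which all vanish, so it
  is the generated one.\<close>

lemma hall_ideal_cases:
  obtains (collapse) "(hall_ideal :: ('k::{field,finite} iclass \<Rightarrow> real) set) = UNIV"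
  | (ring) "ring (hall :: ('k iclass \<Rightarrow> real) ring)" "(hall_ideal :: ('k iclass \<Rightarrow> real) set) = {\<lambda>_. 0}"
proof -
  let ?H = "hall :: ('k iclass \<Rightarrow> real) ring"
  define G :: "('k iclass \<Rightarrow> real) set" where "G = {(\<lambda>c. hclass K c - hclass K' c) 
        | (K :: ('k poly set, nat) module) (K' :: ('k poly set, nat) module).
         pd_le_one K \<and> pd_le_one K' \<and> mod_iso K K'} \<union>
      {(\<lambda>c. hclass L c - hclass (direct_sum K M) c) 
        | (L :: ('k poly set, nat) module) (K :: ('k poly set, nat) module) (M :: ('k poly set, nat) module).
         fd_mod L \<and> fd_mod M \<and> pd_le_one K \<and> (\<exists>f g. short_exact K L M f g)}"
  have I: "hall_ideal = Idl\<^bsub>?H\<^esub> G" unfolding hall_ideal_def G_def ..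
  have G0: "G \<subseteq> {\<lambda>_. 0}"
  proof
    fix x assume "x \<in> G"
    then consider (1) K K' :: "('k poly set, nat) module" where "x = (\<lambda>c. hclass K c - hclass K' c)" 
        "pd_le_one K" "pd_le_one K'" "mod_iso K K'"
      | (2) L K M :: "('k poly set, nat) module" and f g where "x = (\<lambda>c. hclass L c - hclass (direct_sum K M) c)"
         "fd_mod L" "fd_mod M" "pd_le_one K" "short_exact K L M f g"
      unfolding G_def by blast
    then show "x \<in> {\<lambda>_. 0}"
    proof cases
      case 1
      then have "isoclass K = isoclass K'" by (simp add: isoclass_eq_iff pd_le_one_iff)
      then show ?thesis using hclass_eq_if_isoclass_eq[of K K'] 1(1) by simp
    next
      case 2
      then show ?thesis using hclass_eq_if_isoclass_eq[OF hall_ideal_gens_zero[OF 2(2-5)]] by simp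
    qed
  qed
  show ?thesis
  proof (cases "\<exists>J. ideal J ?H \<and> G \<subseteq> J")
    case False
    then have "hall_ideal = (UNIV :: ('k iclass \<Rightarrow> real) set)" unfolding I genideal_def by blast
    then show ?thesis by (rule collapse)
  next
    case True
    then have R: "ring ?H" using ideal.axioms(2) by blast
    interpret ring ?H by (rule R)
    have "ideal {\<zero>\<^bsub>?H\<^esub>} ?H" by (rule zeroideal)
    then have "Idl\<^bsub>?H\<^esub> G \<subseteq> {\<lambda>_. 0}" using G0 unfolding genideal_def hall_simps by blast
    moreover have "(\<lambda>_. 0) \<in> Idl\<^bsub>?H\<^esub> G"
      unfolding genideal_def
    proof (rule InterI)
      fix J assume "J \<in> {J. ideal J ?H \<and> G \<subseteq> J}"
      then have "additive_subgroup J ?H" using ideal.axioms(1) by blast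
      then show "(\<lambda>_. 0) \<in> J" using additive_subgroup.zero_closed by (fastforce simp: hall_simps)
    qed
    ultimately show ?thesis using ring R unfolding I by blast
  qed
qed

lemma hom_number_pos:
  fixes a b :: "'k::{field,finite} iclass"
  assumes "a \<in> isoclasses" "b \<in> isoclasses"
  shows "hom_number a b > 0"
proof -
  note fd = rep_isoclass(1)[OF assms(1)] rep_isoclass(1)[OF assms(2)]
  have mod: "module Lam (rep a)" "module Lam (rep b)" using fd by (simp_all add: fd_mod_iff)
  interpret B: module Lam "rep b" by (rule mod)
  interpret A: module Lam "rep a" by (rule mod)
  have "(\<lambda>_. \<zero>\<^bsub>rep b\<^esub>) \<in> module_hom Lam (rep a) (rep b)" by (intro module_homI) auto
  then have "(\<lambda>x\<in>carrier (rep a). \<zero>\<^bsub>rep b\<^esub>) \<in> Hom_set (rep a) (rep b)"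
    using module_hom_cong[OF _ _ mod(1)] by (fastforce simp: Hom_set_def)
  moreover have "Hom_set (rep a) (rep b) \<subseteq> carrier (rep a) \<rightarrow>\<^sub>E carrier (rep b)"
    by (auto simp: Hom_set_def module_hom_def PiE_def)
  then have "finite (Hom_set (rep a) (rep b))"
    using finite_carrier(1)[OF fd(1)] finite_carrier(1)[OF fd(2)] finite_PiE finite_subset by meson
  ultimately show ?thesis by (auto simp: hom_number_def card_gt_0_iff)
qed

text \<open>Denominators together with their dimension, which is the amount by which they shift
  degrees.\<close>

definition hall_denom :: "('k::{field,finite} iclass \<Rightarrow> real) \<Rightarrow> nat \<Rightarrow> bool" where
  "hall_denom s k \<longleftrightarrow> (\<exists>a (K :: ('k poly set, nat) module). s = (\<lambda>c. a * hclass K c) \<and> a \<in> \<rat> \<and> a \<noteq> 0 \<and> pd_le_one K \<and> dim_k K = k)"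

definition hall_proj :: "int \<Rightarrow> ('k::{field,finite} iclass \<Rightarrow> real) \<Rightarrow> 'k iclass \<Rightarrow> real" where
  "hall_proj d f c = (if int (dim_k (rep c)) = d then f c else 0)"

lemma hall_proj_closed:
  fixes f :: "'k::{field,finite} iclass \<Rightarrow> real"
  shows "f \<in> carrier hall \<Longrightarrow> hall_proj d f \<in> carrier hall"
  using Q_adjoin_rat[OF qsqrt_square_rat[where 'k = 'k], of 0]
  by (auto simp: mem_carrier_hall hall_proj_def elim: finite_subset[rotated])

lemma hall_denom_closed:
  fixes s :: "'k::{field,finite} iclass \<Rightarrow> real"
  assumes "hall_denom s k"
  shows "s \<in> carrier hall"
  using assms Q_adjoin_rat[OF qsqrt_square_rat[where 'k = 'k]]
  by (auto simp: hall_denom_def pd_le_one_iff intro!: hall_smult_closed hclass_in_hall)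

lemma hall_denom_dim:
  fixes s :: "'k::{field,finite} iclass \<Rightarrow> real"
  assumes "hall_denom s k" "s c \<noteq> 0"
  shows "dim_k (rep c) = k"
  using assms by (auto simp: hall_denom_def hclass_def pd_le_one_iff dim_k_rep_isoclass split: if_splits)

text \<open>The product is a rational multiple, by one over the number of homomorphisms, of the
  class of the direct sum, and direct sums of acyclic modules are acyclic.\<close>

lemma hall_denom_mult:
  fixes s t :: "'k::{field,finite} iclass \<Rightarrow> real"
  assumes "hall_denom s k" "hall_denom t l"
  shows "hall_denom (s \<otimes>\<^bsub>hall\<^esub> t) (k + l)"
proof -
  obtain a K where s: "s = (\<lambda>c. a * hclass (K :: ('k poly set, nat) module) c)" "a \<in> \<rat>" "a \<noteq> 0" "fd_mod K" "acyclic_mod K" "dim_k K = k"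
    using assms(1) by (auto simp: hall_denom_def pd_le_one_iff)
  obtain b L where t: "t = (\<lambda>c. b * hclass (L :: ('k poly set, nat) module) c)" "b \<in> \<rat>" "b \<noteq> 0" "fd_mod L" "acyclic_mod L" "dim_k L = l"
    using assms(2) by (auto simp: hall_denom_def pd_le_one_iff)
  note h = hclass_in_hall[OF s(4)] hclass_in_hall[OF t(4)]
  have tc: "t \<in> carrier hall" by (rule hall_denom_closed[OF assms(2)])
  note fdD = fd_mod_direct_sum[OF s(4) t(4)]
  \<comment> \<open>The direct sum lives on pairs, whereas \<open>hall_denom\<close> asks for a
    module on \<open>nat\<close>.\<close>
  define N where "N = rep (isoclass (direct_sum K L))"
  have N: "fd_mod N" "isoclass N = isoclass (direct_sum K L)" "acyclic_mod N" "dim_k N = k + l"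
    using rep_isoclass[OF isoclass_in_isoclasses[OF fdD]] rep_isoclass_card(3)[OF fdD] acyclic_direct_sum[OF s(4) t(4) s(5) t(5)]
      dim_k_rep_isoclass[OF fdD] dim_k_direct_sum[OF s(4) t(4)] s(6) t(6) by (simp_all add: N_def)
  define w where "w = hom_number (isoclass K) (isoclass L)"
  have w: "w > 0" unfolding w_def by (intro hom_number_pos isoclass_in_isoclasses s(4) t(4))
  have "s \<otimes>\<^bsub>hall\<^esub> t = (\<lambda>c. a * (hclass K \<otimes>\<^bsub>hall\<^esub> t) c)"
    unfolding s(1) by (rule hall_mult_smult(1)[OF h(1) tc])
  also have "hclass K \<otimes>\<^bsub>hall\<^esub> t = (\<lambda>c. b * (hclass K \<otimes>\<^bsub>hall\<^esub> hclass L) c)"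
    unfolding t(1) by (rule hall_mult_smult(2)[OF h])
  also have "hclass K \<otimes>\<^bsub>hall\<^esub> hclass L = (\<lambda>c. 1 / w * hclass N c)"
    unfolding w_def hclass_eq_if_isoclass_eq[OF N(2)] by (rule hclass_mult_acyclic[OF s(4,5) t(4)])
  finally have "s \<otimes>\<^bsub>hall\<^esub> t = (\<lambda>c. (a * b / w) * hclass N c)" by (simp add: mult_ac)
  moreover have "a * b / w \<in> \<rat>" "a * b / w \<noteq> 0" using s t w by (auto simp: w_def hom_number_def)
  ultimately show ?thesis unfolding hall_denom_def pd_le_one_iff using N by blast
qed

lemma hall_denom_one: "hall_denom (\<one>\<^bsub>hall\<^esub> :: 'k::{field,finite} iclass \<Rightarrow> real) 0"
proof -
  have "dim_k (zero_mod :: ('k poly set, nat) module) = 0"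
    by (rule dim_k_eqI[OF fd_zero_mod]) simp
  then show ?thesis
    unfolding hall_denom_def hall_simps
    by (intro exI[of _ 1] exI[of _ zero_mod]) (simp add: pd_le_one_iff fd_zero_mod acyclic_zero_mod)
qed

lemma hall_denom_central:
  fixes s f :: "'k::{field,finite} iclass \<Rightarrow> real"
  assumes "hall_denom s k" "f \<in> carrier hall"
  shows "s \<otimes>\<^bsub>hall\<^esub> f = f \<otimes>\<^bsub>hall\<^esub> s"
proof -
  obtain a K where s: "s = (\<lambda>c. a * hclass (K :: ('k poly set, nat) module) c)" "fd_mod K" "acyclic_mod K"
    using assms(1) by (auto simp: hall_denom_def pd_le_one_iff)
  show ?thesis
    unfolding s(1) hall_mult_smult(1)[OF hclass_in_hall[OF s(2)] assms(2)] hall_mult_smult(2)[OF assms(2) hclass_in_hall[OF s(2)]]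
    by (simp add: hclass_acyclic_central[OF s(2,3) assms(2)])
qed

text \<open>Hall numbers vanish unless dimensions add up, and a denominator is concentrated in the
  single dimension \<open>k\<close>.\<close>

lemma hall_proj_mult_denom:
  fixes f s :: "'k::{field,finite} iclass \<Rightarrow> real"
  assumes f: "f \<in> carrier hall" and s: "hall_denom s k"
  shows "hall_proj (d + int k) (f \<otimes>\<^bsub>hall\<^esub> s) = hall_proj d f \<otimes>\<^bsub>hall\<^esub> s"
proof
  fix c
  have fin: "finite {c. f c \<noteq> 0}" "finite {c. s c \<noteq> 0}" and iso: "\<And>c. f c \<noteq> 0 \<Longrightarrow> c \<in> isoclasses" "\<And>c. s c \<noteq> 0 \<Longrightarrow> c \<in> isoclasses"
    using f hall_denom_closed[OF s] by (auto simp: mem_carrier_hall)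
  have 1: "(f \<otimes>\<^bsub>hall\<^esub> s) c = (if c \<in> isoclasses then \<Sum>a | f a \<noteq> 0. \<Sum>b | s b \<noteq> 0. f a * s b * hall_number a b c else 0)"
    by (rule hall_mult_apply[OF fin(1) _ fin(2)]) auto
  have 2: "(hall_proj d f \<otimes>\<^bsub>hall\<^esub> s) c = (if c \<in> isoclasses then \<Sum>a | f a \<noteq> 0. \<Sum>b | s b \<noteq> 0. hall_proj d f a * s b * hall_number a b c else 0)"
    by (rule hall_mult_apply[OF fin(1) _ fin(2)]) (auto simp: hall_proj_def split: if_splits)
  show "hall_proj (d + int k) (f \<otimes>\<^bsub>hall\<^esub> s) c = (hall_proj d f \<otimes>\<^bsub>hall\<^esub> s) c"
  proof (cases "c \<in> isoclasses")
    case True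
    have t: "(if int (dim_k (rep c)) = d + int k then f a * s b * hall_number a b c else 0) = hall_proj d f a * s b * hall_number a b c"
      if "f a \<noteq> 0" "s b \<noteq> 0" for a b
      using hall_number_dim[OF iso(1)[OF that(1)] iso(2)[OF that(2)] True] hall_denom_dim[OF s that(2)] 
      by (cases "hall_number a b c = 0") (auto simp: hall_proj_def)
    have "hall_proj (d + int k) (f \<otimes>\<^bsub>hall\<^esub> s) c = 
        (\<Sum>a | f a \<noteq> 0. \<Sum>b | s b \<noteq> 0. if int (dim_k (rep c)) = d + int k then f a * s b * hall_number a b c else 0)"
      using True by (simp add: hall_proj_def 1)
    also have "\<dots> = (\<Sum>a | f a \<noteq> 0. \<Sum>b | s b \<noteq> 0. hall_proj d f a * s b * hall_number a b c)"
      by (intro sum.cong refl t) simp_all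
    also have "\<dots> = (hall_proj d f \<otimes>\<^bsub>hall\<^esub> s) c" using True by (simp add: 2)
    finally show ?thesis .
  qed (simp add: hall_proj_def 1 2)
qed

subsection \<open>The localized Hall algebra\<close>

locale hall_ring =
  fixes T :: "'k::{field,finite} itself"
  assumes ring_hall: "ring (hall :: ('k iclass \<Rightarrow> real) ring)"
    and ideal_zero: "(hall_ideal :: ('k iclass \<Rightarrow> real) set) = {\<lambda>_. 0}"
begin

sublocale H: ring "hall :: ('k iclass \<Rightarrow> real) ring"
  by (rule ring_hall)

text \<open>The ideal is zero, so the quotient merely wraps elements into singletons.\<close>

lemma coset_eq: "hall_ideal +>\<^bsub>hall\<^esub> (f :: 'k iclass \<Rightarrow> real) = {f}"
  by (simp add: ideal_zero a_r_coset_def r_coset_def hall_simps)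

lemma ring_hall_quot: "ring (hall_quot :: ('k iclass \<Rightarrow> real) set ring)"
proof -
  have "ideal (hall_ideal :: ('k iclass \<Rightarrow> real) set) hall"
    using H.zeroideal by (simp add: ideal_zero hall_simps)
  then show ?thesis unfolding hall_quot_def by (rule ideal.quotient_is_ring)
qed

lemma hall_quot_simps:
  fixes f g :: "'k iclass \<Rightarrow> real"
  shows "carrier hall_quot = (\<lambda>f. {f}) ` carrier (hall :: ('k iclass \<Rightarrow> real) ring)"
    "\<one>\<^bsub>hall_quot\<^esub> = {\<one>\<^bsub>hall\<^esub> :: 'k iclass \<Rightarrow> real}" "\<zero>\<^bsub>hall_quot\<^esub> = {\<lambda>_ :: 'k iclass. 0}"
    "{f} \<otimes>\<^bsub>hall_quot\<^esub> {g} = {f \<otimes>\<^bsub>hall\<^esub> g}" "{f} \<oplus>\<^bsub>hall_quot\<^esub> {g} = {f \<oplus>\<^bsub>hall\<^esub> g}"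
proof -
  show "carrier hall_quot = (\<lambda>f. {f}) ` carrier (hall :: ('k iclass \<Rightarrow> real) ring)"
    unfolding hall_quot_def FactRing_def A_RCOSETS_def RCOSETS_def a_r_coset_def[symmetric] by (auto simp: coset_eq)
  show "\<one>\<^bsub>hall_quot\<^esub> = {\<one>\<^bsub>hall\<^esub> :: 'k iclass \<Rightarrow> real}" by (simp add: hall_quot_def FactRing_def coset_eq)
  show "\<zero>\<^bsub>hall_quot\<^esub> = {\<lambda>_ :: 'k iclass. 0}" by (simp add: hall_quot_def FactRing_def ideal_zero)
  show "{f} \<otimes>\<^bsub>hall_quot\<^esub> {g} = {f \<otimes>\<^bsub>hall\<^esub> g}" by (simp add: hall_quot_def FactRing_def rcoset_mult_def coset_eq)
  show "{f} \<oplus>\<^bsub>hall_quot\<^esub> {g} = {f \<oplus>\<^bsub>hall\<^esub> g}" by (simp add: hall_quot_def FactRing_def set_add_def set_mult_def)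
qed

lemma mem_hall_denoms: "{s :: 'k iclass \<Rightarrow> real} \<in> hall_denoms \<longleftrightarrow> (\<exists>k. hall_denom s k)"
  "z \<in> (hall_denoms :: ('k iclass \<Rightarrow> real) set set) \<Longrightarrow> \<exists>s k. z = {s} \<and> hall_denom s k"
  unfolding hall_denoms_def hall_denom_def coset_eq by blast+

sublocale L: central_localization "hall_quot :: ('k iclass \<Rightarrow> real) set ring" "hall_denoms"
proof (intro central_localization.intro ring_hall_quot central_localization_axioms.intro)
  show "hall_denoms \<subseteq> carrier (hall_quot :: ('k iclass \<Rightarrow> real) set ring)"
    using mem_hall_denoms(2) hall_denom_closed by (fastforce simp: hall_quot_simps)
  show "\<one>\<^bsub>hall_quot\<^esub> \<in> (hall_denoms :: ('k iclass \<Rightarrow> real) set set)"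
    unfolding hall_quot_simps mem_hall_denoms using hall_denom_one by blast
next
  fix s t :: "('k iclass \<Rightarrow> real) set" assume "s \<in> hall_denoms" "t \<in> hall_denoms"
  then obtain s' k t' l where st: "s = {s'}" "hall_denom s' k" "t = {t'}" "hall_denom t' l" using mem_hall_denoms(2) by meson
  then show "s \<otimes>\<^bsub>hall_quot\<^esub> t \<in> hall_denoms"
    using hall_denom_mult[OF st(2,4)] unfolding st(1,3) hall_quot_simps mem_hall_denoms by blast
next
  fix s r :: "('k iclass \<Rightarrow> real) set" assume "s \<in> hall_denoms" "r \<in> carrier hall_quot"
  moreover from this obtain s' k where "s = {s'}" "hall_denom s' k" using mem_hall_denoms(2) by meson
  moreover have "r \<in> (\<lambda>f. {f}) ` carrier (hall :: ('k iclass \<Rightarrow> real) ring)" using calculation(2) by (simp only: hall_quot_simps)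
  then obtain f where "r = {f}" "f \<in> carrier hall" by blast
  ultimately show "s \<otimes>\<^bsub>hall_quot\<^esub> r = r \<otimes>\<^bsub>hall_quot\<^esub> s"
    using hall_denom_central[of s' k f] by (simp add: hall_quot_simps)
qed

lemma quot_closed: "f \<in> carrier (hall :: ('k iclass \<Rightarrow> real) ring) \<Longrightarrow> {f} \<in> carrier hall_quot"
  by (simp add: hall_quot_simps)

lemma denom_closed: "hall_denom (s :: 'k iclass \<Rightarrow> real) k \<Longrightarrow> {s} \<in> hall_denoms"
  using mem_hall_denoms by blast

lemma hall_to_sd_frac: "hall_to_sd (f :: 'k iclass \<Rightarrow> real) = L.frac {f} {\<one>\<^bsub>hall\<^esub>}"
  by (simp add: hall_to_sd_def coset_eq hall_quot_simps)

abbreviation \<theta> :: "('k iclass \<Rightarrow> real) \<Rightarrow> 'k ihall_elt" where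
  "\<theta> \<equiv> hall_to_sd"

lemma \<theta>_closed: "f \<in> carrier hall \<Longrightarrow> \<theta> f \<in> carrier sd_hall"
  unfolding sd_hall_def hall_to_sd_frac by (intro L.frac_closed quot_closed denom_closed[OF hall_denom_one])

lemma \<theta>_add:
  assumes "f \<in> carrier hall" "g \<in> carrier hall"
  shows "\<theta> f \<oplus>\<^bsub>sd_hall\<^esub> \<theta> g = \<theta> (\<lambda>c. f c + g c)"
  unfolding sd_hall_def hall_to_sd_frac
  using L.frac_add_same[OF quot_closed[OF assms(1)] quot_closed[OF assms(2)] denom_closed[OF hall_denom_one]]
  by (simp add: hall_quot_simps hall_simps)

lemma \<theta>_mult:
  assumes "f \<in> carrier hall" "g \<in> carrier hall"
  shows "\<theta> f \<otimes>\<^bsub>sd_hall\<^esub> \<theta> g = \<theta> (f \<otimes>\<^bsub>hall\<^esub> g)"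
  unfolding sd_hall_def hall_to_sd_frac
  using L.frac_mult[OF quot_closed[OF assms(1)] denom_closed[OF hall_denom_one] quot_closed[OF assms(2)] denom_closed[OF hall_denom_one]]
  by (simp add: hall_quot_simps)

lemma \<theta>_zero: "\<zero>\<^bsub>sd_hall\<^esub> = \<theta> (\<lambda>_. 0)" and \<theta>_one: "\<one>\<^bsub>sd_hall\<^esub> = \<theta> \<one>\<^bsub>hall\<^esub>"
  by (simp_all add: sd_hall_def hall_to_sd_frac L.zero_localization L.one_localization hall_quot_simps)

sublocale Q: abelian_monoid "sd_hall :: 'k ihall_elt ring"
  unfolding sd_hall_def by (rule L.abelian_monoid_localization)

lemma zero_in_hall: "(\<lambda>_ :: 'k iclass. 0) \<in> carrier hall"
  using H.zero_closed by (simp add: hall_simps)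

lemma hall_sum_closed:
  assumes "\<And>i. i \<in> I \<Longrightarrow> F i \<in> carrier (hall :: ('k iclass \<Rightarrow> real) ring)"
  shows "(\<lambda>c. \<Sum>i\<in>I. F i c) \<in> carrier hall"
  using assms
  by (induction I rule: infinite_finite_induct) (auto simp: zero_in_hall intro: hall_add_closed)

lemma \<theta>_sum:
  assumes "finite I" "\<And>i. i \<in> I \<Longrightarrow> F i \<in> carrier (hall :: ('k iclass \<Rightarrow> real) ring)"
  shows "(\<Oplus>\<^bsub>sd_hall\<^esub>i\<in>I. \<theta> (F i)) = \<theta> (\<lambda>c. \<Sum>i\<in>I. F i c)"
  using assms
proof (induction I)
  case empty
  then show ?case by (simp add: \<theta>_zero)
next
  case (insert i I)
  then have "(\<Oplus>\<^bsub>sd_hall\<^esub>i\<in>insert i I. \<theta> (F i)) = \<theta> (F i) \<oplus>\<^bsub>sd_hall\<^esub> \<theta> (\<lambda>c. \<Sum>i\<in>I. F i c)"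
    by (subst Q.finsum_insert) (auto intro: \<theta>_closed)
  also have "\<dots> = \<theta> (\<lambda>c. \<Sum>i\<in>insert i I. F i c)"
    using insert by (subst \<theta>_add) (auto intro: hall_sum_closed)
  finally show ?case .
qed

lemma sd_smult_\<theta>:
  assumes f: "f \<in> carrier (hall :: ('k iclass \<Rightarrow> real) ring)" and r: "r \<in> Q_adjoin (qsqrt TYPE('k))"
  shows "sd_smult r (\<theta> f) = \<theta> (\<lambda>c. r * f c)"
proof -
  have one: "hclass zero_mod = (\<one>\<^bsub>hall\<^esub> :: 'k iclass \<Rightarrow> real)" by (simp add: hall_simps)
  have "(\<lambda>c. r * hclass zero_mod c) \<otimes>\<^bsub>hall\<^esub> f = (\<lambda>c. r * f c)"
    unfolding one using hall_mult_smult(1)[OF H.one_closed f, of r] f by simp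
  then show ?thesis
    unfolding sd_smult_def one using \<theta>_mult[OF hall_smult_closed[OF H.one_closed r] f] by (simp add: one)
qed

lemma mem_sd_degree_part:
  "y \<in> sd_degree_part d \<longleftrightarrow> (\<exists>f s k. y = L.frac {f} {s} \<and> f \<in> carrier (hall :: ('k iclass \<Rightarrow> real) ring) \<and> hall_denom s k \<and>
     (\<forall>c. f c \<noteq> 0 \<longrightarrow> int (dim_k (rep c)) = d + int k))"
proof
  assume "y \<in> sd_degree_part d"
  then obtain f a and K :: "('k poly set, nat) module" where y: "y = L.frac {f} {\<lambda>c. a * hclass K c}" "f \<in> carrier hall"
    "a \<in> \<rat>" "a \<noteq> 0" "pd_le_one K" "\<forall>c. f c \<noteq> 0 \<longrightarrow> int (dim_k (rep c)) - int (dim_k K) = d"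
    unfolding sd_degree_part_def coset_eq by blast
  have "hall_denom (\<lambda>c. a * hclass K c) (dim_k K)" unfolding hall_denom_def using y(3-5) by blast
  moreover have "\<forall>c. f c \<noteq> 0 \<longrightarrow> int (dim_k (rep c)) = d + int (dim_k K)" using y(6) by force
  ultimately show "\<exists>f s k. y = L.frac {f} {s} \<and> f \<in> carrier hall \<and> hall_denom s k \<and>
     (\<forall>c. f c \<noteq> 0 \<longrightarrow> int (dim_k (rep c)) = d + int k)" using y(1,2) by blast
next
  assume "\<exists>f s k. y = L.frac {f} {s} \<and> f \<in> carrier hall \<and> hall_denom s k \<and>
     (\<forall>c. f c \<noteq> 0 \<longrightarrow> int (dim_k (rep c)) = d + int k)"
  then obtain f s k where y: "y = L.frac {f} {s}" "f \<in> carrier hall" "hall_denom s k"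
     "\<forall>c. f c \<noteq> 0 \<longrightarrow> int (dim_k (rep c)) = d + int k" by blast
  then obtain a K where s: "s = (\<lambda>c. a * hclass (K :: ('k poly set, nat) module) c)" "a \<in> \<rat>" "a \<noteq> 0" "pd_le_one K" "dim_k K = k"
    unfolding hall_denom_def by blast
  have "\<forall>c. f c \<noteq> 0 \<longrightarrow> int (dim_k (rep c)) - int (dim_k K) = d" using y(4) s(5) by simp
  then show "y \<in> sd_degree_part d"
    unfolding sd_degree_part_def coset_eq y(1) s(1) using y(2) s(2-4) by blast
qed

lemma hall_proj_homogeneous:
  assumes "\<forall>c. f c \<noteq> 0 \<longrightarrow> int (dim_k (rep c)) = d"
  shows "hall_proj d f = f" "e \<noteq> d \<Longrightarrow> hall_proj e f = (\<lambda>_. 0)"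
  using assms by (auto simp: hall_proj_def fun_eq_iff)

lemma hall_proj_add: "hall_proj d (f \<oplus>\<^bsub>hall\<^esub> g) = hall_proj d f \<oplus>\<^bsub>hall\<^esub> hall_proj d g"
  by (auto simp: hall_proj_def fun_eq_iff hall_simps)

lemma frac_zero:
  assumes "hall_denom s k"
  shows "L.frac {\<lambda>_ :: 'k iclass. 0} {s} = \<zero>\<^bsub>sd_hall\<^esub>"
proof -
  note c = denom_closed[OF assms] L.S_carrier[OF denom_closed[OF assms]]
  have "L.frac (\<zero>\<^bsub>hall_quot\<^esub> \<otimes>\<^bsub>hall_quot\<^esub> {s}) (\<one>\<^bsub>hall_quot\<^esub> \<otimes>\<^bsub>hall_quot\<^esub> {s}) = L.frac \<zero>\<^bsub>hall_quot\<^esub> \<one>\<^bsub>hall_quot\<^esub>"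
    by (intro L.frac_cancel L.zero_closed L.S_one c)
  then show ?thesis
    unfolding L.l_null[OF c(2)] L.l_one[OF c(2)] by (simp add: sd_hall_def L.zero_localization hall_quot_simps(3))
qed

text \<open>A finite family of homogeneous fractions is brought to one denominator \<open>s\<close>
  of dimension \<open>k\<close>; the member of degree \<open>d\<close> becomes the part of the
  common numerator in dimension \<open>d + k\<close>. This is how the members can be recovered from
  the sum.\<close>

lemma homogeneous_sum:
  assumes "finite D" "\<And>d. d \<in> D \<Longrightarrow> h d \<in> (sd_degree_part d :: 'k ihall_elt set)"
  shows "\<exists>r s k. r \<in> carrier hall \<and> hall_denom s k \<and> (\<Oplus>\<^bsub>sd_hall\<^esub>d\<in>D. h d) = L.frac {r} {s} \<and>
    (\<forall>d\<in>D. h d = L.frac {hall_proj (d + int k) r} {s}) \<and> (\<forall>d. d \<notin> D \<longrightarrow> hall_proj (d + int k) r = (\<lambda>_. 0))"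
  using assms
proof (induction D)
  case empty
  have "(\<Oplus>\<^bsub>sd_hall\<^esub>d\<in>{}. h d) = L.frac {\<lambda>_. 0} {\<one>\<^bsub>hall\<^esub>}" by (simp add: \<theta>_zero hall_to_sd_frac)
  moreover have "hall_proj (d + int 0) (\<lambda>_ :: 'k iclass. 0) = (\<lambda>_. 0)" for d by (auto simp: hall_proj_def)
  ultimately show ?case using zero_in_hall hall_denom_one by blast
next
  case (insert e D)
  then obtain r s k where r: "r \<in> carrier hall" "hall_denom s k" "(\<Oplus>\<^bsub>sd_hall\<^esub>d\<in>D. h d) = L.frac {r} {s}"
    "\<And>d. d \<in> D \<Longrightarrow> h d = L.frac {hall_proj (d + int k) r} {s}" "\<And>d. d \<notin> D \<Longrightarrow> hall_proj (d + int k) r = (\<lambda>_. 0)"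
    by blast
  obtain r0 s0 k0 where r0: "h e = L.frac {r0} {s0}" "r0 \<in> carrier hall" "hall_denom s0 k0" 
    "\<forall>c. r0 c \<noteq> 0 \<longrightarrow> int (dim_k (rep c)) = e + int k0"
    using insert(4)[of e] unfolding mem_sd_degree_part by blast
  note c = hall_denom_closed[OF r(2)] hall_denom_closed[OF r0(3)]
  note qc = quot_closed[OF r(1)] denom_closed[OF r(2)] quot_closed[OF r0(2)] denom_closed[OF r0(3)]
  have hD: "h d \<in> carrier sd_hall" if d: "d \<in> insert e D" for d
  proof -
    obtain f s' k' where "h d = L.frac {f} {s'}" "f \<in> carrier hall" "hall_denom s' k'" 
      using insert(4)[OF d] unfolding mem_sd_degree_part by blast
    then show ?thesis unfolding sd_hall_def using L.frac_closed quot_closed denom_closed by metis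
  qed
  define R where "R = (r0 \<otimes>\<^bsub>hall\<^esub> s) \<oplus>\<^bsub>hall\<^esub> (r \<otimes>\<^bsub>hall\<^esub> s0)"
  have Rc: "R \<in> carrier hall" using r r0 c by (simp add: R_def)
  have den: "hall_denom (s0 \<otimes>\<^bsub>hall\<^esub> s) (k0 + k)" by (rule hall_denom_mult[OF r0(3) r(2)])
  have "(\<Oplus>\<^bsub>sd_hall\<^esub>d\<in>insert e D. h d) = h e \<oplus>\<^bsub>sd_hall\<^esub> (\<Oplus>\<^bsub>sd_hall\<^esub>d\<in>D. h d)"
    using insert(1,2) hD by (subst Q.finsum_insert) auto
  also have "\<dots> = L.frac {r0} {s0} \<oplus>\<^bsub>sd_hall\<^esub> L.frac {r} {s}" by (simp only: r0(1) r(3))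
  also have "\<dots> = L.frac {R} {s0 \<otimes>\<^bsub>hall\<^esub> s}"
    unfolding sd_hall_def L.frac_add[OF qc(3,4,1,2)] by (simp add: hall_quot_simps R_def)
  finally have sum: "(\<Oplus>\<^bsub>sd_hall\<^esub>d\<in>insert e D. h d) = L.frac {R} {s0 \<otimes>\<^bsub>hall\<^esub> s}" .
  have pR: "hall_proj (d + int (k0 + k)) R = (hall_proj (d + int k0) r0 \<otimes>\<^bsub>hall\<^esub> s) \<oplus>\<^bsub>hall\<^esub> (hall_proj (d + int k) r \<otimes>\<^bsub>hall\<^esub> s0)" for d
    using hall_proj_mult_denom[OF r0(2) r(2), of "d + int k0"] hall_proj_mult_denom[OF r(1) r0(3), of "d + int k"]
    by (simp add: R_def hall_proj_add algebra_simps)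
  have r0': "hall_proj (e + int k0) r0 = r0" "d \<noteq> e \<Longrightarrow> hall_proj (d + int k0) r0 = (\<lambda>_. 0)" for d
    using hall_proj_homogeneous[OF r0(4)] by auto
  have z: "(\<lambda>_. 0) \<otimes>\<^bsub>hall\<^esub> x = (\<lambda>_ :: 'k iclass. 0)" "(\<lambda>_. 0) \<oplus>\<^bsub>hall\<^esub> x = x" "x \<oplus>\<^bsub>hall\<^esub> (\<lambda>_. 0) = x" if "x \<in> carrier hall" for x
    using H.l_null[OF that] H.l_zero[OF that] H.r_zero[OF that] by (simp_all only: hall_simps(2))
  have "h d = L.frac {hall_proj (d + int (k0 + k)) R} {s0 \<otimes>\<^bsub>hall\<^esub> s}" if d: "d \<in> insert e D" for d
  proof (cases "d = e")
    case True
    have "hall_proj (d + int (k0 + k)) R = r0 \<otimes>\<^bsub>hall\<^esub> s"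
      unfolding pR True r0'(1) r(5)[OF insert(2)] using c r0(2) by (simp add: z)
    then show ?thesis
      using L.frac_cancel[OF qc(3,4,2)] r0(1) True by (simp add: hall_quot_simps)
  next
    case False
    then have dD: "d \<in> D" using d by simp
    have p: "hall_proj (d + int k) r \<in> carrier hall" by (rule hall_proj_closed[OF r(1)])
    have "hall_proj (d + int (k0 + k)) R = hall_proj (d + int k) r \<otimes>\<^bsub>hall\<^esub> s0"
      unfolding pR r0'(2)[OF False] using c p by (simp add: z)
    moreover have "s0 \<otimes>\<^bsub>hall\<^esub> s = s \<otimes>\<^bsub>hall\<^esub> s0" by (rule hall_denom_central[OF r0(3) c(1)])
    ultimately show ?thesis
      using L.frac_cancel[OF quot_closed[OF p] qc(2,4)] r(4)[OF dD] by (simp add: hall_quot_simps)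
  qed
  moreover have "hall_proj (d + int (k0 + k)) R = (\<lambda>_. 0)" if "d \<notin> insert e D" for d
    unfolding pR using that r0'(2)[of d] r(5)[of d] c by (simp add: z zero_in_hall)
  ultimately show ?case using Rc den sum by blast
qed

text \<open>Equality of fractions yields only \<open>f s u = r u\<close> for some denominator
  \<open>u\<close>. Projected to one degree it becomes the same relation between homogeneous parts,
  which is an equality of fractions again.\<close>

lemma sd_component_unique:
  assumes f: "f \<in> carrier hall" and h: "\<And>d. h d \<in> (sd_degree_part d :: 'k ihall_elt set)" 
    and fin: "finite {d. h d \<noteq> \<zero>\<^bsub>sd_hall\<^esub>}"
    and sum: "\<theta> f = (\<Oplus>\<^bsub>sd_hall\<^esub>d\<in>{d. h d \<noteq> \<zero>\<^bsub>sd_hall\<^esub>}. h d)"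
  shows "h d = \<theta> (hall_proj d f)"
proof -
  let ?D = "{d. h d \<noteq> \<zero>\<^bsub>sd_hall\<^esub>}"
  obtain r s k where r: "r \<in> carrier hall" "hall_denom s k" "(\<Oplus>\<^bsub>sd_hall\<^esub>d\<in>?D. h d) = L.frac {r} {s}"
    "\<And>d. d \<in> ?D \<Longrightarrow> h d = L.frac {hall_proj (d + int k) r} {s}" "\<And>d. d \<notin> ?D \<Longrightarrow> hall_proj (d + int k) r = (\<lambda>_. 0)"
    using homogeneous_sum[OF fin h] by blast
  have c: "s \<in> carrier hall" by (rule hall_denom_closed[OF r(2)])
  note one = denom_closed[OF hall_denom_one]
  have "L.frac {f} {\<one>\<^bsub>hall\<^esub>} = L.frac {r} {s}" using sum r(3) by (simp add: hall_to_sd_frac)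
  then obtain U where U: "U \<in> hall_denoms" "{f} \<otimes>\<^bsub>hall_quot\<^esub> ({s} \<otimes>\<^bsub>hall_quot\<^esub> U) = {r} \<otimes>\<^bsub>hall_quot\<^esub> ({\<one>\<^bsub>hall\<^esub>} \<otimes>\<^bsub>hall_quot\<^esub> U)"
    using L.frac_eq_iff[OF quot_closed[OF f] one quot_closed[OF r(1)] denom_closed[OF r(2)]] by blast
  obtain u l where u: "U = {u}" "hall_denom u l" using mem_hall_denoms(2)[OF U(1)] by blast
  have uc: "u \<in> carrier hall" by (rule hall_denom_closed[OF u(2)])
  have eq: "f \<otimes>\<^bsub>hall\<^esub> (s \<otimes>\<^bsub>hall\<^esub> u) = r \<otimes>\<^bsub>hall\<^esub> u" using U(2) uc unfolding u(1) by (simp add: hall_quot_simps)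
  have "hall_proj d f \<otimes>\<^bsub>hall\<^esub> (s \<otimes>\<^bsub>hall\<^esub> u) = hall_proj (d + int (k + l)) (f \<otimes>\<^bsub>hall\<^esub> (s \<otimes>\<^bsub>hall\<^esub> u))"
    by (rule hall_proj_mult_denom[OF f hall_denom_mult[OF r(2) u(2)], symmetric])
  also have "\<dots> = hall_proj (d + int k) r \<otimes>\<^bsub>hall\<^esub> u"
    unfolding eq using hall_proj_mult_denom[OF r(1) u(2), of "d + int k"] by (simp add: algebra_simps)
  finally have pe: "hall_proj d f \<otimes>\<^bsub>hall\<^esub> (s \<otimes>\<^bsub>hall\<^esub> u) = hall_proj (d + int k) r \<otimes>\<^bsub>hall\<^esub> u" .
  have "L.frac {hall_proj d f} {\<one>\<^bsub>hall\<^esub>} = L.frac {hall_proj (d + int k) r} {s}"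
    using L.frac_eq_iff[OF quot_closed[OF hall_proj_closed[OF f]] one quot_closed[OF hall_proj_closed[OF r(1)]] denom_closed[OF r(2)]]
      denom_closed[OF u(2)] pe uc by (auto simp: hall_quot_simps intro!: bexI[of _ "{u}"])
  then have "\<theta> (hall_proj d f) = L.frac {hall_proj (d + int k) r} {s}" by (simp add: hall_to_sd_frac)
  then show ?thesis using r(4)[of d] r(5)[of d] frac_zero[OF r(2)] by (cases "d \<in> ?D") auto
qed

lemma hall_proj_support:
  assumes "f \<in> carrier (hall :: ('k iclass \<Rightarrow> real) ring)"
  shows "finite ((\<lambda>c. int (dim_k (rep c))) ` {c. f c \<noteq> 0})"
    and "d \<notin> (\<lambda>c. int (dim_k (rep c))) ` {c. f c \<noteq> 0} \<Longrightarrow> hall_proj d f = (\<lambda>_. 0)"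
  using assms by (auto simp: mem_carrier_hall hall_proj_def fun_eq_iff)

lemma sum_hall_proj:
  assumes "finite D" "(\<lambda>c. int (dim_k (rep c))) ` {c. f c \<noteq> 0} \<subseteq> D"
  shows "(\<Sum>d\<in>D. hall_proj d f c) = f c"
  using assms by (cases "f c = 0") (auto simp: hall_proj_def)

lemma finsum_zero_outside:
  assumes "finite D'" "{d. y d \<noteq> \<zero>\<^bsub>sd_hall\<^esub>} \<subseteq> D \<inter> D'" "D \<subseteq> D'" "\<And>d. y d \<in> carrier (sd_hall :: 'k ihall_elt ring)"
  shows "(\<Oplus>\<^bsub>sd_hall\<^esub>d\<in>D. y d) = (\<Oplus>\<^bsub>sd_hall\<^esub>d\<in>D'. y d)"
  using assms by (intro Q.add.finprod_mono_neutral_cong_left) auto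

text \<open>\<open>sd_component\<close> is a definite description, so both halves matter: the
  projections of \<open>f\<close> form a decomposition, and \<open>sd_component_unique\<close>
  excludes any other.\<close>

lemma sd_component_\<theta>:
  assumes f: "f \<in> carrier hall"
  shows "sd_component (\<theta> f) = (\<lambda>d. \<theta> (hall_proj d f))"
  unfolding sd_component_def
proof (rule the_equality)
  note D = hall_proj_support[OF f]
  let ?D = "(\<lambda>c. int (dim_k (rep c))) ` {c. f c \<noteq> 0}"
  have sub: "{d. \<theta> (hall_proj d f) \<noteq> \<zero>\<^bsub>sd_hall\<^esub>} \<subseteq> ?D" using D(2) \<theta>_zero by (metis (mono_tags, lifting) mem_Collect_eq subsetI)
  have "\<theta> (hall_proj d f) \<in> sd_degree_part d" for d
    unfolding mem_sd_degree_part hall_to_sd_frac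
    using hall_proj_closed[OF f] hall_denom_one
    by (intro exI[of _ "hall_proj d f"] exI[of _ "\<one>\<^bsub>hall\<^esub>"] exI[of _ 0]) (auto simp: hall_proj_def split: if_splits) 
  moreover have "finite {d. \<theta> (hall_proj d f) \<noteq> \<zero>\<^bsub>sd_hall\<^esub>}" by (rule finite_subset[OF sub D(1)])
  moreover have "(\<Oplus>\<^bsub>sd_hall\<^esub>d\<in>{d. \<theta> (hall_proj d f) \<noteq> \<zero>\<^bsub>sd_hall\<^esub>}. \<theta> (hall_proj d f)) = (\<Oplus>\<^bsub>sd_hall\<^esub>d\<in>?D. \<theta> (hall_proj d f))"
    using sub D(1) \<theta>_closed[OF hall_proj_closed[OF f]] by (intro finsum_zero_outside) auto
  moreover have "(\<Oplus>\<^bsub>sd_hall\<^esub>d\<in>?D. \<theta> (hall_proj d f)) = \<theta> f"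
    unfolding \<theta>_sum[OF D(1) hall_proj_closed[OF f]] sum_hall_proj[OF D(1) order_refl] ..
  ultimately show "(\<forall>d. \<theta> (hall_proj d f) \<in> sd_degree_part d) \<and> finite {d. \<theta> (hall_proj d f) \<noteq> \<zero>\<^bsub>sd_hall\<^esub>} \<and>
     \<theta> f = (\<Oplus>\<^bsub>sd_hall\<^esub>d\<in>{d. \<theta> (hall_proj d f) \<noteq> \<zero>\<^bsub>sd_hall\<^esub>}. \<theta> (hall_proj d f))" by metis
next
  fix h assume "(\<forall>d. h d \<in> sd_degree_part d) \<and> finite {d. h d \<noteq> \<zero>\<^bsub>sd_hall\<^esub>} \<and>
     \<theta> f = (\<Oplus>\<^bsub>sd_hall\<^esub>d\<in>{d. h d \<noteq> \<zero>\<^bsub>sd_hall\<^esub>}. h d)"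
  then show "h = (\<lambda>d. \<theta> (hall_proj d f))" using sd_component_unique[OF f, of h] by blast
qed

end

section \<open>The twisted product computed on numerators\<close>

locale twisted_hall = hall_ring T for T :: "'k::{field,finite} itself" +
  fixes v :: real
  assumes v_eq: "v = qsqrt TYPE('k)"
begin

lemma v_pos: "v > 1" "v > 0" "v \<noteq> 0"
  using qsqrt_gt_one[where 'k = 'k] by (auto simp: v_eq)

lemma v_square: "v\<^sup>2 = real (card (UNIV :: 'k set))"
  by (simp add: v_eq qsqrt_square)

lemma v_square_rat: "v\<^sup>2 \<in> \<rat>"
  by (simp add: v_square)

lemmas Qv_intros = Q_adjoin_intros[OF v_square_rat] Q_adjoin_qint[OF v_square_rat] Q_adjoin_qfact[OF v_square_rat]

lemma Qv_rat: "r \<in> \<rat> \<Longrightarrow> r \<in> Q_adjoin v"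
  by (rule Q_adjoin_rat[OF v_square_rat])

lemma smult_closed:
  "f \<in> carrier (hall :: ('k iclass \<Rightarrow> real) ring) \<Longrightarrow> r \<in> Q_adjoin v \<Longrightarrow> (\<lambda>c. r * f c) \<in> carrier hall"
  by (rule hall_smult_closed) (simp_all add: v_eq)

text \<open>
  The cocycle \<open>(d, e) \<mapsto> d e\<close> is the coboundary of \<open>d \<mapsto> d choose 2\<close>, so rescaling the class of
  \<open>M\<close> by \<open>v ^ (dim M choose 2)\<close> turns the product of the Hall algebra into the twisted one.
\<close>

definition untwist :: "('k iclass \<Rightarrow> real) \<Rightarrow> 'k iclass \<Rightarrow> real" where
  "untwist f = (\<lambda>c. v ^ (dim_k (rep c) choose 2) * f c)"

definition \<Theta> :: "('k iclass \<Rightarrow> real) \<Rightarrow> 'k ihall_elt" where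
  "\<Theta> f = \<theta> (untwist f)"

lemma untwist_closed: "f \<in> carrier hall \<Longrightarrow> untwist f \<in> carrier hall"
  using v_pos by (auto simp: mem_carrier_hall untwist_def simp flip: v_eq intro!: Qv_intros)

lemma choose_two_add: "(m + n) choose 2 = (m choose 2) + (n choose 2) + m * n" for m n :: nat
  by (induction m) (simp_all add: numeral_2_eq_2)

text \<open>A pair of classes \<open>a\<close>, \<open>b\<close> contributes only for
  \<open>d = dim a\<close> and \<open>e = dim b\<close>. Where the Hall number is nonzero,
  \<open>dim c = dim a + dim b\<close>, and the factor with exponent \<open>dim a * dim b\<close> is
  the discrepancy between the binomials in \<open>choose_two_add\<close>.\<close>

lemma twisted_sum:
  assumes f: "f \<in> carrier hall" and g: "g \<in> carrier hall" and D: "finite D" "(\<lambda>c. int (dim_k (rep c))) ` {c. f c \<noteq> 0} \<subseteq> D"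
    and E: "finite E" "(\<lambda>c. int (dim_k (rep c))) ` {c. g c \<noteq> 0} \<subseteq> E"
  shows "(\<Sum>d\<in>D. \<Sum>e\<in>E. v powi (d * e) * (hall_proj d (untwist f) \<otimes>\<^bsub>hall\<^esub> hall_proj e (untwist g)) c) = untwist (f \<otimes>\<^bsub>hall\<^esub> g) c"
proof (cases "c \<in> isoclasses")
  case False
  have "(h \<otimes>\<^bsub>hall\<^esub> h') c = 0" for h h' :: "'k iclass \<Rightarrow> real" using False by (simp add: hall_def)
  then show ?thesis by (simp add: untwist_def)
next
  case True
  let ?d = "\<lambda>a :: 'k iclass. dim_k (rep a)"
  let ?F = "untwist f" and ?G = "untwist g"
  let ?A = "{a. f a \<noteq> 0}" and ?B = "{b. g b \<noteq> 0}"
  have fin: "finite ?A" "finite ?B" and iso: "\<And>a. f a \<noteq> 0 \<Longrightarrow> a \<in> isoclasses" "\<And>b. g b \<noteq> 0 \<Longrightarrow> b \<in> isoclasses"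
    using f g by (auto simp: mem_carrier_hall)
  have p: "(hall_proj d ?F \<otimes>\<^bsub>hall\<^esub> hall_proj e ?G) c = 
      (\<Sum>a\<in>?A. \<Sum>b\<in>?B. hall_proj d ?F a * hall_proj e ?G b * hall_number a b c)" for d e
    using True by (subst hall_mult_apply[OF fin(1) _ fin(2)]) (auto simp: hall_proj_def untwist_def split: if_splits)
  have "(\<Sum>d\<in>D. \<Sum>e\<in>E. v powi (d * e) * (hall_proj d ?F \<otimes>\<^bsub>hall\<^esub> hall_proj e ?G) c) =
      (\<Sum>d\<in>D. \<Sum>e\<in>E. \<Sum>a\<in>?A. \<Sum>b\<in>?B. v powi (d * e) * (hall_proj d ?F a * hall_proj e ?G b * hall_number a b c))"
    by (simp only: p sum_distrib_left)
  \<comment> \<open>The sums over classes move outside, so that for each pair the sums over degrees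
    collapse to one term.\<close>
  also have "\<dots> = (\<Sum>d\<in>D. \<Sum>a\<in>?A. \<Sum>e\<in>E. \<Sum>b\<in>?B. v powi (d * e) * (hall_proj d ?F a * hall_proj e ?G b * hall_number a b c))"
    by (intro sum.cong refl sum.swap)
  also have "\<dots> = (\<Sum>a\<in>?A. \<Sum>d\<in>D. \<Sum>b\<in>?B. \<Sum>e\<in>E. v powi (d * e) * (hall_proj d ?F a * hall_proj e ?G b * hall_number a b c))"
    by (subst sum.swap, intro sum.cong refl sum.swap)
  also have "\<dots> = (\<Sum>a\<in>?A. \<Sum>b\<in>?B. \<Sum>d\<in>D. \<Sum>e\<in>E. v powi (d * e) * (hall_proj d ?F a * hall_proj e ?G b * hall_number a b c))"
    by (intro sum.cong refl sum.swap)
  also have "\<dots> = (\<Sum>a\<in>?A. \<Sum>b\<in>?B. v ^ (?d c choose 2) * (f a * g b * hall_number a b c))"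
  proof (intro sum.cong refl)
    fix a b assume ab: "a \<in> ?A" "b \<in> ?B"
    have mem: "int (?d a) \<in> D" "int (?d b) \<in> E" using ab D(2) E(2) by auto
    have "(\<Sum>d\<in>D. \<Sum>e\<in>E. v powi (d * e) * (hall_proj d ?F a * hall_proj e ?G b * hall_number a b c)) =
       (\<Sum>d\<in>D. if int (?d a) = d then (\<Sum>e\<in>E. if int (?d b) = e then v powi (d * e) * (?F a * ?G b * hall_number a b c) else 0) else 0)"
      by (intro sum.cong refl) (auto simp: hall_proj_def intro!: sum.cong)
    also have "\<dots> = v powi (int (?d a) * int (?d b)) * (?F a * ?G b * hall_number a b c)"
      using D(1) E(1) mem by simp
    also have "\<dots> = v ^ (?d c choose 2) * (f a * g b * hall_number a b c)"
    proof (cases "hall_number a b c = 0")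
      case False
      then have dc: "?d c = ?d a + ?d b" using hall_number_dim[of a b c] iso ab True by auto
      have "v powi (int (?d a) * int (?d b)) = v ^ (?d a * ?d b)" by (simp flip: of_nat_mult)
      then show ?thesis unfolding dc choose_two_add by (simp add: untwist_def power_add mult_ac)
    qed simp
    finally show "(\<Sum>d\<in>D. \<Sum>e\<in>E. v powi (d * e) * (hall_proj d ?F a * hall_proj e ?G b * hall_number a b c)) = 
      v ^ (?d c choose 2) * (f a * g b * hall_number a b c)" .
  qed
  also have "\<dots> = untwist (f \<otimes>\<^bsub>hall\<^esub> g) c"
    unfolding untwist_def using True by (subst hall_mult_apply[OF fin(1) _ fin(2)]) (auto simp: sum_distrib_left)
  finally show ?thesis .
qed

text \<open>The defining sums run over degrees whose components are nonzero in the localization,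
  while the formula for numerators runs over the degrees in the supports. The latter sets may be
  larger, but their additional terms vanish.\<close>

lemma sd_twisted_mult_\<Theta>:
  assumes f: "f \<in> carrier hall" and g: "g \<in> carrier hall"
  shows "sd_twisted_mult (\<Theta> f) (\<Theta> g) = \<Theta> (f \<otimes>\<^bsub>hall\<^esub> g)"
proof -
  let ?F = "untwist f" and ?G = "untwist g"
  have F: "?F \<in> carrier hall" and G: "?G \<in> carrier hall" using untwist_closed f g by auto
  have supp: "{c. ?F c \<noteq> 0} = {c. f c \<noteq> 0}" "{c. ?G c \<noteq> 0} = {c. g c \<noteq> 0}" using v_pos by (auto simp: untwist_def)
  let ?D' = "(\<lambda>c. int (dim_k (rep c))) ` {c. f c \<noteq> 0}" and ?E' = "(\<lambda>c. int (dim_k (rep c))) ` {c. g c \<noteq> 0}"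
  define D where "D = {d. \<theta> (hall_proj d ?F) \<noteq> \<zero>\<^bsub>sd_hall\<^esub>}"
  define E where "E = {d. \<theta> (hall_proj d ?G) \<noteq> \<zero>\<^bsub>sd_hall\<^esub>}"
  note sF = hall_proj_support[OF F, unfolded supp] and sG = hall_proj_support[OF G, unfolded supp]
  have DE: "D \<subseteq> ?D'" "E \<subseteq> ?E'" using sF(2) sG(2) \<theta>_zero by (auto simp: D_def E_def)
  note pF = hall_proj_closed[OF F] and pG = hall_proj_closed[OF G]
  have Q: "v powi k \<in> Q_adjoin v" for k by (intro Qv_intros)
  define P where "P d e = (\<lambda>c. v powi (d * e) * (hall_proj d ?F \<otimes>\<^bsub>hall\<^esub> hall_proj e ?G) c)" for d e
  have P: "P d e \<in> carrier hall" for d e unfolding P_def by (intro smult_closed H.m_closed pF pG Q)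
  have trm: "sd_smult (v powi (d * e)) (\<theta> (hall_proj d ?F) \<otimes>\<^bsub>sd_hall\<^esub> \<theta> (hall_proj e ?G)) = \<theta> (P d e)" for d e
    unfolding \<theta>_mult[OF pF pG] sd_smult_\<theta>[folded v_eq, OF H.m_closed[OF pF pG] Q] P_def ..
  have null: "\<theta> (P d e) = \<zero>\<^bsub>sd_hall\<^esub>" if "d \<notin> D \<or> e \<notin> E" for d e
  proof -
    have z: "\<theta> (\<lambda>_. 0) \<otimes>\<^bsub>sd_hall\<^esub> \<theta> h = \<theta> (\<lambda>_. 0)" "\<theta> h \<otimes>\<^bsub>sd_hall\<^esub> \<theta> (\<lambda>_. 0) = \<theta> (\<lambda>_. 0)" if "h \<in> carrier hall" for h
      unfolding \<theta>_mult[OF zero_in_hall that] \<theta>_mult[OF that zero_in_hall]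
      using H.l_null[OF that] H.r_null[OF that] by (simp_all add: hall_simps)
    have "\<theta> (hall_proj d ?F) \<otimes>\<^bsub>sd_hall\<^esub> \<theta> (hall_proj e ?G) = \<theta> (\<lambda>_. 0)"
      using that z pF pG by (auto simp: D_def E_def \<theta>_zero)
    then show ?thesis using trm[of d e] sd_smult_\<theta>[folded v_eq, OF zero_in_hall Q] by (simp add: \<theta>_zero)
  qed
  have EE: "(\<Oplus>\<^bsub>sd_hall\<^esub>e\<in>E. \<theta> (P d e)) = (\<Oplus>\<^bsub>sd_hall\<^esub>e\<in>?E'. \<theta> (P d e))" for d
  proof (rule finsum_zero_outside[OF sG(1) _ DE(2)])
    show "{e. \<theta> (P d e) \<noteq> \<zero>\<^bsub>sd_hall\<^esub>} \<subseteq> E \<inter> ?E'" using null[of d] DE(2) by blast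
  qed (rule \<theta>_closed[OF P])
  have "sd_twisted_mult (\<Theta> f) (\<Theta> g) = (\<Oplus>\<^bsub>sd_hall\<^esub>d\<in>D. \<Oplus>\<^bsub>sd_hall\<^esub>e\<in>E. \<theta> (P d e))"
    unfolding sd_twisted_mult_def v_eq[symmetric] \<Theta>_def sd_component_\<theta>[OF F] sd_component_\<theta>[OF G] trm D_def E_def ..
  also have "\<dots> = (\<Oplus>\<^bsub>sd_hall\<^esub>d\<in>D. \<Oplus>\<^bsub>sd_hall\<^esub>e\<in>?E'. \<theta> (P d e))"
    by (simp only: EE)
  also have "\<dots> = (\<Oplus>\<^bsub>sd_hall\<^esub>d\<in>D. \<theta> (\<lambda>c. \<Sum>e\<in>?E'. P d e c))"
    unfolding \<theta>_sum[OF sG(1) P] ..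
  also have "\<dots> = (\<Oplus>\<^bsub>sd_hall\<^esub>d\<in>?D'. \<theta> (\<lambda>c. \<Sum>e\<in>?E'. P d e c))"
  proof (rule finsum_zero_outside)
    have "\<theta> (\<lambda>c. \<Sum>e\<in>?E'. P d e c) = \<zero>\<^bsub>sd_hall\<^esub>" if "d \<notin> D" for d
      unfolding \<theta>_sum[OF sG(1) P, symmetric] using null[of d] that by (simp add: Q.finsum_zero)
    then show "{d. \<theta> (\<lambda>c. \<Sum>e\<in>?E'. P d e c) \<noteq> \<zero>\<^bsub>sd_hall\<^esub>} \<subseteq> D \<inter> ?D'" using DE(1) by blast
  qed (use DE sF(1) in \<open>auto intro!: \<theta>_closed hall_sum_closed P\<close>)
  also have "\<dots> = \<theta> (\<lambda>c. \<Sum>d\<in>?D'. \<Sum>e\<in>?E'. P d e c)"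
    by (rule \<theta>_sum[OF sF(1)]) (intro hall_sum_closed P)
  also have "(\<lambda>c. \<Sum>d\<in>?D'. \<Sum>e\<in>?E'. P d e c) = untwist (f \<otimes>\<^bsub>hall\<^esub> g)"
    unfolding P_def by (rule ext) (rule twisted_sum[OF f g sF(1) order_refl sG(1) order_refl])
  finally show ?thesis by (simp add: \<Theta>_def)
qed

lemma ihall_simps [simp]:
  "carrier ihall = carrier (sd_hall :: 'k ihall_elt ring)" "x \<oplus>\<^bsub>ihall\<^esub> y = x \<oplus>\<^bsub>(sd_hall :: 'k ihall_elt ring)\<^esub> y"
  "\<zero>\<^bsub>ihall\<^esub> = \<zero>\<^bsub>(sd_hall :: 'k ihall_elt ring)\<^esub>" "\<one>\<^bsub>ihall\<^esub> = \<one>\<^bsub>(sd_hall :: 'k ihall_elt ring)\<^esub>"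
  "x \<otimes>\<^bsub>ihall\<^esub> y = sd_twisted_mult x y" "r \<odot>\<^bsub>ihall\<^esub> x = sd_smult r x" for x y :: "'k ihall_elt"
  by (simp_all add: ihall_def)

lemma \<Theta>_add: "f \<in> carrier hall \<Longrightarrow> g \<in> carrier hall \<Longrightarrow> \<Theta> f \<oplus>\<^bsub>ihall\<^esub> \<Theta> g = \<Theta> (\<lambda>c. f c + g c)"
  by (simp add: \<Theta>_def \<theta>_add untwist_closed) (simp add: untwist_def ring_distribs)

lemma \<Theta>_mult: "f \<in> carrier hall \<Longrightarrow> g \<in> carrier hall \<Longrightarrow> \<Theta> f \<otimes>\<^bsub>ihall\<^esub> \<Theta> g = \<Theta> (f \<otimes>\<^bsub>hall\<^esub> g)"
  by (simp add: sd_twisted_mult_\<Theta>)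

lemma \<Theta>_smult: "f \<in> carrier hall \<Longrightarrow> r \<in> Q_adjoin v \<Longrightarrow> r \<odot>\<^bsub>ihall\<^esub> \<Theta> f = \<Theta> (\<lambda>c. r * f c)"
  by (simp add: \<Theta>_def sd_smult_\<theta>[folded v_eq] untwist_closed) (simp add: untwist_def mult_ac)

lemma \<Theta>_one: "\<one>\<^bsub>ihall\<^esub> = \<Theta> \<one>\<^bsub>hall\<^esub>"
proof -
  have "untwist (hclass zero_mod) = (hclass zero_mod :: 'k iclass \<Rightarrow> real)"
  proof -
    have "dim_k (rep (isoclass (zero_mod :: ('k poly set, nat) module))) = 0"
      unfolding dim_k_rep_isoclass[OF fd_zero_mod] by (rule dim_k_eqI[OF fd_zero_mod]) simp
    then show ?thesis by (auto simp: untwist_def hclass_def fun_eq_iff numeral_2_eq_2)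
  qed
  then show ?thesis by (simp add: \<Theta>_def \<theta>_one hall_simps)
qed

text \<open>\<open>ihall\<close> and \<open>sd_hall\<close> share addition and zero, and finite sums
  depend only on these.\<close>

lemma \<Theta>_sum:
  assumes "finite I" "\<And>i. i \<in> I \<Longrightarrow> F i \<in> carrier (hall :: ('k iclass \<Rightarrow> real) ring)"
  shows "(\<Oplus>\<^bsub>ihall\<^esub>i\<in>I. \<Theta> (F i)) = \<Theta> (\<lambda>c. \<Sum>i\<in>I. F i c)"
proof -
  have "(\<Oplus>\<^bsub>ihall\<^esub>i\<in>I. \<Theta> (F i)) = (\<Oplus>\<^bsub>sd_hall\<^esub>i\<in>I. \<theta> (untwist (F i)))"
    unfolding \<Theta>_def ihall_def finsum_def finprod_def by simp
  also have "\<dots> = \<theta> (\<lambda>c. \<Sum>i\<in>I. untwist (F i) c)" using assms by (intro \<theta>_sum untwist_closed)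
  finally show ?thesis by (simp add: \<Theta>_def untwist_def sum_distrib_left)
qed

lemma \<Theta>_pow: "f \<in> carrier hall \<Longrightarrow> \<Theta> f [^]\<^bsub>ihall\<^esub> (n :: nat) = \<Theta> (f [^]\<^bsub>hall\<^esub> n)"
proof (induction n)
  case 0
  then show ?case by (simp add: nat_pow_def \<Theta>_one[simplified])
next
  case (Suc n)
  have "\<Theta> f [^]\<^bsub>ihall\<^esub> Suc n = \<Theta> f [^]\<^bsub>ihall\<^esub> n \<otimes>\<^bsub>ihall\<^esub> \<Theta> f" by (simp only: nat_pow_def nat.rec)
  also have "\<dots> = \<Theta> (f [^]\<^bsub>hall\<^esub> n \<otimes>\<^bsub>hall\<^esub> f)" unfolding Suc.IH[OF Suc.prems] by (rule \<Theta>_mult) (simp_all add: Suc.prems)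
  finally show ?case by simp
qed

text \<open>\<open>ihall_class\<close> is formed with the plain \<theta>; the inverse power
  compensates the rescaling contained in \<Theta>.\<close>

lemma ihall_class_\<Theta>:
  fixes M :: "('k poly set, 'a) module"
  assumes M: "fd_mod M"
  shows "ihall_class M = \<Theta> (\<lambda>c. inverse v ^ (dim_k M choose 2) * hclass M c)"
proof -
  have "untwist (\<lambda>c. inverse v ^ (dim_k M choose 2) * hclass M c) = hclass M"
    using v_pos dim_k_rep_isoclass[OF M] by (auto simp: untwist_def hclass_def fun_eq_iff power_mult_distrib[symmetric])
  then show ?thesis by (simp add: ihall_class_def \<Theta>_def)
qed

end

subsection \<open>Sums of simple modules and the regular module\<close>

text \<open>A nonzero \<open>w\<close> killed by \<open>x\<close> spans a submodule, hence all of
  \<open>S\<close>. If \<open>x w\<close> were nonzero, it would be such a vector, so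
  \<open>w = c x w\<close> and then \<open>x w = c x x w = 0\<close>. Thus \<open>x\<close> acts by
  zero and \<open>S\<close> is a line.\<close>

lemma simple_mod_props:
  fixes S :: "('k::{field,finite} poly set, 'a) module"
  assumes S: "simple_mod S"
  shows "fd_mod S" "card (carrier S) = card (UNIV :: 'k set)" "card (xim S) = 1"
proof -
  have mod: "module Lam S" and ne: "carrier S \<noteq> {\<zero>\<^bsub>S\<^esub>}"
    and sub: "\<And>N. LinearCombinations.submodule Lam N S \<Longrightarrow> N = {\<zero>\<^bsub>S\<^esub>} \<or> N = carrier S"
    using S by (auto simp: simple_mod_def)
  interpret S: module Lam S by (rule mod)
  interpret V: vectorspace "kring :: 'k ring" "restrict_to_k S" by (rule vectorspace_restrict[OF mod])
  have smul: "lam [:c:] \<odot>\<^bsub>S\<^esub> x \<in> carrier S" if "x \<in> carrier S" for c x using V.smult_closed[of c x] that by simp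
  have line: "carrier S = (\<lambda>c. lam [:c:] \<odot>\<^bsub>S\<^esub> w) ` UNIV" if w: "w \<in> carrier S" "w \<noteq> \<zero>\<^bsub>S\<^esub>" "xop S w = \<zero>\<^bsub>S\<^esub>" for w
  proof -
    let ?N = "(\<lambda>c. lam [:c:] \<odot>\<^bsub>S\<^esub> w) ` UNIV"
    have "LinearCombinations.submodule Lam ?N S"
    proof
      show "?N \<subseteq> carrier S" using w smul by auto
      show "x \<oplus>\<^bsub>S\<^esub> y \<in> ?N" if "x \<in> ?N" "y \<in> ?N" for x y
        using that w(1) V.smult_l_distr[of _ _ w] by auto (metis rangeI)
      show "\<zero>\<^bsub>S\<^esub> \<in> ?N" using V.smult_l_null[of w] w(1) by (auto intro!: image_eqI[of _ _ 0])
      show "r \<odot>\<^bsub>S\<^esub> x \<in> ?N" if r: "r \<in> carrier Lam" and x: "x \<in> ?N" for r x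
      proof -
        obtain a b where ab: "r = lam [:a, b:]" using Lam_cases[OF r] by blast
        obtain c where c: "x = lam [:c:] \<odot>\<^bsub>S\<^esub> w" using x by blast
        have xc: "xop S x = \<zero>\<^bsub>S\<^esub>"
          unfolding c using module_hom_smult[OF xop_hom[OF mod], of c w] w V.smult_r_null[of c] by simp
        have "r \<odot>\<^bsub>S\<^esub> x = lam [:a:] \<odot>\<^bsub>S\<^esub> x"
          unfolding ab using smult_lam[OF mod, of x a b] smul[OF w(1), of c] smul[of x a] xc V.smult_r_null[of b] by (simp add: c)
        also have "\<dots> = lam [:a * c:] \<odot>\<^bsub>S\<^esub> w" unfolding c using V.smult_assoc1[of a c w] w(1) by simp
        finally show ?thesis by blast
      qed
    qed
    moreover have "w \<in> ?N" using V.smult_one[of w] w(1) by (auto intro!: image_eqI[of _ _ 1])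
    then have "?N \<noteq> {\<zero>\<^bsub>S\<^esub>}" using w(2) by blast
    ultimately show ?thesis using sub by blast
  qed
  have x0: "xop S w = \<zero>\<^bsub>S\<^esub>" if w: "w \<in> carrier S" for w
  proof (rule ccontr)
    assume nz: "xop S w \<noteq> \<zero>\<^bsub>S\<^esub>"
    have "w \<in> (\<lambda>c. lam [:c:] \<odot>\<^bsub>S\<^esub> xop S w) ` UNIV"
      using line[OF xop_closed[OF mod w] nz xop_xop[OF mod w]] w by blast
    then obtain c where "w = lam [:c:] \<odot>\<^bsub>S\<^esub> xop S w" by blast
    then have "xop S w = lam [:c:] \<odot>\<^bsub>S\<^esub> xop S (xop S w)"
      using module_hom_smult[OF xop_hom[OF mod], of c "xop S w"] xop_closed[OF mod w] by simp
    then show False using nz xop_xop[OF mod w] V.smult_r_null[of c] by simp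
  qed
  obtain w where w: "w \<in> carrier S" "w \<noteq> \<zero>\<^bsub>S\<^esub>" using ne S.M.zero_closed by blast
  have N: "carrier S = (\<lambda>c. lam [:c:] \<odot>\<^bsub>S\<^esub> w) ` UNIV" by (rule line[OF w x0[OF w(1)]])
  have "inj (\<lambda>c. lam [:c:] \<odot>\<^bsub>S\<^esub> w)"
  proof (rule injI)
    fix c c' :: 'k assume "lam [:c:] \<odot>\<^bsub>S\<^esub> w = lam [:c':] \<odot>\<^bsub>S\<^esub> w"
    then show "c = c'"
      using V.adjoin_unique[OF V.zero_submodule, of w "\<zero>\<^bsub>S\<^esub>" "\<zero>\<^bsub>S\<^esub>" c c'] w by simp
  qed
  then show "card (carrier S) = card (UNIV :: 'k set)" unfolding N by (rule card_image)
  show "fd_mod S" unfolding fd_mod_iff using mod N by (metis finite finite_imageI)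
  have "xim S = {\<zero>\<^bsub>S\<^esub>}" unfolding xim_def using x0 w(1) by force
  then show "card (xim S) = 1" by simp
qed

lemma direct_power_simps [simp]:
  "carrier (direct_power m M) = {..<m} \<rightarrow>\<^sub>E carrier M" "\<zero>\<^bsub>direct_power m M\<^esub> = (\<lambda>i\<in>{..<m}. \<zero>\<^bsub>M\<^esub>)"
  "x \<oplus>\<^bsub>direct_power m M\<^esub> y = (\<lambda>i\<in>{..<m}. x i \<oplus>\<^bsub>M\<^esub> y i)" "c \<odot>\<^bsub>direct_power m M\<^esub> x = (\<lambda>i\<in>{..<m}. c \<odot>\<^bsub>M\<^esub> x i)"
  by (simp_all add: direct_power_def)

lemma module_direct_power:
  fixes M :: "('k::{field,finite} poly set, 'a) module"
  assumes "module Lam M"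
  shows "module Lam (direct_power m M)"
proof -
  interpret M: module Lam M by fact
  note ext = extensionalityI[of _ "{..<m}"]
  show ?thesis
  proof (rule moduleI)
    show "cring Lam" by (rule cring_Lam)
    show "abelian_group (direct_power m M)"
    proof (rule abelian_groupI)
      fix x assume x: "x \<in> carrier (direct_power m M)"
      show "\<zero>\<^bsub>direct_power m M\<^esub> \<oplus>\<^bsub>direct_power m M\<^esub> x = x"
        using x by (intro ext) (auto simp: PiE_def Pi_iff)
      show "\<exists>y\<in>carrier (direct_power m M). y \<oplus>\<^bsub>direct_power m M\<^esub> x = \<zero>\<^bsub>direct_power m M\<^esub>"
        using x by (intro bexI[of _ "\<lambda>i\<in>{..<m}. \<ominus>\<^bsub>M\<^esub> x i"] ext) (auto simp: PiE_def Pi_iff M.M.l_neg)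
    qed (auto simp: PiE_def Pi_iff M.M.a_ac intro!: ext)
  qed (auto simp: PiE_def Pi_iff M.smult_l_distr M.smult_r_distr M.smult_assoc1 intro!: ext)
qed

lemma direct_power_props:
  fixes S :: "('k::{field,finite} poly set, 'a) module"
  assumes S: "fd_mod S" "card (xim S) = 1"
  shows "fd_mod (direct_power m S)" "card (carrier (direct_power m S)) = card (carrier S) ^ m" "card (xim (direct_power m S)) = 1"
proof -
  have mod: "module Lam S" using S by (simp add: fd_mod_iff)
  interpret S: module Lam S by (rule mod)
  show fd: "fd_mod (direct_power m S)"
    using S module_direct_power[OF mod, of m] by (auto simp: fd_mod_iff intro!: finite_PiE)
  show "card (carrier (direct_power m S)) = card (carrier S) ^ m" by (simp add: card_funcsetE)
  have "xim S = {\<zero>\<^bsub>S\<^esub>}" using S(2) xim_eq_zero_iff[OF S(1)] by simp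
  then have x0: "xop S w = \<zero>\<^bsub>S\<^esub>" if "w \<in> carrier S" for w
    using that by (auto simp: xim_def)
  have D0: "xop (direct_power m S) x = \<zero>\<^bsub>direct_power m S\<^esub>" if "x \<in> carrier (direct_power m S)" for x
    using that x0 by (intro extensionalityI[of _ "{..<m}"]) (auto simp: PiE_def Pi_iff)
  have "\<zero>\<^bsub>direct_power m S\<^esub> \<in> carrier (direct_power m S)" by auto
  moreover have "xim (direct_power m S) = (\<lambda>_. \<zero>\<^bsub>direct_power m S\<^esub>) ` carrier (direct_power m S)"
    unfolding xim_def by (rule image_cong[OF refl D0])
  ultimately have "xim (direct_power m S) = {\<zero>\<^bsub>direct_power m S\<^esub>}" by (simp only: image_constant)
  then show "card (xim (direct_power m S)) = 1" by simp
qed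

lemma regular_mod_props:
  shows "fd_mod (regular_mod :: ('k::{field,finite} poly set, 'k poly set) module)"
    and "card (carrier (regular_mod :: ('k poly set, 'k poly set) module)) = card (UNIV :: 'k set) ^ 2"
    and "card (xim (regular_mod :: ('k poly set, 'k poly set) module)) = card (UNIV :: 'k set)"
    and "acyclic_mod (regular_mod :: ('k poly set, 'k poly set) module)"
proof -
  let ?R = "regular_mod :: ('k poly set, 'k poly set) module"
  interpret L: cring "Lam :: 'k poly set ring" by (rule cring_Lam)
  have ops: "carrier ?R = carrier Lam" "\<zero>\<^bsub>?R\<^esub> = \<zero>\<^bsub>Lam\<^esub>" "a \<oplus>\<^bsub>?R\<^esub> b = a \<oplus>\<^bsub>Lam\<^esub> b" "a \<odot>\<^bsub>?R\<^esub> b = a \<otimes>\<^bsub>Lam\<^esub> b" for a b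
    by (simp_all add: regular_mod_def)
  have mod: "module Lam ?R"
  proof (rule moduleI)
    show "abelian_group ?R"
    proof (rule abelian_groupI)
      fix x assume "x \<in> carrier ?R"
      then show "\<exists>y\<in>carrier ?R. y \<oplus>\<^bsub>?R\<^esub> x = \<zero>\<^bsub>?R\<^esub>" 
        using L.l_neg[of x] unfolding ops by (intro bexI[of _ "\<ominus>\<^bsub>Lam\<^esub> x"]) auto
    qed (auto simp: ops L.a_ac)
  qed (auto simp: ops cring_Lam L.l_distr L.r_distr L.m_assoc)
  have card: "card (carrier ?R) = card (UNIV :: 'k set) ^ 2"
    unfolding ops carrier_Lam card_image[OF inj_lam]
    by (simp add: card_cartesian_product power2_eq_square flip: UNIV_Times_UNIV)
  show fd: "fd_mod ?R" unfolding fd_mod_iff using mod by (simp add: ops carrier_Lam)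
  show "card (carrier ?R) = card (UNIV :: 'k set) ^ 2" by (rule card)
  have "xim ?R = (\<lambda>a. lam [:0, a:]) ` UNIV"
  proof -
    \<comment> \<open>Multiplication by \<open>x\<close> moves the constant coefficient into degree
      one, so the image is the line of multiples of \<open>x\<close>.\<close>
    have x: "xop ?R (lam [:a, b:]) = lam [:0, a:]" for a b :: 'k by (simp add: ops lam_mult lam_eq_iff)
    have "xim ?R = range (\<lambda>(a, b). xop ?R (lam [:a, b:]))"
      unfolding xim_def ops carrier_Lam by (simp add: image_image split_beta)
    then show ?thesis by (auto simp: x)
  qed
  moreover have "inj (\<lambda>a :: 'k. lam [:0, a:])" by (auto simp: inj_def lam_eq_iff)
  ultimately show cx: "card (xim ?R) = card (UNIV :: 'k set)" by (simp add: card_image)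
  show "acyclic_mod ?R" unfolding acyclic_mod_iff_card[OF fd] cx card by (simp add: power2_eq_square)
qed

text \<open>The factor \<open>q ^ (m - 1)\<close> is the number of homomorphisms from the regular
  module to \<open>(m - 1) S\<close>; it turns the class of the direct sum into a product. At
  \<open>m = 0\<close> the truncated \<open>m - 1\<close> does no harm, since
  \<open>q ^ 0 - 1\<close> vanishes.\<close>

lemma hclass_simple_mult:
  fixes S :: "('k::{field,finite} poly set, 'a) module" and m :: nat
  assumes S: "fd_mod S" "card (carrier S) = card (UNIV :: 'k set)" "card (xim S) = 1"
  defines "q \<equiv> real (card (UNIV :: 'k set))"
  shows "(hclass S \<otimes>\<^bsub>hall\<^esub> hclass (direct_power m S)) c =
    (hclass (direct_power (Suc m) S) c + (q ^ m - 1) * q ^ (m - 1) * (hclass regular_mod \<otimes>\<^bsub>hall\<^esub> hclass (direct_power (m - 1) S)) c) / q ^ m"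
proof -
  let ?q = "card (UNIV :: 'k set)"
  let ?R = "regular_mod :: ('k poly set, 'k poly set) module"
  note P = direct_power_props[OF S(1,3)]
  note R = regular_mod_props[where 'k = 'k]
  have q1: "?q > 1" by (rule card_field_gt_one)
  note D = fd_mod_direct_sum[OF R(1) P(1)[of "m - 1"]]
  have K: "hclass ?R \<otimes>\<^bsub>hall\<^esub> hclass (direct_power (m - 1) S) = (\<lambda>c. 1 / q ^ (m - 1) * hclass (direct_sum ?R (direct_power (m - 1) S)) c)"
    unfolding hclass_mult_acyclic[OF R(1,4) P(1)] hom_number_acyclic_rank_one[OF R(1,4,3) P(1)] P(2) S(2) q_def by simp
  show ?thesis
  proof (cases "c \<in> isoclasses")
    case False
    then have "hclass (direct_power (Suc m) S) c = 0" "hclass (direct_sum ?R (direct_power (m - 1) S)) c = 0"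
      using isoclass_in_isoclasses[OF P(1)] isoclass_in_isoclasses[OF D] by (auto simp: hclass_def)
    then show ?thesis using False by (simp add: hclass_mult_hclass K)
  next
    case True
    have q0: "q \<noteq> 0" using q1 by (simp add: q_def)
    have 1: "hclass (direct_power (Suc m) S) c = (if card (carrier (rep c)) = ?q ^ Suc m \<and> card (xim (rep c)) = 1 then 1 else 0)"
      using isoclass_eq_card[OF True P(1)[of "Suc m"]] by (simp add: hclass_def P(2,3) S(2) del: direct_power_simps)
    have 2: "hclass (direct_sum ?R (direct_power (m - 1) S)) c = (if card (carrier (rep c)) = ?q ^ 2 * ?q ^ (m - 1) \<and> card (xim (rep c)) = ?q then 1 else 0)"
      using isoclass_eq_card[OF True D] by (simp add: hclass_def xim_direct_sum card_cartesian_product P(2,3) R(2,3) S(2) del: direct_power_simps)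
    have 3: "(hclass S \<otimes>\<^bsub>hall\<^esub> hclass (direct_power m S)) c = (if card (carrier (rep c)) = ?q ^ m * ?q then
        if card (xim (rep c)) = 1 then 1 else if card (xim (rep c)) = ?q then q ^ m - 1 else 0 else 0) / q ^ m"
      unfolding hclass_mult_hclass using hall_number_simple[OF S(1,3,2) P(1,3) True, of m] True
      by (simp add: P(2) S(2) q_def del: direct_power_simps)
    \<comment> \<open>For positive \<open>m\<close> the direct sum of the regular module and
      \<open>(m - 1) S\<close> has the order of an extension of \<open>S\<close> by
      \<open>m S\<close>.\<close>
    have "m = 0 \<or> ?q ^ 2 * ?q ^ (m - 1) = ?q ^ m * ?q"
      by (cases m) (simp_all add: power2_eq_square mult_ac)
    then show ?thesis
      unfolding K 1 2 3 using q1 q0 by (auto simp: mult.commute)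
  qed
qed

subsection \<open>Identities between the coefficients\<close>

text \<open>
  The exponent of \<open>v\<close> depends on the parity of \<open>n = M + 2 l\<close>, which is encoded by the sign
  \<open>s = (-1)\<^sup>n\<close>.
\<close>

definition ipow_coeff :: "real \<Rightarrow> int \<Rightarrow> nat \<Rightarrow> nat \<Rightarrow> real" where
  "ipow_coeff v s M l = v powi (int l * (int l - s) - int (M choose 2)) * (v - inverse v) ^ l / (qfact v M * qdfact_even v l)"

context
  fixes v :: real
  assumes v: "v > 1"
begin

lemma v_nz: "v \<noteq> 0" "v - inverse v \<noteq> 0"
proof -
  have "inverse v < 1" using v by (simp add: inverse_less_1_iff)
  then show "v \<noteq> 0" "v - inverse v \<noteq> 0" using v by auto
qed

lemma qint_nz: "m > 0 \<Longrightarrow> qint v m \<noteq> 0"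
proof -
  assume "m > 0"
  then have "v ^ m > 1" "inverse v ^ m < 1" using v by (simp_all add: one_less_power power_inverse inverse_less_1_iff)
  then show ?thesis using v_nz by (simp add: qint_def)
qed

lemma qfact_Suc: "qfact v (Suc m) = qfact v m * qint v (Suc m)" "qdfact_even v (Suc m) = qdfact_even v m * qint v (2 * Suc m)"
  by (simp_all add: qfact_def qdfact_even_def)

lemma qfact_nz: "qfact v m \<noteq> 0" "qdfact_even v m \<noteq> 0"
  using qint_nz by (auto simp: qfact_def qdfact_even_def)

lemma qint_times: "qint v m * (v - inverse v) = v ^ m - inverse v ^ m"
  using v_nz by (simp add: qint_def)

lemma powi_shift: "i = j + int a - int b \<Longrightarrow> v powi i = v powi j * v ^ a * inverse v ^ b"
  using v_nz(1) by (simp add: power_int_add power_int_diff divide_inverse power_inverse)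

lemma choose_two_Suc: "int (Suc m choose 2) = int m + int (m choose 2)"
  by (simp add: numeral_2_eq_2)

text \<open>Raising \<open>M\<close> by one reverses the parity of \<open>M + 2 l\<close>, hence the
  sign. The exponents of \<open>v\<close> then differ by \<open>M + 2 l\<close> in the first case
  and by \<open>M - 2 l\<close> in the second.\<close>

lemma ipow_coeff_M:
  "inverse v ^ M * ipow_coeff v (- 1) M l = v ^ (2 * l) * qint v (Suc M) * ipow_coeff v 1 (Suc M) l"
  "inverse v ^ M * ipow_coeff v 1 M l = inverse v ^ (2 * l) * qint v (Suc M) * ipow_coeff v (- 1) (Suc M) l"
proof -
  have c: "inverse v ^ M * v ^ M = 1" using v_nz by (simp flip: power_mult_distrib)
  have 1: "v powi (int l * (int l - (- 1)) - int (M choose 2)) = v powi (int l * (int l - 1) - int (Suc M choose 2)) * v ^ (2 * l + M) * inverse v ^ 0"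
    by (rule powi_shift) (simp add: choose_two_Suc algebra_simps)
  have 2: "v powi (int l * (int l - 1) - int (M choose 2)) = v powi (int l * (int l - (- 1)) - int (Suc M choose 2)) * v ^ M * inverse v ^ (2 * l)"
    by (rule powi_shift) (simp add: choose_two_Suc algebra_simps)
  show "inverse v ^ M * ipow_coeff v (- 1) M l = v ^ (2 * l) * qint v (Suc M) * ipow_coeff v 1 (Suc M) l"
    unfolding ipow_coeff_def 1 qfact_Suc using v_nz(1) qint_nz[of "Suc M"] qfact_nz c by (simp add: power_add field_simps)
  show "inverse v ^ M * ipow_coeff v 1 M l = inverse v ^ (2 * l) * qint v (Suc M) * ipow_coeff v (- 1) (Suc M) l"
    unfolding ipow_coeff_def 2 qfact_Suc using v_nz(1) qint_nz[of "Suc M"] qfact_nz c by (simp add: power_add field_simps)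
qed

text \<open>The first two compare summands exchanged when multiplication by \<open>[S]\<close>
  trades a copy of \<open>S\<close> for a factor \<open>[K]\<close>. The third belongs to
  multiplication by \<open>[K]\<close>, which preserves the parity.\<close>

lemma ipow_coeff_l:
  "(v ^ Suc M - inverse v ^ Suc M) * ipow_coeff v (- 1) (Suc M) l = inverse v ^ M * qint v (2 * Suc l) * ipow_coeff v 1 M (Suc l)"
  "(v ^ Suc M - inverse v ^ Suc M) * ipow_coeff v 1 (Suc M) l = v ^ 2 * inverse v ^ (4 * Suc l + M) * qint v (2 * Suc l) * ipow_coeff v (- 1) M (Suc l)"
  "(v - inverse v) * ipow_coeff v (- 1) M l = inverse v ^ (2 * Suc l) * qint v (2 * Suc l) * ipow_coeff v (- 1) M (Suc l)"
proof -
  have 1: "v powi (int l * (int l - (- 1)) - int (Suc M choose 2)) = v powi (int (Suc l) * (int (Suc l) - 1) - int (M choose 2)) * v ^ 0 * inverse v ^ M"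
    by (rule powi_shift) (simp add: choose_two_Suc algebra_simps)
  have 2: "v powi (int l * (int l - 1) - int (Suc M choose 2)) = v powi (int (Suc l) * (int (Suc l) - (- 1)) - int (M choose 2)) * v ^ 2 * inverse v ^ (4 * Suc l + M)"
    by (rule powi_shift) (simp add: choose_two_Suc algebra_simps)
  have 3: "v powi (int l * (int l - (- 1)) - int (M choose 2)) = v powi (int (Suc l) * (int (Suc l) - (- 1)) - int (M choose 2)) * v ^ 0 * inverse v ^ (2 * Suc l)"
    by (rule powi_shift) (simp add: algebra_simps)
  note nz = qint_nz[of "Suc M"] qint_nz[of "2 * Suc l"] qfact_nz
  show "(v ^ Suc M - inverse v ^ Suc M) * ipow_coeff v (- 1) (Suc M) l = inverse v ^ M * qint v (2 * Suc l) * ipow_coeff v 1 M (Suc l)"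
    unfolding ipow_coeff_def 1 qfact_Suc qint_times[symmetric] power_Suc[of "v - inverse v"] using nz 
    by (simp add: divide_simps del: power_Suc power_inverse mult_Suc_right)
  show "(v ^ Suc M - inverse v ^ Suc M) * ipow_coeff v 1 (Suc M) l = v ^ 2 * inverse v ^ (4 * Suc l + M) * qint v (2 * Suc l) * ipow_coeff v (- 1) M (Suc l)"
    unfolding ipow_coeff_def 2 qfact_Suc qint_times[symmetric] power_Suc[of "v - inverse v"] using nz 
    by (simp add: divide_simps del: power_Suc power_inverse mult_Suc_right)
  show "(v - inverse v) * ipow_coeff v (- 1) M l = inverse v ^ (2 * Suc l) * qint v (2 * Suc l) * ipow_coeff v (- 1) M (Suc l)"
    unfolding ipow_coeff_def 3 qfact_Suc power_Suc[of "v - inverse v"] using nz 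
    by (simp add: divide_simps del: power_Suc power_inverse mult_Suc_right)
qed

lemma qint_add: "qint v (M + b) = v ^ b * qint v M + inverse v ^ M * qint v b"
proof -
  have "v ^ b * (v ^ M - inverse v ^ M) + inverse v ^ M * (v ^ b - inverse v ^ b) = v ^ (M + b) - inverse v ^ (M + b)"
    by (simp add: power_add algebra_simps)
  then show ?thesis by (simp add: qint_def add_divide_distrib[symmetric])
qed

text \<open>The bracket equals \<open>v ^ M\<close>, so this is \<open>qint_add\<close> with
  \<open>v\<close> and its inverse interchanged. The expanded form matches the two terms that raise
  \<open>l\<close> when \<open>n\<close> is even.\<close>

lemma qint_add':
  assumes "M + b > 0"
  shows "qint v (M + b) = inverse v ^ b * qint v M + 
    qint v b * (v ^ 2 * inverse v ^ (2 * b + M) + (v\<^sup>2 - 1) * inverse v ^ b * qint v (M + b - 1))"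
proof -
  obtain p where p: "M + b = Suc p" using assms by (cases "M + b") auto
  have e: "(v\<^sup>2 - 1) * qint v p = v * (v ^ p - inverse v ^ p)"
    using v_nz by (simp add: qint_def field_simps power2_eq_square)
  have i: "inverse v ^ b * v ^ b = 1" "v * inverse v = 1" using v_nz by (simp_all flip: power_mult_distrib)
  have k: "v ^ 2 * inverse v ^ (2 * b + M) + (v\<^sup>2 - 1) * inverse v ^ b * qint v p = v ^ M"
  proof -
    have "(v\<^sup>2 - 1) * inverse v ^ b * qint v p = inverse v ^ b * (v ^ Suc p - v ^ 2 * inverse v ^ Suc p)"
    proof -
      have v2: "v ^ 2 * inverse v ^ Suc p = v * inverse v ^ p" using v_nz by (simp add: power2_eq_square)
      have "(v\<^sup>2 - 1) * inverse v ^ b * qint v p = inverse v ^ b * ((v\<^sup>2 - 1) * qint v p)" by simp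
      also have "\<dots> = inverse v ^ b * (v ^ Suc p - v ^ 2 * inverse v ^ Suc p)"
        unfolding e v2 by (simp add: right_diff_distrib)
      finally show ?thesis .
    qed
    also have "\<dots> = (inverse v ^ b * v ^ b) * v ^ M - v ^ 2 * inverse v ^ (2 * b + M)"
      unfolding p[symmetric] by (simp add: power_add right_diff_distrib mult_2)
    finally show ?thesis using i by simp
  qed
  have "inverse v ^ b * (v ^ M - inverse v ^ M) + (v ^ b - inverse v ^ b) * v ^ M = v ^ (M + b) - inverse v ^ (M + b)"
    by (simp add: power_add algebra_simps)
  then have "qint v (M + b) = inverse v ^ b * qint v M + qint v b * v ^ M" by (simp add: qint_def add_divide_distrib[symmetric])
  then show ?thesis using k p by simp
qed

text \<open>The value 0 beyond \<open>n div 2\<close> lets sums run over a longer range and survive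
  index shifts.\<close>

definition coeff_n :: "nat \<Rightarrow> nat \<Rightarrow> real" where
  "coeff_n n l = (if 2 * l \<le> n then ipow_coeff v ((-1) ^ n) (n - 2 * l) l else 0)"

text \<open>With \<open>M = n + 1 - 2 l\<close> the two terms are \<open>v ^ (2 l) [M]\<close> and
  \<open>v ^ (- M) [2 l]\<close> times the new coefficient, and \<open>qint_add\<close> sums them to
  \<open>[n + 1]\<close>. At the ends \<open>M = 0\<close> and \<open>l = 0\<close> the missing term
  is accounted for by \<open>[0] = 0\<close>.\<close>

lemma coeff_n_odd:
  assumes n: "odd n"
  shows "qint v (Suc n) * coeff_n (Suc n) l = inverse v ^ (n - 2 * l) * coeff_n n l + 
    (if l = 0 then 0 else (v ^ (n + 2 - 2 * l) - inverse v ^ (n + 2 - 2 * l)) * coeff_n n (l - 1))"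
proof (cases "2 * l \<le> Suc n")
  case False
  then have "\<not> 2 * l \<le> n" "\<not> 2 * (l - 1) \<le> n" using n by presburger+
  then show ?thesis using False by (simp add: coeff_n_def)
next
  case True
  define M where "M = Suc n - 2 * l"
  have M: "Suc n = M + 2 * l" using True by (simp add: M_def)
  have s: "(-1 :: int) ^ n = -1" "(-1 :: int) ^ Suc n = 1" using n by simp_all
  have t1: "inverse v ^ (n - 2 * l) * coeff_n n l = v ^ (2 * l) * qint v M * ipow_coeff v 1 M l"
  proof (cases M)
    case 0
    then have "\<not> 2 * l \<le> n" using M by simp
    then show ?thesis using 0 by (simp add: coeff_n_def qint_def)
  next
    case (Suc p)
    then have "n - 2 * l = p" "2 * l \<le> n" using M by simp_all
    then show ?thesis using ipow_coeff_M(1)[of p l] unfolding coeff_n_def s Suc by simp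
  qed
  have t2: "(if l = 0 then 0 else (v ^ (n + 2 - 2 * l) - inverse v ^ (n + 2 - 2 * l)) * coeff_n n (l - 1)) = 
    inverse v ^ M * qint v (2 * l) * ipow_coeff v 1 M l"
  proof (cases l)
    case 0
    then show ?thesis by (simp add: qint_def)
  next
    case (Suc r)
    then have "n + 2 - 2 * l = Suc M" "n - 2 * r = Suc M" "2 * r \<le> n" using M by simp_all
    then show ?thesis using ipow_coeff_l(1)[of M r] unfolding coeff_n_def s Suc by (simp del: power_Suc)
  qed
  have "qint v (Suc n) * coeff_n (Suc n) l = (v ^ (2 * l) * qint v M + inverse v ^ M * qint v (2 * l)) * ipow_coeff v 1 M l"
  proof -
    have "coeff_n (Suc n) l = ipow_coeff v 1 M l" using True unfolding coeff_n_def s M_def by simp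
    then show ?thesis using qint_add[of M "2 * l"] M by simp
  qed
  then show ?thesis unfolding t1 t2 by (simp add: ring_distribs)
qed

text \<open>The first term gives \<open>v ^ (- 2 l) [M]\<close> times the new coefficient, and the
  other two give \<open>[2 l]\<close> times the two parts of the bracket in
  \<open>qint_add'\<close>. The constant in the divided powers is what makes the \<open>[K]\<close>
  term equal to the second part.\<close>

lemma coeff_n_even:
  assumes n: "even n" "n > 0"
  shows "qint v (Suc n) * coeff_n (Suc n) l = inverse v ^ (n - 2 * l) * coeff_n n l + 
    (if l = 0 then 0 else (v ^ (n + 2 - 2 * l) - inverse v ^ (n + 2 - 2 * l)) * coeff_n n (l - 1)) +
    inverse v * (v\<^sup>2 - 1)\<^sup>2 * qint v n * (if l = 0 then 0 else coeff_n (n - 1) (l - 1))"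
proof (cases "2 * l \<le> Suc n")
  case False
  then have f: "\<not> 2 * l \<le> n" "\<not> 2 * (l - 1) \<le> n - 1" "n + 2 - 2 * l = 0" using n by presburger+
  show ?thesis using False f by (simp add: coeff_n_def)
next
  case True
  define M where "M = Suc n - 2 * l"
  have M: "Suc n = M + 2 * l" using True by (simp add: M_def)
  have s: "(-1 :: int) ^ n = 1" "(-1 :: int) ^ Suc n = -1" "(-1 :: int) ^ (n - 1) = -1" using n by simp_all
  \<comment> \<open>\<open>M\<close> is odd like \<open>n + 1\<close>, hence positive.\<close>
  obtain p where p: "M = Suc p" using M n by (cases M) presburger+
  have t1: "inverse v ^ (n - 2 * l) * coeff_n n l = inverse v ^ (2 * l) * qint v M * ipow_coeff v (-1) M l"
  proof -
    have "n - 2 * l = p" "2 * l \<le> n" using M p by simp_all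
    then show ?thesis using ipow_coeff_M(2)[of p l] unfolding coeff_n_def s p by simp
  qed
  have t2: "(if l = 0 then 0 else (v ^ (n + 2 - 2 * l) - inverse v ^ (n + 2 - 2 * l)) * coeff_n n (l - 1)) = 
    v ^ 2 * inverse v ^ (2 * (2 * l) + M) * qint v (2 * l) * ipow_coeff v (-1) M l"
  proof (cases l)
    case 0
    then show ?thesis by (simp add: qint_def)
  next
    case (Suc r)
    then have "n + 2 - 2 * l = Suc M" "n - 2 * r = Suc M" "2 * r \<le> n" "2 * (2 * l) + M = 4 * Suc r + M" using M by simp_all
    then show ?thesis using ipow_coeff_l(2)[of M r] unfolding coeff_n_def s Suc by (simp del: power_Suc mult_Suc_right)
  qed
  \<comment> \<open>One factor \<open>v - inverse v\<close> is absorbed by raising \<open>l\<close>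
    in \<open>ipow_coeff\<close>; the factor \<open>v\<^sup>2 - 1\<close> is the one in
    \<open>qint_add'\<close>.\<close>
  have cc: "inverse v * (v\<^sup>2 - 1)\<^sup>2 = (v\<^sup>2 - 1) * (v - inverse v)"
    using v_nz by (simp add: field_simps power2_eq_square)
  have t3: "inverse v * (v\<^sup>2 - 1)\<^sup>2 * qint v n * (if l = 0 then 0 else coeff_n (n - 1) (l - 1)) =
    (v\<^sup>2 - 1) * inverse v ^ (2 * l) * qint v n * qint v (2 * l) * ipow_coeff v (-1) M l"
  proof (cases l)
    case 0
    then show ?thesis by (simp add: qint_def)
  next
    case (Suc r)
    have a: "n - 1 - 2 * r = M" "2 * r \<le> n - 1" "l - 1 = r" using M p Suc by simp_all
    have "inverse v * (v\<^sup>2 - 1)\<^sup>2 * qint v n * ipow_coeff v (-1) M r = (v\<^sup>2 - 1) * qint v n * ((v - inverse v) * ipow_coeff v (-1) M r)"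
      unfolding cc by (simp only: mult_ac)
    also have "\<dots> = (v\<^sup>2 - 1) * inverse v ^ (2 * l) * qint v n * qint v (2 * l) * ipow_coeff v (-1) M l"
      unfolding ipow_coeff_l(3) Suc by (simp only: mult_ac)
    finally show ?thesis using Suc a unfolding coeff_n_def s by simp
  qed
  have nM: "M + 2 * l - 1 = n" using M by simp
  have "qint v (Suc n) = inverse v ^ (2 * l) * qint v M + 
    qint v (2 * l) * (v ^ 2 * inverse v ^ (2 * (2 * l) + M) + (v\<^sup>2 - 1) * inverse v ^ (2 * l) * qint v n)"
    using qint_add'[of M "2 * l"] p M nM by simp
  moreover have "coeff_n (Suc n) l = ipow_coeff v (-1) M l" using True unfolding coeff_n_def s M_def by simp
  ultimately show ?thesis unfolding t1 t2 t3 by (simp add: ring_distribs mult_ac)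
qed

lemma coeff_n_zero: "coeff_n 0 0 = 1" "coeff_n 1 0 = 1"
  using v_nz by (simp_all add: coeff_n_def ipow_coeff_def qfact_def qdfact_even_def qint_def numeral_2_eq_2)

end


subsection \<open>Divided powers in the Hall algebra\<close>

locale simple_hall = twisted_hall T v for T :: "'k::{field,finite} itself" and v +
  fixes S :: "('k poly set, nat) module"
  assumes simple: "simple_mod S"
begin

lemmas S = simple_mod_props[OF simple]
lemmas P = direct_power_props[OF S(1,3)]
lemmas R = regular_mod_props[where 'k = 'k]

text \<open>
  \<open>U m\<close>, \<open>\<kappa>\<close> and \<open>e m b\<close> correspond to \<open>[mS]\<close>, \<open>[K]\<close> and \<open>[mS] * [K]\<^sup>b\<close> under \<open>\<Theta>\<close>; the twist on
  \<open>K\<close> is \<open>v ^ (2 choose 2) = v\<close>.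
\<close>

definition U :: "nat \<Rightarrow> 'k iclass \<Rightarrow> real" where
  "U m = (\<lambda>c. inverse v ^ (m choose 2) * hclass (direct_power m S) c)"

definition \<kappa> :: "'k iclass \<Rightarrow> real" where
  "\<kappa> = (\<lambda>c. inverse v * hclass (regular_mod :: ('k poly set, 'k poly set) module) c)"

definition e :: "nat \<Rightarrow> nat \<Rightarrow> 'k iclass \<Rightarrow> real" where
  "e m b = U m \<otimes>\<^bsub>hall\<^esub> \<kappa> [^]\<^bsub>hall\<^esub> b"

lemma U_closed [simp]: "U m \<in> carrier hall"
  unfolding U_def by (intro smult_closed hclass_in_hall P Qv_intros)

lemma \<kappa>_closed [simp]: "\<kappa> \<in> carrier hall"
  unfolding \<kappa>_def by (intro smult_closed hclass_in_hall R Qv_intros)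

lemma e_closed [simp]: "e m b \<in> carrier hall"
  by (simp add: e_def)

lemma dim_direct_power: "dim_k (direct_power m S) = m"
  by (rule dim_k_eqI[OF P(1)]) (simp only: P(2) S(2))

lemma ihall_class_power: "ihall_class (direct_power m S) = \<Theta> (U m)"
  unfolding ihall_class_\<Theta>[OF P(1)] dim_direct_power U_def ..

lemma ihall_class_regular: "ihall_class (regular_mod :: ('k poly set, 'k poly set) module) = \<Theta> \<kappa>"
proof -
  have "dim_k (regular_mod :: ('k poly set, 'k poly set) module) = 2" by (rule dim_k_eqI[OF R(1,2)])
  then show ?thesis unfolding ihall_class_\<Theta>[OF R(1)] \<kappa>_def by simp
qed

lemma hclass_S: "hclass S = U 1"
proof -
  have "isoclass S = isoclass (direct_power 1 S)"
    by (rule isoclass_eqI_card[OF S(1) P(1)]) (simp_all only: P(2,3) S(3) power_one_right)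
  then show ?thesis by (simp add: U_def hclass_def numeral_2_eq_2)
qed

lemma ihall_class_S: "ihall_class S = \<Theta> (U 1)"
  unfolding ihall_class_power[symmetric] by (simp add: ihall_class_def hclass_S U_def numeral_2_eq_2)

lemma U_zero: "U 0 = \<one>\<^bsub>hall\<^esub>"
proof -
  have "isoclass (direct_power 0 S) = isoclass (zero_mod :: ('k poly set, nat) module)"
  proof (rule isoclass_eqI_card[OF P(1) fd_zero_mod])
    show "card (carrier (direct_power 0 S)) = card (carrier (zero_mod :: ('k poly set, nat) module))" by simp
    show "card (xim (direct_power 0 S)) = card (xim (zero_mod :: ('k poly set, nat) module))" unfolding P(3) by (simp add: xim_def)
  qed
  then show ?thesis by (simp add: U_def hclass_def hall_simps numeral_2_eq_2)
qed

lemma \<kappa>_central: "f \<in> carrier hall \<Longrightarrow> \<kappa> \<otimes>\<^bsub>hall\<^esub> f = f \<otimes>\<^bsub>hall\<^esub> \<kappa>"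
  unfolding \<kappa>_def by (simp add: hall_mult_smult hclass_in_hall[OF R(1)] hclass_acyclic_central[OF R(1,4)])

text \<open>This is \<open>hclass_simple_mult\<close> after rescaling, with \<open>q\<close> the
  square of \<open>v\<close>: \<open>1 / q ^ m\<close> becomes \<open>v ^ (- m)\<close> and
  \<open>(q ^ m - 1) / q\<close> becomes \<open>v ^ m - v ^ (- m)\<close>.\<close>

lemma U_one_mult_U:
  "U 1 \<otimes>\<^bsub>hall\<^esub> U m = (\<lambda>c. inverse v ^ m * U (Suc m) c + (v ^ m - inverse v ^ m) * (\<kappa> \<otimes>\<^bsub>hall\<^esub> U (m - 1)) c)"
proof
  fix c
  let ?h = "\<lambda>m. hclass (direct_power m S) :: 'k iclass \<Rightarrow> real"
  let ?Z = "hclass (regular_mod :: ('k poly set, 'k poly set) module) \<otimes>\<^bsub>hall\<^esub> ?h (m - 1)"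
  note h = hclass_in_hall[OF S(1)] hclass_in_hall[OF P(1)] hclass_in_hall[OF R(1)]
  have 1: "(U 1 \<otimes>\<^bsub>hall\<^esub> U m) c = inverse v ^ (m choose 2) * ((?h (Suc m) c + ((v\<^sup>2) ^ m - 1) * (v\<^sup>2) ^ (m - 1) * ?Z c) / (v\<^sup>2) ^ m)"
    unfolding hclass_S[symmetric] unfolding U_def hall_mult_smult(2)[OF h(1,2)]
    using hclass_simple_mult[OF S, of m c] by (simp add: v_square)
  have 2: "(\<kappa> \<otimes>\<^bsub>hall\<^esub> U (m - 1)) c = inverse v * inverse v ^ ((m - 1) choose 2) * ?Z c"
    unfolding \<kappa>_def U_def hall_mult_smult(1)[OF h(3) U_closed[unfolded U_def]] hall_mult_smult(2)[OF h(3,2)] by simp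
  show "(U 1 \<otimes>\<^bsub>hall\<^esub> U m) c = inverse v ^ m * U (Suc m) c + (v ^ m - inverse v ^ m) * (\<kappa> \<otimes>\<^bsub>hall\<^esub> U (m - 1)) c"
  proof (cases m)
    case 0
    then show ?thesis unfolding 1 by (simp add: U_def numeral_2_eq_2)
  next
    case (Suc p)
    \<comment> \<open>With these abbreviations a rational identity in \<open>v\<close>,
      \<open>a\<close> and \<open>w\<close> remains.\<close>
    define w a where "w = inverse v ^ (p choose 2)" and "a = v ^ p"
    have a: "a \<noteq> 0" "v \<noteq> 0" using v_pos by (auto simp: a_def)
    have ch: "Suc p choose 2 = p + (p choose 2)" "Suc (Suc p) choose 2 = 1 + p + p + (p choose 2)" by (simp_all add: numeral_2_eq_2)
    have iv: "inverse v ^ p = 1 / a" "(v\<^sup>2) ^ p = a * a" by (simp_all add: a_def power_inverse divide_inverse power2_eq_square power_mult_distrib)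
    show ?thesis
      unfolding 1 2 unfolding U_def Suc ch power_add power_Suc diff_Suc_1 iv w_def[symmetric] a_def[symmetric] power_one_right power_0
      using a by (simp add: field_simps power2_eq_square)
  qed
qed

lemma U_one_mult_e:
  "U 1 \<otimes>\<^bsub>hall\<^esub> e m b = (\<lambda>c. inverse v ^ m * e (Suc m) b c + (v ^ m - inverse v ^ m) * e (m - 1) (Suc b) c)"
proof -
  have Q: "inverse v ^ m \<in> Q_adjoin v" "v ^ m - inverse v ^ m \<in> Q_adjoin v" by (intro Qv_intros)+
  let ?p = "\<kappa> [^]\<^bsub>hall\<^esub> b"
  have p: "?p \<in> carrier hall" by simp
  have eb: "(\<kappa> \<otimes>\<^bsub>hall\<^esub> U (m - 1)) \<otimes>\<^bsub>hall\<^esub> ?p = e (m - 1) (Suc b)"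
    unfolding e_def \<kappa>_central[OF U_closed] H.nat_pow_Suc \<kappa>_central[OF p, symmetric] by (rule H.m_assoc) simp_all
  have "U 1 \<otimes>\<^bsub>hall\<^esub> e m b = (U 1 \<otimes>\<^bsub>hall\<^esub> U m) \<otimes>\<^bsub>hall\<^esub> ?p" unfolding e_def by (simp add: H.m_assoc)
  also have "\<dots> = ((\<lambda>c. inverse v ^ m * U (Suc m) c) \<oplus>\<^bsub>hall\<^esub> (\<lambda>c. (v ^ m - inverse v ^ m) * (\<kappa> \<otimes>\<^bsub>hall\<^esub> U (m - 1)) c)) \<otimes>\<^bsub>hall\<^esub> ?p"
    unfolding U_one_mult_U hall_simps ..
  also have "\<dots> = (\<lambda>c. inverse v ^ m * U (Suc m) c) \<otimes>\<^bsub>hall\<^esub> ?p \<oplus>\<^bsub>hall\<^esub> (\<lambda>c. (v ^ m - inverse v ^ m) * (\<kappa> \<otimes>\<^bsub>hall\<^esub> U (m - 1)) c) \<otimes>\<^bsub>hall\<^esub> ?p"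
    by (rule H.l_distr) (simp_all add: smult_closed Q)
  also have "\<dots> = (\<lambda>c. inverse v ^ m * e (Suc m) b c + (v ^ m - inverse v ^ m) * e (m - 1) (Suc b) c)"
    unfolding hall_mult_smult(1)[OF U_closed p] hall_mult_smult(1)[OF H.m_closed[OF \<kappa>_closed U_closed] p] eb hall_simps e_def[symmetric] ..
  finally show ?thesis .
qed

lemma \<kappa>_mult_e: "\<kappa> \<otimes>\<^bsub>hall\<^esub> e m b = e m (Suc b)"
proof -
  have "\<kappa> \<otimes>\<^bsub>hall\<^esub> (U m \<otimes>\<^bsub>hall\<^esub> \<kappa> [^]\<^bsub>hall\<^esub> b) = (U m \<otimes>\<^bsub>hall\<^esub> \<kappa> [^]\<^bsub>hall\<^esub> b) \<otimes>\<^bsub>hall\<^esub> \<kappa>" by (rule \<kappa>_central) simp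
  then show ?thesis by (simp add: e_def H.m_assoc)
qed

lemma hall_mult_sum:
  assumes f: "f \<in> carrier hall" and F: "\<And>i. i \<in> I \<Longrightarrow> F i \<in> carrier hall" and r: "\<And>i. i \<in> I \<Longrightarrow> r i \<in> Q_adjoin v"
  shows "f \<otimes>\<^bsub>hall\<^esub> (\<lambda>c :: 'k iclass. \<Sum>i\<in>I. r i * F i c) = (\<lambda>c. \<Sum>i\<in>I. r i * (f \<otimes>\<^bsub>hall\<^esub> F i) c)"
proof (cases "finite I")
  case False
  then show ?thesis using H.r_null[OF f] by (simp add: hall_simps)
next
  case True
  then show ?thesis using F r
  proof (induction I)
    case empty
    then show ?case using H.r_null[OF f] by (simp add: hall_simps)
  next
    case (insert i I)
    have c: "(\<lambda>c. r i * F i c) \<in> carrier hall" "(\<lambda>c. \<Sum>j\<in>I. r j * F j c) \<in> carrier hall"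
      using insert by (auto intro!: smult_closed hall_sum_closed)
    have "f \<otimes>\<^bsub>hall\<^esub> (\<lambda>c. \<Sum>j\<in>insert i I. r j * F j c) = f \<otimes>\<^bsub>hall\<^esub> ((\<lambda>c. r i * F i c) \<oplus>\<^bsub>hall\<^esub> (\<lambda>c. \<Sum>j\<in>I. r j * F j c))"
      using insert(1,2) by (simp add: hall_simps)
    also have "\<dots> = f \<otimes>\<^bsub>hall\<^esub> (\<lambda>c. r i * F i c) \<oplus>\<^bsub>hall\<^esub> f \<otimes>\<^bsub>hall\<^esub> (\<lambda>c. \<Sum>j\<in>I. r j * F j c)"
      by (rule H.r_distr) (use c f in auto)
    also have "\<dots> = (\<lambda>c. \<Sum>j\<in>insert i I. r j * (f \<otimes>\<^bsub>hall\<^esub> F j) c)"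
      using insert f by (simp add: hall_mult_smult(2)) (simp add: hall_simps)
    finally show ?case .
  qed
qed

section \<open>Combinations of the elements \<open>e (n - 2 l) l\<close>\<close>

definition Y :: "nat \<Rightarrow> (nat \<Rightarrow> real) \<Rightarrow> 'k iclass \<Rightarrow> real" where
  "Y n C = (\<lambda>c. \<Sum>l\<le>n. C l * e (n - 2 * l) l c)"

lemma Y_closed: "(\<And>l. C l \<in> Q_adjoin v) \<Longrightarrow> Y n C \<in> carrier hall"
  unfolding Y_def by (intro hall_sum_closed smult_closed e_closed)

text \<open>The first part of \<open>U_one_mult_e\<close> keeps \<open>l\<close>, the second raises
  it and is reindexed. Where \<open>2 l\<close> exceeds \<open>n\<close>, the truncated subtraction
  is masked by \<open>C l = 0\<close>.\<close>

lemma U_one_mult_Y: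
  assumes C: "\<And>l. C l \<in> Q_adjoin v" "\<And>l. n < 2 * l \<Longrightarrow> C l = 0"
  shows "U 1 \<otimes>\<^bsub>hall\<^esub> Y n C = Y (Suc n) (\<lambda>l. inverse v ^ (n - 2 * l) * C l +
    (if l = 0 then 0 else (v ^ (n + 2 - 2 * l) - inverse v ^ (n + 2 - 2 * l)) * C (l - 1)))"
proof
  fix c
  have "(U 1 \<otimes>\<^bsub>hall\<^esub> Y n C) c = (\<Sum>l\<le>n. C l * (inverse v ^ (n - 2 * l) * e (Suc (n - 2 * l)) l c + 
      (v ^ (n - 2 * l) - inverse v ^ (n - 2 * l)) * e (n - 2 * l - 1) (Suc l) c))"
    unfolding Y_def hall_mult_sum[OF U_closed e_closed C(1)] U_one_mult_e ..
  also have "\<dots> = (\<Sum>l\<le>n. inverse v ^ (n - 2 * l) * C l * e (Suc n - 2 * l) l c) +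
      (\<Sum>l\<le>n. (v ^ (n - 2 * l) - inverse v ^ (n - 2 * l)) * C l * e (Suc n - 2 * Suc l) (Suc l) c)"
    unfolding sum.distrib[symmetric]
  proof (intro sum.cong refl)
    fix l
    show "C l * (inverse v ^ (n - 2 * l) * e (Suc (n - 2 * l)) l c + (v ^ (n - 2 * l) - inverse v ^ (n - 2 * l)) * e (n - 2 * l - 1) (Suc l) c) =
      inverse v ^ (n - 2 * l) * C l * e (Suc n - 2 * l) l c + (v ^ (n - 2 * l) - inverse v ^ (n - 2 * l)) * C l * e (Suc n - 2 * Suc l) (Suc l) c"
    proof (cases "n < 2 * l")
      case False
      then have "Suc (n - 2 * l) = Suc n - 2 * l" "n - 2 * l - 1 = Suc n - 2 * Suc l" by simp_all
      then show ?thesis by (simp only: ring_distribs mult_ac)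
    qed (simp add: C(2))
  qed
  also have "(\<Sum>l\<le>n. inverse v ^ (n - 2 * l) * C l * e (Suc n - 2 * l) l c) = (\<Sum>l\<le>Suc n. inverse v ^ (n - 2 * l) * C l * e (Suc n - 2 * l) l c)"
    using C(2)[of "Suc n"] by simp
  also have "(\<Sum>l\<le>n. (v ^ (n - 2 * l) - inverse v ^ (n - 2 * l)) * C l * e (Suc n - 2 * Suc l) (Suc l) c) =
     (\<Sum>l\<le>Suc n. (if l = 0 then 0 else (v ^ (n + 2 - 2 * l) - inverse v ^ (n + 2 - 2 * l)) * C (l - 1)) * e (Suc n - 2 * l) l c)"
    by (subst sum.atMost_Suc_shift) simp
  finally show "(U 1 \<otimes>\<^bsub>hall\<^esub> Y n C) c = Y (Suc n) (\<lambda>l. inverse v ^ (n - 2 * l) * C l +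
    (if l = 0 then 0 else (v ^ (n + 2 - 2 * l) - inverse v ^ (n + 2 - 2 * l)) * C (l - 1))) c"
    unfolding Y_def sum.distrib[symmetric] distrib_right .
qed

lemma \<kappa>_mult_Y:
  assumes C: "\<And>l. C l \<in> Q_adjoin v" "\<And>l. n < 2 * l \<Longrightarrow> C l = 0"
  shows "\<kappa> \<otimes>\<^bsub>hall\<^esub> Y n C = Y (n + 2) (\<lambda>l. if l = 0 then 0 else C (l - 1))"
proof
  fix c
  have "(\<kappa> \<otimes>\<^bsub>hall\<^esub> Y n C) c = (\<Sum>l\<le>n. C l * e (n - 2 * l) (Suc l) c)"
    unfolding Y_def hall_mult_sum[OF \<kappa>_closed e_closed C(1)] \<kappa>_mult_e ..
  also have "\<dots> = (\<Sum>l\<le>Suc n. C l * e (n - 2 * l) (Suc l) c)"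
    using C(2)[of "Suc n"] by simp
  also have "\<dots> = (\<Sum>l\<le>Suc (Suc n). (if l = 0 then 0 else C (l - 1)) * e (n + 2 - 2 * l) l c)"
    by (subst (2) sum.atMost_Suc_shift) simp
  finally show "(\<kappa> \<otimes>\<^bsub>hall\<^esub> Y n C) c = Y (n + 2) (\<lambda>l. if l = 0 then 0 else C (l - 1)) c"
    by (simp add: Y_def)
qed

lemma Y_linear: "(\<lambda>c. r * Y n C c) = Y n (\<lambda>l. r * C l)" "(\<lambda>c. Y n C c + r * Y n D c) = Y n (\<lambda>l. C l + r * D l)"
  by (simp_all add: Y_def sum_distrib_left sum.distrib distrib_right mult_ac)

section \<open>The quadratic factors of the divided powers\<close>

text \<open>Corresponds to \<open>[S]^2 + a [K]\<close> under \<Theta>.\<close>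

definition G :: "real \<Rightarrow> 'k iclass \<Rightarrow> real" where
  "G a = (\<lambda>c. (U 1 \<otimes>\<^bsub>hall\<^esub> U 1) c + a * \<kappa> c)"

lemma G_closed: "a \<in> Q_adjoin v \<Longrightarrow> G a \<in> carrier hall"
  unfolding G_def by (intro hall_add_closed smult_closed) auto

lemma G_mult:
  assumes "a \<in> Q_adjoin v" "f \<in> carrier hall"
  shows "G a \<otimes>\<^bsub>hall\<^esub> f = (\<lambda>c. (U 1 \<otimes>\<^bsub>hall\<^esub> (U 1 \<otimes>\<^bsub>hall\<^esub> f)) c + a * (\<kappa> \<otimes>\<^bsub>hall\<^esub> f) c)"
proof -
  have "G a \<otimes>\<^bsub>hall\<^esub> f = ((U 1 \<otimes>\<^bsub>hall\<^esub> U 1) \<oplus>\<^bsub>hall\<^esub> (\<lambda>c. a * \<kappa> c)) \<otimes>\<^bsub>hall\<^esub> f" by (simp add: G_def hall_simps)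
  also have "\<dots> = (U 1 \<otimes>\<^bsub>hall\<^esub> U 1) \<otimes>\<^bsub>hall\<^esub> f \<oplus>\<^bsub>hall\<^esub> (\<lambda>c. a * \<kappa> c) \<otimes>\<^bsub>hall\<^esub> f"
    by (rule H.l_distr) (auto intro!: smult_closed assms)
  finally show ?thesis using assms(2) by (simp add: hall_mult_smult(1) H.m_assoc) (simp add: hall_simps)
qed

lemma G_commute_U:
  assumes a: "a \<in> Q_adjoin v"
  shows "G a \<otimes>\<^bsub>hall\<^esub> U 1 = U 1 \<otimes>\<^bsub>hall\<^esub> G a"
proof -
  have "U 1 \<otimes>\<^bsub>hall\<^esub> G a = U 1 \<otimes>\<^bsub>hall\<^esub> ((U 1 \<otimes>\<^bsub>hall\<^esub> U 1) \<oplus>\<^bsub>hall\<^esub> (\<lambda>c. a * \<kappa> c))" by (simp add: G_def hall_simps)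
  also have "\<dots> = U 1 \<otimes>\<^bsub>hall\<^esub> (U 1 \<otimes>\<^bsub>hall\<^esub> U 1) \<oplus>\<^bsub>hall\<^esub> U 1 \<otimes>\<^bsub>hall\<^esub> (\<lambda>c. a * \<kappa> c)"
    by (rule H.r_distr) (auto intro!: smult_closed a)
  finally show ?thesis unfolding G_mult[OF a U_closed] by (simp add: hall_mult_smult(2) \<kappa>_central) (simp add: hall_simps)
qed

text \<open>All \<open>G a\<close> are polynomials in \<open>U 1\<close> and the central
  \<kappa>.\<close>

lemma G_commute:
  assumes "a \<in> Q_adjoin v" "b \<in> Q_adjoin v"
  shows "G a \<otimes>\<^bsub>hall\<^esub> G b = G b \<otimes>\<^bsub>hall\<^esub> G a"
proof -
  have "G b \<otimes>\<^bsub>hall\<^esub> G a = (\<lambda>c. (U 1 \<otimes>\<^bsub>hall\<^esub> (U 1 \<otimes>\<^bsub>hall\<^esub> G a)) c + b * (\<kappa> \<otimes>\<^bsub>hall\<^esub> G a) c)"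
    by (rule G_mult[OF assms(2) G_closed[OF assms(1)]])
  also have "U 1 \<otimes>\<^bsub>hall\<^esub> (U 1 \<otimes>\<^bsub>hall\<^esub> G a) = G a \<otimes>\<^bsub>hall\<^esub> (U 1 \<otimes>\<^bsub>hall\<^esub> U 1)"
    by (metis G_commute_U G_closed U_closed H.m_assoc assms(1))
  also have "\<kappa> \<otimes>\<^bsub>hall\<^esub> G a = G a \<otimes>\<^bsub>hall\<^esub> \<kappa>" by (rule \<kappa>_central[OF G_closed[OF assms(1)]])
  also have "(\<lambda>c. (G a \<otimes>\<^bsub>hall\<^esub> (U 1 \<otimes>\<^bsub>hall\<^esub> U 1)) c + b * (G a \<otimes>\<^bsub>hall\<^esub> \<kappa>) c) =
      G a \<otimes>\<^bsub>hall\<^esub> (U 1 \<otimes>\<^bsub>hall\<^esub> U 1) \<oplus>\<^bsub>hall\<^esub> G a \<otimes>\<^bsub>hall\<^esub> (\<lambda>c. b * \<kappa> c)"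
    using G_closed[OF assms(1)] by (simp add: hall_mult_smult(2)) (simp add: hall_simps)
  also have "\<dots> = G a \<otimes>\<^bsub>hall\<^esub> ((U 1 \<otimes>\<^bsub>hall\<^esub> U 1) \<oplus>\<^bsub>hall\<^esub> (\<lambda>c. b * \<kappa> c))"
    by (rule H.r_distr[symmetric]) (auto intro!: smult_closed G_closed assms)
  finally show ?thesis by (simp add: G_def hall_simps)
qed

lemma foldr_mult_closed:
  assumes "\<And>j. F j \<in> carrier hall" "y \<in> carrier hall"
  shows "foldr (\<lambda>j y. F j \<otimes>\<^bsub>hall\<^esub> y) js y \<in> carrier (hall :: ('k iclass \<Rightarrow> real) ring)"
  using assms by (induction js) auto

text \<open>\<open>foldr\<close> places the last factor innermost, while the induction on the length
  wants it in front; a factor commuting with the others can be pulled out.\<close>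

lemma foldr_mult_commute:
  assumes F: "\<And>j. F j \<in> carrier (hall :: ('k iclass \<Rightarrow> real) ring)" and g: "g \<in> carrier hall" "y \<in> carrier hall"
    and comm: "\<And>j. F j \<otimes>\<^bsub>hall\<^esub> g = g \<otimes>\<^bsub>hall\<^esub> F j"
  shows "foldr (\<lambda>j y. F j \<otimes>\<^bsub>hall\<^esub> y) js (g \<otimes>\<^bsub>hall\<^esub> y) = g \<otimes>\<^bsub>hall\<^esub> foldr (\<lambda>j y. F j \<otimes>\<^bsub>hall\<^esub> y) js y"
proof (induction js)
  case (Cons j js)
  have "F j \<otimes>\<^bsub>hall\<^esub> (g \<otimes>\<^bsub>hall\<^esub> foldr (\<lambda>j y. F j \<otimes>\<^bsub>hall\<^esub> y) js y) = g \<otimes>\<^bsub>hall\<^esub> (F j \<otimes>\<^bsub>hall\<^esub> foldr (\<lambda>j y. F j \<otimes>\<^bsub>hall\<^esub> y) js y)"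
    using foldr_mult_closed[OF F g(2), where js = js] F g(1) comm by (simp add: H.m_assoc[symmetric])
  then show ?case using Cons by simp
qed simp

lemma list_product_\<Theta>:
  assumes "\<And>j. F j \<in> carrier (hall :: ('k iclass \<Rightarrow> real) ring)"
  shows "list_product ihall (\<lambda>j. \<Theta> (F j)) l = \<Theta> (list_product hall F l)"
proof -
  have "foldr (\<lambda>j y. \<Theta> (F j) \<otimes>\<^bsub>ihall\<^esub> y) js \<one>\<^bsub>ihall\<^esub> = \<Theta> (foldr (\<lambda>j y. F j \<otimes>\<^bsub>hall\<^esub> y) js \<one>\<^bsub>hall\<^esub>)" for js
  proof (induction js)
    case Nil
    show ?case unfolding foldr.simps id_apply by (rule \<Theta>_one)
  next
    case (Cons j js)
    then show ?case using \<Theta>_mult[OF assms foldr_mult_closed[OF assms H.one_closed]] by (simp del: ihall_simps)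
  qed
  then show ?thesis by (simp only: list_product_def)
qed

definition cst :: real where
  "cst = inverse v * (v\<^sup>2 - 1)\<^sup>2"

lemma cst_Q: "cst * (qint v j)\<^sup>2 \<in> Q_adjoin v"
proof -
  have "1 \<in> Q_adjoin v" by (rule Qv_rat) simp
  then show ?thesis unfolding cst_def by (intro Qv_intros)
qed

lemma coeff_n_Q: "coeff_n v n l \<in> Q_adjoin v"
proof -
  have "0 \<in> Q_adjoin v" by (rule Qv_rat) simp
  moreover have "ipow_coeff v s m l \<in> Q_adjoin v" for s m unfolding ipow_coeff_def by (intro Qv_intros)
  ultimately show ?thesis by (simp add: coeff_n_def[OF v_pos(1)])
qed

lemma coeff_n_vanish: "n < 2 * l \<Longrightarrow> coeff_n v n l = 0"
  by (simp add: coeff_n_def[OF v_pos(1)])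

text \<open>The right-hand side of the formula for the divided power, pulled back along
  \<Theta>.\<close>

abbreviation "D n \<equiv> Y n (coeff_n v n)"

lemma D_closed: "D n \<in> carrier hall"
  by (intro Y_closed coeff_n_Q)

lemma U_one_mult_D:
  "U 1 \<otimes>\<^bsub>hall\<^esub> D n = Y (Suc n) (\<lambda>l. inverse v ^ (n - 2 * l) * coeff_n v n l +
    (if l = 0 then 0 else (v ^ (n + 2 - 2 * l) - inverse v ^ (n + 2 - 2 * l)) * coeff_n v n (l - 1)))"
  by (rule U_one_mult_Y[OF coeff_n_Q coeff_n_vanish])

lemma \<kappa>_mult_D: "\<kappa> \<otimes>\<^bsub>hall\<^esub> D n = Y (n + 2) (\<lambda>l. if l = 0 then 0 else coeff_n v n (l - 1))"
  by (rule \<kappa>_mult_Y[OF coeff_n_Q coeff_n_vanish])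

lemma D_odd:
  assumes "odd n"
  shows "U 1 \<otimes>\<^bsub>hall\<^esub> D n = (\<lambda>c. qint v (Suc n) * D (Suc n) c)"
  unfolding U_one_mult_D Y_linear coeff_n_odd[OF v_pos(1) assms] ..

lemma D_even:
  assumes "even n" "n > 0"
  shows "(\<lambda>c. (U 1 \<otimes>\<^bsub>hall\<^esub> D n) c + cst * qint v n * (\<kappa> \<otimes>\<^bsub>hall\<^esub> D (n - 1)) c) = (\<lambda>c. qint v (Suc n) * D (Suc n) c)"
proof -
  have n: "n - 1 + 2 = Suc n" using assms by simp
  show ?thesis
    unfolding U_one_mult_D \<kappa>_mult_D n Y_linear cst_def coeff_n_even[OF v_pos(1) assms] ..
qed

text \<open>The product in the odd divided powers; the even ones reduce to it because the constant
  in their first factor is zero.\<close>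

definition Pr :: "nat \<Rightarrow> 'k iclass \<Rightarrow> real" where
  "Pr l = list_product hall (\<lambda>j. G (cst * (qint v (2 * j))\<^sup>2)) l"

lemma Pr_closed: "Pr l \<in> carrier hall"
  unfolding Pr_def list_product_def by (intro foldr_mult_closed G_closed cst_Q H.one_closed)

lemma Pr_Suc: "Pr (Suc l) = G (cst * (qint v (2 * Suc l))\<^sup>2) \<otimes>\<^bsub>hall\<^esub> Pr l"
proof -
  have "Pr (Suc l) = foldr (\<lambda>j y. G (cst * (qint v (2 * j))\<^sup>2) \<otimes>\<^bsub>hall\<^esub> y) [1..<Suc l] (G (cst * (qint v (2 * Suc l))\<^sup>2) \<otimes>\<^bsub>hall\<^esub> \<one>\<^bsub>hall\<^esub>)"
    unfolding Pr_def list_product_def by simp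
  also have "\<dots> = G (cst * (qint v (2 * Suc l))\<^sup>2) \<otimes>\<^bsub>hall\<^esub> Pr l"
    unfolding Pr_def list_product_def by (intro foldr_mult_commute G_closed G_commute cst_Q H.one_closed)
  finally show ?thesis .
qed

text \<open>Each new factor \<open>G\<close> raises the index by two: \<open>D_odd\<close> leads to
  the even index, and \<open>D_even\<close>, with the \<kappa> part of \<open>G\<close> as its
  correction term, leads to the next odd one.\<close>

lemma U_one_mult_Pr:
  "U 1 \<otimes>\<^bsub>hall\<^esub> Pr l = (\<lambda>c. qfact v (2 * l + 1) * D (2 * l + 1) c)"
  "U 1 \<otimes>\<^bsub>hall\<^esub> (U 1 \<otimes>\<^bsub>hall\<^esub> Pr l) = (\<lambda>c. qfact v (2 * l + 2) * D (2 * l + 2) c)"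
proof -
  have step: "U 1 \<otimes>\<^bsub>hall\<^esub> (U 1 \<otimes>\<^bsub>hall\<^esub> Pr l) = (\<lambda>c. qfact v (2 * l + 2) * D (2 * l + 2) c)"
    if "U 1 \<otimes>\<^bsub>hall\<^esub> Pr l = (\<lambda>c. qfact v (2 * l + 1) * D (2 * l + 1) c)" for l
    unfolding that hall_mult_smult(2)[OF U_closed D_closed] using D_odd[of "2 * l + 1"] qfact_Suc(1)[OF v_pos(1), of "2 * l + 1"]
    by (simp add: mult_ac)
  show 1: "U 1 \<otimes>\<^bsub>hall\<^esub> Pr l = (\<lambda>c. qfact v (2 * l + 1) * D (2 * l + 1) c)"
  proof (induction l)
    case 0
    have "coeff_n v 1 1 = 0" by (rule coeff_n_vanish) simp
    then have "D 1 = U 1" using coeff_n_zero[OF v_pos(1)] by (simp add: Y_def e_def)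
    moreover have "qfact v 1 = 1" using v_nz[OF v_pos(1)] by (simp add: qfact_def qint_def)
    ultimately show ?case by (simp add: Pr_def list_product_def)
  next
    case (Suc l)
    let ?a = "cst * (qint v (2 * Suc l))\<^sup>2"
    let ?n = "2 * Suc l"
    have c: "U 1 \<otimes>\<^bsub>hall\<^esub> Pr l \<in> carrier hall" using Pr_closed by simp
    have "U 1 \<otimes>\<^bsub>hall\<^esub> Pr (Suc l) = G ?a \<otimes>\<^bsub>hall\<^esub> (U 1 \<otimes>\<^bsub>hall\<^esub> Pr l)"
      unfolding Pr_Suc by (metis G_commute_U[OF cst_Q] G_closed[OF cst_Q] U_closed Pr_closed H.m_assoc)
    also have "\<dots> = (\<lambda>c. (U 1 \<otimes>\<^bsub>hall\<^esub> (U 1 \<otimes>\<^bsub>hall\<^esub> (U 1 \<otimes>\<^bsub>hall\<^esub> Pr l))) c + ?a * (\<kappa> \<otimes>\<^bsub>hall\<^esub> (U 1 \<otimes>\<^bsub>hall\<^esub> Pr l)) c)"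
      by (rule G_mult[OF cst_Q c])
    also have "\<dots> = (\<lambda>c. qfact v ?n * (U 1 \<otimes>\<^bsub>hall\<^esub> D ?n) c + ?a * (qfact v (?n - 1) * (\<kappa> \<otimes>\<^bsub>hall\<^esub> D (?n - 1)) c))"
      unfolding step[OF Suc] unfolding Suc using hall_mult_smult(2)[OF U_closed D_closed] hall_mult_smult(2)[OF \<kappa>_closed D_closed] by simp
    \<comment> \<open>Of the two factors \<open>[n]\<close> in the constant, one completes
      \<open>[n - 1]!\<close> to \<open>[n]!\<close> and the other is the one in
      \<open>D_even\<close>.\<close>
    also have "\<dots> = (\<lambda>c. qfact v ?n * ((U 1 \<otimes>\<^bsub>hall\<^esub> D ?n) c + cst * qint v ?n * (\<kappa> \<otimes>\<^bsub>hall\<^esub> D (?n - 1)) c))"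
      using qfact_Suc(1)[OF v_pos(1), of "?n - 1"] by (simp add: power2_eq_square ring_distribs mult_ac)
    also have "\<dots> = (\<lambda>c. qfact v ?n * (qint v (Suc ?n) * D (Suc ?n) c))"
      using fun_cong[OF D_even[of ?n]] by simp
    also have "\<dots> = (\<lambda>c. qfact v (2 * Suc l + 1) * D (2 * Suc l + 1) c)"
      using qfact_Suc(1)[OF v_pos(1), of ?n] by (simp add: mult_ac)
    finally show ?case .
  qed
  show "U 1 \<otimes>\<^bsub>hall\<^esub> (U 1 \<otimes>\<^bsub>hall\<^esub> Pr l) = (\<lambda>c. qfact v (2 * l + 2) * D (2 * l + 2) c)" by (rule step[OF 1])
qed

lemma \<Theta>_G:
  assumes "a \<in> Q_adjoin v"
  shows "\<Theta> (U 1) [^]\<^bsub>ihall\<^esub> (2 :: nat) \<oplus>\<^bsub>ihall\<^esub> a \<odot>\<^bsub>ihall\<^esub> \<Theta> \<kappa> = \<Theta> (G a)"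
proof -
  have "U 1 [^]\<^bsub>hall\<^esub> (2 :: nat) = U 1 \<otimes>\<^bsub>hall\<^esub> U 1" by (simp add: numeral_2_eq_2)
  then show ?thesis
    unfolding \<Theta>_pow[OF U_closed] \<Theta>_smult[OF \<kappa>_closed assms] G_def 
    by (simp only: \<Theta>_add H.m_closed U_closed smult_closed[OF \<kappa>_closed assms])
qed

lemma idivided_power_\<Theta>: "idivided_power_even S n = \<Theta> (D n)"
proof -
  define l where "l = n div 2"
  have q: "qfact v m \<noteq> 0" "1 / qfact v m \<in> Q_adjoin v" for m
  proof -
    show "qfact v m \<noteq> 0" by (rule qfact_nz(1)[OF v_pos(1)])
    have "1 \<in> Q_adjoin v" by (rule Qv_rat) simp
    then show "1 / qfact v m \<in> Q_adjoin v" by (intro Qv_intros)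
  qed
  have cst: "inverse v * (v\<^sup>2 - 1)\<^sup>2 * (qint v j)\<^sup>2 = cst * (qint v j)\<^sup>2" for j by (simp add: cst_def)
  note unf = idivided_power_even_def Let_def v_eq[symmetric] l_def[symmetric] ihall_class_S ihall_class_regular cst \<Theta>_G[OF cst_Q]
    list_product_\<Theta>[OF G_closed[OF cst_Q]]
  show ?thesis
  proof (cases "even n")
    case True
    then have n: "n = 2 * l" by (simp add: l_def)
    let ?L = "list_product hall (\<lambda>j. G (cst * (qint v (2 * j - 2))\<^sup>2)) l"
    have Lc: "?L \<in> carrier hall" unfolding list_product_def by (intro foldr_mult_closed G_closed cst_Q H.one_closed)
    have "?L = (\<lambda>c. qfact v n * D n c)"
    proof (cases l)
      case 0
      then have "D n = \<one>\<^bsub>hall\<^esub>" using n coeff_n_zero[OF v_pos(1)] by (simp add: Y_def e_def U_zero)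
      then show ?thesis using 0 n by (simp add: list_product_def qfact_def)
    next
      case (Suc k)
      \<comment> \<open>At \<open>j = 1\<close> the constant contains \<open>[0]\<close>, so the
        first factor is \<open>[S]^2\<close>; the others, with the index shifted by one, form
        \<open>Pr k\<close>.\<close>
      have z: "G (cst * (qint v 0)\<^sup>2) = U 1 \<otimes>\<^bsub>hall\<^esub> U 1" by (simp add: G_def qint_def)
      have "[1..<Suc l] = 1 # map Suc [1..<Suc k]" unfolding Suc map_Suc_upt by (simp add: upt_conv_Cons)
      then have "?L = G (cst * (qint v 0)\<^sup>2) \<otimes>\<^bsub>hall\<^esub> Pr k"
        unfolding list_product_def Pr_def by (simp add: foldr_map comp_def)
      also have "\<dots> = U 1 \<otimes>\<^bsub>hall\<^esub> (U 1 \<otimes>\<^bsub>hall\<^esub> Pr k)" unfolding z by (rule H.m_assoc) (simp_all add: Pr_closed)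
      finally show ?thesis unfolding U_one_mult_Pr(2) n Suc by simp
    qed
    then have "(\<lambda>c. 1 / qfact v n * ?L c) = D n" using q(1) by simp
    then show ?thesis using True unfolding unf n[symmetric] \<Theta>_smult[OF Lc q(2)] by simp
  next
    case False
    then have n: "n = 2 * l + 1" by (simp add: l_def)
    have "(\<lambda>c. 1 / qfact v n * (U 1 \<otimes>\<^bsub>hall\<^esub> Pr l) c) = D n"
      unfolding U_one_mult_Pr n using q(1) by simp
    then show ?thesis
      using False unfolding unf n[symmetric] Pr_def[symmetric] \<Theta>_mult[OF U_closed Pr_closed] \<Theta>_smult[OF H.m_closed[OF U_closed Pr_closed] q(2)]
      by simp
  qed
qed

lemma idivided_power_formula:
  "idivided_power_even S n =
    (\<Oplus>\<^bsub>ihall\<^esub>l\<in>{0..n div 2}.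
       (v powi (int l * (int l - (-1) ^ n) - int ((n - 2 * l) choose 2)) * (v - inverse v) ^ l
          / (qfact v (n - 2 * l) * qdfact_even v l)) \<odot>\<^bsub>ihall\<^esub>
       (ihall_class (direct_power (n - 2 * l) S) \<otimes>\<^bsub>ihall\<^esub>
          ihall_class (regular_mod :: ('k poly set, 'k poly set) module) [^]\<^bsub>ihall\<^esub> l))"
proof -
  have Q: "ipow_coeff v ((-1) ^ n) (n - 2 * l) l \<in> Q_adjoin v" for l unfolding ipow_coeff_def by (intro Qv_intros)
  have t: "ipow_coeff v ((-1) ^ n) (n - 2 * l) l \<odot>\<^bsub>ihall\<^esub> (\<Theta> (U (n - 2 * l)) \<otimes>\<^bsub>ihall\<^esub> \<Theta> \<kappa> [^]\<^bsub>ihall\<^esub> l) =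
    \<Theta> (\<lambda>c. ipow_coeff v ((-1) ^ n) (n - 2 * l) l * e (n - 2 * l) l c)" for l
    unfolding \<Theta>_pow[OF \<kappa>_closed] \<Theta>_mult[OF U_closed H.nat_pow_closed[OF \<kappa>_closed]] e_def[symmetric] by (rule \<Theta>_smult[OF e_closed Q])
  have "D n = (\<lambda>c. \<Sum>l\<in>{0..n div 2}. ipow_coeff v ((-1) ^ n) (n - 2 * l) l * e (n - 2 * l) l c)"
    unfolding Y_def
  proof (rule ext, rule sum.mono_neutral_cong_right)
    show "\<forall>l\<in>{..n} - {0..n div 2}. coeff_n v n l * e (n - 2 * l) l c = 0" for c
    proof
      fix l assume "l \<in> {..n} - {0..n div 2}"
      then have "n < 2 * l" by simp presburger
      then show "coeff_n v n l * e (n - 2 * l) l c = 0" by (simp add: coeff_n_vanish)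
    qed
    show "coeff_n v n l * e (n - 2 * l) l c = ipow_coeff v ((-1) ^ n) (n - 2 * l) l * e (n - 2 * l) l c" if "l \<in> {0..n div 2}" for l c
    proof -
      have "2 * l \<le> n" using that by simp
      then show ?thesis by (simp add: coeff_n_def[OF v_pos(1)])
    qed
  qed auto
  then show ?thesis
    unfolding idivided_power_\<Theta> ihall_class_power ihall_class_regular ipow_coeff_def[symmetric] t
    by (simp only: \<Theta>_sum finite_atLeastAtMost smult_closed[OF e_closed Q])
qed

end

subsection \<open>The collapsed case\<close>

text \<open>
  If no ideal contains the relations, which would happen if the Hall algebra were not a ring, then
  \<^const>\<open>hall_ideal\<close> is everything and the algebra has a single element. This spares a proof that the
  product of the Hall algebra is associative.
\<close>

context
  assumes collapse: "(hall_ideal :: ('k::{field,finite} iclass \<Rightarrow> real) set) = UNIV"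
begin

lemma collapse_coset: "hall_ideal +>\<^bsub>hall\<^esub> (f :: 'k iclass \<Rightarrow> real) = UNIV"
proof -
  have "h \<in> hall_ideal +>\<^bsub>hall\<^esub> f" for h :: "'k iclass \<Rightarrow> real"
    by (auto simp: a_r_coset_def r_coset_def collapse hall_simps intro!: exI[of _ "\<lambda>c. h c - f c"])
  then show ?thesis by blast
qed

text \<open>The only fraction: numerator and denominator are both the coset
  \<open>UNIV\<close>.\<close>

definition pt :: "'k ihall_elt" where
  "pt = {(UNIV, UNIV)}"

lemma collapse_quot:
  "carrier hall_quot = {UNIV :: ('k iclass \<Rightarrow> real) set}" "(hall_denoms :: ('k iclass \<Rightarrow> real) set set) = {UNIV}"
  "UNIV \<otimes>\<^bsub>hall_quot\<^esub> UNIV = (UNIV :: ('k iclass \<Rightarrow> real) set)" "UNIV \<oplus>\<^bsub>hall_quot\<^esub> UNIV = (UNIV :: ('k iclass \<Rightarrow> real) set)"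
  "\<one>\<^bsub>hall_quot\<^esub> = (UNIV :: ('k iclass \<Rightarrow> real) set)" "\<zero>\<^bsub>hall_quot\<^esub> = (UNIV :: ('k iclass \<Rightarrow> real) set)"
proof -
  have "hclass zero_mod \<in> carrier (hall :: ('k iclass \<Rightarrow> real) ring)" by (rule hclass_in_hall[OF fd_zero_mod])
  then show "carrier hall_quot = {UNIV :: ('k iclass \<Rightarrow> real) set}"
    unfolding hall_quot_def FactRing_def A_RCOSETS_def RCOSETS_def a_r_coset_def[symmetric] by (auto simp: collapse_coset)
  have "pd_le_one (zero_mod :: ('k poly set, nat) module)" by (simp add: pd_le_one_iff fd_zero_mod acyclic_zero_mod)
  then show "(hall_denoms :: ('k iclass \<Rightarrow> real) set set) = {UNIV}"
    unfolding hall_denoms_def collapse_coset by (auto intro!: exI[of _ 1])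
  show "UNIV \<otimes>\<^bsub>hall_quot\<^esub> UNIV = (UNIV :: ('k iclass \<Rightarrow> real) set)"
    by (simp add: hall_quot_def FactRing_def rcoset_mult_def collapse_coset)
  have "h \<in> UNIV <+>\<^bsub>hall\<^esub> UNIV" for h :: "'k iclass \<Rightarrow> real"
    unfolding set_add_def' by (rule UN_I[of h], simp, rule UN_I[of "\<lambda>_. 0"]) (simp_all add: hall_simps)
  then show "UNIV \<oplus>\<^bsub>hall_quot\<^esub> UNIV = (UNIV :: ('k iclass \<Rightarrow> real) set)"
    by (auto simp: hall_quot_def FactRing_def)
  show "\<one>\<^bsub>hall_quot\<^esub> = (UNIV :: ('k iclass \<Rightarrow> real) set)" "\<zero>\<^bsub>hall_quot\<^esub> = (UNIV :: ('k iclass \<Rightarrow> real) set)"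
    by (simp_all add: hall_quot_def FactRing_def collapse_coset) (simp add: collapse)
qed

lemma collapse_frac: "ore_frac hall_quot {UNIV} UNIV (UNIV :: ('k iclass \<Rightarrow> real) set) = pt"
  by (auto simp: ore_frac_def ore_rel_def collapse_quot pt_def)

lemma collapse_sd:
  "carrier sd_hall = {pt}" "pt \<otimes>\<^bsub>sd_hall\<^esub> pt = pt" "pt \<oplus>\<^bsub>sd_hall\<^esub> pt = pt" "\<one>\<^bsub>sd_hall\<^esub> = pt" "\<zero>\<^bsub>sd_hall\<^esub> = pt"
  "hall_to_sd f = pt"
proof -
  have rel: "ore_rel hall_quot {UNIV :: ('k iclass \<Rightarrow> real) set} = {((UNIV, UNIV), (UNIV, UNIV))}"
    by (auto simp: ore_rel_def collapse_quot)
  show "carrier sd_hall = {pt}"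
    by (simp add: sd_hall_def ore_localization_def rel collapse_quot quotient_def pt_def Image_singleton)
  show "\<one>\<^bsub>sd_hall\<^esub> = pt" "\<zero>\<^bsub>sd_hall\<^esub> = pt"
    by (simp_all add: sd_hall_def ore_localization_def collapse_quot collapse_frac)
  show "hall_to_sd f = pt" by (simp add: hall_to_sd_def collapse_coset collapse_quot collapse_frac)
  show "pt \<otimes>\<^bsub>sd_hall\<^esub> pt = pt" "pt \<oplus>\<^bsub>sd_hall\<^esub> pt = pt"
    by (simp_all add: sd_hall_def ore_localization_def pt_def collapse_quot collapse_frac[unfolded pt_def])
qed

lemma collapse_abelian_monoid: "abelian_monoid (sd_hall :: 'k ihall_elt ring)"
  by (rule abelian_monoidI) (auto simp: collapse_sd)

text \<open>Every degree part is the single point, which is also zero, so the constant function is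
  the only candidate and its sum over the empty set of nonzero degrees is correct.\<close>

lemma collapse_component: "sd_component (pt :: 'k ihall_elt) = (\<lambda>_. pt)"
proof -
  interpret Q: abelian_monoid "sd_hall :: 'k ihall_elt ring" by (rule collapse_abelian_monoid)
  have part: "sd_degree_part d = {pt :: 'k ihall_elt}" for d
  proof -
    have "pd_le_one (zero_mod :: ('k poly set, nat) module)" by (simp add: pd_le_one_iff fd_zero_mod acyclic_zero_mod)
    moreover have "(\<lambda>_ :: 'k iclass. 0) \<in> carrier hall"
      using Q_adjoin_rat[OF qsqrt_square_rat[where 'k = 'k], of 0] by (simp add: mem_carrier_hall)
    ultimately show ?thesis
      unfolding sd_degree_part_def collapse_coset collapse_quot(2) collapse_frac by (auto intro!: exI[of _ "\<lambda>_. 0"] exI[of _ 1] exI[of _ zero_mod])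
  qed
  show ?thesis
    unfolding sd_component_def part
    by (rule the_equality) (auto simp: collapse_sd fun_eq_iff)
qed

lemma collapse_ihall:
  "sd_smult r pt = (pt :: 'k ihall_elt)" "sd_twisted_mult pt pt = (pt :: 'k ihall_elt)"
proof -
  interpret Q: abelian_monoid "sd_hall :: 'k ihall_elt ring" by (rule collapse_abelian_monoid)
  show "sd_smult r pt = (pt :: 'k ihall_elt)" by (simp add: sd_smult_def collapse_sd)
  show "sd_twisted_mult pt pt = (pt :: 'k ihall_elt)" by (simp add: sd_twisted_mult_def collapse_component collapse_sd)
qed

lemma collapse_ihall_ops:
  "carrier ihall = {pt :: 'k ihall_elt}" "pt \<oplus>\<^bsub>ihall\<^esub> pt = (pt :: 'k ihall_elt)" "pt \<otimes>\<^bsub>ihall\<^esub> pt = (pt :: 'k ihall_elt)"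
  "r \<odot>\<^bsub>ihall\<^esub> pt = (pt :: 'k ihall_elt)" "\<one>\<^bsub>ihall\<^esub> = (pt :: 'k ihall_elt)" "\<zero>\<^bsub>ihall\<^esub> = (pt :: 'k ihall_elt)"
  by (simp_all add: ihall_def collapse_sd collapse_ihall)

lemma collapse_pow: "pt [^]\<^bsub>ihall\<^esub> (n :: nat) = (pt :: 'k ihall_elt)"
proof (induction n)
  case (Suc n)
  have "pt [^]\<^bsub>ihall\<^esub> Suc n = pt [^]\<^bsub>ihall\<^esub> n \<otimes>\<^bsub>ihall\<^esub> (pt :: 'k ihall_elt)" by (simp only: nat_pow_def nat.rec)
  then show ?case by (simp add: Suc collapse_ihall_ops)
qed (simp add: nat_pow_def collapse_ihall_ops)

lemma collapse_list_product: "list_product ihall (\<lambda>_. pt :: 'k ihall_elt) l = pt"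
proof -
  have "foldr (\<lambda>_ y. pt \<otimes>\<^bsub>ihall\<^esub> y) js \<one>\<^bsub>ihall\<^esub> = (pt :: 'k ihall_elt)" for js :: "nat list"
    by (induction js) (simp_all add: collapse_ihall_ops)
  then show ?thesis by (simp add: list_product_def)
qed

lemma collapse_finsum: "(\<Oplus>\<^bsub>ihall\<^esub>i\<in>I. pt) = (pt :: 'k ihall_elt)"
proof -
  have "abelian_monoid (ihall :: (real, 'k ihall_elt) module)"
    by (rule abelian_monoidI) (auto simp: collapse_ihall_ops)
  from abelian_monoid.finsum_zero[OF this, of I] show ?thesis by (simp only: collapse_ihall_ops)
qed

lemma collapse_idivided_power:
  fixes S :: "('k poly set, 'a) module"
  shows "idivided_power_even S n = pt" "ihall_class S = pt"
  by (simp_all add: idivided_power_even_def ihall_class_def Let_def collapse_sd collapse_ihall_ops collapse_pow collapse_list_product)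

end

theorem proposition6p4:
  fixes S :: "('k::{field,finite} poly set, nat) module" and n :: nat and v :: real
  assumes "simple_mod S"
  defines "v \<equiv> qsqrt TYPE('k)"
  shows "idivided_power_even S n =
    (\<Oplus>\<^bsub>ihall\<^esub>l\<in>{0..n div 2}.
       (v powi (int l * (int l - (-1) ^ n) - int ((n - 2 * l) choose 2)) * (v - inverse v) ^ l
          / (qfact v (n - 2 * l) * qdfact_even v l)) \<odot>\<^bsub>ihall\<^esub>
       (ihall_class (direct_power (n - 2 * l) S) \<otimes>\<^bsub>ihall\<^esub>
          ihall_class regular_mod [^]\<^bsub>ihall\<^esub> l))"
proof (cases rule: hall_ideal_cases[where 'k = 'k])
  case collapse
  then show ?thesis
    by (simp add: collapse_idivided_power collapse_ihall_ops collapse_pow collapse_finsum)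
next
  case ring
  interpret simple_hall "TYPE('k)" v S
    by (intro simple_hall.intro twisted_hall.intro hall_ring.intro twisted_hall_axioms.intro simple_hall_axioms.intro ring assms(1))
      (simp add: v_def)
  show ?thesis by (rule idivided_power_formula)
qed

end
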